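(* Let $k$ be a field of characteristic zero and let $q$ be a nondegenerate quadratic form over $k$ of rank $n\geq 2$. For any almost free finite-dimensional linear representation $V$ of the special orthogonal group $\mathrm{SO}(q)$ over $k$, the field $k(V)^{\mathrm{SO}(q)}$ is stably rational over $k$.
   Context: Let $\bar k$ be an algebraic closure of $k$. For a linear algebraic $k$-group $G$ acting on a geometrically integral $k$-variety $X$, $k(X)^G$ denotes the subfield of $\bar k(X)^{G(\bar k)}$ fixed by $\mathrm{Gal}(\bar k/k)$. The action is almost free if there is a non-empty open set $U\subset X$ such that for every $x\in U(\bar k)$ the stabilizer $G_x\subset G(\bar k)$ is trivial. A field $K/k$ is stably rational (equivalently, stably pure) over $k$ if $K(x_1,\dots,x_r)$ is purely transcendental over $k$ for some independent variables $x_1,\dots,x_r$. *)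

theory Defs
  imports
    "HOL-Library.Poly_Mapping"
    "HOL-Computational_Algebra.Fraction_Field"
    "HOL-Computational_Algebra.Polynomial_Factorial"
    "HOL-Algebra.Generated_Fields"
    "HOL-Algebra.Algebraic_Closure_Type"
    "Jordan_Normal_Form.Determinant"
begin

section \<open>Polynomials and rational functions\<close>

text \<open>
  Polynomials are finitely supported families of coefficients indexed by monomials, and monomials
  are finitely supported families of exponents indexed by the variables.
\<close>

type_synonym ('i, 'a) mpoly = "('i \<Rightarrow>\<^sub>0 nat) \<Rightarrow>\<^sub>0 'a"

definition mvar :: "'i \<Rightarrow> ('i, 'a::zero_neq_one) mpoly"
  where "mvar i = Poly_Mapping.single (Poly_Mapping.single i 1) 1"

definition mconst :: "'a::zero \<Rightarrow> ('i, 'a) mpoly"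
  where "mconst c = Poly_Mapping.single 0 c"

definition mvars :: "('i, 'a::zero) mpoly \<Rightarrow> 'i set"
  where "mvars p = (\<Union>\<mu>\<in>Poly_Mapping.keys p. Poly_Mapping.keys \<mu>)"

text \<open>The value of \<open>p\<close> at \<open>x\<close>, with coefficients pushed forward along \<open>h\<close>.\<close>

definition meval :: "('a::zero \<Rightarrow> 'b::comm_semiring_1) \<Rightarrow> ('i \<Rightarrow> 'b) \<Rightarrow> ('i, 'a) mpoly \<Rightarrow> 'b"
  where "meval h x p = (\<Sum>\<mu>\<in>Poly_Mapping.keys p.
    h (Poly_Mapping.lookup p \<mu>) * (\<Prod>i\<in>Poly_Mapping.keys \<mu>. x i ^ Poly_Mapping.lookup \<mu> i))"

text \<open>
  The field of rational functions in the variables $x_0, x_1, x_2, \ldots$; rational functions in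
  finitely many variables $x_0, \ldots, x_{m-1}$ form the subfield \<open>rat_funs m\<close>.
\<close>

type_synonym 'a rat_fun = "(nat, 'a) mpoly fract"

definition rat_funs :: "nat \<Rightarrow> 'a::idom rat_fun set"
  where "rat_funs m =
    {Fract p q |p q. q \<noteq> 0 \<and> mvars p \<subseteq> {..<m} \<and> mvars q \<subseteq> {..<m}}"

definition rvar :: "nat \<Rightarrow> 'a::idom rat_fun"
  where "rvar i = to_fract (mvar i)"

definition rconst :: "'a::idom \<Rightarrow> 'a rat_fun"
  where "rconst c = to_fract (mconst c)"

text \<open>
  The extension to fraction fields of an injective ring homomorphism \<open>\<phi>\<close>: by
  \<open>fract_map_Fract\<close> below, the choice of numerator and denominator is irrelevant.
\<close>

definition fract_map :: "('a::idom \<Rightarrow> 'b::idom) \<Rightarrow> 'a fract \<Rightarrow> 'b fract"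
  where "fract_map \<phi> f =
    (let (p, q) = (SOME (p, q). q \<noteq> 0 \<and> f = Fract p q) in Fract (\<phi> p) (\<phi> q))"

lemma fract_map_Fract:
  assumes "inj_idom_hom \<phi>" and "q \<noteq> 0"
  shows "fract_map \<phi> (Fract p q) = Fract (\<phi> p) (\<phi> q)"
proof -
  interpret inj_idom_hom \<phi> by fact
  obtain p' q' where *: "(SOME (p', q'). q' \<noteq> 0 \<and> Fract p q = Fract p' q') = (p', q')"
    by (meson surj_pair)
  have "q' \<noteq> 0 \<and> Fract p q = Fract p' q'"
    using someI_ex[of "\<lambda>(p', q'). q' \<noteq> 0 \<and> Fract p q = Fract p' q'"] assms(2) *
    by (metis (mono_tags, lifting) case_prod_conv)
  moreover from this assms(2) have "\<phi> p * \<phi> q' = \<phi> p' * \<phi> q"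
    by (metis eq_fract(1) hom_mult)
  moreover have "fract_map \<phi> (Fract p q) = Fract (\<phi> p') (\<phi> q')"
    unfolding fract_map_def * by simp
  ultimately show ?thesis
    using assms(2) by (simp add: eq_fract)
qed


section \<open>Stably rational field extensions\<close>

text \<open>Subfields of a field type, generated by a set of elements.\<close>

definition field_gen :: "'l::field set \<Rightarrow> 'l set"
  where "field_gen S = generate_field ring_of_type_algebra S"

text \<open>The elements of \<open>B\<close> themselves serve as names of the variables.\<close>

definition alg_independent :: "'l::field set \<Rightarrow> 'l set \<Rightarrow> bool"
  where "alg_independent k B \<longleftrightarrow>
    (\<forall>p :: ('l, 'l) mpoly. Poly_Mapping.range p \<subseteq> k \<longrightarrow> mvars p \<subseteq> B \<longrightarrow>
      meval id id p = 0 \<longrightarrow> p = 0)"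

definition purely_transcendental :: "'l::field set \<Rightarrow> 'l set \<Rightarrow> bool"
  where "purely_transcendental k K \<longleftrightarrow>
    (\<exists>B. alg_independent k B \<and> K = field_gen (k \<union> B))"

text \<open>
  For subfields $k \subseteq K$ of a field $L$, the field $K(x_0, \ldots, x_{r-1})$ is formed
  inside the field of rational functions over $L$.
\<close>

definition stably_rational :: "'l::field set \<Rightarrow> 'l set \<Rightarrow> bool"
  where "stably_rational k K \<longleftrightarrow>
    (\<exists>r. purely_transcendental (rconst ` k) (field_gen (rconst ` K \<union> rvar ` {..<r})))"


section \<open>Representations of linear algebraic groups and their invariant fields\<close>

text \<open>
  A closed $k$-subgroup of $\mathrm{GL}_n$ is given by its group \<open>G\<close> of points over the algebraic
  closure; in characteristic zero it is smooth, hence determined by them. Its $k$-regular functions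
  are the restrictions of polynomials over $k$ in the matrix entries and in $1/\det$.
\<close>

definition regular_over ::
    "nat \<Rightarrow> 'k::field alg_closure mat set \<Rightarrow> ('k alg_closure mat \<Rightarrow> 'k alg_closure) \<Rightarrow> bool"
  where "regular_over n G f \<longleftrightarrow>
    (\<exists>(p :: (nat \<times> nat, 'k) mpoly) N. mvars p \<subseteq> {..<n} \<times> {..<n} \<and>
      (\<forall>g\<in>G. f g = meval to_ac (\<lambda>ij. g $$ ij) p / det g ^ N))"

text \<open>Homomorphisms \<open>\<rho>\<close> of algebraic $k$-groups from $G \subseteq \mathrm{GL}_n$ to
  $\mathrm{GL}_m = \mathrm{GL}(V)$, where $V = k^m$.\<close>

definition linear_rep ::
    "nat \<Rightarrow> 'k::field alg_closure mat set \<Rightarrow> nat \<Rightarrow>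
      ('k alg_closure mat \<Rightarrow> 'k alg_closure mat) \<Rightarrow> bool"
  where "linear_rep n G m \<rho> \<longleftrightarrow>
    (\<forall>g\<in>G. \<rho> g \<in> carrier_mat m m) \<and>
    \<rho> (1\<^sub>m n) = 1\<^sub>m m \<and>
    (\<forall>g\<in>G. \<forall>h\<in>G. \<rho> (g * h) = \<rho> g * \<rho> h) \<and>
    (\<forall>i<m. \<forall>j<m. regular_over n G (\<lambda>g. \<rho> g $$ (i, j)))"

text \<open>The geometric points of open subsets of the $k$-variety $V = \mathbf{A}^m_k$.\<close>

definition zariski_open :: "nat \<Rightarrow> 'k::field alg_closure vec set \<Rightarrow> bool"
  where "zariski_open m U \<longleftrightarrow>
    (\<exists>S :: (nat, 'k) mpoly set. (\<forall>p\<in>S. mvars p \<subseteq> {..<m}) \<and>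
      U = {x \<in> carrier_vec m. \<exists>p\<in>S. meval to_ac (\<lambda>i. x $ i) p \<noteq> 0})"

definition almost_free ::
    "nat \<Rightarrow> 'k::field alg_closure mat set \<Rightarrow> nat \<Rightarrow>
      ('k alg_closure mat \<Rightarrow> 'k alg_closure mat) \<Rightarrow> bool"
  where "almost_free n G m \<rho> \<longleftrightarrow>
    (\<exists>U. zariski_open m U \<and> U \<noteq> {} \<and>
      (\<forall>x\<in>U. {g \<in> G. \<rho> g *\<^sub>v x = x} = {1\<^sub>m n}))"

text \<open>
  $p \mapsto p \circ A$ for an $m \times m$ matrix \<open>A\<close>. The variables from $x_m$ on do not occur in
  functions on $V$; they are left alone so that the substitution stays injective for invertible
  \<open>A\<close>.
\<close>

definition lin_subst :: "nat \<Rightarrow> 'a::comm_ring_1 mat \<Rightarrow> (nat, 'a) mpoly \<Rightarrow> (nat, 'a) mpoly"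
  where "lin_subst m A =
    meval mconst (\<lambda>i. if i < m then (\<Sum>j<m. mconst (A $$ (i, j)) * mvar j) else mvar i)"

definition galois_group :: "('k::field alg_closure \<Rightarrow> 'k alg_closure) set"
  where "galois_group = {\<sigma>. field_isom \<sigma> \<and> (\<forall>c. \<sigma> (to_ac c) = to_ac c)}"

text \<open>
  The field $\bar k(V)^{G(\bar k)}$. The group acts on functions by
  $(g f)(x) = f(\rho(g)^{-1} x)$; being fixed by all of $G(\bar k)$ amounts to
  $f \circ \rho(g) = f$ for all $g$.
\<close>

definition geom_invariant_field ::
    "'k::field alg_closure mat set \<Rightarrow> nat \<Rightarrow> ('k alg_closure mat \<Rightarrow> 'k alg_closure mat) \<Rightarrow>
      'k alg_closure rat_fun set"
  where "geom_invariant_field G m \<rho> =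
    {f \<in> rat_funs m. \<forall>g\<in>G. fract_map (lin_subst m (\<rho> g)) f = f}"

text \<open>The field $k(V)^G$; the Galois group acts on $\bar k(V)$ through the coefficients.\<close>

definition invariant_field ::
    "'k::field alg_closure mat set \<Rightarrow> nat \<Rightarrow> ('k alg_closure mat \<Rightarrow> 'k alg_closure mat) \<Rightarrow>
      'k alg_closure rat_fun set"
  where "invariant_field G m \<rho> =
    {f \<in> geom_invariant_field G m \<rho>.
      \<forall>\<sigma>\<in>galois_group. fract_map (Poly_Mapping.map \<sigma>) f = f}"

text \<open>The image of $k$ in $\bar k(V)$.\<close>

definition ground_field :: "'k::field alg_closure rat_fun set"
  where "ground_field = range (\<lambda>c. rconst (to_ac c))"


section \<open>Quadratic forms and special orthogonal groups\<close>

definition polar :: "('k::field vec \<Rightarrow> 'k) \<Rightarrow> 'k vec \<Rightarrow> 'k vec \<Rightarrow> 'k"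
  where "polar q v w = q (v + w) - q v - q w"

definition quadratic_form :: "nat \<Rightarrow> ('k::field vec \<Rightarrow> 'k) \<Rightarrow> bool"
  where "quadratic_form n q \<longleftrightarrow>
    (\<forall>a. \<forall>v\<in>carrier_vec n. q (a \<cdot>\<^sub>v v) = a\<^sup>2 * q v) \<and>
    (\<forall>u\<in>carrier_vec n. \<forall>v\<in>carrier_vec n. \<forall>w\<in>carrier_vec n.
      polar q (u + v) w = polar q u w + polar q v w) \<and>
    (\<forall>a. \<forall>v\<in>carrier_vec n. \<forall>w\<in>carrier_vec n. polar q (a \<cdot>\<^sub>v v) w = a * polar q v w)"

definition nondegenerate :: "nat \<Rightarrow> ('k::field vec \<Rightarrow> 'k) \<Rightarrow> bool"
  where "nondegenerate n q \<longleftrightarrow>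
    (\<forall>v\<in>carrier_vec n. (\<forall>w\<in>carrier_vec n. polar q v w = 0) \<longrightarrow> v = 0\<^sub>v n)"

text \<open>The extension of \<open>q\<close> to $\bar k^n$, written out in coordinates.\<close>

definition base_change ::
    "nat \<Rightarrow> ('k::field vec \<Rightarrow> 'k) \<Rightarrow> 'k alg_closure vec \<Rightarrow> 'k alg_closure"
  where "base_change n q x =
    (\<Sum>i<n. to_ac (q (unit_vec n i)) * (x $ i)\<^sup>2) +
    (\<Sum>j<n. \<Sum>i<j. to_ac (polar q (unit_vec n i) (unit_vec n j)) * x $ i * x $ j)"

text \<open>The $\bar k$-points of $\mathrm{SO}(q)$.\<close>

definition special_orthogonal :: "nat \<Rightarrow> ('k::field vec \<Rightarrow> 'k) \<Rightarrow> 'k alg_closure mat set"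
  where "special_orthogonal n q =
    {g \<in> carrier_mat n n. det g = 1 \<and>
      (\<forall>x\<in>carrier_vec n. base_change n q (g *\<^sub>v x) = base_change n q x)}"

end

theory Submission
  imports Defs
begin

text \<open>
  Write \<open>G\<close> for $\mathrm{SO}(q)$, \<open>V\<close> for the given representation, with coordinates \<open>x\<close>, and \<open>W\<close>
  for the space of $n \times n$ matrices, with generic matrix \<open>X\<close>, on which \<open>G\<close> acts by left
  multiplication. The invariant field of $V \oplus W$ is computed twice. On one side it is purely
  transcendental over $k(V)^G$, on the other side it is purely transcendental over \<open>k\<close>.
  Comparing the two descriptions gives the theorem, with $n^2$ auxiliary variables.

  Both computations take place in \<open>E\<close>, the field of rational functions on $V \oplus W$ over the
  algebraic closure, with the group \<open>J\<close> of all pairs of a point of \<open>G\<close> and a Galois automorphism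
  acting semilinearly. Putting the Galois group into \<open>J\<close> yields the invariants over \<open>k\<close> at once,
  without a separate descent.

  The comparison rests on Hilbert 90 for \<open>J\<close> (\<open>hilbert_90\<close>). As the action on \<open>V\<close> is almost free,
  there is an invertible matrix \<open>\<Phi>\<close> of rational functions on \<open>V\<close> that transforms like \<open>X\<close>
  (\<open>covariant_frame_V\<close>). The entries of $\Phi^{-1} X$ are therefore invariant, they are again
  coordinates of \<open>W\<close> over the functions on \<open>V\<close>, and so the invariants of $V \oplus W$ are the
  rational functions in these $n^2$ independent variables over $k(V)^G$. In the same way \<open>G\<close> acts
  freely on invertible matrices, so that there is an invertible matrix \<open>\<Psi>\<close> of rational functions
  on \<open>W\<close> that transforms like the representation (\<open>covariant_frame_W\<close>), and the invariants of
  $V \oplus W$ are the rational functions in the \<open>m\<close> entries of $\Psi^{-1} x$ over $k(W)^G$.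

  It remains to know $k(W)^G$. Two invertible matrices with the same Gram matrix $X^t B X$ and the
  same determinant differ by an element of \<open>G\<close>, so these functions separate orbits and, in
  characteristic zero, generate the invariants (\<open>invariants_W\<close>). They satisfy the relation
  $\det(X^t B X) = \det(X)^2 \det B$. It is linear in the last diagonal entry of the Gram matrix,
  which can thus be dropped (\<open>bset_field\<close>). What is left is algebraically independent, because
  every symmetric matrix that satisfies the relation is a Gram matrix (\<open>gram_matrix_surjective\<close>);
  the entries of $\Psi^{-1} x$ can be added since \<open>x\<close> is generic over the functions on \<open>W\<close>
  (\<open>invariants_independent\<close>).

  Three general facts carry the field theory. A partial homomorphism into an algebraically closed
  field extends to finitely many further elements if it does not annihilate a suitable nonzero element
  (\<open>specialisation_extends\<close>). An element outside the field generated by given ones is separated by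
  two specialisations that agree on those (\<open>separating_points\<close>). Finally, for a group that fixes
  the elements of \<open>Z\<close>, every fixed element of \<open>F(Z)\<close> is a rational function of elements of \<open>Z\<close>
  with fixed coefficients (\<open>fixed_field_generators\<close>).
\<close>

section \<open>Subrings, subfields and partial homomorphisms\<close>

definition is_subring :: "'a::comm_ring_1 set \<Rightarrow> bool"
  where "is_subring R \<longleftrightarrow> 1 \<in> R \<and> (\<forall>a\<in>R. \<forall>b\<in>R. a - b \<in> R \<and> a * b \<in> R)"

definition is_subfield :: "'a::field set \<Rightarrow> bool"
  where "is_subfield R \<longleftrightarrow> is_subring R \<and> (\<forall>a\<in>R. inverse a \<in> R)"

text \<open>
  Specialisations are defined only on part of a field, where denominators do not vanish. As
  functions are total, they are functions on the whole field that respect the ring operations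
  on a subring.
\<close>

definition hom_on :: "'a::comm_ring_1 set \<Rightarrow> ('a \<Rightarrow> 'b::comm_ring_1) \<Rightarrow> bool"
  where "hom_on R \<phi> \<longleftrightarrow> \<phi> 1 = 1 \<and>
    (\<forall>a\<in>R. \<forall>b\<in>R. \<phi> (a - b) = \<phi> a - \<phi> b \<and> \<phi> (a * b) = \<phi> a * \<phi> b)"

inductive_set ring_gen :: "'a::comm_ring_1 set \<Rightarrow> 'a set" for S where
  one: "1 \<in> ring_gen S"
| incl: "a \<in> S \<Longrightarrow> a \<in> ring_gen S"
| diff: "a \<in> ring_gen S \<Longrightarrow> b \<in> ring_gen S \<Longrightarrow> a - b \<in> ring_gen S"
| mult: "a \<in> ring_gen S \<Longrightarrow> b \<in> ring_gen S \<Longrightarrow> a * b \<in> ring_gen S"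

context
  fixes R :: "'a::comm_ring_1 set"
  assumes R: "is_subring R"
begin

lemma subring_one: "1 \<in> R" and subring_diff: "a \<in> R \<Longrightarrow> b \<in> R \<Longrightarrow> a - b \<in> R"
  and subring_mult: "a \<in> R \<Longrightarrow> b \<in> R \<Longrightarrow> a * b \<in> R"
  using R by (auto simp: is_subring_def)

lemma subring_zero: "0 \<in> R"
  using subring_diff[OF subring_one subring_one] by simp

lemma subring_uminus: "a \<in> R \<Longrightarrow> - a \<in> R"
  using subring_diff[OF subring_zero, of a] by simp

lemma subring_add: "a \<in> R \<Longrightarrow> b \<in> R \<Longrightarrow> a + b \<in> R"
  using subring_diff[of a "- b"] subring_uminus[of b] by simp

lemma subring_sum: "(\<And>i. i \<in> I \<Longrightarrow> f i \<in> R) \<Longrightarrow> sum f I \<in> R"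
  by (induction I rule: infinite_finite_induct) (auto intro: subring_zero subring_add)

lemma subring_prod: "(\<And>i. i \<in> I \<Longrightarrow> f i \<in> R) \<Longrightarrow> prod f I \<in> R"
  by (induction I rule: infinite_finite_induct) (auto intro: subring_one subring_mult)

lemma subring_power: "a \<in> R \<Longrightarrow> a ^ n \<in> R"
  by (induction n) (auto intro: subring_one subring_mult)

lemma subring_of_nat: "of_nat n \<in> R"
  by (induction n) (auto intro: subring_one subring_zero subring_add)

lemmas subring_closed = subring_zero subring_one subring_diff subring_uminus subring_add
  subring_mult subring_sum subring_prod subring_power subring_of_nat

lemma subring_signof: "signof p \<in> R"
  by (auto simp: sign_def intro: subring_closed)

lemma subring_det:
  assumes "\<And>i j. i < dim_row M \<Longrightarrow> j < dim_col M \<Longrightarrow> M $$ (i, j) \<in> R"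
  shows "det M \<in> R"
proof (cases "dim_row M = dim_col M")
  case True
  define n where "n = dim_row M"
  have "p i < n" if "p permutes {0..<n}" "i < n" for p i
    using permutes_in_image[OF that(1), of i] that by simp
  then have *: "M $$ (i, p i) \<in> R" if "p permutes {0..<n}" "i < n" for p i
    using assms[of i "p i"] that True by (simp add: n_def)
  have "(\<Sum>p | p permutes {0..<n}. signof p * (\<Prod>i = 0..<n. M $$ (i, p i))) \<in> R"
    by (intro subring_sum subring_mult subring_signof subring_prod) (simp add: *)
  then show ?thesis
    using True by (simp add: det_def n_def)
qed (simp add: det_def subring_zero)

lemma ring_gen_least: "S \<subseteq> R \<Longrightarrow> ring_gen S \<subseteq> R"
proof
  fix a assume "S \<subseteq> R" "a \<in> ring_gen S"
  from this(2) show "a \<in> R"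
    by induction (use \<open>S \<subseteq> R\<close> in \<open>auto intro: subring_closed\<close>)
qed

context
  fixes \<phi> :: "'a \<Rightarrow> 'b::comm_ring_1"
  assumes \<phi>: "hom_on R \<phi>"
begin

lemma hom_on_one: "\<phi> 1 = 1" and hom_on_diff: "a \<in> R \<Longrightarrow> b \<in> R \<Longrightarrow> \<phi> (a - b) = \<phi> a - \<phi> b"
  and hom_on_mult: "a \<in> R \<Longrightarrow> b \<in> R \<Longrightarrow> \<phi> (a * b) = \<phi> a * \<phi> b"
  using \<phi> by (auto simp: hom_on_def)

lemma hom_on_zero: "\<phi> 0 = 0"
  using hom_on_diff[OF subring_one subring_one] by simp

lemma hom_on_uminus: "a \<in> R \<Longrightarrow> \<phi> (- a) = - \<phi> a"
  using hom_on_diff[OF subring_zero, of a] hom_on_zero by simp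

lemma hom_on_add: "a \<in> R \<Longrightarrow> b \<in> R \<Longrightarrow> \<phi> (a + b) = \<phi> a + \<phi> b"
  using hom_on_diff[of a "- b"] subring_uminus[of b] hom_on_uminus[of b] by simp

lemma hom_on_sum: "(\<And>i. i \<in> I \<Longrightarrow> f i \<in> R) \<Longrightarrow> \<phi> (sum f I) = (\<Sum>i\<in>I. \<phi> (f i))"
  by (induction I rule: infinite_finite_induct)
    (auto simp: hom_on_zero hom_on_add subring_sum)

lemma hom_on_prod: "(\<And>i. i \<in> I \<Longrightarrow> f i \<in> R) \<Longrightarrow> \<phi> (prod f I) = (\<Prod>i\<in>I. \<phi> (f i))"
  by (induction I rule: infinite_finite_induct)
    (auto simp: hom_on_one hom_on_mult subring_prod)

lemma hom_on_power: "a \<in> R \<Longrightarrow> \<phi> (a ^ n) = \<phi> a ^ n"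
  by (induction n) (auto simp: hom_on_one hom_on_mult subring_power)

lemma hom_on_of_nat: "\<phi> (of_nat n) = of_nat n"
  by (induction n) (auto simp: hom_on_zero hom_on_one hom_on_add subring_one subring_of_nat)

lemma hom_on_signof: "\<phi> (signof p) = signof p"
  by (auto simp: sign_def hom_on_one hom_on_uminus subring_one)

lemma hom_on_det:
  assumes "\<And>i j. i < dim_row M \<Longrightarrow> j < dim_col M \<Longrightarrow> M $$ (i, j) \<in> R"
  shows "\<phi> (det M) = det (map_mat \<phi> M)"
proof (cases "dim_row M = dim_col M")
  case True
  define n where "n = dim_row M"
  have "p i < n" if "p permutes {0..<n}" "i < n" for p i
    using permutes_in_image[OF that(1), of i] that by simp
  then have lt: "p i < n" and *: "M $$ (i, p i) \<in> R" if "p permutes {0..<n}" "i < n" for p i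
    using assms[of i "p i"] that True by (simp_all add: n_def)
  have "\<phi> (det M) =
    \<phi> (\<Sum>p | p permutes {0..<n}. signof p * (\<Prod>i = 0..<n. M $$ (i, p i)))"
    using True by (simp add: det_def n_def)
  also have "\<dots> =
    (\<Sum>p | p permutes {0..<n}. \<phi> (signof p * (\<Prod>i = 0..<n. M $$ (i, p i))))"
    by (rule hom_on_sum) (intro subring_mult subring_signof subring_prod, simp add: *)
  also have "\<dots> =
    (\<Sum>p | p permutes {0..<n}. signof p * (\<Prod>i = 0..<n. \<phi> (M $$ (i, p i))))"
  proof (rule sum.cong[OF refl])
    fix p assume "p \<in> {p. p permutes {0..<n}}"
    then have p: "p permutes {0..<n}" by simp
    have "\<phi> (\<Prod>i = 0..<n. M $$ (i, p i)) = (\<Prod>i = 0..<n. \<phi> (M $$ (i, p i)))"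
      using p by (intro hom_on_prod) (simp add: *)
    moreover have "\<phi> (signof p * (\<Prod>i = 0..<n. M $$ (i, p i))) =
        \<phi> (signof p) * \<phi> (\<Prod>i = 0..<n. M $$ (i, p i))"
      using p by (intro hom_on_mult subring_signof subring_prod) (simp add: *)
    ultimately show "\<phi> (signof p * (\<Prod>i = 0..<n. M $$ (i, p i))) =
        signof p * (\<Prod>i = 0..<n. \<phi> (M $$ (i, p i)))"
      by (simp add: hom_on_signof)
  qed
  also have "\<dots> = (\<Sum>p | p permutes {0..<n}. signof p * (\<Prod>i = 0..<n. map_mat \<phi> M $$ (i, p i)))"
    using True lt by (intro sum.cong prod.cong refl arg_cong2[where f = "(*)"]) (simp add: n_def)
  also have "\<dots> = det (map_mat \<phi> M)"
    using True by (simp add: det_def n_def)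
  finally show ?thesis .
qed (simp add: det_def hom_on_zero)

end

lemma hom_on_agree:
  assumes "hom_on R \<phi>" "hom_on R \<psi>" and "S \<subseteq> R" "\<And>a. a \<in> S \<Longrightarrow> \<phi> a = \<psi> a"
    and "a \<in> ring_gen S"
  shows "\<phi> a = \<psi> a"
  using assms(5)
proof induction
  case (diff a b)
  then have "a \<in> R" "b \<in> R" using ring_gen_least[OF assms(3)] by auto
  then show ?case
    using diff hom_on_diff[OF assms(1)] hom_on_diff[OF assms(2)] by simp
next
  case (mult a b)
  then have "a \<in> R" "b \<in> R" using ring_gen_least[OF assms(3)] by auto
  then show ?case
    using mult hom_on_mult[OF assms(1)] hom_on_mult[OF assms(2)] by simp
qed (use assms in \<open>auto simp: hom_on_def\<close>)

end

lemma is_subring_ring_gen: "is_subring (ring_gen S)"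
  by (auto simp: is_subring_def intro: ring_gen.intros)

lemma is_subring_UNIV: "is_subring UNIV"
  by (simp add: is_subring_def)

lemma ring_gen_mono: "S \<subseteq> T \<Longrightarrow> ring_gen S \<subseteq> ring_gen T"
  by (rule ring_gen_least[OF is_subring_ring_gen]) (auto intro: ring_gen.incl)

lemma hom_on_mono: "hom_on R \<phi> \<Longrightarrow> S \<subseteq> R \<Longrightarrow> hom_on S \<phi>"
  by (auto simp: hom_on_def)

lemma is_subring_image:
  assumes "is_subring R" "hom_on R \<phi>"
  shows "is_subring (\<phi> ` R)"
  unfolding is_subring_def
proof (intro conjI ballI)
  show "1 \<in> \<phi> ` R"
    using hom_on_one[OF assms] subring_one[OF assms(1)] by (metis imageI)
next
  fix a b assume "a \<in> \<phi> ` R" "b \<in> \<phi> ` R"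
  then obtain a' b' where "a = \<phi> a'" "b = \<phi> b'" "a' \<in> R" "b' \<in> R" by auto
  then show "a - b \<in> \<phi> ` R" "a * b \<in> \<phi> ` R"
    using hom_on_diff[OF assms, of a' b'] hom_on_mult[OF assms, of a' b']
      subring_diff[OF assms(1), of a' b'] subring_mult[OF assms(1), of a' b']
    by (metis imageI)+
qed

lemma hom_on_fieldI:
  assumes "inj_idom_hom \<phi>" shows "hom_on R \<phi>"
proof -
  interpret inj_idom_hom \<phi> by fact
  show ?thesis by (simp add: hom_on_def hom_distribs)
qed

lemma is_subring_subfield: "is_subfield R \<Longrightarrow> is_subring R"
  by (simp add: is_subfield_def)

lemma subfield_inverse: "is_subfield R \<Longrightarrow> a \<in> R \<Longrightarrow> inverse a \<in> R"
  by (simp add: is_subfield_def)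

lemma subfield_divide: "is_subfield R \<Longrightarrow> a \<in> R \<Longrightarrow> b \<in> R \<Longrightarrow> a / b \<in> R"
  by (simp add: divide_inverse subring_mult is_subring_subfield subfield_inverse)

text \<open>
  The fields generated in the sense of \<open>generate_field\<close> are described by the operations of a ring
  record. The next lemmas turn them into the operations of the field type.
\<close>

lemma m_inv_type_algebra:
  assumes "(a::'a::field) \<noteq> 0"
  shows "m_inv ring_of_type_algebra a = inverse a"
proof -
  interpret field "ring_of_type_algebra :: 'a ring" by (rule field_from_type_algebra)
  show ?thesis
    by (rule comm_inv_char) (use assms in \<open>auto simp: ring_of_type_algebra_def\<close>)
qed

lemma a_inv_type_algebra: "a_inv ring_of_type_algebra (a::'a::field) = - a"
proof -
  interpret field "ring_of_type_algebra :: 'a ring" by (rule field_from_type_algebra)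
  show ?thesis
    using add.inv_equality[of "- a" a] by (simp add: ring_of_type_algebra_def)
qed

lemma is_subfield_field_gen: "is_subfield (field_gen S)"
proof -
  note [simp] = m_inv_type_algebra a_inv_type_algebra
  have one: "1 \<in> field_gen S"
    using generate_field.one[of ring_of_type_algebra S]
    by (simp add: field_gen_def ring_of_type_algebra_def)
  have mult: "a * b \<in> field_gen S" and add: "a + b \<in> field_gen S"
    if "a \<in> field_gen S" "b \<in> field_gen S" for a b
    using generate_field.eng_mult[of a ring_of_type_algebra S b]
      generate_field.eng_add[of a ring_of_type_algebra S b] that
    by (simp_all add: field_gen_def ring_of_type_algebra_def)
  have uminus: "- a \<in> field_gen S" if "a \<in> field_gen S" for a
    using generate_field.a_inv[of a ring_of_type_algebra S] that by (simp add: field_gen_def)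
  have inv: "inverse a \<in> field_gen S" if "a \<in> field_gen S" for a
  proof (cases "a = 0")
    case False
    then show ?thesis
      using generate_field.m_inv[of a ring_of_type_algebra S] that
      by (auto simp: field_gen_def) (simp add: ring_of_type_algebra_def)
  qed (use that in simp)
  show ?thesis
    unfolding is_subfield_def is_subring_def
    by (metis add uminus diff_conv_add_uminus mult inv one)
qed

lemma field_gen_incl: "a \<in> S \<Longrightarrow> a \<in> field_gen S"
  by (simp add: field_gen_def generate_field.incl)

lemma field_gen_least:
  assumes "is_subfield R" "S \<subseteq> R"
  shows "field_gen S \<subseteq> R"
proof
  note R = is_subring_subfield[OF assms(1)]
  fix a assume "a \<in> field_gen S"
  then show "a \<in> R"
    unfolding field_gen_def
  proof induction
    case one then show ?case using subring_one[OF R] by (simp add: ring_of_type_algebra_def)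
  next
    case (incl h) then show ?case using assms by auto
  next
    case (a_inv h) then show ?case using subring_uminus[OF R] by (simp add: a_inv_type_algebra)
  next
    case (m_inv h)
    then have "h \<noteq> 0" by (simp add: ring_of_type_algebra_def)
    with m_inv show ?case by (simp add: m_inv_type_algebra subfield_inverse[OF assms(1)])
  next
    case (eng_add h1 h2)
    then show ?case using subring_add[OF R] by (simp add: ring_of_type_algebra_def)
  next
    case (eng_mult h1 h2)
    then show ?case using subring_mult[OF R] by (simp add: ring_of_type_algebra_def)
  qed
qed

lemma field_gen_mono: "S \<subseteq> T \<Longrightarrow> field_gen S \<subseteq> field_gen T"
  by (rule field_gen_least[OF is_subfield_field_gen]) (auto intro: field_gen_incl)

lemma is_subring_field_gen: "is_subring (field_gen S)"
  by (rule is_subring_subfield[OF is_subfield_field_gen])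

lemma ring_gen_subset_field_gen: "ring_gen S \<subseteq> field_gen S"
  by (rule ring_gen_least[OF is_subring_field_gen]) (auto intro: field_gen_incl)

lemma field_gen_fractions:
  assumes "f \<in> field_gen S"
  obtains a b where "a \<in> ring_gen S" "b \<in> ring_gen S" "b \<noteq> 0" "f = a / b"
proof -
  let ?Q = "{a / b |a b. a \<in> ring_gen S \<and> b \<in> ring_gen S \<and> b \<noteq> 0}"
  note rg = ring_gen.intros subring_closed[OF is_subring_ring_gen[of S]]
  have "is_subfield ?Q"
    unfolding is_subfield_def is_subring_def
  proof (intro conjI ballI)
    show "1 \<in> ?Q"
      by (rule CollectI, rule exI[of _ 1], rule exI[of _ 1]) (auto intro: rg)
  next
    fix x y assume "x \<in> ?Q" "y \<in> ?Q"
    then obtain a b c d where *: "x = a / b" "y = c / d" "b \<noteq> 0" "d \<noteq> 0"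
      "a \<in> ring_gen S" "b \<in> ring_gen S" "c \<in> ring_gen S" "d \<in> ring_gen S"
      by blast
    have "x - y = (a * d - c * b) / (b * d)" "x * y = (a * c) / (b * d)"
      unfolding *(1,2) using *(3,4) by (simp_all add: diff_frac_eq)
    then show "x - y \<in> ?Q" "x * y \<in> ?Q"
      using *(3-) rg by (smt (verit) mem_Collect_eq no_zero_divisors)+
  next
    fix x assume "x \<in> ?Q"
    then obtain a b where *: "x = a / b" "b \<noteq> 0" "a \<in> ring_gen S" "b \<in> ring_gen S"
      by blast
    show "inverse x \<in> ?Q"
    proof (cases "a = 0")
      case True
      then have "inverse x = 0 / 1" using * by simp
      moreover have "(0::'a) \<in> ring_gen S" "(1::'a) \<in> ring_gen S" by (rule rg)+
      ultimately show ?thesis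
        by (intro CollectI exI[of _ 0] exI[of _ 1]) simp
    next
      case False
      moreover have "inverse x = b / a" using * by simp
      ultimately show ?thesis
        using * by (intro CollectI exI[of _ b] exI[of _ a]) simp
    qed
  qed
  moreover have "S \<subseteq> ?Q"
  proof
    fix a assume "a \<in> S"
    then show "a \<in> ?Q"
      by (intro CollectI exI[of _ a] exI[of _ 1]) (simp add: rg)
  qed
  ultimately show ?thesis
    using field_gen_least[of ?Q S] assms that by blast
qed

lemma field_gen_hom_agree:
  assumes \<phi>: "inj_idom_hom (\<phi> :: 'a::field \<Rightarrow> 'b::field)" and \<psi>: "inj_idom_hom \<psi>"
    and "\<And>a. a \<in> S \<Longrightarrow> \<phi> a = \<psi> a" and "f \<in> field_gen S"
  shows "\<phi> f = \<psi> f"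
proof -
  interpret p: field_hom \<phi> using \<phi> by (simp add: field_hom_def inj_idom_hom_def)
  interpret q: field_hom \<psi> using \<psi> by (simp add: field_hom_def inj_idom_hom_def)
  have "is_subfield {f. \<phi> f = \<psi> f}"
    by (auto simp: is_subfield_def is_subring_def hom_distribs)
  with assms show ?thesis
    using field_gen_least[of "{f. \<phi> f = \<psi> f}" S] by auto
qed

lemma field_gen_image:
  assumes \<phi>: "inj_idom_hom (\<phi> :: 'a::field \<Rightarrow> 'b::field)"
  shows "\<phi> ` field_gen S = field_gen (\<phi> ` S)"
proof
  interpret p: field_hom \<phi> using \<phi> by (simp add: field_hom_def inj_idom_hom_def)
  have "is_subfield {f. \<phi> f \<in> field_gen (\<phi> ` S)}"
    using is_subfield_field_gen[of "\<phi> ` S"]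
    by (auto simp: is_subfield_def is_subring_def hom_distribs)
  then show "\<phi> ` field_gen S \<subseteq> field_gen (\<phi> ` S)"
    using field_gen_least[of "{f. \<phi> f \<in> field_gen (\<phi> ` S)}" S] by (auto intro: field_gen_incl)
  have "is_subring (\<phi> ` field_gen S)"
    by (intro is_subring_image is_subring_field_gen hom_on_fieldI \<phi>)
  then have "is_subfield (\<phi> ` field_gen S)"
    unfolding is_subfield_def using subfield_inverse[OF is_subfield_field_gen]
    by (auto simp flip: p.hom_inverse)
  then show "field_gen (\<phi> ` S) \<subseteq> \<phi> ` field_gen S"
    by (rule field_gen_least) (auto intro: field_gen_incl)
qed

section \<open>Extending specialisations\<close>

definition poly_over :: "'a::comm_ring_1 set \<Rightarrow> 'a poly set"
  where "poly_over R = {p. \<forall>i. Polynomial.coeff p i \<in> R}"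

definition adjoin :: "'a::comm_ring_1 set \<Rightarrow> 'a \<Rightarrow> 'a set"
  where "adjoin R b = (\<lambda>p. poly p b) ` poly_over R"

context
  fixes R :: "'a::idom set"
  assumes R: "is_subring R"
begin

lemma coeff_in_R: "p \<in> poly_over R \<Longrightarrow> Polynomial.coeff p i \<in> R"
  by (simp add: poly_over_def)

lemma is_subring_poly_over: "is_subring (poly_over R)"
  unfolding is_subring_def poly_over_def
  by (auto simp: coeff_mult coeff_1 intro!: subring_diff[OF R] subring_sum[OF R] subring_mult[OF R]
      intro: subring_one[OF R] subring_zero[OF R])

lemma const_poly_over: "c \<in> R \<Longrightarrow> [:c:] \<in> poly_over R"
  by (auto simp: poly_over_def coeff_pCons subring_zero[OF R] split: nat.splits)

lemma monom_poly_over: "c \<in> R \<Longrightarrow> monom c n \<in> poly_over R"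
  by (auto simp: poly_over_def subring_zero[OF R])

lemma smult_poly_over: "c \<in> R \<Longrightarrow> p \<in> poly_over R \<Longrightarrow> smult c p \<in> poly_over R"
  by (auto simp: poly_over_def subring_mult[OF R])

lemma pderiv_poly_over: "p \<in> poly_over R \<Longrightarrow> pderiv p \<in> poly_over R"
  by (auto simp: poly_over_def coeff_pderiv intro!: subring_mult[OF R] subring_of_nat[OF R] simp del: of_nat_Suc)

lemma poly_in_R: "p \<in> poly_over R \<Longrightarrow> x \<in> R \<Longrightarrow> poly p x \<in> R"
  unfolding poly_altdef by (intro subring_sum[OF R] subring_mult[OF R] subring_power[OF R] coeff_in_R)

lemma is_subring_adjoin: "is_subring (adjoin R b)"
  unfolding adjoin_def
  by (intro is_subring_image is_subring_poly_over) (simp add: hom_on_def)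

lemma adjoin_incl: "c \<in> R \<Longrightarrow> c \<in> adjoin R b"
  unfolding adjoin_def using const_poly_over[of c] by (intro image_eqI[of _ _ "[:c:]"]) simp_all

lemma adjoin_gen: "b \<in> adjoin R b"
  unfolding adjoin_def using monom_poly_over[OF subring_one[OF R], of 1]
  by (intro image_eqI[of _ _ "monom 1 1"]) (simp_all add: poly_monom)

text \<open>
  The least subring property identifies \<open>adjoin R b\<close> with the ring generated by \<open>R\<close> and \<open>b\<close>;
  the description by polynomials is the one that computes with homomorphisms.
\<close>

lemma adjoin_least:
  assumes T: "is_subring T" "R \<subseteq> T" "b \<in> T"
  shows "adjoin R b \<subseteq> T"
proof
  fix x assume "x \<in> adjoin R b"
  then obtain p where "p \<in> poly_over R" "x = poly p b" by (auto simp: adjoin_def)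
  moreover from this have "Polynomial.coeff p i \<in> T" for i using T(2) coeff_in_R by blast
  ultimately show "x \<in> T"
    unfolding poly_altdef using T by (auto intro!: subring_sum[OF T(1)] subring_mult[OF T(1)] subring_power[OF T(1)])
qed

text \<open>
  The coefficients need not be invertible in \<open>R\<close>, hence the dividend is multiplied by a power of
  the leading coefficient of the divisor.
\<close>

lemma pseudo_division:
  assumes f: "f \<in> poly_over R" "f \<noteq> 0" and p: "p \<in> poly_over R"
  shows "\<exists>j h r. h \<in> poly_over R \<and> r \<in> poly_over R \<and>
    smult (lead_coeff f ^ j) p = f * h + r \<and> (r = 0 \<or> degree r < degree f)"
  using p
proof (induction "degree p" arbitrary: p rule: less_induct)
  case less
  note PR = is_subring_poly_over
  show ?case
  proof (cases "p = 0 \<or> degree p < degree f")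
    case True
    then show ?thesis
      using less.prems subring_zero[OF PR] by (intro exI[of _ 0] exI[of _ p]) auto
  next
    case False
    define l where "l = lead_coeff f"
    define t where "t = monom (lead_coeff p) (degree p - degree f)"
    define p' where "p' = smult l p - f * t"
    have l: "l \<in> R" "l \<noteq> 0" using f coeff_in_R by (auto simp: l_def)
    have t: "t \<in> poly_over R" unfolding t_def by (intro monom_poly_over coeff_in_R less.prems)
    have p': "p' \<in> poly_over R"
      unfolding p'_def by (intro subring_diff[OF PR] subring_mult[OF PR] smult_poly_over l f t less.prems)
    have deg: "p' = 0 \<or> degree p' < degree p"
    proof -
      have 1: "degree (smult l p) = degree p" using l by simp
      have 2: "degree (f * t) = degree p"
        using f False by (simp add: t_def degree_mult_eq degree_monom_eq)
      have 3: "lead_coeff (f * t) = lead_coeff (smult l p)"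
        using f False unfolding t_def lead_coeff_mult by (simp add: l_def degree_monom_eq)
      have "degree p' \<le> degree p" unfolding p'_def using 1 2 degree_diff_le_max[of "smult l p" "f * t"] by simp
      moreover have "Polynomial.coeff p' (degree p) = 0"
        unfolding p'_def using 1 2 3 by simp
      ultimately show ?thesis
        by (metis le_neq_implies_less leading_coeff_0_iff)
    qed
    have "\<exists>j h r. h \<in> poly_over R \<and> r \<in> poly_over R \<and>
      smult (l ^ j) p' = f * h + r \<and> (r = 0 \<or> degree r < degree f)"
    proof (cases "p' = 0")
      case True
      then show ?thesis
        using subring_zero[OF PR] by (intro exI[of _ 0]) auto
    qed (use less.hyps[of p'] deg p' l_def in auto)
    then obtain j h r where *: "h \<in> poly_over R" "r \<in> poly_over R"
      "smult (l ^ j) p' = f * h + r" "r = 0 \<or> degree r < degree f" by blast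
    have "smult (l ^ Suc j) p = smult (l ^ j) (p' + f * t)"
      by (simp add: p'_def mult.commute)
    also have "\<dots> = f * (h + smult (l ^ j) t) + r"
      by (simp add: smult_add_right *(3) algebra_simps)
    finally show ?thesis
      using * l t
      by (intro exI[of _ "Suc j"] exI[of _ "h + smult (l ^ j) t"] exI[of _ r])
        (auto simp: l_def intro!: subring_add[OF PR] smult_poly_over subring_power[OF R])
  qed
qed

definition min_poly :: "'a \<Rightarrow> 'a poly \<Rightarrow> bool"
  where "min_poly b f \<longleftrightarrow> f \<in> poly_over R \<and> f \<noteq> 0 \<and> poly f b = 0 \<and>
    (\<forall>p\<in>poly_over R. poly p b = 0 \<longrightarrow> p \<noteq> 0 \<longrightarrow> degree f \<le> degree p)"

lemma min_poly_exists:
  assumes "p \<in> poly_over R" "p \<noteq> 0" "poly p b = 0"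
  obtains f where "min_poly b f"
proof -
  let ?P = "\<lambda>p. p \<in> poly_over R \<and> p \<noteq> 0 \<and> poly p b = 0"
  have "?P (arg_min degree ?P)"
    by (rule arg_min_natI[of ?P p]) (use assms in auto)
  moreover have "degree (arg_min degree ?P) \<le> degree p'" if "?P p'" for p'
    using arg_min_nat_le[of ?P p' degree] that by auto
  ultimately show ?thesis
    by (intro that[of "arg_min degree ?P"]) (auto simp: min_poly_def)
qed

context
  fixes b :: 'a and f :: "'a poly"
  assumes f: "min_poly b f"
begin

lemma min_poly_degree_pos: "degree f > 0"
proof (rule ccontr)
  assume "\<not> degree f > 0"
  then obtain c where "f = [:c:]" by (metis degree_eq_zeroE gr0I)
  with f show False by (auto simp: min_poly_def)
qed

text \<open>
  Minimality of the degree kills the remainder of pseudo-division. The power of the leading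
  coefficient is harmless later, since specialisations that annihilate it are avoided.
\<close>

lemma min_poly_divides:
  assumes p: "p \<in> poly_over R" "poly p b = 0"
  obtains j h where "h \<in> poly_over R" "smult (lead_coeff f ^ j) p = f * h"
proof -
  obtain j h r where *: "h \<in> poly_over R" "r \<in> poly_over R"
      "smult (lead_coeff f ^ j) p = f * h + r" "r = 0 \<or> degree r < degree f"
    using pseudo_division[of f p] f p by (auto simp: min_poly_def)
  have "poly (smult (lead_coeff f ^ j) p) b = poly f b * poly h b + poly r b"
    by (simp only: * poly_add poly_mult)
  then have "poly r b = 0" using f p by (simp add: min_poly_def)
  with * f have "r = 0" by (auto simp: min_poly_def)
  with * that show ?thesis by simp
qed

text \<open>
  This reduces a condition on an extended homomorphism, that it does not annihilate \<open>poly p b\<close>, to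
  a condition on the given one. It is proved by the Euclidean algorithm for \<open>p\<close> and the minimal
  polynomial. No remainder vanishes at \<open>b\<close>, because the degree of the minimal polynomial is least, and
  so the algorithm ends with a nonzero constant.
\<close>

lemma algebraic_divides_constant:
  assumes "p \<in> poly_over R" "poly p b \<noteq> 0"
  shows "\<exists>u r. u \<in> poly_over R \<and> r \<in> R \<and> r \<noteq> 0 \<and> poly u b * poly p b = r"
proof -
  note PR = is_subring_poly_over
  have f': "f \<in> poly_over R" "f \<noteq> 0" "poly f b = 0" using f by (auto simp: min_poly_def)
  have small: "\<exists>u r. u \<in> poly_over R \<and> r \<in> R \<and> r \<noteq> 0 \<and> poly u b * poly p b = r"
    if "p \<in> poly_over R" "poly p b \<noteq> 0" "degree p < degree f" for p
    using that
  proof (induction "degree p" arbitrary: p rule: less_induct)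
    case less
    show ?case
    proof (cases "degree p = 0")
      case True
      then obtain c where c: "p = [:c:]" by (metis degree_eq_zeroE)
      with less.prems coeff_in_R[of p 0] show ?thesis
        using subring_one[OF PR] by (intro exI[of _ 1] exI[of _ c]) auto
    next
      case False
      have p0: "p \<noteq> 0" using less.prems by auto
      obtain j h r where *: "h \<in> poly_over R" "r \<in> poly_over R"
        "smult (lead_coeff p ^ j) f = p * h + r" "r = 0 \<or> degree r < degree p"
        using pseudo_division[OF less.prems(1) p0 f'(1)] by auto
      have "poly (smult (lead_coeff p ^ j) f) b = poly p b * poly h b + poly r b"
        by (simp only: * poly_add poly_mult)
      then have eq: "poly r b = - (poly p b * poly h b)"
        using f' by (simp add: eq_neg_iff_add_eq_0 add.commute)
      \<comment> \<open>if the remainder vanished at \<open>b\<close>, then \<open>h\<close> would be a polynomial of too small degree that vanishes at \<open>b\<close>\<close>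
      have "poly r b \<noteq> 0"
      proof
        assume r0: "poly r b = 0"
        have "r = 0"
        proof (rule ccontr)
          assume "r \<noteq> 0"
          then have "degree f \<le> degree r" using f * r0 by (auto simp: min_poly_def)
          with * \<open>r \<noteq> 0\<close> less.prems show False by auto
        qed
        then have eq2: "smult (lead_coeff p ^ j) f = p * h" using * by simp
        have "poly h b = 0" using eq r0 less.prems by auto
        moreover have "h \<noteq> 0" using eq2 p0 f' by auto
        ultimately have "degree f \<le> degree h" using f * by (auto simp: min_poly_def)
        moreover have "degree f = degree p + degree h"
          using arg_cong[OF eq2, of degree] p0 \<open>h \<noteq> 0\<close> by (simp add: degree_mult_eq)
        ultimately show False using False by simp
      qed
      moreover from this have "r \<noteq> 0" by auto
      ultimately obtain u c where u: "u \<in> poly_over R" "c \<in> R" "c \<noteq> 0" "poly u b * poly r b = c"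
        using less.hyps[of r] * less.prems by auto
      have "poly (- u * h) b * poly p b = poly u b * poly r b"
        by (simp add: eq algebra_simps)
      with u * show ?thesis
        by (intro exI[of _ "- u * h"] exI[of _ c])
          (auto intro!: subring_mult[OF PR] subring_uminus[OF PR])
    qed
  qed
  obtain j h r where *: "h \<in> poly_over R" "r \<in> poly_over R"
    "smult (lead_coeff f ^ j) p = f * h + r" "r = 0 \<or> degree r < degree f"
    using pseudo_division[OF f'(1,2) assms(1)] by auto
  have "poly (smult (lead_coeff f ^ j) p) b = poly f b * poly h b + poly r b"
    by (simp only: * poly_add poly_mult)
  then have eq: "poly r b = lead_coeff f ^ j * poly p b" using f' by simp
  then have "poly r b \<noteq> 0" using assms f' by simp
  moreover from this have "degree r < degree f" using * by auto
  ultimately obtain u c where u: "u \<in> poly_over R" "c \<in> R" "c \<noteq> 0" "poly u b * poly r b = c"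
    using small[of r] * by auto
  then show ?thesis
    using coeff_in_R[OF f'(1)]
    by (intro exI[of _ "smult (lead_coeff f ^ j) u"] exI[of _ c])
      (auto simp: eq algebra_simps intro!: smult_poly_over subring_power[OF R])
qed

end

end

context
  fixes R :: "'a::idom set" and \<phi> :: "'a \<Rightarrow> 'b::idom"
  assumes R: "is_subring R" and \<phi>: "hom_on R \<phi>"
begin

lemma coeff_map_hom: "Polynomial.coeff (map_poly \<phi> p) i = \<phi> (Polynomial.coeff p i)"
  by (simp add: coeff_map_poly hom_on_zero[OF R \<phi>])

lemma hom_on_map_poly: "hom_on (poly_over R) (map_poly \<phi>)"
  unfolding hom_on_def
proof (intro conjI ballI poly_eqI)
  fix i
  show "Polynomial.coeff (map_poly \<phi> 1) i = Polynomial.coeff 1 i"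
    by (simp add: coeff_map_hom coeff_1 hom_on_one[OF R \<phi>] hom_on_zero[OF R \<phi>])
next
  fix p q i assume p: "p \<in> poly_over R" "q \<in> poly_over R"
  note c = coeff_in_R[OF R p(1)] coeff_in_R[OF R p(2)]
  show "Polynomial.coeff (map_poly \<phi> (p - q)) i = Polynomial.coeff (map_poly \<phi> p - map_poly \<phi> q) i"
    by (simp add: coeff_map_hom hom_on_diff[OF R \<phi>] c)
  show "Polynomial.coeff (map_poly \<phi> (p * q)) i = Polynomial.coeff (map_poly \<phi> p * map_poly \<phi> q) i"
    by (simp add: coeff_map_hom coeff_mult hom_on_sum[OF R \<phi>] hom_on_mult[OF R \<phi>] c subring_mult[OF R])
qed

lemma map_poly_smult_hom:
  "c \<in> R \<Longrightarrow> p \<in> poly_over R \<Longrightarrow> map_poly \<phi> (smult c p) = smult (\<phi> c) (map_poly \<phi> p)"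
  by (rule poly_eqI) (simp add: coeff_map_hom hom_on_mult[OF R \<phi>] coeff_in_R[OF R])

lemma map_poly_pderiv_hom:
  "p \<in> poly_over R \<Longrightarrow> map_poly \<phi> (pderiv p) = pderiv (map_poly \<phi> p)"
  by (rule poly_eqI)
    (simp add: coeff_map_hom coeff_pderiv hom_on_mult[OF R \<phi>] hom_on_of_nat[OF R \<phi>] coeff_in_R[OF R]
      subring_of_nat[OF R] del: of_nat_Suc)

text \<open>
  A value for \<open>b\<close> is admissible as soon as it respects the polynomial relations of \<open>b\<close> over \<open>R\<close>:
  then the value of the extension does not depend on the polynomial that represents an element.
\<close>

lemma extend_hom:
  assumes "\<And>p. p \<in> poly_over R \<Longrightarrow> poly p b = 0 \<Longrightarrow> poly (map_poly \<phi> p) \<beta> = 0"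
  obtains \<psi> where "hom_on (adjoin R b) \<psi>" "\<And>c. c \<in> R \<Longrightarrow> \<psi> c = \<phi> c" "\<psi> b = \<beta>"
    "\<And>p. p \<in> poly_over R \<Longrightarrow> \<psi> (poly p b) = poly (map_poly \<phi> p) \<beta>"
proof -
  note PR = is_subring_poly_over[OF R] and MH = hom_on_map_poly
  define \<psi> where "\<psi> x = poly (map_poly \<phi> (SOME p. p \<in> poly_over R \<and> poly p b = x)) \<beta>" for x
  have \<psi>: "\<psi> (poly p b) = poly (map_poly \<phi> p) \<beta>" if p: "p \<in> poly_over R" for p
  proof -
    define p' where "p' = (SOME p'. p' \<in> poly_over R \<and> poly p' b = poly p b)"
    have p': "p' \<in> poly_over R" "poly p' b = poly p b"
      unfolding p'_def using someI[of "\<lambda>p'. p' \<in> poly_over R \<and> poly p' b = poly p b" p] p by auto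
    have "poly (map_poly \<phi> (p' - p)) \<beta> = 0"
      by (rule assms) (use p p' in \<open>auto intro: subring_diff[OF PR]\<close>)
    then show ?thesis
      using p p' hom_on_diff[OF PR MH, of p' p] by (simp add: \<psi>_def flip: p'_def)
  qed
  show ?thesis
  proof (rule that[of \<psi>])
    show "hom_on (adjoin R b) \<psi>"
      unfolding hom_on_def adjoin_def
    proof (intro conjI ballI; (elim imageE)?)
      show "\<psi> 1 = 1"
        using \<psi>[OF subring_one[OF PR]] hom_on_one[OF PR MH] by simp
    next
      fix x y p p' assume *: "x = poly p b" "p \<in> poly_over R" "y = poly p' b" "p' \<in> poly_over R"
      show "\<psi> (x - y) = \<psi> x - \<psi> y"
        using \<psi>[of "p - p'"] \<psi>[of p] \<psi>[of p'] * hom_on_diff[OF PR MH, of p p'] subring_diff[OF PR, of p p']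
        by simp
      show "\<psi> (x * y) = \<psi> x * \<psi> y"
        using \<psi>[of "p * p'"] \<psi>[of p] \<psi>[of p'] * hom_on_mult[OF PR MH, of p p'] subring_mult[OF PR, of p p']
        by simp
    qed
    show "\<psi> c = \<phi> c" if "c \<in> R" for c
      using \<psi>[OF const_poly_over[OF R that]] hom_on_zero[OF R \<phi>]
      by (simp add: map_poly_pCons)
    have "map_poly \<phi> (monom 1 1) = monom 1 1"
      using hom_on_zero[OF R \<phi>] hom_on_one[OF R \<phi>] by (intro poly_eqI) (simp add: coeff_map_hom)
    then show "\<psi> b = \<beta>"
      using \<psi>[OF monom_poly_over[OF R subring_one[OF R], of 1]]
      by (simp add: poly_monom)
  qed (fact \<psi>)
qed

end

lemma poly_nonroot_of_nat:
  fixes p :: "'a::idom poly"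
  assumes char: "\<And>n. n > 0 \<Longrightarrow> of_nat n \<noteq> (0::'a)" and p: "p \<noteq> 0"
  shows "\<exists>n. poly p (of_nat n) \<noteq> 0"
proof (rule ccontr)
  assume "\<nexists>n. poly p (of_nat n) \<noteq> 0"
  then have "range of_nat \<subseteq> {x. poly p x = 0}" by auto
  then have "finite (range (of_nat :: nat \<Rightarrow> 'a))"
    using poly_roots_finite[OF p] finite_subset by blast
  moreover have "inj (of_nat :: nat \<Rightarrow> 'a)"
  proof (rule linorder_inj_onI)
    fix m n :: nat assume "m < n"
    then have "(of_nat n :: 'a) = of_nat m + of_nat (n - m)" by (simp flip: of_nat_add)
    then show "(of_nat m :: 'a) \<noteq> of_nat n" using char[of "n - m"] \<open>m < n\<close> by simp
  qed auto
  ultimately have "finite (UNIV :: nat set)" by (rule finite_imageD)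
  then show False by simp
qed

context
  fixes R :: "'a::field set"
  assumes R: "is_subring R"
begin

text \<open>
  If \<open>b\<close> is algebraic over \<open>R\<close>, then any root of the image of its minimal polynomial is an
  admissible value, provided that the leading coefficient survives. If it is transcendental, then
  every value is admissible, and all but finitely many keep \<open>c\<close> away from zero.
\<close>

lemma extension_step:
  assumes c: "c \<in> adjoin R b" "c \<noteq> 0"
  shows "\<exists>a\<in>R. a \<noteq> 0 \<and> (\<forall>\<phi> :: 'a \<Rightarrow> 'o::{alg_closed_field, field_char_0}.
    hom_on R \<phi> \<longrightarrow> \<phi> a \<noteq> 0 \<longrightarrow>
    (\<exists>\<psi>. hom_on (adjoin R b) \<psi> \<and> (\<forall>x\<in>R. \<psi> x = \<phi> x) \<and> \<psi> c \<noteq> 0))"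
proof -
  note PR = is_subring_poly_over[OF R]
  obtain g where g: "g \<in> poly_over R" "c = poly g b" using c by (auto simp: adjoin_def)
  show ?thesis
  proof (cases "\<exists>p\<in>poly_over R. p \<noteq> 0 \<and> poly p b = 0")
    case True
    then obtain f where f: "min_poly R b f" using min_poly_exists[OF R] by blast
    obtain u r where u: "u \<in> poly_over R" "r \<in> R" "r \<noteq> 0" "poly u b * poly g b = r"
      using algebraic_divides_constant[OF R f g(1)] g c by auto
    define l where "l = lead_coeff f"
    have l: "l \<in> R" "l \<noteq> 0" and fR: "f \<in> poly_over R"
      using f coeff_in_R[OF R] by (auto simp: l_def min_poly_def[OF R])
    have "\<exists>\<psi>. hom_on (adjoin R b) \<psi> \<and> (\<forall>x\<in>R. \<psi> x = \<phi> x) \<and> \<psi> c \<noteq> 0"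
      if \<phi>: "hom_on R \<phi>" "\<phi> (l * r) \<noteq> 0" for \<phi> :: "'a \<Rightarrow> 'o"
    proof -
      note MH = hom_on_map_poly[OF R \<phi>(1)]
      have lr: "\<phi> l \<noteq> 0" "\<phi> r \<noteq> 0" using \<phi> hom_on_mult[OF R \<phi>(1), of l r] l u by auto
      have "degree (map_poly \<phi> f) = degree f"
        using lr by (intro map_poly_degree_eq) (simp add: l_def)
      then obtain \<beta> where \<beta>: "poly (map_poly \<phi> f) \<beta> = 0"
        using alg_closed_imp_poly_has_root min_poly_degree_pos[OF R f] by metis
      have ker: "poly (map_poly \<phi> p) \<beta> = 0" if p: "p \<in> poly_over R" "poly p b = 0" for p
      proof -
        obtain j h where h: "h \<in> poly_over R" "smult (l ^ j) p = f * h"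
          using min_poly_divides[OF R f p] l_def by blast
        have "map_poly \<phi> (smult (l ^ j) p) = smult (\<phi> l ^ j) (map_poly \<phi> p)"
          using p(1) l by (simp add: map_poly_smult_hom[OF R \<phi>(1)] hom_on_power[OF R \<phi>(1)] subring_power[OF R])
        moreover have "map_poly \<phi> (f * h) = map_poly \<phi> f * map_poly \<phi> h"
          by (rule hom_on_mult[OF PR MH fR h(1)])
        ultimately have "smult (\<phi> l ^ j) (map_poly \<phi> p) = map_poly \<phi> f * map_poly \<phi> h"
          using h(2) by simp
        then have "\<phi> l ^ j * poly (map_poly \<phi> p) \<beta> = 0"
          using \<beta> by (metis mult_zero_left poly_mult poly_smult)
        then show ?thesis using lr by simp
      qed
      then obtain \<psi> where \<psi>: "hom_on (adjoin R b) \<psi>" "\<And>c. c \<in> R \<Longrightarrow> \<psi> c = \<phi> c"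
        using extend_hom[OF R \<phi>(1)] by metis
      have "poly u b \<in> adjoin R b" "poly g b \<in> adjoin R b" using u g by (auto simp: adjoin_def)
      then have "\<psi> (poly u b) * \<psi> c = \<phi> r"
        using hom_on_mult[OF is_subring_adjoin[OF R] \<psi>(1)] u g \<psi>(2)[of r] by metis
      with \<psi> lr show ?thesis by auto
    qed
    then show ?thesis
      using l u by (intro bexI[of _ "l * r"]) (auto intro: subring_mult[OF R])
  next
    case False
    have "g \<noteq> 0" using g c by auto
    have "\<exists>\<psi>. hom_on (adjoin R b) \<psi> \<and> (\<forall>x\<in>R. \<psi> x = \<phi> x) \<and> \<psi> c \<noteq> 0"
      if \<phi>: "hom_on R \<phi>" "\<phi> (lead_coeff g) \<noteq> 0" for \<phi> :: "'a \<Rightarrow> 'o"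
    proof -
      have "Polynomial.coeff (map_poly \<phi> g) (degree g) \<noteq> 0"
        using \<phi> by (simp add: coeff_map_hom[OF R])
      then have "map_poly \<phi> g \<noteq> 0" by auto
      then obtain n where n: "poly (map_poly \<phi> g) (of_nat n) \<noteq> 0" using poly_nonroot_of_nat[where ?'a = 'o] by (metis of_nat_0_eq_iff less_numeral_extra(3))
      have "poly (map_poly \<phi> p) (of_nat n) = 0" if "p \<in> poly_over R" "poly p b = 0" for p
        using False that by auto
      then obtain \<psi> where \<psi>: "hom_on (adjoin R b) \<psi>" "\<And>c. c \<in> R \<Longrightarrow> \<psi> c = \<phi> c"
        "\<And>p. p \<in> poly_over R \<Longrightarrow> \<psi> (poly p b) = poly (map_poly \<phi> p) (of_nat n)"
        using extend_hom[OF R \<phi>(1)] by metis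
      with n g show ?thesis by metis
    qed
    then show ?thesis
      using \<open>g \<noteq> 0\<close> coeff_in_R[OF R g(1)] by (intro bexI[of _ "lead_coeff g"]) auto
  qed
qed

text \<open>
  An element that is not a fraction of elements of \<open>R\<close> is transcendental or has a minimal
  polynomial of degree at least two. In the second case characteristic zero makes its roots
  simple, also after specialisation, so that there are two of them.
\<close>

lemma two_extensions:
  assumes char: "\<And>n. n > 0 \<Longrightarrow> of_nat n \<noteq> (0::'a)"
    and b: "\<And>r. r \<in> R \<Longrightarrow> r \<noteq> 0 \<Longrightarrow> r * b \<notin> R"
    and c: "c \<in> adjoin R b" "c \<noteq> 0"
  shows "\<exists>a\<in>R. a \<noteq> 0 \<and> (\<forall>\<phi> :: 'a \<Rightarrow> 'o::{alg_closed_field, field_char_0}.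
    hom_on R \<phi> \<longrightarrow> \<phi> a \<noteq> 0 \<longrightarrow>
    (\<exists>\<psi>1 \<psi>2. hom_on (adjoin R b) \<psi>1 \<and> hom_on (adjoin R b) \<psi>2 \<and>
      (\<forall>x\<in>R. \<psi>1 x = \<phi> x \<and> \<psi>2 x = \<phi> x) \<and> \<psi>1 c \<noteq> 0 \<and> \<psi>2 c \<noteq> 0 \<and> \<psi>1 b \<noteq> \<psi>2 b))"
proof -
  note PR = is_subring_poly_over[OF R]
  obtain g where g: "g \<in> poly_over R" "c = poly g b" using c by (auto simp: adjoin_def)
  show ?thesis
  proof (cases "\<exists>p\<in>poly_over R. p \<noteq> 0 \<and> poly p b = 0")
    case True
    then obtain f where f: "min_poly R b f" using min_poly_exists[OF R] by blast
    have fR: "f \<in> poly_over R" "f \<noteq> 0" "poly f b = 0" using f by (auto simp: min_poly_def[OF R])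
    define l where "l = lead_coeff f"
    have l: "l \<in> R" "l \<noteq> 0"
      using fR coeff_in_R[OF R] by (auto simp: l_def)
    have deg: "degree f \<ge> 2"
    proof (rule ccontr)
      assume "\<not> degree f \<ge> 2"
      with min_poly_degree_pos[OF R f] have d: "degree f = 1" by simp
      then have "Polynomial.coeff f 0 + b * l = 0"
        using fR by (simp add: poly_altdef l_def mult.commute)
      then have "l * b = - Polynomial.coeff f 0" by (simp add: eq_neg_iff_add_eq_0 mult.commute add.commute)
      with b[of l] l show False using subring_uminus[OF R coeff_in_R[OF R fR(1)]] by simp
    qed
    \<comment> \<open>in characteristic zero the derivative of the minimal polynomial does not vanish at \<open>b\<close>\<close>
    have "poly (pderiv f) b \<noteq> 0"
    proof
      assume 0: "poly (pderiv f) b = 0"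
      have "Polynomial.coeff (pderiv f) (degree f - 1) = of_nat (degree f) * l"
        using deg by (simp add: coeff_pderiv l_def)
      then have nz: "pderiv f \<noteq> 0" using char[of "degree f"] deg l by auto
      then have "degree f \<le> degree (pderiv f)"
        using f 0 pderiv_poly_over[OF R fR(1)] by (auto simp: min_poly_def[OF R])
      moreover have "degree (pderiv f) \<le> degree f - 1"
        by (rule degree_le) (auto simp: coeff_pderiv intro!: coeff_eq_0)
      ultimately show False using deg by simp
    qed
    then obtain v s where v: "v \<in> poly_over R" "s \<in> R" "s \<noteq> 0" "poly v b * poly (pderiv f) b = s"
      using algebraic_divides_constant[OF R f pderiv_poly_over[OF R fR(1)]] by auto
    obtain u r where u: "u \<in> poly_over R" "r \<in> R" "r \<noteq> 0" "poly u b * poly g b = r"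
      using algebraic_divides_constant[OF R f g(1)] g c by auto
    \<comment> \<open>the three factors preserve the degree of \<open>f\<close>, the value \<open>c\<close> and the simplicity of the roots\<close>
    have "\<exists>\<psi>1 \<psi>2. hom_on (adjoin R b) \<psi>1 \<and> hom_on (adjoin R b) \<psi>2 \<and>
      (\<forall>x\<in>R. \<psi>1 x = \<phi> x \<and> \<psi>2 x = \<phi> x) \<and> \<psi>1 c \<noteq> 0 \<and> \<psi>2 c \<noteq> 0 \<and> \<psi>1 b \<noteq> \<psi>2 b"
      if \<phi>: "hom_on R \<phi>" "\<phi> (l * r * s) \<noteq> 0" for \<phi> :: "'a \<Rightarrow> 'o"
    proof -
      note MH = hom_on_map_poly[OF R \<phi>(1)]
      have lr: "\<phi> l \<noteq> 0" "\<phi> r \<noteq> 0" "\<phi> s \<noteq> 0"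
        using \<phi> l u v by (auto simp: hom_on_mult[OF R \<phi>(1)] subring_mult[OF R])
      have deg': "degree (map_poly \<phi> f) = degree f"
        using lr by (intro map_poly_degree_eq) (simp add: l_def)
      have ext: "\<exists>\<psi>. hom_on (adjoin R b) \<psi> \<and> (\<forall>x\<in>R. \<psi> x = \<phi> x) \<and> \<psi> c \<noteq> 0 \<and> \<psi> b = \<beta> \<and>
          poly (pderiv (map_poly \<phi> f)) \<beta> \<noteq> 0"
        if \<beta>: "poly (map_poly \<phi> f) \<beta> = 0" for \<beta>
      proof -
        have ker: "poly (map_poly \<phi> p) \<beta> = 0" if p: "p \<in> poly_over R" "poly p b = 0" for p
        proof -
          obtain j h where h: "h \<in> poly_over R" "smult (l ^ j) p = f * h"
            using min_poly_divides[OF R f p] l_def by blast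
          have "map_poly \<phi> (smult (l ^ j) p) = smult (\<phi> l ^ j) (map_poly \<phi> p)"
            using p(1) l by (simp add: map_poly_smult_hom[OF R \<phi>(1)] hom_on_power[OF R \<phi>(1)] subring_power[OF R])
          moreover have "map_poly \<phi> (f * h) = map_poly \<phi> f * map_poly \<phi> h"
            by (rule hom_on_mult[OF PR MH fR(1) h(1)])
          ultimately have "smult (\<phi> l ^ j) (map_poly \<phi> p) = map_poly \<phi> f * map_poly \<phi> h"
            using h(2) by simp
          then have "\<phi> l ^ j * poly (map_poly \<phi> p) \<beta> = 0"
            using \<beta> by (metis mult_zero_left poly_mult poly_smult)
          then show ?thesis using lr by simp
        qed
        then obtain \<psi> where \<psi>: "hom_on (adjoin R b) \<psi>" "\<And>c. c \<in> R \<Longrightarrow> \<psi> c = \<phi> c" "\<psi> b = \<beta>"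
          "\<And>p. p \<in> poly_over R \<Longrightarrow> \<psi> (poly p b) = poly (map_poly \<phi> p) \<beta>"
          using extend_hom[OF R \<phi>(1)] by metis
        have "poly u b \<in> adjoin R b" "poly g b \<in> adjoin R b" "poly v b \<in> adjoin R b"
          "poly (pderiv f) b \<in> adjoin R b"
          using u g v pderiv_poly_over[OF R fR(1)] by (auto simp: adjoin_def)
        then have "\<psi> (poly u b) * \<psi> c = \<phi> r" "\<psi> (poly v b) * \<psi> (poly (pderiv f) b) = \<phi> s"
          using hom_on_mult[OF is_subring_adjoin[OF R] \<psi>(1)] u g v \<psi>(2)[of r] \<psi>(2)[of s] by metis+
        moreover have "\<psi> (poly (pderiv f) b) = poly (pderiv (map_poly \<phi> f)) \<beta>"
          using \<psi>(4) pderiv_poly_over[OF R fR(1)] map_poly_pderiv_hom[OF R \<phi>(1) fR(1)] by metis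
        ultimately show ?thesis
          using \<psi> lr by (intro exI[of _ \<psi>]) auto
      qed
      obtain \<beta> where \<beta>: "poly (map_poly \<phi> f) \<beta> = 0"
        using alg_closed_imp_poly_has_root[of "map_poly \<phi> f"] deg deg' by auto
      obtain \<psi>1 where \<psi>1: "hom_on (adjoin R b) \<psi>1" "\<forall>x\<in>R. \<psi>1 x = \<phi> x" "\<psi>1 c \<noteq> 0" "\<psi>1 b = \<beta>"
        and d: "poly (pderiv (map_poly \<phi> f)) \<beta> \<noteq> 0"
        using ext[OF \<beta>] by auto
      \<comment> \<open>a further root \<open>\<gamma>\<close> of the cofactor differs from \<open>\<beta>\<close>, since \<open>\<beta>\<close> is a simple root\<close>
      obtain h where h: "map_poly \<phi> f = [:- \<beta>, 1:] * h"
        using \<beta> by (metis dvdE poly_eq_0_iff_dvd)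
      have "h \<noteq> 0" using h deg deg' by auto
      then have "degree (map_poly \<phi> f) = 1 + degree h"
        by (subst h) (simp add: degree_mult_eq del: mult_pCons_left)
      then obtain \<gamma> where \<gamma>: "poly h \<gamma> = 0"
        using alg_closed_imp_poly_has_root[of h] deg deg' by auto
      have "\<gamma> \<noteq> \<beta>"
      proof
        assume "\<gamma> = \<beta>"
        with \<gamma> have "poly (pderiv (map_poly \<phi> f)) \<beta> = 0"
          by (simp add: h pderiv_mult pderiv_pCons del: mult_pCons_left)
        with d show False by simp
      qed
      moreover have "poly (map_poly \<phi> f) \<gamma> = 0" using h \<gamma> by simp
      then obtain \<psi>2 where "hom_on (adjoin R b) \<psi>2" "\<forall>x\<in>R. \<psi>2 x = \<phi> x" "\<psi>2 c \<noteq> 0" "\<psi>2 b = \<gamma>"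
        using ext[of \<gamma>] by auto
      ultimately show ?thesis using \<psi>1 by auto
    qed
    then show ?thesis
      using l u v by (intro bexI[of _ "l * r * s"]) (auto intro!: subring_mult[OF R])
  next
    case False
    have "g \<noteq> 0" using g c by auto
    have "\<exists>\<psi>1 \<psi>2. hom_on (adjoin R b) \<psi>1 \<and> hom_on (adjoin R b) \<psi>2 \<and>
      (\<forall>x\<in>R. \<psi>1 x = \<phi> x \<and> \<psi>2 x = \<phi> x) \<and> \<psi>1 c \<noteq> 0 \<and> \<psi>2 c \<noteq> 0 \<and> \<psi>1 b \<noteq> \<psi>2 b"
      if \<phi>: "hom_on R \<phi>" "\<phi> (lead_coeff g) \<noteq> 0" for \<phi> :: "'a \<Rightarrow> 'o"
    proof -
      have "Polynomial.coeff (map_poly \<phi> g) (degree g) \<noteq> 0"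
        using \<phi> by (simp add: coeff_map_hom[OF R])
      then have nz: "map_poly \<phi> g \<noteq> 0" by auto
      then obtain n where n: "poly (map_poly \<phi> g) (of_nat n) \<noteq> 0" using poly_nonroot_of_nat[where ?'a = 'o] by (metis of_nat_0_eq_iff less_numeral_extra(3))
      have "map_poly \<phi> g * [:- of_nat n, 1:] \<noteq> 0" using nz by (simp del: mult_pCons_right)
      then obtain n' where "poly (map_poly \<phi> g * [:- of_nat n, 1:]) (of_nat n') \<noteq> 0"
        using poly_nonroot_of_nat[where ?'a = 'o] by (metis of_nat_0_eq_iff less_numeral_extra(3))
      then have n': "poly (map_poly \<phi> g) (of_nat n') \<noteq> 0" "of_nat n' \<noteq> (of_nat n :: 'o)"
        by (auto simp del: mult_pCons_right)
      have "\<exists>\<psi>. hom_on (adjoin R b) \<psi> \<and> (\<forall>x\<in>R. \<psi> x = \<phi> x) \<and> \<psi> c \<noteq> 0 \<and> \<psi> b = \<beta>"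
        if "poly (map_poly \<phi> g) \<beta> \<noteq> 0" for \<beta>
      proof -
        have "poly (map_poly \<phi> p) \<beta> = 0" if "p \<in> poly_over R" "poly p b = 0" for p
          using False that by auto
        then obtain \<psi> where \<psi>: "hom_on (adjoin R b) \<psi>" "\<And>c. c \<in> R \<Longrightarrow> \<psi> c = \<phi> c" "\<psi> b = \<beta>"
          "\<And>p. p \<in> poly_over R \<Longrightarrow> \<psi> (poly p b) = poly (map_poly \<phi> p) \<beta>"
          using extend_hom[OF R \<phi>(1)] by metis
        with that g show ?thesis by metis
      qed
      from this[OF n(1)] this[OF n'(1)] n'(2) show ?thesis by metis
    qed
    then show ?thesis
      using \<open>g \<noteq> 0\<close> coeff_in_R[OF R g(1)] by (intro bexI[of _ "lead_coeff g"]) auto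
  qed
qed

lemma adjoin_eq_ring_gen: "adjoin R b = ring_gen (insert b R)"
proof
  show "adjoin R b \<subseteq> ring_gen (insert b R)"
    by (rule adjoin_least[OF R is_subring_ring_gen]) (auto intro: ring_gen.incl)
  show "ring_gen (insert b R) \<subseteq> adjoin R b"
    by (rule ring_gen_least[OF is_subring_adjoin[OF R]]) (auto intro: adjoin_gen[OF R] adjoin_incl[OF R])
qed

end

text \<open>
  Adjoining the elements of \<open>B\<close> one at a time, the element to be avoided moves down from
  \<open>R[B]\<close> to \<open>R\<close>. In geometric terms, the image of a dominant morphism contains an open set.
\<close>

theorem specialisation_extends:
  fixes R :: "'a::field set"
  assumes "is_subring R" "finite B" "c \<in> ring_gen (R \<union> B)" "c \<noteq> 0"
  shows "\<exists>a\<in>R. a \<noteq> 0 \<and> (\<forall>\<phi> :: 'a \<Rightarrow> 'o::{alg_closed_field, field_char_0}.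
    hom_on R \<phi> \<longrightarrow> \<phi> a \<noteq> 0 \<longrightarrow>
    (\<exists>\<psi>. hom_on (ring_gen (R \<union> B)) \<psi> \<and> (\<forall>x\<in>R. \<psi> x = \<phi> x) \<and> \<psi> c \<noteq> 0))"
  using assms(2,1,3,4)
proof (induction B arbitrary: R c rule: finite_induct)
  case empty
  then have "c \<in> R" using ring_gen_least[OF empty.prems(1) subset_refl] by auto
  moreover have "ring_gen (R \<union> {}) = R"
    using ring_gen_least[OF empty.prems(1) subset_refl] by (auto intro: ring_gen.incl)
  ultimately show ?case using empty.prems by (intro bexI[of _ c]) auto
next
  case (insert b B)
  have eq: "ring_gen (R \<union> insert b B) = ring_gen (adjoin R b \<union> B)"
    unfolding adjoin_eq_ring_gen[OF insert.prems(1)]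
  proof (rule antisym)
    show "ring_gen (R \<union> insert b B) \<subseteq> ring_gen (ring_gen (insert b R) \<union> B)"
      by (rule ring_gen_mono) (auto intro: ring_gen.incl)
    have "ring_gen (insert b R) \<subseteq> ring_gen (R \<union> insert b B)" by (rule ring_gen_mono) auto
    then show "ring_gen (ring_gen (insert b R) \<union> B) \<subseteq> ring_gen (R \<union> insert b B)"
      by (intro ring_gen_least[OF is_subring_ring_gen]) (auto intro: ring_gen.incl)
  qed
  obtain a' where a': "a' \<in> adjoin R b" "a' \<noteq> 0"
    "\<forall>\<phi> :: 'a \<Rightarrow> 'o. hom_on (adjoin R b) \<phi> \<longrightarrow> \<phi> a' \<noteq> 0 \<longrightarrow>
    (\<exists>\<psi>. hom_on (ring_gen (adjoin R b \<union> B)) \<psi> \<and> (\<forall>x\<in>adjoin R b. \<psi> x = \<phi> x) \<and> \<psi> c \<noteq> 0)"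
    using insert.IH[OF is_subring_adjoin[OF insert.prems(1)]] insert.prems eq by metis
  obtain a where a: "a \<in> R" "a \<noteq> 0" "\<forall>\<phi> :: 'a \<Rightarrow> 'o.
    hom_on R \<phi> \<longrightarrow> \<phi> a \<noteq> 0 \<longrightarrow>
    (\<exists>\<psi>. hom_on (adjoin R b) \<psi> \<and> (\<forall>x\<in>R. \<psi> x = \<phi> x) \<and> \<psi> a' \<noteq> 0)"
    using extension_step[OF insert.prems(1) a'(1,2), where 'o = 'o] by auto
  show ?case
  proof (rule bexI[OF _ a(1)], intro conjI allI impI a(2))
    fix \<phi> :: "'a \<Rightarrow> 'o" assume \<phi>: "hom_on R \<phi>" "\<phi> a \<noteq> 0"
    then obtain \<psi> where \<psi>: "hom_on (adjoin R b) \<psi>" "\<forall>x\<in>R. \<psi> x = \<phi> x" "\<psi> a' \<noteq> 0"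
      using a(3) by auto
    then obtain \<chi> where \<chi>: "hom_on (ring_gen (adjoin R b \<union> B)) \<chi>" "\<forall>x\<in>adjoin R b. \<chi> x = \<psi> x"
      "\<chi> c \<noteq> 0"
      using a'(3) by auto
    then show "\<exists>\<psi>. hom_on (ring_gen (R \<union> insert b B)) \<psi> \<and> (\<forall>x\<in>R. \<psi> x = \<phi> x) \<and> \<psi> c \<noteq> 0"
      unfolding eq using \<psi>(2) adjoin_incl[OF insert.prems(1)] by (intro exI[of _ \<chi>]) auto
  qed
qed

text \<open>
  In characteristic zero, a function that is constant on the generic fibres of \<open>Y\<close> is a rational
  function of \<open>Y\<close>. If \<open>u\<close> is not in the field generated by \<open>Y\<close>, then it has two values
  over a generic specialisation of \<open>Y\<close>, and each extends to the remaining elements \<open>B\<close>.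
\<close>

theorem separating_points:
  fixes \<iota> :: "'o::{alg_closed_field, field_char_0} \<Rightarrow> 'a::field"
  assumes \<iota>: "inj_idom_hom \<iota>" and fin: "finite Y" "finite B"
    and u: "u \<in> ring_gen (range \<iota> \<union> Y \<union> B)" "u \<notin> field_gen (range \<iota> \<union> Y)"
    and c: "c \<in> ring_gen (range \<iota> \<union> Y \<union> B)" "c \<noteq> 0"
  obtains \<psi>1 \<psi>2 where "hom_on (ring_gen (range \<iota> \<union> Y \<union> B)) \<psi>1"
    "hom_on (ring_gen (range \<iota> \<union> Y \<union> B)) \<psi>2"
    "\<And>a. \<psi>1 (\<iota> a) = a" "\<And>a. \<psi>2 (\<iota> a) = a" "\<And>y. y \<in> Y \<Longrightarrow> \<psi>1 y = \<psi>2 y"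
    "\<psi>1 c \<noteq> 0" "\<psi>2 c \<noteq> 0" "\<psi>1 u \<noteq> \<psi>2 u"
proof -
  interpret inj_idom_hom \<iota> by fact
  define R where "R = ring_gen (range \<iota> \<union> Y)"
  have R: "is_subring R" unfolding R_def by (rule is_subring_ring_gen)
  have char: "of_nat n \<noteq> (0::'a)" if "n > 0" for n
    using that by (metis gr_implies_not0 hom_of_nat hom_0_iff of_nat_eq_0_iff)
  have ru: "r * u \<notin> R" if r: "r \<in> R" "r \<noteq> 0" for r
  proof
    assume "r * u \<in> R"
    with r have "r * u \<in> field_gen (range \<iota> \<union> Y)" "r \<in> field_gen (range \<iota> \<union> Y)"
      using ring_gen_subset_field_gen unfolding R_def by blast+
    then have "(r * u) / r \<in> field_gen (range \<iota> \<union> Y)"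
      by (rule subfield_divide[OF is_subfield_field_gen])
    with r u show False by simp
  qed
  let ?S = "range \<iota> \<union> Y \<union> B"
  have Ru: "adjoin R u \<subseteq> ring_gen ?S"
    using u ring_gen_mono[of "range \<iota> \<union> Y" ?S] unfolding R_def
    by (intro adjoin_least[OF is_subring_ring_gen is_subring_ring_gen]) auto
  have inR: "x \<in> R" if "x \<in> range \<iota> \<union> Y" for x using that by (auto simp: R_def intro: ring_gen.incl)
  have eq: "ring_gen ?S = ring_gen (adjoin R u \<union> B)"
  proof (rule antisym)
    show "ring_gen ?S \<subseteq> ring_gen (adjoin R u \<union> B)"
      using inR adjoin_incl[OF R] by (intro ring_gen_mono) auto
    show "ring_gen (adjoin R u \<union> B) \<subseteq> ring_gen ?S"
      using Ru by (intro ring_gen_least[OF is_subring_ring_gen]) (auto intro: ring_gen.incl)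
  qed
  \<comment> \<open>the elements to be avoided are chosen downwards along \<open>range \<iota> \<subseteq> R \<subseteq> R[u] \<subseteq> R[u, B]\<close>\<close>
  obtain a' where a': "a' \<in> adjoin R u" "a' \<noteq> 0" "\<forall>\<phi> :: 'a \<Rightarrow> 'o.
    hom_on (adjoin R u) \<phi> \<longrightarrow> \<phi> a' \<noteq> 0 \<longrightarrow>
    (\<exists>\<psi>. hom_on (ring_gen ?S) \<psi> \<and> (\<forall>x\<in>adjoin R u. \<psi> x = \<phi> x) \<and> \<psi> c \<noteq> 0)"
    using specialisation_extends[OF is_subring_adjoin[OF R, of u] fin(2), of c, where 'o = 'o] c
    unfolding eq by auto
  obtain a where a: "a \<in> R" "a \<noteq> 0" "\<forall>\<phi> :: 'a \<Rightarrow> 'o.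
    hom_on R \<phi> \<longrightarrow> \<phi> a \<noteq> 0 \<longrightarrow>
    (\<exists>\<psi>1 \<psi>2. hom_on (adjoin R u) \<psi>1 \<and> hom_on (adjoin R u) \<psi>2 \<and>
      (\<forall>x\<in>R. \<psi>1 x = \<phi> x \<and> \<psi>2 x = \<phi> x) \<and> \<psi>1 a' \<noteq> 0 \<and> \<psi>2 a' \<noteq> 0 \<and> \<psi>1 u \<noteq> \<psi>2 u)"
    using two_extensions[OF R char ru a'(1,2), where 'o = 'o] by auto
  have rng: "is_subring (range \<iota>)"
    using is_subring_image[OF is_subring_UNIV hom_on_fieldI[OF \<iota>]] .
  obtain a0 where a0: "a0 \<in> range \<iota>" "a0 \<noteq> 0" "\<forall>\<phi> :: 'a \<Rightarrow> 'o.
    hom_on (range \<iota>) \<phi> \<longrightarrow> \<phi> a0 \<noteq> 0 \<longrightarrow>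
    (\<exists>\<psi>. hom_on R \<psi> \<and> (\<forall>x\<in>range \<iota>. \<psi> x = \<phi> x) \<and> \<psi> a \<noteq> 0)"
    using specialisation_extends[OF rng fin(1), of a, where 'o = 'o] a unfolding R_def by auto
  define \<phi>0 where "\<phi>0 = inv_into UNIV \<iota>"
  have \<phi>0: "\<phi>0 (\<iota> x) = x" for x unfolding \<phi>0_def by simp
  have "hom_on (range \<iota>) \<phi>0"
    unfolding hom_on_def
    by (auto simp: \<phi>0 simp flip: hom_minus hom_mult) (metis \<phi>0 hom_one)
  moreover have "\<phi>0 a0 \<noteq> 0" using a0 \<phi>0 by auto
  ultimately obtain \<phi> where \<phi>: "hom_on R \<phi>" "\<forall>x\<in>range \<iota>. \<phi> x = \<phi>0 x" "\<phi> a \<noteq> 0"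
    using a0 by blast
  obtain \<psi>1 \<psi>2 where \<psi>: "hom_on (adjoin R u) \<psi>1" "hom_on (adjoin R u) \<psi>2"
      "\<forall>x\<in>R. \<psi>1 x = \<phi> x \<and> \<psi>2 x = \<phi> x" "\<psi>1 a' \<noteq> 0" "\<psi>2 a' \<noteq> 0" "\<psi>1 u \<noteq> \<psi>2 u"
    using a(3) \<phi> by blast
  obtain \<chi>1 where \<chi>1: "hom_on (ring_gen ?S) \<chi>1" "\<forall>x\<in>adjoin R u. \<chi>1 x = \<psi>1 x" "\<chi>1 c \<noteq> 0"
    using a'(3) \<psi> by blast
  obtain \<chi>2 where \<chi>2: "hom_on (ring_gen ?S) \<chi>2" "\<forall>x\<in>adjoin R u. \<chi>2 x = \<psi>2 x" "\<chi>2 c \<noteq> 0"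
    using a'(3) \<psi> by blast
  show ?thesis
  proof (rule that[OF \<chi>1(1) \<chi>2(1)])
    show "\<chi>1 (\<iota> x) = x" "\<chi>2 (\<iota> x) = x" for x
      using \<chi>1(2) \<chi>2(2) \<psi>(3) \<phi>(2) inR[of "\<iota> x"] adjoin_incl[OF R] \<phi>0 by auto
    show "\<chi>1 y = \<chi>2 y" if "y \<in> Y" for y
      using \<chi>1(2) \<chi>2(2) \<psi>(3) inR[of y] that adjoin_incl[OF R] by auto
  qed (use \<chi>1 \<chi>2 \<psi> adjoin_gen[OF R] in auto)
qed

text \<open>
  This is the weak Nullstellensatz for finitely generated domains, as the case of
  \<open>specialisation_extends\<close> where \<open>R\<close> is the ground field.
\<close>

lemma nonvanishing_point:
  fixes \<iota> :: "'o::{alg_closed_field, field_char_0} \<Rightarrow> 'a::field"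
  assumes \<iota>: "inj_idom_hom \<iota>" and fin: "finite Y"
    and c: "c \<in> ring_gen (range \<iota> \<union> Y)" "c \<noteq> 0"
  obtains \<psi> where "hom_on (ring_gen (range \<iota> \<union> Y)) \<psi>" "\<And>a. \<psi> (\<iota> a) = a" "\<psi> c \<noteq> 0"
proof -
  interpret inj_idom_hom \<iota> by fact
  have rng: "is_subring (range \<iota>)"
    using is_subring_image[OF is_subring_UNIV hom_on_fieldI[OF \<iota>]] .
  obtain a0 where a0: "a0 \<in> range \<iota>" "a0 \<noteq> 0" "\<forall>\<phi> :: 'a \<Rightarrow> 'o.
    hom_on (range \<iota>) \<phi> \<longrightarrow> \<phi> a0 \<noteq> 0 \<longrightarrow>
    (\<exists>\<psi>. hom_on (ring_gen (range \<iota> \<union> Y)) \<psi> \<and> (\<forall>x\<in>range \<iota>. \<psi> x = \<phi> x) \<and> \<psi> c \<noteq> 0)"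
    using specialisation_extends[OF rng fin c, where 'o = 'o] by auto
  define \<phi>0 where "\<phi>0 = inv_into UNIV \<iota>"
  have \<phi>0: "\<phi>0 (\<iota> x) = x" for x unfolding \<phi>0_def by simp
  have "hom_on (range \<iota>) \<phi>0"
    unfolding hom_on_def
    by (auto simp: \<phi>0 simp flip: hom_minus hom_mult) (metis \<phi>0 hom_one)
  moreover have "\<phi>0 a0 \<noteq> 0" using a0 \<phi>0 by auto
  ultimately obtain \<psi> where "hom_on (ring_gen (range \<iota> \<union> Y)) \<psi>" "\<forall>x\<in>range \<iota>. \<psi> x = \<phi>0 x" "\<psi> c \<noteq> 0"
    using a0(3) by blast
  with that[of \<psi>] \<phi>0 show ?thesis by auto
qed

section \<open>The fixed field of the Galois group\<close>

lemma inj_idom_hom_to_ac: "inj_idom_hom to_ac"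
  by unfold_locales auto

lemma algebraic_over_range_to_ac:
  obtains p where "p \<in> poly_over (range to_ac)" "p \<noteq> 0" "poly p (b :: 'k::field alg_closure) = 0"
proof -
  obtain p :: "'k poly" where p: "p \<noteq> 0" "poly (map_poly to_ac p) b = 0"
    by (rule alg_closure_algebraic)
  show ?thesis
    by (rule that[of "map_poly to_ac p"]) (use p in \<open>auto simp: poly_over_def coeff_map_poly map_poly_eq_0_iff\<close>)
qed

text \<open>
  A nonzero algebraic element divides a nonzero constant, and constants are fixed.
\<close>

lemma hom_on_algebraic_nonzero:
  assumes D: "is_subring D" "hom_on D \<theta>" and sub: "range to_ac \<subseteq> D"
    and fixc: "\<And>c. \<theta> (to_ac c) = to_ac c" and x: "(x :: 'k::field alg_closure) \<in> D" "x \<noteq> 0"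
  shows "\<theta> x \<noteq> (0 :: 'k alg_closure)"
proof -
  have R: "is_subring (range to_ac :: 'k alg_closure set)"
    using is_subring_image[OF is_subring_UNIV hom_on_fieldI[OF inj_idom_hom_to_ac]] .
  obtain f where f: "min_poly (range to_ac) x f"
    using min_poly_exists[OF R] algebraic_over_range_to_ac[of x] by metis
  have "[:0, 1:] \<in> poly_over (range to_ac :: 'k alg_closure set)"
    using monom_poly_over[OF R subring_one[OF R], of 1] by (simp add: monom_altdef)
  moreover have "poly [:0, 1:] x \<noteq> 0" using x by simp
  ultimately obtain u r where u: "u \<in> poly_over (range to_ac)" "r \<in> range to_ac" "r \<noteq> 0"
    "poly u x * poly [:0, 1:] x = r"
    using algebraic_divides_constant[OF R f] by blast
  have "poly u x \<in> D"
    using u sub by (intro poly_in_R[OF D(1)] x) (auto simp: poly_over_def)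
  then have "\<theta> (poly u x) * \<theta> x = r"
    using hom_on_mult[OF D, of "poly u x" x] u x fixc by auto
  with u show ?thesis by auto
qed

text \<open>
  By Zorn's lemma there is a maximal extension. Its domain is everything by \<open>extension_step\<close>,
  whose condition holds automatically since no nonzero element is annihilated. It is surjective,
  as it permutes the finitely many roots of each polynomial over the ground field.
\<close>

lemma extend_to_closure:
  fixes \<psi> :: "'k::field_char_0 alg_closure \<Rightarrow> 'k alg_closure"
  assumes D0: "is_subring D0" "range to_ac \<subseteq> D0" and \<psi>: "hom_on D0 \<psi>"
    and fixc: "\<And>c. \<psi> (to_ac c) = to_ac c"
  obtains \<sigma> where "\<sigma> \<in> galois_group" "\<And>x. x \<in> D0 \<Longrightarrow> \<sigma> x = \<psi> x"
proof -
  \<comment> \<open>Zorn's lemma for the graphs of partial homomorphisms that extend \<open>\<psi>\<close>\<close>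
  define good where "good G \<longleftrightarrow> (\<forall>x\<in>D0. (x, \<psi> x) \<in> G) \<and>
    (\<forall>x y x' y'. (x, y) \<in> G \<longrightarrow> (x', y') \<in> G \<longrightarrow> (x - x', y - y') \<in> G \<and> (x * x', y * y') \<in> G) \<and>
    (\<forall>y. (0, y) \<in> G \<longrightarrow> y = 0)" for G :: "('k alg_closure \<times> 'k alg_closure) set"
  have graph: "good {(x, \<chi> x) |x. x \<in> D}"
    if D: "is_subring D" "D0 \<subseteq> D" "hom_on D \<chi>" "\<And>x. x \<in> D0 \<Longrightarrow> \<chi> x = \<psi> x" for D \<chi>
    using D unfolding good_def
    by (auto simp: hom_on_diff[OF D(1,3)] hom_on_mult[OF D(1,3)] hom_on_zero[OF D(1,3)]
        subring_diff[OF D(1)] subring_mult[OF D(1)])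
  have "\<exists>M\<in>{G. good G}. \<forall>H\<in>{G. good G}. M \<subseteq> H \<longrightarrow> H = M"
  proof (rule subset_Zorn_nonempty)
    show "{G. good G} \<noteq> {}"
      using graph[OF D0(1) subset_refl \<psi>] by auto
    fix C assume C: "C \<noteq> {}" "subset.chain {G. good G} C"
    have lin: "H \<subseteq> H2 \<or> H2 \<subseteq> H" if "H \<in> C" "H2 \<in> C" for H H2
      using C(2) that unfolding subset.chain_def by auto
    have g: "good H" if "H \<in> C" for H using C(2) that unfolding subset.chain_def by auto
    have "good (\<Union>C)"
      unfolding good_def
    proof (intro conjI ballI allI impI)
      fix x assume "x \<in> D0" then show "(x, \<psi> x) \<in> \<Union>C" using C(1) g by (auto simp: good_def)
    next
      fix x y x' y' assume "(x, y) \<in> \<Union>C" "(x', y') \<in> \<Union>C"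
      then obtain H H2 where "H \<in> C" "H2 \<in> C" "(x, y) \<in> H" "(x', y') \<in> H2" by auto
      then obtain Z where "Z \<in> C" "(x, y) \<in> Z" "(x', y') \<in> Z" using lin[of H H2] by auto
      then show "(x - x', y - y') \<in> \<Union>C" "(x * x', y * y') \<in> \<Union>C"
        using g[of Z] by (auto simp: good_def intro!: bexI[of _ Z])
    next
      fix y assume "(0, y) \<in> \<Union>C" then show "y = 0" using g by (auto simp: good_def)
    qed
    then show "\<Union>C \<in> {G. good G}" by simp
  qed
  then obtain G where G: "good G" and max: "\<And>H. good H \<Longrightarrow> G \<subseteq> H \<Longrightarrow> H = G" by auto
  define D where "D = Domain G"
  define \<theta> where "\<theta> x = (THE y. (x, y) \<in> G)" for x
  have Gd: "(x - x', y - y') \<in> G" "(x * x', y * y') \<in> G" if "(x, y) \<in> G" "(x', y') \<in> G" for x y x' y'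
    using G that by (auto simp: good_def)
  have uniq: "y = y'" if "(x, y) \<in> G" "(x, y') \<in> G" for x y y'
    using Gd(1)[OF that] G by (auto simp: good_def)
  have \<theta>: "(x, \<theta> x) \<in> G" if "x \<in> D" for x
  proof -
    obtain y where "(x, y) \<in> G" using \<open>x \<in> D\<close> by (auto simp: D_def)
    then show ?thesis unfolding \<theta>_def using uniq by (metis theI)
  qed
  have \<theta>_eq: "\<theta> x = y" if "(x, y) \<in> G" for x y
    by (rule uniq[OF \<theta> that]) (use that in \<open>auto simp: D_def\<close>)
  have \<theta>\<psi>: "x \<in> D" "\<theta> x = \<psi> x" if "x \<in> D0" for x
    using G that \<theta>_eq by (auto simp: D_def good_def)
  have D: "is_subring D"
    unfolding is_subring_def
  proof (intro conjI ballI)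
    show "1 \<in> D" by (rule \<theta>\<psi>(1)[OF subring_one[OF D0(1)]])
    fix x y assume "x \<in> D" "y \<in> D"
    then show "x - y \<in> D" "x * y \<in> D"
      using Gd[OF \<theta> \<theta>] unfolding D_def by (meson DomainI)+
  qed
  have h\<theta>: "hom_on D \<theta>"
    unfolding hom_on_def
    using \<theta>\<psi>(2)[OF subring_one[OF D0(1)]] hom_on_one[OF D0(1) \<psi>] \<theta>_eq[OF Gd(1)[OF \<theta> \<theta>]]
      \<theta>_eq[OF Gd(2)[OF \<theta> \<theta>]] by simp
  have sub: "range to_ac \<subseteq> D" and \<theta>fix: "\<theta> (to_ac c) = to_ac c" for c
    using D0(2) \<theta>\<psi>(1) \<theta>\<psi>(2)[of "to_ac c"] fixc by auto
  have "b \<in> D" for b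
  proof -
    obtain a where a: "a \<in> D" "a \<noteq> 0" "\<forall>\<phi> :: 'k alg_closure \<Rightarrow> 'k alg_closure.
      hom_on D \<phi> \<longrightarrow> \<phi> a \<noteq> 0 \<longrightarrow>
      (\<exists>\<psi>. hom_on (adjoin D b) \<psi> \<and> (\<forall>x\<in>D. \<psi> x = \<phi> x) \<and> \<psi> 1 \<noteq> 0)"
      using extension_step[OF D subring_one[OF is_subring_adjoin[OF D, of b]], where 'o = "'k alg_closure"]
      by auto
    have "\<theta> a \<noteq> 0" by (rule hom_on_algebraic_nonzero[OF D h\<theta> sub \<theta>fix a(1,2)])
    then obtain \<chi> where \<chi>: "hom_on (adjoin D b) \<chi>" "\<forall>x\<in>D. \<chi> x = \<theta> x"
      using a h\<theta> by blast
    have DD: "D \<subseteq> adjoin D b" using adjoin_incl[OF D] by auto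
    have "good {(x, \<chi> x) |x. x \<in> adjoin D b}"
      using \<theta>\<psi> \<chi> DD by (intro graph is_subring_adjoin D) auto
    moreover have "G \<subseteq> {(x, \<chi> x) |x. x \<in> adjoin D b}"
    proof (rule subrelI)
      fix x y assume xy: "(x, y) \<in> G"
      then have "x \<in> D" by (auto simp: D_def)
      with xy DD \<chi>(2) \<theta>_eq[OF xy] show "(x, y) \<in> {(x, \<chi> x) |x. x \<in> adjoin D b}" by auto
    qed
    ultimately have "{(x, \<chi> x) |x. x \<in> adjoin D b} = G" by (rule max)
    then show ?thesis using adjoin_gen[OF D, of b] by (auto simp: D_def)
  qed
  then have DU: "D = UNIV" by auto
  note h = hom_on_diff[OF D h\<theta>, unfolded DU] hom_on_mult[OF D h\<theta>, unfolded DU]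
    hom_on_add[OF D h\<theta>, unfolded DU] hom_on_one[OF D h\<theta>] hom_on_zero[OF D h\<theta>]
  have inj: "inj \<theta>"
    using hom_on_algebraic_nonzero[OF D h\<theta> sub \<theta>fix] DU h by (intro injI) (metis UNIV_I right_minus_eq)
  have surj: "surj \<theta>"
  proof -
    have "\<exists>x. \<theta> x = y" for y
    proof -
      obtain p where p: "p \<in> poly_over (range to_ac)" "p \<noteq> 0" "poly p y = 0"
        by (rule algebraic_over_range_to_ac)
      let ?S = "{x. poly p x = 0}"
      have "\<theta> (Polynomial.coeff p i) = Polynomial.coeff p i" for i using p \<theta>fix by (auto simp: poly_over_def image_iff) (metis)
      then have "poly p (\<theta> x) = \<theta> (poly p x)" for x
        unfolding poly_altdef using DU
        by (simp add: hom_on_sum[OF D h\<theta>] hom_on_mult[OF D h\<theta>] hom_on_power[OF D h\<theta>])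
      then have "\<theta> ` ?S \<subseteq> ?S" using h by auto
      then have "\<theta> ` ?S = ?S"
        using poly_roots_finite[OF p(2)] inj by (intro card_subset_eq) (auto simp: card_image inj_on_subset)
      then have "y \<in> \<theta> ` ?S" using p by simp
      then show ?thesis by auto
    qed
    then show ?thesis by (metis surjI)
  qed
  have "field_isom \<theta>"
    by unfold_locales (use h surj in \<open>auto simp: surj_def\<close>)
  with \<theta>fix \<theta>\<psi> show ?thesis by (intro that[of \<theta>]) (auto simp: galois_group_def)
qed

text \<open>
  An element outside the ground field has a conjugate different from itself, by
  \<open>two_extensions\<close>, and the corresponding embedding extends to an automorphism.
\<close>

theorem galois_fixed_field:
  fixes a :: "'k::field_char_0 alg_closure"
  assumes fixed: "\<And>\<sigma>. \<sigma> \<in> galois_group \<Longrightarrow> \<sigma> a = a"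
  shows "a \<in> range to_ac"
proof (rule ccontr)
  assume a: "a \<notin> range to_ac"
  define R :: "'k alg_closure set" where "R = range to_ac"
  have R: "is_subring R"
    unfolding R_def using is_subring_image[OF is_subring_UNIV hom_on_fieldI[OF inj_idom_hom_to_ac]] .
  have ra: "r * a \<notin> R" if r: "r \<in> R" "r \<noteq> 0" for r
  proof
    assume "r * a \<in> R"
    then obtain x y where xy: "r * a = to_ac x" "r = to_ac y" using r by (auto simp: R_def)
    then have "a = to_ac (x / y)" using r by (simp add: field_simps)
    with a show False by blast
  qed
  have char: "of_nat n \<noteq> (0 :: 'k alg_closure)" if "n > 0" for n using that by simp
  obtain a0 where "a0 \<in> R" "a0 \<noteq> 0" and ext: "\<And>\<phi> :: 'k alg_closure \<Rightarrow> 'k alg_closure.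
    hom_on R \<phi> \<Longrightarrow> \<phi> a0 \<noteq> 0 \<Longrightarrow>
    (\<exists>\<psi>1 \<psi>2. hom_on (adjoin R a) \<psi>1 \<and> hom_on (adjoin R a) \<psi>2 \<and>
      (\<forall>x\<in>R. \<psi>1 x = \<phi> x \<and> \<psi>2 x = \<phi> x) \<and> \<psi>1 1 \<noteq> 0 \<and> \<psi>2 1 \<noteq> 0 \<and> \<psi>1 a \<noteq> \<psi>2 a)"
    using two_extensions[OF R char ra subring_one[OF is_subring_adjoin[OF R, of a]] one_neq_zero,
        where 'o = "'k alg_closure"] by blast
  moreover have "hom_on R id" by (simp add: hom_on_def)
  ultimately obtain \<psi>1 \<psi>2 where *: "hom_on (adjoin R a) \<psi>1" "hom_on (adjoin R a) \<psi>2"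
      "\<forall>x\<in>R. \<psi>1 x = x \<and> \<psi>2 x = x" "\<psi>1 a \<noteq> \<psi>2 a"
    using ext[of id] by auto
  then obtain \<psi> where \<psi>: "hom_on (adjoin R a) \<psi>" "\<forall>x\<in>R. \<psi> x = x" "\<psi> a \<noteq> a"
    by (metis (full_types))
  obtain \<sigma> where "\<sigma> \<in> galois_group" "\<And>x. x \<in> adjoin R a \<Longrightarrow> \<sigma> x = \<psi> x"
    using extend_to_closure[OF is_subring_adjoin[OF R] _ \<psi>(1)] \<psi>(2) adjoin_incl[OF R] R_def by blast
  with fixed \<psi>(3) adjoin_gen[OF R, of a] show False by metis
qed

section \<open>Generators of fixed fields\<close>

lemma field_hom_of_inj:
  "inj_idom_hom (\<phi> :: 'a::field \<Rightarrow> 'b::field) \<Longrightarrow> field_hom \<phi>"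
  by (simp add: field_hom_def inj_idom_hom_def)

text \<open>
  Artin's argument: in a relation with the fewest terms, normalised to have a coefficient \<open>1\<close>,
  the coefficients are fixed, as otherwise subtracting its image under \<open>act j\<close> would give a
  shorter one.
\<close>

lemma artin_relation:
  fixes act :: "'j \<Rightarrow> 'e::field \<Rightarrow> 'e"
  assumes act: "\<And>j. j \<in> J \<Longrightarrow> inj_idom_hom (act j)"
    and F: "is_subfield F" and stable: "\<And>j x. j \<in> J \<Longrightarrow> x \<in> F \<Longrightarrow> act j x \<in> F"
    and v: "\<And>j i. j \<in> J \<Longrightarrow> i \<in> I \<Longrightarrow> act j (v i) = v i" and "finite I"
    and c: "\<And>i. i \<in> I \<Longrightarrow> c i \<in> F" "(\<Sum>i\<in>I. c i * v i) = 0" "\<exists>i\<in>I. c i \<noteq> 0"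
  shows "\<exists>d. (\<forall>i\<in>I. d i \<in> F \<and> (\<forall>j\<in>J. act j (d i) = d i)) \<and> (\<Sum>i\<in>I. d i * v i) = 0 \<and> (\<exists>i\<in>I. d i \<noteq> 0)"
  using c
proof (induction "card {i \<in> I. c i \<noteq> 0}" arbitrary: c rule: less_induct)
  case less
  note R = is_subring_subfield[OF F]
  obtain i0 where i0: "i0 \<in> I" "c i0 \<noteq> 0" using less.prems by auto
  define d where "d i = c i / c i0" for i
  have dF: "d i \<in> F" if "i \<in> I" for i
    using that i0 less.prems subfield_divide[OF F] by (auto simp: d_def)
  have "(\<Sum>i\<in>I. d i * v i) = (\<Sum>i\<in>I. c i * v i) / c i0"
    by (simp add: d_def sum_divide_distrib)
  then have d0: "(\<Sum>i\<in>I. d i * v i) = 0" using less.prems by simp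
  show ?case
  proof (cases "\<forall>i\<in>I. \<forall>j\<in>J. act j (d i) = d i")
    case True
    then show ?thesis using d0 dF i0 by (intro exI[of _ d]) (auto simp: d_def)
  next
    case False
    then obtain i1 j where ij: "i1 \<in> I" "j \<in> J" "act j (d i1) \<noteq> d i1" by auto
    interpret inj_idom_hom "act j" by (rule act[OF ij(2)])
    define d' where "d' i = act j (d i) - d i" for i
    have "(\<Sum>i\<in>I. d' i * v i) = (\<Sum>i\<in>I. act j (d i * v i)) - (\<Sum>i\<in>I. d i * v i)"
      by (simp add: d'_def left_diff_distrib sum_subtractf hom_distribs v[OF ij(2)])
    also have "\<dots> = act j (\<Sum>i\<in>I. d i * v i) - (\<Sum>i\<in>I. d i * v i)"
      by (simp add: hom_sum)
    finally have "(\<Sum>i\<in>I. d' i * v i) = 0" using d0 by simp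
    moreover have "d' i \<in> F" if "i \<in> I" for i
      unfolding d'_def using that dF stable[OF ij(2)] by (intro subring_diff[OF R]) auto
    moreover have "d' i0 = 0" "\<And>i. c i = 0 \<Longrightarrow> d' i = 0"
      using i0 by (simp_all add: d'_def d_def)
    then have "{i \<in> I. d' i \<noteq> 0} \<subset> {i \<in> I. c i \<noteq> 0}"
      using i0 by auto
    then have "card {i \<in> I. d' i \<noteq> 0} < card {i \<in> I. c i \<noteq> 0}"
      using \<open>finite I\<close> by (intro psubset_card_mono) auto
    moreover have "\<exists>i\<in>I. d' i \<noteq> 0" using ij by (auto simp: d'_def)
    ultimately show ?thesis by (intro less.hyps[of d']) auto
  qed
qed

text \<open>
  Let \<open>D\<close> be the field generated by \<open>Z\<close> and the fixed elements of \<open>F\<close>. Then \<open>f\<close> is a quotient of two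
  linear combinations of elements of \<open>D\<close> with coefficients in \<open>F\<close>. That \<open>f\<close> times the denominator is the
  numerator is a linear relation, with coefficients in \<open>F\<close>, between fixed elements, namely elements \<open>e\<close>
  of \<open>D\<close> and their multiples \<open>f * e\<close>. Artin's argument replaces the coefficients by fixed ones, and the
  new relation expresses \<open>f\<close> over \<open>D\<close>.
\<close>

theorem fixed_field_generators:
  fixes act :: "'j \<Rightarrow> 'e::field \<Rightarrow> 'e"
  assumes act: "\<And>j. j \<in> J \<Longrightarrow> inj_idom_hom (act j)"
    and F: "is_subfield F" and stable: "\<And>j x. j \<in> J \<Longrightarrow> x \<in> F \<Longrightarrow> act j x \<in> F"
    and Z: "\<And>j z. j \<in> J \<Longrightarrow> z \<in> Z \<Longrightarrow> act j z = z"
    and f: "f \<in> field_gen (F \<union> Z)" "\<And>j. j \<in> J \<Longrightarrow> act j f = f"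
  shows "f \<in> field_gen ({x \<in> F. \<forall>j\<in>J. act j x = x} \<union> Z)"
proof -
  note R = is_subring_subfield[OF F]
  define D where "D = field_gen ({x \<in> F. \<forall>j\<in>J. act j x = x} \<union> Z)"
  have D: "is_subfield D" and DR: "is_subring D"
    unfolding D_def by (rule is_subfield_field_gen is_subring_field_gen)+
  have Dfix: "act j x = x" if j: "j \<in> J" and "x \<in> D" for j x
  proof -
    interpret field_hom "act j" by (rule field_hom_of_inj[OF act[OF j]])
    have "is_subfield {x. act j x = x}"
      by (auto simp: is_subfield_def is_subring_def hom_distribs)
    then have "D \<subseteq> {x. act j x = x}"
      unfolding D_def using Z[OF j] j by (intro field_gen_least) auto
    with that show ?thesis by auto
  qed
  \<comment> \<open>the ring generated by \<open>F\<close> and \<open>D\<close>, written as the \<open>F\<close>-linear span of \<open>D\<close>\<close>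
  define SP where "SP = {x. \<exists>A q. finite A \<and> A \<subseteq> D \<and> (\<forall>e\<in>A. q e \<in> F) \<and> x = (\<Sum>e\<in>A. q e * e)}"
  have SPI: "(\<Sum>e\<in>A. q e * e) \<in> SP" if "finite A" "A \<subseteq> D" "\<And>e. e \<in> A \<Longrightarrow> q e \<in> F" for A q
    using that by (auto simp: SP_def)
  have SP_extend: "\<exists>q'. (\<forall>e\<in>A \<union> B. q' e \<in> F) \<and> (\<Sum>e\<in>A \<union> B. q' e * e) = (\<Sum>e\<in>A. q e * e)"
    if "finite A" "finite B" "\<And>e. e \<in> A \<Longrightarrow> q e \<in> F" for A B q
  proof (intro exI[of _ "\<lambda>e. if e \<in> A then q e else 0"] conjI)
    show "\<forall>e\<in>A \<union> B. (if e \<in> A then q e else 0) \<in> F" using that subring_zero[OF R] by auto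
    show "(\<Sum>e\<in>A \<union> B. (if e \<in> A then q e else 0) * e) = (\<Sum>e\<in>A. q e * e)"
      using that by (intro sum.mono_neutral_cong_right) auto
  qed
  have SP_common: "\<exists>A p q. finite A \<and> A \<subseteq> D \<and> (\<forall>e\<in>A. p e \<in> F \<and> q e \<in> F) \<and>
      x = (\<Sum>e\<in>A. p e * e) \<and> y = (\<Sum>e\<in>A. q e * e)" if xy: "x \<in> SP" "y \<in> SP" for x y
  proof -
    obtain A p where A: "finite A" "A \<subseteq> D" "\<forall>e\<in>A. p e \<in> F" "x = (\<Sum>e\<in>A. p e * e)"
      using xy(1) by (auto simp: SP_def)
    obtain B q where B: "finite B" "B \<subseteq> D" "\<forall>e\<in>B. q e \<in> F" "y = (\<Sum>e\<in>B. q e * e)"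
      using xy(2) by (auto simp: SP_def)
    obtain p' where p': "\<forall>e\<in>A \<union> B. p' e \<in> F" "(\<Sum>e\<in>A \<union> B. p' e * e) = x"
      using SP_extend[of A B p] A B by auto
    obtain q' where q': "\<forall>e\<in>B \<union> A. q' e \<in> F" "(\<Sum>e\<in>B \<union> A. q' e * e) = y"
      using SP_extend[of B A q] A B by auto
    show ?thesis
      using A B p' q' by (intro exI[of _ "A \<union> B"] exI[of _ p'] exI[of _ q']) (auto simp: Un_commute)
  qed
  have SP_diff: "x - y \<in> SP" if xy: "x \<in> SP" "y \<in> SP" for x y
  proof -
    obtain A p q where A: "finite A" "A \<subseteq> D" "\<forall>e\<in>A. p e \<in> F \<and> q e \<in> F"
      and eq: "x = (\<Sum>e\<in>A. p e * e)" "y = (\<Sum>e\<in>A. q e * e)"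
      using SP_common[OF xy] by blast
    have "x - y = (\<Sum>e\<in>A. (p e - q e) * e)"
      by (simp add: eq left_diff_distrib sum_subtractf)
    also have "\<dots> \<in> SP" using A by (intro SPI subring_diff[OF R]) auto
    finally show ?thesis .
  qed
  have SP_0: "0 \<in> SP" using SPI[of "{}"] by auto
  have SP_sum: "sum g A \<in> SP" if "\<And>e. e \<in> A \<Longrightarrow> g e \<in> SP" for g and A :: "'e set"
    using that
  proof (induction A rule: infinite_finite_induct)
    case (insert a A)
    have "g a - (0 - sum g A) \<in> SP" using insert by (intro SP_diff SP_0) auto
    with insert show ?case by simp
  qed (auto simp: SP_0)
  have SP_single: "c * e \<in> SP" if "c \<in> F" "e \<in> D" for c e
    using SPI[of "{e}" "\<lambda>_. c"] that by auto
  have SP_mult: "x * y \<in> SP" if xy: "x \<in> SP" "y \<in> SP" for x y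
  proof -
    obtain A p q where A: "finite A" "A \<subseteq> D" "\<forall>e\<in>A. p e \<in> F \<and> q e \<in> F"
      and eq: "x = (\<Sum>e\<in>A. p e * e)" "y = (\<Sum>e\<in>A. q e * e)"
      using SP_common[OF xy] by blast
    have "x * y = (\<Sum>e\<in>A. \<Sum>e'\<in>A. (p e * q e') * (e * e'))"
      by (simp add: eq sum_product algebra_simps)
    also have "\<dots> \<in> SP"
      using A by (intro SP_sum SP_single subring_mult[OF R] subring_mult[OF DR]) auto
    finally show ?thesis .
  qed
  have "ring_gen (F \<union> Z) \<subseteq> SP"
  proof (rule ring_gen_least)
    show "is_subring SP"
      unfolding is_subring_def
      using SP_single[OF subring_one[OF R] subring_one[OF DR]] SP_diff SP_mult by simp
    show "F \<union> Z \<subseteq> SP"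
      using SP_single[OF _ subring_one[OF DR]] SP_single[OF subring_one[OF R]]
      by (auto simp: D_def intro: field_gen_incl)
  qed
  then obtain P Q where PQ: "P \<in> SP" "Q \<in> SP" "Q \<noteq> 0" "f = P / Q"
    using field_gen_fractions[OF f(1)] by (metis subsetD)
  \<comment> \<open>a representation of \<open>f\<close> with as few elements of \<open>D\<close> as possible: these are then linearly independent over \<open>F\<close>\<close>
  define rel where "rel A p q \<longleftrightarrow> finite A \<and> A \<subseteq> D \<and> (\<forall>e\<in>A. p e \<in> F \<and> q e \<in> F) \<and>
    f * (\<Sum>e\<in>A. q e * e) = (\<Sum>e\<in>A. p e * e) \<and> (\<Sum>e\<in>A. q e * e) \<noteq> 0" for A p q
  have "\<exists>A p q. rel A p q"
  proof -
    obtain A p q where *: "finite A" "A \<subseteq> D" "\<forall>e\<in>A. p e \<in> F \<and> q e \<in> F"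
      "P = (\<Sum>e\<in>A. p e * e)" "Q = (\<Sum>e\<in>A. q e * e)"
      using SP_common[OF PQ(1,2)] by blast
    have "f * Q = P" using PQ by simp
    then have "rel A p q" unfolding rel_def using * PQ(3) by simp
    then show ?thesis by blast
  qed
  then obtain A where "\<exists>p q. rel A p q" and min: "\<And>B p q. rel B p q \<Longrightarrow> card A \<le> card B"
    using ex_has_least_nat[of "\<lambda>A. \<exists>p q. rel A p q" _ card] by metis
  then obtain p q where rel: "rel A p q" by blast
  then have A: "finite A" "A \<subseteq> D" "\<And>e. e \<in> A \<Longrightarrow> p e \<in> F" "\<And>e. e \<in> A \<Longrightarrow> q e \<in> F"
    and eq: "f * (\<Sum>e\<in>A. q e * e) = (\<Sum>e\<in>A. p e * e)" "(\<Sum>e\<in>A. q e * e) \<noteq> 0"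
    by (auto simp: rel_def)
  have indep: "c e = 0" if c: "\<And>e. e \<in> A \<Longrightarrow> c e \<in> F" "(\<Sum>e\<in>A. c e * e) = 0" and "e \<in> A" for c e
  proof (rule ccontr)
    assume "c e \<noteq> 0"
    have red: "(\<Sum>x\<in>A - {e}. (g x - g e * (c x / c e)) * x) = (\<Sum>x\<in>A. g x * x)" for g
    proof -
      have "(\<Sum>x\<in>A. g x * x) = (\<Sum>x\<in>A. g x * x) - (g e / c e) * (\<Sum>x\<in>A. c x * x)"
        using c by simp
      also have "\<dots> = (\<Sum>x\<in>A. (g x - g e * (c x / c e)) * x)"
        by (simp add: sum_subtractf sum_distrib_left algebra_simps)
      also have "\<dots> = (\<Sum>x\<in>A - {e}. (g x - g e * (c x / c e)) * x)"
        using A(1) \<open>e \<in> A\<close> \<open>c e \<noteq> 0\<close> by (intro sum.mono_neutral_right) auto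
      finally show ?thesis by simp
    qed
    have "rel (A - {e}) (\<lambda>x. p x - p e * (c x / c e)) (\<lambda>x. q x - q e * (c x / c e))"
      unfolding rel_def red
    proof (intro conjI ballI)
      fix x assume "x \<in> A - {e}"
      then show "p x - p e * (c x / c e) \<in> F" "q x - q e * (c x / c e) \<in> F"
        using A c(1) \<open>e \<in> A\<close>
        by (auto intro!: subring_diff[OF R] subring_mult[OF R] subfield_divide[OF F])
    qed (use A eq in auto)
    then have "card A \<le> card (A - {e})" by (rule min)
    with A(1) \<open>e \<in> A\<close> show False by (meson card_Diff1_less not_le)
  qed
  \<comment> \<open>the relation with its two kinds of terms, indexed by a flag\<close>
  define v where "v = (\<lambda>(e, s). if s then f * e else (e :: 'e))"
  define c where "c = (\<lambda>(e, s). if s then q e else - p e)"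
  have split: "(\<Sum>i\<in>A \<times> UNIV. g i) = (\<Sum>e\<in>A. g (e, True)) + (\<Sum>e\<in>A. g (e, False))" for g :: "_ \<Rightarrow> 'e"
  proof -
    have "(\<Sum>i\<in>A \<times> UNIV. g i) = (\<Sum>e\<in>A. \<Sum>s\<in>UNIV. g (e, s))"
      by (simp only: sum.cartesian_product) (simp add: case_prod_unfold)
    also have "\<dots> = (\<Sum>e\<in>A. g (e, True)) + (\<Sum>e\<in>A. g (e, False))"
      by (simp add: UNIV_bool sum.distrib add.commute)
    finally show ?thesis .
  qed
  have "\<exists>d. (\<forall>i\<in>A \<times> UNIV. d i \<in> F \<and> (\<forall>j\<in>J. act j (d i) = d i)) \<and>
      (\<Sum>i\<in>A \<times> UNIV. d i * v i) = 0 \<and> (\<exists>i\<in>A \<times> UNIV. d i \<noteq> 0)"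
  proof (rule artin_relation[OF act F stable, where c = c])
    fix j and i :: "'e \<times> bool" assume "j \<in> J" "i \<in> A \<times> UNIV"
    then interpret inj_idom_hom "act j" using act by simp
    show "act j (v i) = v i"
      using \<open>j \<in> J\<close> \<open>i \<in> A \<times> UNIV\<close> A f by (auto simp: v_def hom_distribs Dfix)
  next
    show "(\<Sum>i\<in>A \<times> UNIV. c i * v i) = 0"
      using eq by (simp add: split c_def v_def sum_negf sum_distrib_left algebra_simps)
    show "\<exists>i\<in>A \<times> UNIV. c i \<noteq> 0"
    proof -
      obtain e where "e \<in> A" "q e \<noteq> 0" using eq(2) by (metis (no_types, lifting) mult_zero_left sum.neutral)
      then show ?thesis by (intro bexI[of _ "(e, True)"]) (auto simp: c_def)
    qed
  qed (use A subring_uminus[OF R] in \<open>auto simp: c_def\<close>)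
  then obtain d where d0: "\<forall>i\<in>A \<times> UNIV. d i \<in> F \<and> (\<forall>j\<in>J. act j (d i) = d i)"
    "(\<Sum>i\<in>A \<times> UNIV. d i * v i) = 0" "\<exists>i\<in>A \<times> UNIV. d i \<noteq> 0" by (elim exE conjE) rule
  have d: "d i \<in> F" "\<And>j. j \<in> J \<Longrightarrow> act j (d i) = d i" if "i \<in> A \<times> UNIV" for i
    using bspec[OF d0(1) that] by simp_all
  let ?q = "\<Sum>e\<in>A. d (e, True) * e" and ?p = "\<Sum>e\<in>A. d (e, False) * e"
  have eq': "f * ?q + ?p = 0"
    using d0(2) by (simp add: split v_def sum_distrib_left algebra_simps)
  \<comment> \<open>a vanishing denominator would be a linear relation between the elements of \<open>A\<close>\<close>
  have "?q \<noteq> 0"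
  proof
    assume q0: "?q = 0"
    then have "?p = 0" using eq' by simp
    then have "d (e, True) = 0" "d (e, False) = 0" if "e \<in> A" for e
      using indep[of "\<lambda>e. d (e, True)" e] indep[of "\<lambda>e. d (e, False)" e] q0 that d(1) by auto
    with d0(3) show False by auto (metis (full_types))
  qed
  then have "f = - ?p / ?q" using eq' by (simp add: field_simps eq_neg_iff_add_eq_0)
  moreover have "d i \<in> D" if "i \<in> A \<times> UNIV" for i
    unfolding D_def using d that by (intro field_gen_incl) auto
  then have "?q \<in> D" "?p \<in> D" using A by (auto intro!: subring_sum[OF DR] subring_mult[OF DR])
  ultimately show ?thesis
    using subfield_divide[OF D subring_uminus[OF DR, of ?p], of ?q] by (simp add: D_def)
qed

section \<open>Hilbert 90\<close>

text \<open>
  A group \<open>J\<close> acts on \<open>F\<close> by field automorphisms, and \<open>T\<close> is a cocycle with values in the invertible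
  matrices over \<open>F\<close>. The last assumption provides the products of \<open>J\<close>, together with the cocycle identity
  for them. The maps \<open>act j\<close> are defined on an ambient field type, of which \<open>F\<close> is a stable subfield.
\<close>

locale semilinear_action =
  fixes J :: "'j set" and act :: "'j \<Rightarrow> 'e::field \<Rightarrow> 'e" and T :: "'j \<Rightarrow> 'e mat"
    and F :: "'e set" and r :: nat and one :: 'j
  assumes act: "\<And>j. j \<in> J \<Longrightarrow> inj_idom_hom (act j)"
    and F: "is_subfield F" and stable: "\<And>j x. j \<in> J \<Longrightarrow> x \<in> F \<Longrightarrow> act j x \<in> F"
    and char: "\<And>n. n > 0 \<Longrightarrow> of_nat n \<noteq> (0::'e)"
    and one: "one \<in> J" "\<And>x. x \<in> F \<Longrightarrow> act one x = x" "T one = 1\<^sub>m r"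
    and T: "\<And>j. j \<in> J \<Longrightarrow> T j \<in> carrier_mat r r"
    and TF: "\<And>j a b. j \<in> J \<Longrightarrow> a < r \<Longrightarrow> b < r \<Longrightarrow> T j $$ (a, b) \<in> F"
    and T_inv: "\<And>j. j \<in> J \<Longrightarrow> \<exists>S\<in>carrier_mat r r. (\<forall>a<r. \<forall>b<r. S $$ (a, b) \<in> F) \<and> S * T j = 1\<^sub>m r"
    and comp: "\<And>i j. i \<in> J \<Longrightarrow> j \<in> J \<Longrightarrow>
      \<exists>l\<in>J. (\<forall>x\<in>F. act l x = act i (act j x)) \<and> T l = map_mat (act i) (T j) * T i"
begin

lemmas FR = is_subring_subfield[OF F]

definition ev :: "('e \<times> 'e) list \<Rightarrow> 'j \<Rightarrow> 'e"
  where "ev L j = (\<Sum>(m, f)\<leftarrow>L. m * act j f)"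

text \<open>
  Hilbert 90 fails for arbitrary cocycles of infinite groups. It holds if the entries of the cocycle
  are linear combinations, with coefficients in \<open>F\<close>, of orbit maps \<open>j \<mapsto> act j f\<close>. For functions on
  an algebraic group this replaces the requirement that the cocycle be algebraic.
\<close>

definition orbit_sum :: "('j \<Rightarrow> 'e) \<Rightarrow> bool"
  where "orbit_sum \<phi> \<longleftrightarrow> (\<exists>L. set L \<subseteq> F \<times> F \<and> (\<forall>j\<in>J. \<phi> j = ev L j))"

lemma ev_simps [simp]: "ev [] j = 0" "ev ((m, f) # L) j = m * act j f + ev L j"
  "ev (L @ L') j = ev L j + ev L' j"
  by (simp_all add: ev_def)

lemma act_hom: "j \<in> J \<Longrightarrow> act j (x + y) = act j x + act j y"
  "j \<in> J \<Longrightarrow> act j (x * y) = act j x * act j y"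
  "j \<in> J \<Longrightarrow> act j (x - y) = act j x - act j y"
  "j \<in> J \<Longrightarrow> act j 1 = 1" "j \<in> J \<Longrightarrow> act j 0 = 0" "j \<in> J \<Longrightarrow> act j (of_nat n) = of_nat n"
  "j \<in> J \<Longrightarrow> act j (x / y) = act j x / act j y"
  "j \<in> J \<Longrightarrow> act j (sum g I) = (\<Sum>i\<in>I. act j (g i))"
proof -
  assume "j \<in> J"
  then interpret field_hom "act j" by (intro field_hom_of_inj act)
  show "act j (x + y) = act j x + act j y" "act j (x * y) = act j x * act j y"
    "act j (x - y) = act j x - act j y" "act j 1 = 1" "act j 0 = 0" "act j (of_nat n) = of_nat n"
    "act j (x / y) = act j x / act j y" "act j (sum g I) = (\<Sum>i\<in>I. act j (g i))"
    by (simp_all add: hom_distribs)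
qed

lemma orbit_sum_cong: "orbit_sum \<phi> \<Longrightarrow> (\<And>j. j \<in> J \<Longrightarrow> \<phi> j = \<psi> j) \<Longrightarrow> orbit_sum \<psi>"
  by (auto simp: orbit_sum_def)

lemma orbit_sum_ev: "set L \<subseteq> F \<times> F \<Longrightarrow> orbit_sum (ev L)"
  by (auto simp: orbit_sum_def)

lemma orbit_sum_const: "m \<in> F \<Longrightarrow> orbit_sum (\<lambda>_. m)"
  unfolding orbit_sum_def by (rule exI[of _ "[(m, 1)]"]) (auto simp: act_hom subring_one[OF FR])

lemma orbit_sum_orbit: "f \<in> F \<Longrightarrow> orbit_sum (\<lambda>j. act j f)"
  unfolding orbit_sum_def by (rule exI[of _ "[(1, f)]"]) (auto simp: subring_one[OF FR])

lemma orbit_sum_add: "orbit_sum \<phi> \<Longrightarrow> orbit_sum \<psi> \<Longrightarrow> orbit_sum (\<lambda>j. \<phi> j + \<psi> j)"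
proof -
  assume "orbit_sum \<phi>" "orbit_sum \<psi>"
  then obtain L L' where "set L \<subseteq> F \<times> F" "\<forall>j\<in>J. \<phi> j = ev L j" "set L' \<subseteq> F \<times> F" "\<forall>j\<in>J. \<psi> j = ev L' j"
    by (auto simp: orbit_sum_def)
  then show ?thesis unfolding orbit_sum_def by (intro exI[of _ "L @ L'"]) auto
qed

lemma ev_scale: "j \<in> J \<Longrightarrow> ev (map (\<lambda>(m, f). (m' * m, f' * f)) L) j = m' * act j f' * ev L j"
  by (induction L) (auto simp: act_hom algebra_simps)

lemma orbit_sum_mult:
  assumes "orbit_sum \<phi>" "orbit_sum \<psi>" shows "orbit_sum (\<lambda>j. \<phi> j * \<psi> j)"
proof -
  obtain L L' where L: "set L \<subseteq> F \<times> F" "\<forall>j\<in>J. \<phi> j = ev L j" "set L' \<subseteq> F \<times> F" "\<forall>j\<in>J. \<psi> j = ev L' j"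
    using assms by (auto simp: orbit_sum_def)
  have "orbit_sum (\<lambda>j. ev L j * ev L' j)" using L(1)
  proof (induction L)
    case Nil
    then show ?case using orbit_sum_const[OF subring_zero[OF FR]] by simp
  next
    case (Cons x L)
    obtain m f where x: "x = (m, f)" by force
    have "orbit_sum (ev (map (\<lambda>(m', f'). (m * m', f * f')) L'))"
      using Cons.prems L(3) x by (intro orbit_sum_ev) (auto intro!: subring_mult[OF FR])
    then have "orbit_sum (\<lambda>j. m * act j f * ev L' j)"
      by (rule orbit_sum_cong) (simp add: ev_scale)
    from orbit_sum_add[OF this Cons.IH] Cons.prems show ?case by (simp add: x distrib_right)
  qed
  then show ?thesis by (rule orbit_sum_cong) (use L in simp)
qed

lemma orbit_sum_diff: "orbit_sum \<phi> \<Longrightarrow> orbit_sum \<psi> \<Longrightarrow> orbit_sum (\<lambda>j. \<phi> j - \<psi> j)"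
  using orbit_sum_add[OF _ orbit_sum_mult[OF orbit_sum_const[OF subring_uminus[OF FR subring_one[OF FR]]]]]
  by fastforce

lemma orbit_sum_sum: "(\<And>i. i \<in> I \<Longrightarrow> orbit_sum (\<phi> i)) \<Longrightarrow> orbit_sum (\<lambda>j. \<Sum>i\<in>I. \<phi> i j)"
  by (induction I rule: infinite_finite_induct)
    (auto intro: orbit_sum_add orbit_sum_const[OF subring_zero[OF FR]])

lemma orbit_sum_prod: "(\<And>i. i \<in> I \<Longrightarrow> orbit_sum (\<phi> i)) \<Longrightarrow> orbit_sum (\<lambda>j. \<Prod>i\<in>I. \<phi> i j)"
  by (induction I rule: infinite_finite_induct)
    (auto intro: orbit_sum_mult orbit_sum_const[OF subring_one[OF FR]])

lemma orbit_sum_power: "orbit_sum \<phi> \<Longrightarrow> orbit_sum (\<lambda>j. \<phi> j ^ n)"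
  by (induction n) (auto intro: orbit_sum_mult orbit_sum_const[OF subring_one[OF FR]])

definition mul :: "'j \<Rightarrow> 'j \<Rightarrow> 'j"
  where "mul i j = (SOME l. l \<in> J \<and> (\<forall>x\<in>F. act l x = act i (act j x)) \<and> T l = map_mat (act i) (T j) * T i)"

lemma mul:
  assumes "i \<in> J" "j \<in> J"
  shows "mul i j \<in> J" "\<And>x. x \<in> F \<Longrightarrow> act (mul i j) x = act i (act j x)"
    "T (mul i j) = map_mat (act i) (T j) * T i"
  using someI_ex[of "\<lambda>l. l \<in> J \<and> (\<forall>x\<in>F. act l x = act i (act j x)) \<and> T l = map_mat (act i) (T j) * T i"]
    comp[OF assms] unfolding mul_def by blast+

lemma ev_mul:
  assumes "i \<in> J" "j \<in> J" "set L \<subseteq> F \<times> F"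
  shows "ev L (mul i j) = ev (map (\<lambda>(m, f). (m, act j f)) L) i"
  using assms(3) by (induction L) (auto simp: mul[OF assms(1,2)])

lemma orbit_sum_mul:
  assumes "j \<in> J" "orbit_sum \<phi>" shows "orbit_sum (\<lambda>i. \<phi> (mul i j))"
proof -
  obtain L where L: "set L \<subseteq> F \<times> F" "\<forall>j\<in>J. \<phi> j = ev L j"
    using assms by (auto simp: orbit_sum_def)
  have "orbit_sum (ev (map (\<lambda>(m, f). (m, act j f)) L))"
    using L stable[OF assms(1)] by (intro orbit_sum_ev) auto
  then show ?thesis
    by (rule orbit_sum_cong) (simp add: L mul assms ev_mul)
qed

text \<open>
  The functions on \<open>J\<close> that are common denominators of the entries of \<open>T\<close> in the ring of orbit sums.
\<close>

definition good :: "('j \<Rightarrow> 'e) \<Rightarrow> bool"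
  where "good \<phi> \<longleftrightarrow> orbit_sum \<phi> \<and> (\<forall>a<r. \<forall>b<r. orbit_sum (\<lambda>j. \<phi> j * T j $$ (a, b)))"

lemma good_cong: "good \<phi> \<Longrightarrow> (\<And>j. j \<in> J \<Longrightarrow> \<phi> j = \<psi> j) \<Longrightarrow> good \<psi>"
  unfolding good_def
  by (intro conjI allI impI; elim conjE)
    (erule orbit_sum_cong, simp, drule spec, drule (1) mp, drule spec, drule (1) mp,
      erule orbit_sum_cong, simp)

lemma good_mult: "good \<phi> \<Longrightarrow> orbit_sum \<psi> \<Longrightarrow> good (\<lambda>j. \<psi> j * \<phi> j)"
  unfolding good_def by (auto intro: orbit_sum_mult simp: mult.assoc)

lemma good_diff: "good \<phi> \<Longrightarrow> good \<psi> \<Longrightarrow> good (\<lambda>j. \<phi> j - \<psi> j)"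
  unfolding good_def by (auto intro: orbit_sum_diff simp: left_diff_distrib)

text \<open>
  Translating the product \<open>\<phi> T\<close> gives the translate of \<open>\<phi>\<close> times \<open>act j (T i) * T j\<close>, by the
  cocycle identity. The first factor is inverted by an orbit map.
\<close>

lemma good_mul:
  assumes i: "i \<in> J" and \<phi>: "good \<phi>"
  shows "good (\<lambda>j. \<phi> (mul j i))"
  unfolding good_def
proof (intro conjI allI impI)
  show "orbit_sum (\<lambda>j. \<phi> (mul j i))"
    using \<phi> orbit_sum_mul[OF i] by (simp add: good_def)
  fix a b assume ab: "a < r" "b < r"
  obtain S where S: "S \<in> carrier_mat r r" "\<And>a b. a < r \<Longrightarrow> b < r \<Longrightarrow> S $$ (a, b) \<in> F" "S * T i = 1\<^sub>m r"
    using T_inv[OF i] by blast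
  have "orbit_sum (\<lambda>j. \<phi> (mul j i) * T (mul j i) $$ (c, b))" if "c < r" for c
    using orbit_sum_mul[OF i, of "\<lambda>j. \<phi> j * T j $$ (c, b)"] \<phi> that ab by (simp add: good_def)
  then have "orbit_sum (\<lambda>j. \<Sum>c<r. act j (S $$ (a, c)) * (\<phi> (mul j i) * T (mul j i) $$ (c, b)))"
    using ab S by (intro orbit_sum_sum orbit_sum_mult[OF orbit_sum_orbit]) auto
  then show "orbit_sum (\<lambda>j. \<phi> (mul j i) * T j $$ (a, b))"
  proof (rule orbit_sum_cong)
    fix j assume j: "j \<in> J"
    interpret inj_idom_hom "act j" by (rule act[OF j])
    note [simp] = carrier_matD[OF T[OF i]] carrier_matD[OF T[OF j]] carrier_matD[OF S(1)]
    have "map_mat (act j) S * T (mul j i) = map_mat (act j) S * map_mat (act j) (T i) * T j"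
      unfolding mul(3)[OF j i]
      by (rule assoc_mult_mat[symmetric, of _ r r _ r _ r]) (use S T[OF i] T[OF j] in auto)
    also have "map_mat (act j) S * map_mat (act j) (T i) = map_mat (act j) (1\<^sub>m r)"
      using mat_hom_mult[OF S(1) T[OF i]] S(3) by simp
    also have "\<dots> = 1\<^sub>m r" by (simp add: mat_hom_one)
    finally have "map_mat (act j) S * T (mul j i) = T j" using T[OF j] by simp
    then have "T j $$ (a, b) = (map_mat (act j) S * T (mul j i)) $$ (a, b)" by simp
    also have "\<dots> = (\<Sum>c<r. act j (S $$ (a, c)) * T (mul j i) $$ (c, b))"
      using ab T[OF mul(1)[OF j i]] by (simp add: scalar_prod_def atLeast0LessThan)
    finally show "(\<Sum>c<r. act j (S $$ (a, c)) * (\<phi> (mul j i) * T (mul j i) $$ (c, b))) =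
      \<phi> (mul j i) * T j $$ (a, b)"
      by (simp add: sum_distrib_left mult.left_commute)
  qed
qed

text \<open>
  The denominators of \<open>T\<close> form an ideal of the ring of orbit sums that is stable under translation.
  Such an ideal contains \<open>1\<close> if it is not zero: take an element with the fewest orbit maps and
  normalise one of these to be constant. Subtracting a translate removes that term, so
  by minimality the difference is zero and the element is a nonzero constant.
\<close>

lemma orbit_sum_T:
  assumes "good \<phi>" "j0 \<in> J" "\<phi> j0 \<noteq> 0" and ab: "a < r" "b < r"
  shows "orbit_sum (\<lambda>j. T j $$ (a, b))"
proof -
  define ok where "ok L \<longleftrightarrow> set L \<subseteq> F \<times> F \<and> good (ev L) \<and> (\<exists>j\<in>J. ev L j \<noteq> 0)" for L
  have "\<exists>L. ok L"
  proof -
    obtain L where L: "set L \<subseteq> F \<times> F" "\<forall>j\<in>J. \<phi> j = ev L j"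
      using assms by (auto simp: good_def orbit_sum_def)
    with assms have "ok L" unfolding ok_def by (auto intro: good_cong)
    then show ?thesis ..
  qed
  then obtain L where L: "ok L" and min: "\<And>L'. ok L' \<Longrightarrow> length L \<le> length L'"
    using ex_has_least_nat[of ok _ length] by metis
  then obtain m f L0 where L0: "L = (m, f) # L0" by (cases L) (auto simp: ok_def)
  have mf: "m \<in> F" "f \<in> F" "set L0 \<subseteq> F \<times> F" using L by (auto simp: L0 ok_def)
  have f0: "f \<noteq> 0"
  proof
    assume f: "f = 0"
    have "good (ev L0)"
      using L by (auto simp: ok_def intro!: good_cong[of "ev L" "ev L0"]) (simp add: L0 f act_hom)
    moreover have "\<exists>j\<in>J. ev L0 j \<noteq> 0" using L by (auto simp: ok_def L0 f act_hom)
    ultimately have "ok L0" using mf by (simp add: ok_def)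
    from min[OF this] show False by (simp add: L0)
  qed
  define L1 where "L1 = map (\<lambda>(m, g). (1 * m, (1 / f) * g)) L"
  define L2 where "L2 = map (\<lambda>(m, g). (1 * m, (1 / f) * g)) L0"
  have L12: "L1 = (m, 1) # L2" using f0 by (simp add: L1_def L2_def L0)
  have ev1: "ev L1 j = act j (1 / f) * ev L j" if "j \<in> J" for j
    using ev_scale[OF that, of 1 "1 / f" L] unfolding L1_def by simp
  have invF: "1 / f \<in> F" using mf subfield_divide[OF F subring_one[OF FR]] by simp
  have L1F: "set L1 \<subseteq> F \<times> F" "set L2 \<subseteq> F \<times> F"
    using mf by (auto simp: L12 L2_def intro!: subfield_divide[OF F] subring_one[OF FR])
  have g1: "good (ev L1)"
    using good_mult[OF _ orbit_sum_orbit[OF invF], of "ev L"] L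
    by (auto simp: ok_def ev1 intro: good_cong)
  have const: "ev L1 i = ev L1 one" if i: "i \<in> J" for i
  proof (rule ccontr)
    assume ne: "ev L1 i \<noteq> ev L1 one"
    define L3 where "L3 = map (\<lambda>(m, g). (m, act i g - g)) L2"
    have "ev (map (\<lambda>(m, g). (m, act i g - g)) M) j = ev (map (\<lambda>(m, g). (m, act i g)) M) j - ev M j"
      if "j \<in> J" for M j
      using that by (induction M) (auto simp: act_hom algebra_simps)
    then have ev3: "ev L3 j = ev L1 (mul j i) - ev L1 j" if "j \<in> J" for j
      using that i L1F mul(1)[OF that i] by (simp add: L3_def ev_mul L12 act_hom)
    have "good (ev L3)"
      by (rule good_cong[OF good_diff[OF good_mul[OF i g1] g1]]) (simp add: ev3)
    moreover have "ev L1 (mul one i) = ev L1 i"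
    proof -
      have "ev M (mul one i) = ev M i" if "set M \<subseteq> F \<times> F" for M
        using that by (induction M) (auto simp: mul one i stable)
      with L1F show ?thesis by simp
    qed
    with ne have "ev L3 one \<noteq> 0" using ev3[OF one(1)] by simp
    moreover have "set L3 \<subseteq> F \<times> F"
      using L1F(2) stable[OF i] by (auto simp: L3_def intro!: subring_diff[OF FR])
    ultimately have "ok L3" using one(1) by (auto simp: ok_def)
    from min[OF this] show False by (simp add: L3_def L2_def L0)
  qed
  define c where "c = ev L1 one"
  have "c \<noteq> 0"
  proof -
    obtain j where "j \<in> J" "ev L j \<noteq> 0" using L by (auto simp: ok_def)
    moreover from this have "act j (1 / f) \<noteq> 0"
      using f0 inj_idom_hom.axioms(1) act[of j] by (metis act_hom(2,4) divide_self nonzero_mult_div_cancel_right mult_zero_left times_divide_eq_left mult_1 zero_neq_one)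
    ultimately show ?thesis using ev1[of j] const[of j] by (simp add: c_def)
  qed
  have "c \<in> F"
  proof -
    have "ev M one \<in> F" if "set M \<subseteq> F \<times> F" for M
      using that by (induction M) (auto simp: one intro!: subring_zero[OF FR] subring_add[OF FR] subring_mult[OF FR])
    with L1F show ?thesis by (simp add: c_def)
  qed
  then have "orbit_sum (\<lambda>_. 1 / c)" by (intro orbit_sum_const subfield_divide[OF F] subring_one[OF FR])
  moreover have "orbit_sum (\<lambda>j. ev L1 j * T j $$ (a, b))" using g1 ab by (simp add: good_def)
  ultimately have "orbit_sum (\<lambda>j. 1 / c * (ev L1 j * T j $$ (a, b)))" by (rule orbit_sum_mult)
  then show ?thesis
    by (rule orbit_sum_cong) (use \<open>c \<noteq> 0\<close> const in \<open>simp add: c_def\<close>)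
qed

text \<open>
  The solutions of Hilbert 90, up to invertibility.
\<close>

definition equivariant :: "(nat \<times> nat \<Rightarrow> 'e) \<Rightarrow> bool"
  where "equivariant \<Phi> \<longleftrightarrow> (\<forall>x. \<Phi> x \<in> F) \<and>
    (\<forall>i\<in>J. \<forall>a<r. \<forall>b<r. act i (\<Phi> (a, b)) = (\<Sum>c<r. T i $$ (a, c) * \<Phi> (c, b)))"

definition evv :: "('e \<times> (nat \<times> nat \<Rightarrow> 'e)) list \<Rightarrow> 'j \<Rightarrow> nat \<times> nat \<Rightarrow> 'e"
  where "evv L j x = (\<Sum>(m, \<Phi>)\<leftarrow>L. m * act j (\<Phi> x))"

lemma evv_simps [simp]: "evv [] j x = 0" "evv ((m, \<Phi>) # L) j x = m * act j (\<Phi> x) + evv L j x"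
  "evv (L @ L') j x = evv L j x + evv L' j x"
  by (simp_all add: evv_def)

text \<open>
  A list of pairs of a coefficient \<open>m\<close> and a matrix \<open>\<Phi>\<close>, meant as the sum of all \<open>m * act j \<Phi>\<close>.
  A matrix is a function on all pairs of indices here, so that it can be changed entry by entry.
\<close>

definition represents :: "('e \<times> (nat \<times> nat \<Rightarrow> 'e)) list \<Rightarrow> bool"
  where "represents L \<longleftrightarrow> (\<forall>(m, \<Phi>)\<in>set L. m \<in> F \<and> (\<forall>x. \<Phi> x \<in> F)) \<and>
    (\<forall>j\<in>J. \<forall>a<r. \<forall>b<r. T j $$ (a, b) = evv L j (a, b))"

lemma represents_exists:
  assumes "\<And>a b. a < r \<Longrightarrow> b < r \<Longrightarrow> orbit_sum (\<lambda>j. T j $$ (a, b))"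
  shows "\<exists>L. represents L"
proof -
  have "\<exists>L. (\<forall>(m, \<Phi>)\<in>set L. m \<in> F \<and> (\<forall>x. \<Phi> x \<in> F)) \<and>
    (\<forall>j\<in>J. \<forall>x. evv L j x = (if x \<in> P then T j $$ x else 0))" if "finite P" "P \<subseteq> {..<r} \<times> {..<r}" for P
    using that
  proof (induction P rule: finite_induct)
    case (insert y P)
    then obtain L where L: "\<forall>(m, \<Phi>)\<in>set L. m \<in> F \<and> (\<forall>x. \<Phi> x \<in> F)"
      "\<forall>j\<in>J. \<forall>x. evv L j x = (if x \<in> P then T j $$ x else 0)" by auto
    obtain M where M: "set M \<subseteq> F \<times> F" "\<forall>j\<in>J. T j $$ y = ev M j"
      using assms[of "fst y" "snd y"] insert.prems by (auto simp: orbit_sum_def)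
    let ?M = "map (\<lambda>(m, f). (m, \<lambda>x. if x = y then f else 0)) M"
    have "evv ?M j x = (if x = y then ev M j else 0)" if "j \<in> J" for j x
      using that by (induction M) (auto simp: act_hom)
    then show ?case
      using L M insert.hyps subring_zero[OF FR] by (intro exI[of _ "?M @ L"]) fastforce
  qed (auto intro: exI[of _ "[]"])
  from this[of "{..<r} \<times> {..<r}"] obtain L where L: "\<forall>(m, \<Phi>)\<in>set L. m \<in> F \<and> (\<forall>x. \<Phi> x \<in> F)"
    "\<forall>j\<in>J. \<forall>x. evv L j x = (if x \<in> {..<r} \<times> {..<r} then T j $$ x else 0)" by auto
  then have "represents L" unfolding represents_def by simp
  then show ?thesis ..
qed

text \<open>
  If a matrix in the list fails to transform like \<open>T\<close>, then the cocycle identity turns the failure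
  into a linear relation between the terms of the list, which expresses this matrix by the others and makes
  the list shorter.
\<close>

lemma minimal_represents_equivariant:
  assumes L: "represents L" and min: "\<And>L'. represents L' \<Longrightarrow> length L \<le> length L'"
    and "(m0, \<Phi>0) \<in> set L"
  shows "equivariant \<Phi>0"
proof -
  have "\<forall>(m, \<Phi>)\<in>set L. m \<in> F \<and> (\<forall>x. \<Phi> x \<in> F)"
    using L unfolding represents_def by blast
  then have LF: "m \<in> F" "\<Phi> x \<in> F" if "(m, \<Phi>) \<in> set L" for m \<Phi> x
    using that by blast+
  have LT: "T j $$ (a, b) = evv L j (a, b)" if "j \<in> J" "a < r" "b < r" for j a b
    using L that by (auto simp: represents_def)
  have "act i (\<Phi>0 (a, b)) = (\<Sum>c<r. T i $$ (a, c) * \<Phi>0 (c, b))" if i: "i \<in> J" and ab: "a < r" "b < r" for i a b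
  proof (rule ccontr)
    assume ne: "act i (\<Phi>0 (a, b)) \<noteq> (\<Sum>c<r. T i $$ (a, c) * \<Phi>0 (c, b))"
    \<comment> \<open>the failure of \<open>\<Phi>\<close> to be equivariant at \<open>i\<close> and \<open>(a, b)\<close>\<close>
    define d where "d \<Phi> = act i (\<Phi> (a, b)) - (\<Sum>c<r. T i $$ (a, c) * \<Phi> (c, b))" for \<Phi>
    have dF: "d \<Phi> \<in> F" if "(m, \<Phi>) \<in> set L" for m \<Phi>
      unfolding d_def using LF[OF that] TF[OF i] ab stable[OF i]
      by (auto intro!: subring_diff[OF FR] subring_sum[OF FR] subring_mult[OF FR])
    have d0: "d \<Phi>0 \<noteq> 0" using ne by (simp add: d_def)
    have rel: "(\<Sum>(m, \<Phi>)\<leftarrow>L. m * act j (d \<Phi>)) = 0" if j: "j \<in> J" for j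
    proof -
      have 1: "(\<Sum>(m, \<Phi>)\<leftarrow>M. m * act j (d \<Phi>)) =
        (\<Sum>(m, \<Phi>)\<leftarrow>M. m * act j (act i (\<Phi> (a, b)))) - (\<Sum>c<r. act j (T i $$ (a, c)) * evv M j (c, b))" for M
        by (induction M) (auto simp: d_def act_hom[OF j] algebra_simps sum.distrib sum_distrib_left)
      have 2: "evv M (mul j i) (a, b) = (\<Sum>(m, \<Phi>)\<leftarrow>M. m * act j (act i (\<Phi> (a, b))))"
        if "set M \<subseteq> set L" for M
        using that
      proof (induction M)
        case (Cons y M)
        obtain m \<Phi> where y: "y = (m, \<Phi>)" by force
        with Cons.prems have "\<Phi> (a, b) \<in> F" using LF by auto
        with Cons y show ?case by (simp add: mul[OF j i])
      qed simp
      have "T (mul j i) $$ (a, b) = (\<Sum>c<r. act j (T i $$ (a, c)) * T j $$ (c, b))"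
        unfolding mul(3)[OF j i] using ab T[OF i] T[OF j] by (simp add: scalar_prod_def atLeast0LessThan)
      also have "\<dots> = (\<Sum>c<r. act j (T i $$ (a, c)) * evv L j (c, b))"
        using ab j by (simp add: LT)
      finally show ?thesis
        using LT[OF mul(1)[OF j i] ab] 1[of L] 2[of L] by simp
    qed
    obtain L1 L2 where L12: "L = L1 @ (m0, \<Phi>0) # L2" using assms(3) by (meson split_list)
    define g where "g = (\<lambda>(m, \<Phi>). (m :: 'e, \<lambda>x. \<Phi> x - d \<Phi> / d \<Phi>0 * \<Phi>0 x))"
    have ev_g: "evv (map g M) j x = evv M j x - (\<Sum>(m, \<Phi>)\<leftarrow>M. m * act j (d \<Phi>)) / act j (d \<Phi>0) * act j (\<Phi>0 x)"
      if "j \<in> J" for M j x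
    proof (induction M)
      case (Cons y M)
      obtain m \<Phi> where y: "y = (m, \<Phi>)" by force
      show ?case
        using Cons.IH by (simp add: y g_def act_hom[OF that] add_divide_distrib ring_distribs)
    qed (simp add: g_def)
    have "represents (map g (L1 @ L2))"
      unfolding represents_def
    proof (intro conjI ballI allI impI)
      fix y assume "y \<in> set (map g (L1 @ L2))"
      then obtain m \<Phi> where "(m, \<Phi>) \<in> set (L1 @ L2)" "y = g (m, \<Phi>)" by auto
      moreover from this have "(m, \<Phi>) \<in> set L" by (auto simp: L12)
      ultimately show "case y of (m, \<Phi>) \<Rightarrow> m \<in> F \<and> (\<forall>x. \<Phi> x \<in> F)"
        using LF assms(3) dF
        by (auto simp: g_def intro!: subring_diff[OF FR] subring_mult[OF FR] subfield_divide[OF F])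
    next
      fix j a' b' assume j: "j \<in> J" and ab': "a' < r" "b' < r"
      have nz: "act j (d \<Phi>0) \<noteq> 0"
        using inj_comm_ring_hom.axioms act[OF j] d0 act_hom(2)[OF j, of "d \<Phi>0" "1 / d \<Phi>0"] act_hom(4)[OF j] by auto
      have "(\<Sum>(m, \<Phi>)\<leftarrow>L1 @ L2. m * act j (d \<Phi>)) = - (m0 * act j (d \<Phi>0))"
        using rel[OF j] by (simp add: L12 eq_neg_iff_add_eq_0 algebra_simps)
      then have "evv (map g (L1 @ L2)) j (a', b') = evv L j (a', b')"
        unfolding ev_g[OF j] using nz by (simp add: L12)
      then show "T j $$ (a', b') = evv (map g (L1 @ L2)) j (a', b')"
        using LT[OF j ab'] by simp
    qed
    from min[OF this] show False by (simp add: L12)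
  qed
  then show ?thesis using LF assms(3) by (auto simp: equivariant_def)
qed

lemma det_line_nonzero:
  assumes "det (mat r r (\<lambda>x. A x + m * B x)) \<noteq> 0"
  shows "\<exists>n. det (mat r r (\<lambda>x. A x + of_nat n * B x)) \<noteq> (0::'e)"
proof -
  define p where "p = det (mat r r (\<lambda>x. [:A x, B x:]))"
  have p: "poly p t = det (mat r r (\<lambda>x. A x + t * B x))" for t
  proof -
    interpret comm_ring_hom "\<lambda>p. poly p t" by unfold_locales auto
    have "map_mat (\<lambda>p. poly p t) (mat r r (\<lambda>x. [:A x, B x:])) = mat r r (\<lambda>x. A x + t * B x)"
      by (intro eq_matI) auto
    then show ?thesis unfolding p_def by (metis hom_det)
  qed
  have "p \<noteq> 0" using p[of m] assms by auto
  then show ?thesis using poly_nonroot_of_nat[OF char] p by metis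
qed

text \<open>
  At the neutral element a minimal representation expresses the identity matrix as a linear
  combination of equivariant matrices. Its determinant does not vanish. As a polynomial in the coefficients it does not
  vanish identically, so that the coefficients can be replaced one by one by natural numbers, and the resulting matrix is
  equivariant and invertible.
\<close>

theorem hilbert_90:
  assumes "good \<phi>" "j0 \<in> J" "\<phi> j0 \<noteq> 0"
  obtains \<Phi> where "\<Phi> \<in> carrier_mat r r" "\<And>a b. a < r \<Longrightarrow> b < r \<Longrightarrow> \<Phi> $$ (a, b) \<in> F" "det \<Phi> \<noteq> 0"
    "\<And>j. j \<in> J \<Longrightarrow> map_mat (act j) \<Phi> = T j * \<Phi>"
proof -
  obtain L where L: "represents L" and min: "\<And>L'. represents L' \<Longrightarrow> length L \<le> length L'"
    using represents_exists[OF orbit_sum_T[OF assms]]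
      ex_has_least_nat[of represents _ length] by metis
  have eqv: "\<forall>(m, \<Phi>)\<in>set L. equivariant \<Phi>"
    using minimal_represents_equivariant[OF L min] by auto
  have step: "\<exists>\<Phi>. equivariant \<Phi> \<and> det (mat r r \<Phi>) \<noteq> 0"
    if "\<forall>(m, \<Phi>)\<in>set M. equivariant \<Phi>" "equivariant \<Phi>0"
      "det (mat r r (\<lambda>x. \<Phi>0 x + (\<Sum>(m, \<Phi>)\<leftarrow>M. m * \<Phi> x))) \<noteq> 0" for M :: "('e \<times> _) list" and \<Phi>0
    using that
  proof (induction M arbitrary: \<Phi>0)
    case Nil
    then show ?case by auto
  next
    case (Cons y M)
    obtain m \<Phi> where y: "y = (m, \<Phi>)" by force
    have "det (mat r r (\<lambda>x. (\<Phi>0 x + (\<Sum>(m, \<Phi>)\<leftarrow>M. m * \<Phi> x)) + m * \<Phi> x)) \<noteq> 0"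
      using Cons.prems(3) by (simp add: y algebra_simps)
    then obtain n where "det (mat r r (\<lambda>x. (\<Phi>0 x + (\<Sum>(m, \<Phi>)\<leftarrow>M. m * \<Phi> x)) + of_nat n * \<Phi> x)) \<noteq> 0"
      using det_line_nonzero[of "\<lambda>x. \<Phi>0 x + (\<Sum>(m, \<Phi>)\<leftarrow>M. m * \<Phi> x)" m \<Phi>] by blast
    then have "det (mat r r (\<lambda>x. (\<Phi>0 x + of_nat n * \<Phi> x) + (\<Sum>(m, \<Phi>)\<leftarrow>M. m * \<Phi> x))) \<noteq> 0"
      by (simp add: algebra_simps)
    moreover have "equivariant (\<lambda>x. \<Phi>0 x + of_nat n * \<Phi> x)"
      using Cons.prems(1,2) unfolding equivariant_def
      by (auto simp: y act_hom sum_distrib_left distrib_left sum.distrib mult.left_commute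
          intro!: subring_add[OF FR] subring_mult[OF FR] subring_of_nat[OF FR])
    ultimately show ?case using Cons.prems(1) by (intro Cons.IH) auto
  qed
  have "\<exists>\<Phi>. equivariant \<Phi> \<and> det (mat r r \<Phi>) \<noteq> 0"
  proof (rule step[OF eqv])
    show "equivariant (\<lambda>_. 0)" by (auto simp: equivariant_def act_hom subring_zero[OF FR])
    have "evv M one x = (\<Sum>(m, \<Phi>)\<leftarrow>M. m * \<Phi> x)" if "set M \<subseteq> set L" for M x
      using that
    proof (induction M)
      case (Cons y M)
      obtain m \<Phi> where y: "y = (m, \<Phi>)" by force
      with Cons.prems have "equivariant \<Phi>" using eqv by auto
      then have "\<Phi> x \<in> F" unfolding equivariant_def by blast
      with Cons y show ?case by (simp add: one)
    qed simp
    from this[OF subset_refl] have *: "(\<Sum>(m, \<Phi>)\<leftarrow>L. m * \<Phi> x) = evv L one x" for x by simp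
    have "1\<^sub>m r $$ (a, b) = evv L one (a, b)" if "a < r" "b < r" for a b
      using L one that unfolding represents_def by metis
    then have "mat r r (\<lambda>x. 0 + (\<Sum>(m, \<Phi>)\<leftarrow>L. m * \<Phi> x)) = 1\<^sub>m r"
      unfolding * by (intro eq_matI) simp_all
    then show "det (mat r r (\<lambda>x. 0 + (\<Sum>(m, \<Phi>)\<leftarrow>L. m * \<Phi> x))) \<noteq> 0" by simp
  qed
  then obtain \<Phi> where \<Phi>: "equivariant \<Phi>" "det (mat r r \<Phi>) \<noteq> 0" by auto
  show ?thesis
  proof (rule that[of "mat r r \<Phi>"])
    show "map_mat (act j) (mat r r \<Phi>) = T j * mat r r \<Phi>" if "j \<in> J" for j
      using \<Phi> that T[OF that]
      by (intro eq_matI) (auto simp: equivariant_def scalar_prod_def atLeast0LessThan)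
  qed (use \<Phi> in \<open>auto simp: equivariant_def\<close>)
qed

end

section \<open>Polynomial substitution and rational functions\<close>

definition mono_val :: "('i \<Rightarrow> 'b::comm_semiring_1) \<Rightarrow> ('i \<Rightarrow>\<^sub>0 nat) \<Rightarrow> 'b"
  where "mono_val x \<mu> = (\<Prod>i\<in>Poly_Mapping.keys \<mu>. x i ^ Poly_Mapping.lookup \<mu> i)"

lemma mono_val_superset:
  assumes "finite S" "Poly_Mapping.keys \<mu> \<subseteq> S"
  shows "mono_val x \<mu> = (\<Prod>i\<in>S. x i ^ Poly_Mapping.lookup \<mu> i)"
  unfolding mono_val_def using assms
  by (intro prod.mono_neutral_left) (auto simp: in_keys_iff)

lemma mono_val_add: "mono_val x (\<mu> + \<nu>) = mono_val x \<mu> * mono_val x \<nu>"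
proof -
  let ?S = "Poly_Mapping.keys \<mu> \<union> Poly_Mapping.keys \<nu>"
  have "Poly_Mapping.keys (\<mu> + \<nu>) \<subseteq> ?S" by (rule Poly_Mapping.keys_add)
  then show ?thesis
    using mono_val_superset[of ?S _ x] by (simp add: lookup_add power_add prod.distrib)
qed

lemma mono_val_0 [simp]: "mono_val x 0 = 1"
  by (simp add: mono_val_def)

lemma mono_val_var: "mono_val x (Poly_Mapping.single i 1) = x i"
  by (simp add: mono_val_def)

lemma meval_mono: "meval h x p = (\<Sum>\<mu>\<in>Poly_Mapping.keys p. h (Poly_Mapping.lookup p \<mu>) * mono_val x \<mu>)"
  by (simp add: meval_def mono_val_def)

text \<open>
  Decomposition into monomials, which reduces identities that are additive in \<open>p\<close> to monomials.
\<close>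

lemma poly_mapping_sum_single: "p = (\<Sum>\<mu>\<in>Poly_Mapping.keys p. Poly_Mapping.single \<mu> (Poly_Mapping.lookup p \<mu>))"
  by (rule poly_mapping_eqI)
    (auto simp: lookup_sum lookup_single when_def sum.delta' in_keys_iff)

lemma meval_cong:
  assumes "\<And>i. i \<in> mvars p \<Longrightarrow> x i = y i" "\<And>c. c \<in> Poly_Mapping.range p \<Longrightarrow> h c = h' c"
  shows "meval h x p = meval h' y p"
proof -
  have "x i = y i" if "\<mu> \<in> Poly_Mapping.keys p" "i \<in> Poly_Mapping.keys \<mu>" for \<mu> i
    using that assms(1) by (auto simp: mvars_def)
  then show ?thesis
    unfolding meval_def using assms(2)
    by (intro sum.cong prod.cong refl arg_cong2[where f = "(*)"]) (auto simp: in_keys_lookup_in_range)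
qed

lemma meval_in_subring:
  assumes R: "is_subring R" and "\<And>i. i \<in> mvars p \<Longrightarrow> x i \<in> R"
    and "\<And>c. c \<in> Poly_Mapping.range p \<Longrightarrow> h c \<in> R"
  shows "meval h x p \<in> R"
  unfolding meval_def using assms
  by (intro subring_sum[OF R] subring_mult[OF R] subring_prod[OF R] subring_power[OF R])
    (auto simp: mvars_def in_keys_lookup_in_range)

lemma meval_hom_on:
  assumes R: "is_subring R" and \<psi>: "hom_on R \<psi>" and x: "\<And>i. i \<in> mvars p \<Longrightarrow> x i \<in> R"
    and h: "\<And>c. c \<in> Poly_Mapping.range p \<Longrightarrow> h c \<in> R"
  shows "\<psi> (meval h x p) = meval (\<psi> \<circ> h) (\<psi> \<circ> x) p"
proof -
  have x': "x i \<in> R" if "\<mu> \<in> Poly_Mapping.keys p" "i \<in> Poly_Mapping.keys \<mu>" for i \<mu>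
    using that x by (auto simp: mvars_def)
  have h': "h (Poly_Mapping.lookup p \<mu>) \<in> R" if "\<mu> \<in> Poly_Mapping.keys p" for \<mu>
    using that h by (auto simp: in_keys_lookup_in_range)
  note cl = subring_mult[OF R] subring_prod[OF R] subring_power[OF R]
  show ?thesis
    unfolding meval_def
    by (subst hom_on_sum[OF R \<psi>])
      (auto intro!: cl x' h' sum.cong simp: hom_on_mult[OF R \<psi>] hom_on_prod[OF R \<psi>] hom_on_power[OF R \<psi>] cl x' h')
qed

context comm_ring_hom
begin

lemma meval_superset:
  assumes "finite S" "Poly_Mapping.keys p \<subseteq> S"
  shows "meval hom x p = (\<Sum>\<mu>\<in>S. hom (Poly_Mapping.lookup p \<mu>) * mono_val x \<mu>)"
  unfolding meval_mono using assms
  by (intro sum.mono_neutral_left) (auto simp: in_keys_iff)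

lemma meval_add: "meval hom x (p + q) = meval hom x p + meval hom x q"
proof -
  let ?S = "Poly_Mapping.keys p \<union> Poly_Mapping.keys q"
  have "Poly_Mapping.keys (p + q) \<subseteq> ?S" by (rule Poly_Mapping.keys_add)
  then show ?thesis
    using meval_superset[of ?S _ x] by (simp add: lookup_add hom_add distrib_right sum.distrib)
qed

lemma meval_0 [simp]: "meval hom x 0 = 0"
  by (simp add: meval_def)

lemma meval_single: "meval hom x (Poly_Mapping.single \<mu> c) = hom c * mono_val x \<mu>"
  by (cases "c = 0") (simp_all add: meval_mono)

lemma meval_sum: "meval hom x (sum f I) = (\<Sum>i\<in>I. meval hom x (f i))"
  by (induction I rule: infinite_finite_induct) (simp_all add: meval_add)

lemma meval_mult: "meval hom x (p * q) = meval hom x p * meval hom x q"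
proof -
  let ?m = "\<lambda>p. \<Sum>\<mu>\<in>Poly_Mapping.keys p. Poly_Mapping.single \<mu> (Poly_Mapping.lookup p \<mu>)"
  have "meval hom x (?m p * ?m q) = meval hom x (?m p) * meval hom x (?m q)"
    by (simp add: sum_product meval_sum mult_single meval_single mono_val_add hom_mult mult_ac)
  then show ?thesis by (simp flip: poly_mapping_sum_single)
qed

lemma meval_mconst [simp]: "meval hom x (mconst c) = hom c"
  by (simp add: mconst_def meval_single)

lemma meval_mvar [simp]: "meval hom x (mvar i) = x i"
  unfolding mvar_def meval_single by (simp add: mono_val_var del: One_nat_def)

lemma meval_1 [simp]: "meval hom x 1 = 1"
  using meval_mconst[of x 1] by (simp add: mconst_def)

lemma comm_ring_hom_meval: "comm_ring_hom (meval hom x)"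
  by unfold_locales (simp_all add: meval_add meval_mult)

lemma hom_meval: "hom (meval h x p) = meval (hom \<circ> h) (hom \<circ> x) p"
  by (simp add: meval_def hom_distribs)

end

lemma comm_ring_hom_mconst: "comm_ring_hom (mconst :: 'a::comm_ring_1 \<Rightarrow> ('i, 'a) mpoly)"
  by unfold_locales (simp_all add: mconst_def single_add mult_single)

lemma mono_val_mvar: "mono_val (mvar :: _ \<Rightarrow> ('i, 'a::comm_ring_1) mpoly) \<mu> = Poly_Mapping.single \<mu> 1"
proof -
  have pow: "(mvar i :: ('i, 'a) mpoly) ^ n = Poly_Mapping.single (Poly_Mapping.single i n) 1" for i n
    by (induction n) (simp_all add: mvar_def mult_single flip: single_add)
  have "(\<Prod>i\<in>S. Poly_Mapping.single (Poly_Mapping.single i (f i)) (1::'a)) =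
      Poly_Mapping.single (\<Sum>i\<in>S. Poly_Mapping.single i (f i)) 1" for S and f :: "'i \<Rightarrow> nat"
    by (induction S rule: infinite_finite_induct) (simp_all add: mult_single)
  then show ?thesis
    by (simp add: mono_val_def pow flip: poly_mapping_sum_single)
qed

lemma meval_mvar_map:
  fixes h :: "'a::zero \<Rightarrow> 'b::comm_ring_1"
  assumes "h 0 = 0"
  shows "meval (mconst \<circ> h) mvar p = Poly_Mapping.map h (p :: ('i, 'a) mpoly)"
proof (rule poly_mapping_eqI)
  fix \<mu>
  have "meval (mconst \<circ> h) mvar p = (\<Sum>\<mu>\<in>Poly_Mapping.keys p. Poly_Mapping.single \<mu> (h (Poly_Mapping.lookup p \<mu>)))"
    unfolding meval_mono mono_val_mvar by (simp add: mconst_def mult_single)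
  then show "Poly_Mapping.lookup (meval (mconst \<circ> h) mvar p) \<mu> = Poly_Mapping.lookup (Poly_Mapping.map h p) \<mu>"
    using assms
    by (auto simp: lookup_sum lookup_single when_def sum.delta' in_keys_iff Poly_Mapping.map.rep_eq)
qed

lemma meval_self: "meval mconst mvar p = (p :: ('i, 'a::comm_ring_1) mpoly)"
proof -
  have "meval (mconst \<circ> id) mvar p = Poly_Mapping.map id p" by (rule meval_mvar_map) simp
  also have "\<dots> = p" by (rule poly_mapping_eqI) (simp add: Poly_Mapping.map.rep_eq when_def)
  finally show ?thesis by simp
qed

text \<open>
  The substitution \<open>l'\<close> undoes \<open>l\<close> up to the action of \<open>h\<close> on the coefficients, which is injective.
  This is how the actions on polynomials extend to rational functions.
\<close>

lemma inj_idom_hom_subst: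
  fixes h :: "'a::idom \<Rightarrow> 'b::idom" and l :: "nat \<Rightarrow> (nat, 'b) mpoly"
  assumes h: "inj_idom_hom h" and inv: "\<And>i. meval mconst l' (l i) = mvar i"
  shows "inj_idom_hom (meval (mconst \<circ> h) l)"
proof -
  interpret h: inj_idom_hom h by fact
  interpret c: comm_ring_hom "mconst :: 'b \<Rightarrow> (nat, 'b) mpoly" by (rule comm_ring_hom_mconst)
  interpret ch: comm_ring_hom "mconst \<circ> h :: 'a \<Rightarrow> (nat, 'b) mpoly"
    by unfold_locales (simp_all add: h.hom_add h.hom_mult c.hom_add c.hom_mult)
  interpret s: comm_ring_hom "meval (mconst \<circ> h) l :: (nat, 'a) mpoly \<Rightarrow> (nat, 'b) mpoly"
    by (rule ch.comm_ring_hom_meval)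
  interpret s': comm_ring_hom "meval mconst l' :: (nat, 'b) mpoly \<Rightarrow> (nat, 'b) mpoly"
    by (rule c.comm_ring_hom_meval)
  have "meval mconst l' (meval (mconst \<circ> h) l p) = Poly_Mapping.map h p" for p
    unfolding s'.hom_meval
    by (simp add: comp_def inv meval_mvar_map[unfolded comp_def])
  then have "p = 0" if "meval (mconst \<circ> h) l p = 0" for p
    using that map_eq_zero_iff[of h p] s'.hom_zero by (metis h.hom_0_iff in_keys_iff poly_mapping_eqI lookup_zero)
  then show ?thesis by unfold_locales auto
qed

lemma fract_map_hom:
  assumes \<phi>: "inj_idom_hom (\<phi> :: 'a::idom \<Rightarrow> 'b::idom)"
  shows "inj_idom_hom (fract_map \<phi>)" and "fract_map \<phi> (to_fract p) = to_fract (\<phi> p)"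
proof -
  interpret inj_idom_hom \<phi> by fact
  show "inj_idom_hom (fract_map \<phi>)"
  proof unfold_locales
    fix x y :: "'a fract"
    obtain p q p' q' where *: "x = Fract p q" "q \<noteq> 0" "y = Fract p' q'" "q' \<noteq> 0"
      by (metis Fract_cases)
    show "fract_map \<phi> (x + y) = fract_map \<phi> x + fract_map \<phi> y"
      "fract_map \<phi> (x * y) = fract_map \<phi> x * fract_map \<phi> y"
      using * by (simp_all add: fract_map_Fract[OF \<phi>] hom_distribs)
  next
    show "fract_map \<phi> 0 = 0" "fract_map \<phi> 1 = 1"
      using fract_map_Fract[OF \<phi>, of 1] by (simp_all add: Zero_fract_def One_fract_def)
    fix x assume "fract_map \<phi> x = 0"
    moreover obtain p q where *: "x = Fract p q" "q \<noteq> 0" by (metis Fract_cases)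
    ultimately have "Fract (\<phi> p) (\<phi> q) = Fract 0 1" by (simp add: fract_map_Fract[OF \<phi>] Zero_fract_def)
    then show "x = 0" using * by (simp add: eq_fract Zero_fract_def)
  qed
  show "fract_map \<phi> (to_fract p) = to_fract (\<phi> p)"
    by (simp add: to_fract_def fract_map_Fract[OF \<phi>])
qed

lemma inj_idom_hom_comp: "inj_idom_hom f \<Longrightarrow> inj_idom_hom g \<Longrightarrow> inj_idom_hom (f \<circ> g)"
proof -
  assume f: "inj_idom_hom f" and g: "inj_idom_hom g"
  interpret f: inj_idom_hom f by fact
  interpret g: inj_idom_hom g by fact
  show ?thesis by unfold_locales (simp_all add: f.hom_add g.hom_add f.hom_mult g.hom_mult)
qed

lemma inj_idom_hom_to_fract: "inj_idom_hom (to_fract :: 'a::idom \<Rightarrow> 'a fract)"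
  by unfold_locales simp_all

lemma inj_idom_hom_mconst: "inj_idom_hom (mconst :: 'a::idom \<Rightarrow> (nat, 'a) mpoly)"
proof -
  interpret comm_ring_hom "mconst :: 'a \<Rightarrow> (nat, 'a) mpoly" by (rule comm_ring_hom_mconst)
  show ?thesis
    by unfold_locales (metis lookup_single_eq lookup_zero mconst_def)
qed

lemma inj_idom_hom_rconst: "inj_idom_hom (rconst :: 'a::idom \<Rightarrow> 'a rat_fun)"
  using inj_idom_hom_comp[OF inj_idom_hom_to_fract inj_idom_hom_mconst]
  by (simp add: comp_def rconst_def[abs_def])

lemma to_fract_meval: "to_fract p = meval rconst rvar p"
proof -
  interpret inj_idom_hom "to_fract :: (nat, 'a) mpoly \<Rightarrow> 'a rat_fun" by (rule inj_idom_hom_to_fract)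
  have "to_fract p = to_fract (meval mconst mvar p)" by (simp add: meval_self)
  also have "\<dots> = meval rconst rvar p"
    unfolding hom_meval by (simp add: comp_def rconst_def[abs_def] rvar_def[abs_def])
  finally show ?thesis .
qed

lemma to_fract_in_ring_gen:
  "mvars p \<subseteq> V \<Longrightarrow> to_fract p \<in> ring_gen (range rconst \<union> rvar ` V)"
  unfolding to_fract_meval
  by (rule meval_in_subring[OF is_subring_ring_gen]) (auto intro: ring_gen.incl)

lemma to_fract_in_field_gen:
  "mvars p \<subseteq> V \<Longrightarrow> to_fract p \<in> field_gen (range rconst \<union> rvar ` V)"
  using to_fract_in_ring_gen ring_gen_subset_field_gen by blast

lemma mvars_add: "mvars (p + q) \<subseteq> mvars p \<union> mvars q"
  using Poly_Mapping.keys_add[of p q] by (auto simp: mvars_def)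

lemma mvars_uminus: "mvars (- p) = mvars (p :: ('i, 'a::ab_group_add) mpoly)"
  by (simp add: mvars_def in_keys_iff set_eq_iff)

lemma mvars_mult: "mvars (p * q) \<subseteq> mvars p \<union> mvars (q :: ('i, 'a::semiring_0) mpoly)"
proof
  fix i assume "i \<in> mvars (p * q)"
  then obtain \<mu> where "\<mu> \<in> Poly_Mapping.keys (p * q)" "i \<in> Poly_Mapping.keys \<mu>" by (auto simp: mvars_def)
  then obtain a b where "\<mu> = a + b" "a \<in> Poly_Mapping.keys p" "b \<in> Poly_Mapping.keys q"
    using keys_mult[of p q] by auto
  then show "i \<in> mvars p \<union> mvars q"
    using \<open>i \<in> Poly_Mapping.keys \<mu>\<close> Poly_Mapping.keys_add[of a b] by (auto simp: mvars_def)
qed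

lemma mvars_mconst [simp]: "mvars (mconst c) = {}"
  by (auto simp: mvars_def mconst_def)

lemma mvars_mvar: "mvars (mvar i) \<subseteq> {i}"
  by (auto simp: mvars_def mvar_def)

lemma ring_gen_to_fract:
  assumes "f \<in> ring_gen (range rconst \<union> rvar ` V)"
  obtains p where "f = to_fract p" "mvars p \<subseteq> V"
proof -
  have "\<exists>p. f = to_fract p \<and> mvars p \<subseteq> V"
    using assms
  proof induction
    case one
    show ?case using mvars_mconst by (intro exI[of _ 1]) (auto simp: mvars_def)
  next
    case (incl a)
    then show ?case
    proof
      assume "a \<in> range rconst" then show ?thesis by (auto simp: rconst_def intro: exI[of _ "mconst _"])
    next
      assume "a \<in> rvar ` V"
      then obtain i where "a = to_fract (mvar i)" "i \<in> V" by (auto simp: rvar_def)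
      then show ?thesis using mvars_mvar by (intro exI[of _ "mvar i"]) fastforce
    qed
  next
    case (diff a b)
    then obtain p q where "a = to_fract p" "mvars p \<subseteq> V" "b = to_fract q" "mvars q \<subseteq> V" by blast
    then show ?case
      using mvars_add[of p "- q"] mvars_uminus[of q] by (intro exI[of _ "p - q"]) auto
  next
    case (mult a b)
    then obtain p q where "a = to_fract p" "mvars p \<subseteq> V" "b = to_fract q" "mvars q \<subseteq> V" by blast
    then show ?case
      using mvars_mult[of p q] by (intro exI[of _ "p * q"]) auto
  qed
  with that show ?thesis by blast
qed

lemma rat_funs_field_gen: "rat_funs m = field_gen (range rconst \<union> rvar ` {..<m} :: 'a::idom rat_fun set)"
proof
  show "rat_funs m \<subseteq> field_gen (range rconst \<union> rvar ` {..<m} :: 'a rat_fun set)"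
  proof
    fix f :: "'a rat_fun" assume "f \<in> rat_funs m"
    then obtain p q where "f = to_fract p / to_fract q" "mvars p \<subseteq> {..<m}" "mvars q \<subseteq> {..<m}"
      by (auto simp: rat_funs_def Fract_conv_to_fract)
    then show "f \<in> field_gen (range rconst \<union> rvar ` {..<m})"
      using to_fract_in_field_gen
      by (auto intro!: subfield_divide[OF is_subfield_field_gen])
  qed
  show "field_gen (range rconst \<union> rvar ` {..<m}) \<subseteq> (rat_funs m :: 'a rat_fun set)"
  proof
    fix f :: "'a rat_fun" assume "f \<in> field_gen (range rconst \<union> rvar ` {..<m})"
    then obtain a b where ab: "a \<in> ring_gen (range rconst \<union> rvar ` {..<m})"
      "b \<in> ring_gen (range rconst \<union> rvar ` {..<m})" "b \<noteq> 0" "f = a / b"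
      by (rule field_gen_fractions)
    obtain p where "a = to_fract p" "mvars p \<subseteq> {..<m}" using ring_gen_to_fract[OF ab(1)] .
    moreover obtain q where "b = to_fract q" "mvars q \<subseteq> {..<m}" using ring_gen_to_fract[OF ab(2)] .
    ultimately show "f \<in> rat_funs m"
      using ab by (auto simp: rat_funs_def Fract_conv_to_fract)
  qed
qed

lemma field_gen_rat_fun_UNIV: "(field_gen (range rconst \<union> range rvar) :: 'a::idom rat_fun set) = UNIV"
proof -
  have "f \<in> field_gen (range rconst \<union> range rvar)" for f :: "'a rat_fun"
  proof -
    obtain p q where "f = to_fract p / to_fract q" by (metis Fract_cases Fract_conv_to_fract)
    then show ?thesis
      using to_fract_in_field_gen[of _ UNIV]
      by (auto intro!: subfield_divide[OF is_subfield_field_gen])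
  qed
  then show ?thesis by auto
qed

subsection \<open>The value of a rational function at a point\<close>

text \<open>
  A rational function is defined at \<open>s\<close> if some way of writing it has a denominator that does not
  vanish at \<open>s\<close>.
\<close>

definition spec_dom :: "(nat \<Rightarrow> 'a::field) \<Rightarrow> 'a rat_fun set"
  where "spec_dom s = {f. \<exists>p q. f = Fract p q \<and> meval id s q \<noteq> 0}"

definition spec :: "(nat \<Rightarrow> 'a::field) \<Rightarrow> 'a rat_fun \<Rightarrow> 'a"
  where "spec s f = (let (p, q) = (SOME (p, q). f = Fract p q \<and> meval id s q \<noteq> 0)
    in meval id s p / meval id s q)"

context
  fixes s :: "nat \<Rightarrow> 'a::field"
begin

interpretation id: comm_ring_hom "id :: 'a \<Rightarrow> 'a" by unfold_locales simp_all
interpretation ev: comm_ring_hom "meval id s" by (rule id.comm_ring_hom_meval)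

lemma spec_Fract:
  assumes q: "meval id s q \<noteq> 0"
  shows "spec s (Fract p q) = meval id s p / meval id s q"
proof -
  obtain p' q' where *: "(SOME (p', q'). Fract p q = Fract p' q' \<and> meval id s q' \<noteq> 0) = (p', q')"
    by force
  have "Fract p q = Fract p' q' \<and> meval id s q' \<noteq> 0"
    using someI[of "\<lambda>(p', q'). Fract p q = Fract p' q' \<and> meval id s q' \<noteq> 0" "(p, q)"] q *
    by simp
  moreover from this have "q' \<noteq> 0" "q \<noteq> 0" using q by auto
  ultimately have "p * q' = p' * q" "meval id s q' \<noteq> 0" by (auto simp: eq_fract)
  then have "meval id s p * meval id s q' = meval id s p' * meval id s q"
    by (metis ev.hom_mult)
  with * q \<open>meval id s q' \<noteq> 0\<close> show ?thesis
    by (simp add: spec_def frac_eq_eq)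
qed

lemma Fract_in_spec_dom: "meval id s q \<noteq> 0 \<Longrightarrow> Fract p q \<in> spec_dom s"
  by (auto simp: spec_dom_def)

lemma spec_domE:
  assumes "f \<in> spec_dom s"
  obtains p q where "f = Fract p q" "meval id s q \<noteq> 0" "q \<noteq> 0"
proof -
  obtain p q where "f = Fract p q" "meval id s q \<noteq> 0" using assms by (auto simp: spec_dom_def)
  moreover from this have "q \<noteq> 0" by auto
  ultimately show ?thesis using that by blast
qed

lemma hom_on_spec: "is_subring (spec_dom s)" "hom_on (spec_dom s) (spec s)"
proof -
  have one: "1 \<in> spec_dom s" "spec s 1 = 1"
    using Fract_in_spec_dom[of 1 1] spec_Fract[of 1 1] by (simp_all add: One_fract_def)
  have *: "a - b \<in> spec_dom s" "a * b \<in> spec_dom s"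
    "spec s (a - b) = spec s a - spec s b" "spec s (a * b) = spec s a * spec s b"
    if ab: "a \<in> spec_dom s" "b \<in> spec_dom s" for a b
  proof -
    obtain p q where a: "a = Fract p q" "meval id s q \<noteq> 0" "q \<noteq> 0" using spec_domE[OF ab(1)] .
    obtain p' q' where b: "b = Fract p' q'" "meval id s q' \<noteq> 0" "q' \<noteq> 0" using spec_domE[OF ab(2)] .
    have nz: "meval id s (q * q') \<noteq> 0" using a b by (simp add: ev.hom_mult)
    have eq: "a - b = Fract (p * q' - p' * q) (q * q')" "a * b = Fract (p * p') (q * q')"
      using a b by simp_all
    show "a - b \<in> spec_dom s" "a * b \<in> spec_dom s"
      unfolding eq using nz by (auto intro: Fract_in_spec_dom)
    show "spec s (a - b) = spec s a - spec s b" "spec s (a * b) = spec s a * spec s b"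
      unfolding eq spec_Fract[OF nz] unfolding a(1) b(1) spec_Fract[OF a(2)] spec_Fract[OF b(2)]
      using a b by (simp_all add: ev.hom_minus ev.hom_mult diff_frac_eq)
  qed
  show "is_subring (spec_dom s)" "hom_on (spec_dom s) (spec s)"
    using one * by (simp_all add: is_subring_def hom_on_def)
qed

lemma spec_to_fract: "to_fract p \<in> spec_dom s" "spec s (to_fract p) = meval id s p"
  using Fract_in_spec_dom[of 1 p] spec_Fract[of 1 p] by (simp_all add: to_fract_def)

lemma spec_rconst [simp]: "rconst c \<in> spec_dom s" "spec s (rconst c) = c"
  using spec_to_fract[of "mconst c"] by (simp_all add: rconst_def)

lemma spec_rvar [simp]: "rvar i \<in> spec_dom s" "spec s (rvar i) = s i"
  using spec_to_fract[of "mvar i"] by (simp_all add: rvar_def)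

lemma spec_inverse:
  assumes "f \<in> spec_dom s" "spec s f \<noteq> 0"
  shows "inverse f \<in> spec_dom s"
proof -
  obtain p q where f: "f = Fract p q" "meval id s q \<noteq> 0" "q \<noteq> 0" using spec_domE[OF assms(1)] .
  then have "meval id s p \<noteq> 0" using assms(2) spec_Fract by auto
  with f show ?thesis by (auto intro: Fract_in_spec_dom)
qed

end

section \<open>Symmetric bilinear forms and reflections\<close>

text \<open>
  Vectors are functions of the index, of which only the values below \<open>n\<close> matter. This makes generic
  vectors, whose entries are variables, as convenient as vectors over the ground field.
\<close>

definition app :: "nat \<Rightarrow> 'a::comm_ring_1 mat \<Rightarrow> (nat \<Rightarrow> 'a) \<Rightarrow> nat \<Rightarrow> 'a"
  where "app n g x = (\<lambda>i. \<Sum>j<n. g $$ (i, j) * x j)"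

definition bil :: "nat \<Rightarrow> 'a::comm_ring_1 mat \<Rightarrow> (nat \<Rightarrow> 'a) \<Rightarrow> (nat \<Rightarrow> 'a) \<Rightarrow> 'a"
  where "bil n S x y = (\<Sum>i<n. \<Sum>j<n. S $$ (i, j) * x i * y j)"

definition unitf :: "nat \<Rightarrow> nat \<Rightarrow> 'a::zero_neq_one"
  where "unitf i = (\<lambda>j. if j = i then 1 else 0)"

lemma app_cong: "(\<And>j. j < n \<Longrightarrow> x j = y j) \<Longrightarrow> app n g x = app n g y"
  by (auto simp: app_def intro!: sum.cong)

lemma bil_cong: "(\<And>j. j < n \<Longrightarrow> x j = x' j) \<Longrightarrow> (\<And>j. j < n \<Longrightarrow> y j = y' j) \<Longrightarrow> bil n S x y = bil n S x' y'"
  by (auto simp: bil_def intro!: sum.cong)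

lemma app_mult:
  assumes "g \<in> carrier_mat n n" "h \<in> carrier_mat n n" "i < n"
  shows "app n (g * h) x i = app n g (app n h x) i"
proof -
  have "app n (g * h) x i = (\<Sum>j<n. \<Sum>l<n. g $$ (i, l) * h $$ (l, j) * x j)"
    using assms by (simp add: app_def scalar_prod_def atLeast0LessThan sum_distrib_right)
  also have "\<dots> = (\<Sum>l<n. \<Sum>j<n. g $$ (i, l) * h $$ (l, j) * x j)"
    by (rule sum.swap)
  also have "\<dots> = app n g (app n h x) i"
    by (simp add: app_def sum_distrib_left mult.assoc)
  finally show ?thesis .
qed

lemma app_one: "i < n \<Longrightarrow> app n (1\<^sub>m n) x i = x i"
  unfolding app_def by (subst sum.remove[of _ i]) (auto intro!: sum.neutral)

lemma sum_unitf: "i < n \<Longrightarrow> (\<Sum>j<n. f j * unitf i j) = (f i :: 'a::comm_ring_1)"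
  by (subst sum.remove[of _ i]) (auto simp: unitf_def intro!: sum.neutral)

lemma app_unitf: "j < n \<Longrightarrow> app n g (unitf j) i = g $$ (i, j)"
  unfolding app_def by (rule sum_unitf)

lemma mat_eqI_app:
  assumes "g \<in> carrier_mat n n" "h \<in> carrier_mat n n" "\<And>x i. i < n \<Longrightarrow> app n g x i = app n h x i"
  shows "g = h"
proof (rule eq_matI)
  fix i j assume "i < dim_row h" "j < dim_col h"
  then show "g $$ (i, j) = h $$ (i, j)"
    using assms(3)[of i "unitf j"] assms(1,2) by (simp add: app_unitf)
qed (use assms in auto)

lemma bil_unitf_right: "i < n \<Longrightarrow> bil n S z (unitf i) = (\<Sum>k<n. S $$ (k, i) * z k)"
  unfolding bil_def by (intro sum.cong refl) (rule sum_unitf)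

lemma bil_unitf:
  assumes "i < n" "j < n"
  shows "bil n S (unitf i) (unitf j) = S $$ (i, j)"
  unfolding bil_unitf_right[OF assms(2)] by (rule sum_unitf[OF assms(1)])

lemma bil_add_left: "bil n S (\<lambda>i. x i + c * y i) z = bil n S x z + c * bil n S y z"
  unfolding bil_def sum_distrib_left sum.distrib[symmetric]
  by (intro sum.cong refl) (simp add: algebra_simps)

lemma bil_add_right: "bil n S z (\<lambda>i. x i + c * y i) = bil n S z x + c * bil n S z y"
  unfolding bil_def sum_distrib_left sum.distrib[symmetric]
  by (intro sum.cong refl) (simp add: algebra_simps)

lemma bil_scale_left: "bil n S (\<lambda>i. c * y i) z = c * bil n S y z"
  unfolding bil_def sum_distrib_left sum.distrib[symmetric]
  by (intro sum.cong refl) (simp add: algebra_simps)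

lemma bil_scale_right: "bil n S z (\<lambda>i. c * y i) = c * bil n S z y"
  unfolding bil_def sum_distrib_left sum.distrib[symmetric]
  by (intro sum.cong refl) (simp add: algebra_simps)

lemma bil_sum_left: "bil n S (\<lambda>i. \<Sum>j\<in>I. f j i) z = (\<Sum>j\<in>I. bil n S (f j) z)"
proof -
  have "bil n S (\<lambda>i. \<Sum>j\<in>I. f j i) z = (\<Sum>i<n. \<Sum>k\<in>I. \<Sum>j<n. S $$ (i, j) * f k i * z j)"
    unfolding bil_def sum_distrib_left sum_distrib_right by (intro sum.cong refl sum.swap)
  also have "\<dots> = (\<Sum>j\<in>I. bil n S (f j) z)" unfolding bil_def by (rule sum.swap)
  finally show ?thesis .
qed

lemma bil_sym:
  assumes "transpose_mat S = S" "S \<in> carrier_mat n n"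
  shows "bil n S x y = bil n S y x"
proof -
  have "S $$ (i, j) = S $$ (j, i)" if "i < n" "j < n" for i j
    using that assms by (metis carrier_matD index_transpose_mat(1))
  then have "bil n S x y = (\<Sum>i<n. \<Sum>j<n. S $$ (j, i) * y j * x i)"
    unfolding bil_def by (intro sum.cong refl) (simp add: mult_ac)
  also have "\<dots> = bil n S y x" unfolding bil_def by (rule sum.swap)
  finally show ?thesis .
qed

lemma bil_scalar_prod:
  assumes "S \<in> carrier_mat n n"
  shows "bil n S x y = vec n x \<bullet> (S *\<^sub>v vec n y)"
  using assms
  by (simp add: bil_def scalar_prod_def atLeast0LessThan sum_distrib_left mult_ac)

lemma bil_app:
  assumes "S \<in> carrier_mat n n" "g \<in> carrier_mat n n"
  shows "bil n S (app n g x) (app n g y) = bil n (transpose_mat g * S * g) x y"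
proof -
  have v: "vec n (app n g z) = g *\<^sub>v vec n z" for z
    using assms by (intro eq_vecI) (auto simp: app_def scalar_prod_def atLeast0LessThan)
  let ?V = "vec n x" and ?W = "vec n y"
  have "bil n S (app n g x) (app n g y) = (g *\<^sub>v ?V) \<bullet> (S *\<^sub>v (g *\<^sub>v ?W))"
    using assms by (simp add: bil_scalar_prod v)
  also have "\<dots> = (S *\<^sub>v (g *\<^sub>v ?W)) \<bullet> (g *\<^sub>v ?V)"
    using assms by (intro comm_scalar_prod[of _ n]) auto
  also have "\<dots> = (transpose_mat g *\<^sub>v (S *\<^sub>v (g *\<^sub>v ?W))) \<bullet> ?V"
    using assms by (intro transpose_vec_mult_scalar[symmetric, of _ n n]) auto
  also have "\<dots> = ((transpose_mat g * S * g) *\<^sub>v ?W) \<bullet> ?V"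
    using assms
    by (subst assoc_mult_mat_vec[of _ n n _ n], simp_all)+
  also have "\<dots> = ?V \<bullet> ((transpose_mat g * S * g) *\<^sub>v ?W)"
    using assms
    by (intro comm_scalar_prod[of _ n] mult_mat_vec_carrier[of _ n n] mult_carrier_mat[of _ n n]) auto
  also have "\<dots> = bil n (transpose_mat g * S * g) x y"
    using assms by (subst bil_scalar_prod) auto
  finally show ?thesis .
qed

lemma preserves_bil_iff:
  assumes S: "S \<in> carrier_mat n n" and g: "g \<in> carrier_mat n n"
  shows "(\<forall>x y. bil n S (app n g x) (app n g y) = bil n S x y) \<longleftrightarrow> transpose_mat g * S * g = S"
proof
  assume *: "\<forall>x y. bil n S (app n g x) (app n g y) = bil n S x y"
  show "transpose_mat g * S * g = S"
  proof (rule eq_matI)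
    fix i j assume ij: "i < dim_row S" "j < dim_col S"
    have "bil n (transpose_mat g * S * g) (unitf i) (unitf j) = bil n S (unitf i) (unitf j)"
      using * bil_app[OF S g] by simp
    then show "(transpose_mat g * S * g) $$ (i, j) = S $$ (i, j)"
      using ij S by (simp add: bil_unitf)
  qed (use S g in auto)
qed (use bil_app[OF S g] in simp)

text \<open>
  The matrix is the Schur complement of one diagonal block in a block matrix. The scalar on the
  right is the Schur complement of the other one.
\<close>

lemma det_one_minus_rank_one:
  fixes u w :: "nat \<Rightarrow> 'a::idom"
  shows "det (mat n n (\<lambda>(i, j). (if i = j then 1 else 0) - u i * w j)) = 1 - (\<Sum>i<n. w i * u i)"
proof -
  define U where "U = mat n 1 (\<lambda>(i, _). u i)"
  define W where "W = mat 1 n (\<lambda>(_, j). w j)"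
  define P where "P = mat n n (\<lambda>(i, j). (if i = j then 1 else 0) - u i * w j)"
  define Q where "Q = mat 1 1 (\<lambda>_. 1 - (\<Sum>i<n. w i * u i))"
  have c: "U \<in> carrier_mat n 1" "W \<in> carrier_mat 1 n" "P \<in> carrier_mat n n" "Q \<in> carrier_mat 1 1"
    by (auto simp: U_def W_def P_def Q_def)
  let ?L = "four_block_mat (1\<^sub>m n) (0\<^sub>m n 1) W (1\<^sub>m 1)"
  have UW: "P + U * W = 1\<^sub>m n" and WU: "W * U + Q = 1\<^sub>m 1"
    by (intro eq_matI; auto simp: U_def W_def P_def Q_def scalar_prod_def atLeast0LessThan)+
  have "four_block_mat P U (0\<^sub>m 1 n) (1\<^sub>m 1) * ?L = four_block_mat (P + U * W) U W (1\<^sub>m 1)"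
    using c by (subst mult_four_block_mat[of _ n n _ 1 _ 1 _ _ n _ 1]) auto
  moreover have "?L * four_block_mat (1\<^sub>m n) U (0\<^sub>m 1 n) Q = four_block_mat (1\<^sub>m n) U W (W * U + Q)"
    using c by (subst mult_four_block_mat[of _ n n _ 1 _ 1 _ _ n _ 1]) auto
  ultimately have eq: "four_block_mat P U (0\<^sub>m 1 n) (1\<^sub>m 1) * ?L = ?L * four_block_mat (1\<^sub>m n) U (0\<^sub>m 1 n) Q"
    by (simp add: UW WU)
  have "det ?L = det (1\<^sub>m n) * det (1\<^sub>m 1 :: 'a mat)"
    using c by (intro det_four_block_mat_upper_right_zero) auto
  then have L: "det ?L = 1" by simp
  have 1: "det (four_block_mat P U (0\<^sub>m 1 n) (1\<^sub>m 1)) = det P * det (1\<^sub>m 1 :: 'a mat)"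
    using c by (intro det_four_block_mat_lower_left_zero) auto
  have 2: "det (four_block_mat (1\<^sub>m n) U (0\<^sub>m 1 n) Q) = det (1\<^sub>m n :: 'a mat) * det Q"
    using c by (intro det_four_block_mat_lower_left_zero) auto
  have "det (four_block_mat P U (0\<^sub>m 1 n) (1\<^sub>m 1) * ?L) = det (four_block_mat P U (0\<^sub>m 1 n) (1\<^sub>m 1)) * det ?L"
    using c by (intro det_mult[of _ "n + 1"]) auto
  moreover have "det (?L * four_block_mat (1\<^sub>m n) U (0\<^sub>m 1 n) Q) = det ?L * det (four_block_mat (1\<^sub>m n) U (0\<^sub>m 1 n) Q)"
    using c by (intro det_mult[of _ "n + 1"]) auto
  ultimately have "det P = det Q" using eq 1 2 L by simp
  also have "det Q = 1 - (\<Sum>i<n. w i * u i)" by (simp add: Q_def det_single)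
  finally show ?thesis by (simp add: P_def)
qed

definition refl_mat :: "nat \<Rightarrow> 'a::field mat \<Rightarrow> (nat \<Rightarrow> 'a) \<Rightarrow> 'a mat"
  where "refl_mat n S v = mat n n (\<lambda>(i, j).
    (if i = j then 1 else 0) - v i * (2 * inverse (bil n S v v) * (\<Sum>l<n. S $$ (j, l) * v l)))"

lemma refl_mat_carrier [simp]: "refl_mat n S v \<in> carrier_mat n n"
  by (simp add: refl_mat_def)

lemma refl_mat_det:
  assumes "bil n S v v \<noteq> 0"
  shows "det (refl_mat n S v) = (- 1 :: 'a::field)"
proof -
  have "(\<Sum>i<n. 2 * inverse (bil n S v v) * (\<Sum>l<n. S $$ (i, l) * v l) * v i) = 2 * inverse (bil n S v v) * bil n S v v"
    unfolding bil_def[of n S v v] sum_distrib_left sum_distrib_right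
    by (intro sum.cong refl) (simp add: mult_ac)
  then show ?thesis
    using assms unfolding refl_mat_def by (subst det_one_minus_rank_one) simp
qed

lemma app_refl_mat:
  assumes "i < n"
  shows "app n (refl_mat n S v) x i = x i + (- 2 * bil n S x v / bil n S v v) * v i"
proof -
  have "app n (refl_mat n S v) x i =
      (\<Sum>j<n. (if i = j then x j else 0) - v i * 2 * inverse (bil n S v v) * (\<Sum>l<n. S $$ (j, l) * x j * v l))"
    unfolding app_def refl_mat_def using assms
    by (intro sum.cong refl) (auto simp: algebra_simps sum_distrib_left)
  also have "\<dots> = x i - v i * 2 * inverse (bil n S v v) * bil n S x v"
    using assms by (simp add: sum_subtractf sum_distrib_left[symmetric] bil_def)
  finally show ?thesis by (simp add: field_simps)
qed

definition refl_prod :: "nat \<Rightarrow> 'a::field mat \<Rightarrow> (nat \<Rightarrow> 'a) list \<Rightarrow> 'a mat"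
  where "refl_prod n S vs = foldr (\<lambda>v g. refl_mat n S v * g) vs (1\<^sub>m n)"

lemma refl_prod_simps [simp]: "refl_prod n S [] = 1\<^sub>m n" "refl_prod n S (v # vs) = refl_mat n S v * refl_prod n S vs"
  by (simp_all add: refl_prod_def)

lemma refl_prod_carrier [simp]: "refl_prod n S vs \<in> carrier_mat n n"
  by (induction vs) (auto intro: mult_carrier_mat[OF refl_mat_carrier])

lemma refl_prod_append: "refl_prod n S (vs @ ws) = refl_prod n S vs * refl_prod n S ws"
  by (induction vs) (auto simp: assoc_mult_mat[OF refl_mat_carrier refl_prod_carrier refl_prod_carrier] left_mult_one_mat[OF refl_prod_carrier])

context
  fixes n :: nat and S :: "'a::field mat"
  assumes S: "S \<in> carrier_mat n n" "transpose_mat S = S" and char2: "(2 :: 'a) \<noteq> 0"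
begin

lemma refl_preserves:
  assumes v: "bil n S v v \<noteq> 0"
  shows "bil n S (app n (refl_mat n S v) x) (app n (refl_mat n S v) y) = bil n S x y"
proof -
  define c d where "c = - 2 * bil n S x v / bil n S v v" and "d = - 2 * bil n S y v / bil n S v v"
  have "bil n S (app n (refl_mat n S v) x) (app n (refl_mat n S v) y) =
      bil n S (\<lambda>i. x i + c * v i) (\<lambda>i. y i + d * v i)"
    unfolding c_def d_def by (rule bil_cong) (simp_all add: app_refl_mat)
  also have "\<dots> = bil n S x y + d * bil n S x v + c * (bil n S y v + d * bil n S v v)"
    by (simp add: bil_add_left bil_add_right bil_sym[OF S(2,1), of v y])
  also have "\<dots> = bil n S x y"
    using v by (simp add: c_def d_def field_simps)
  finally show ?thesis .
qed

lemma refl_square: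
  assumes v: "bil n S v v \<noteq> 0"
  shows "refl_mat n S v * refl_mat n S v = 1\<^sub>m n"
proof (rule mat_eqI_app[of _ n])
  fix x i assume i: "i < n"
  define c where "c = - 2 * bil n S x v / bil n S v v"
  have "app n (refl_mat n S v) x j = x j + c * v j" if "j < n" for j
    using that by (simp add: app_refl_mat c_def)
  then have "bil n S (app n (refl_mat n S v) x) v = bil n S x v + c * bil n S v v"
    unfolding bil_add_left[symmetric] by (intro bil_cong) auto
  also have "\<dots> = - bil n S x v" using v by (simp add: c_def)
  finally have "app n (refl_mat n S v) (app n (refl_mat n S v) x) i = x i"
    using i by (simp add: app_refl_mat)
  then show "app n (refl_mat n S v * refl_mat n S v) x i = app n (1\<^sub>m n) x i"
    using i by (simp add: app_mult app_one)
qed (auto intro: mult_carrier_mat[of _ n n])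

lemma refl_prod_det:
  "(\<forall>v\<in>set vs. bil n S v v \<noteq> 0) \<Longrightarrow> det (refl_prod n S vs) = (- 1) ^ length vs"
  by (induction vs) (auto simp: det_mult[OF refl_mat_carrier refl_prod_carrier] refl_mat_det)

lemma refl_prod_preserves:
  "(\<forall>v\<in>set vs. bil n S v v \<noteq> 0) \<Longrightarrow>
    bil n S (app n (refl_prod n S vs) x) (app n (refl_prod n S vs) y) = bil n S x y"
proof (induction vs arbitrary: x y)
  case Nil
  show ?case by (auto intro: bil_cong simp: app_one)
next
  case (Cons v vs)
  have "bil n S (app n (refl_prod n S (v # vs)) x) (app n (refl_prod n S (v # vs)) y) =
    bil n S (app n (refl_mat n S v) (app n (refl_prod n S vs) x)) (app n (refl_mat n S v) (app n (refl_prod n S vs) y))"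
    by (rule bil_cong) (simp_all add: app_mult)
  with Cons show ?case by (simp add: refl_preserves)
qed

lemma refl_prod_isometry:
  "(\<forall>v\<in>set vs. bil n S v v \<noteq> 0) \<Longrightarrow> transpose_mat (refl_prod n S vs) * S * refl_prod n S vs = S"
  using preserves_bil_iff[OF S(1), of "refl_prod n S vs"] refl_prod_preserves by simp

text \<open>
  Reflections are involutions, so reversing the order of the factors inverts the product.
\<close>

lemma refl_prod_rev:
  "(\<forall>v\<in>set vs. bil n S v v \<noteq> 0) \<Longrightarrow> refl_prod n S (rev vs) * refl_prod n S vs = 1\<^sub>m n"
proof (induction vs)
  case (Cons v vs)
  let ?R = "refl_mat n S v" and ?P = "refl_prod n S vs" and ?Q = "refl_prod n S (rev vs)"
  have "refl_prod n S (rev (v # vs)) * refl_prod n S (v # vs) = ?Q * ?R * (?R * ?P)"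
    by (simp add: refl_prod_append right_mult_one_mat[OF refl_mat_carrier])
  also have "\<dots> = ?Q * (?R * (?R * ?P))"
    by (rule assoc_mult_mat[of _ n n _ n _ n]) (auto intro: mult_carrier_mat[of _ n n])
  also have "?R * (?R * ?P) = ?R * ?R * ?P"
    by (rule assoc_mult_mat[symmetric, of _ n n _ n _ n]) auto
  also have "\<dots> = ?P"
    using Cons.prems by (simp add: refl_square left_mult_one_mat[OF refl_prod_carrier])
  finally show ?case using Cons by simp
qed simp

lemma bil_nondegenerate:
  assumes det: "det S \<noteq> 0" and z: "\<And>y. bil n S z y = 0" and "l < n"
  shows "z l = 0"
proof (rule ccontr)
  assume "z l \<noteq> 0"
  have "S *\<^sub>v vec n z = 0\<^sub>v n"
  proof (rule eq_vecI)
    fix i assume "i < dim_vec (0\<^sub>v n :: 'a vec)"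
    then have i: "i < n" by simp
    have "bil n S z (unitf i) = (\<Sum>k<n. S $$ (k, i) * z k)"
      by (rule bil_unitf_right[OF i])
    also have "\<dots> = (\<Sum>k<n. S $$ (i, k) * z k)"
      using i S by (intro sum.cong refl) (metis carrier_matD index_transpose_mat(1) lessThan_iff)
    finally show "(S *\<^sub>v vec n z) $ i = 0\<^sub>v n $ i"
      using i S z by (simp add: scalar_prod_def atLeast0LessThan)
  qed (use S in auto)
  moreover have "vec n z \<noteq> 0\<^sub>v n"
    using \<open>z l \<noteq> 0\<close> \<open>l < n\<close> by (metis index_vec index_zero_vec(1))
  ultimately show False
    using det_0_iff_vec_prod_zero_field[OF S(1)] det by (metis vec_carrier)
qed

lemma bil_polarize:
  assumes "\<And>x. bil n T x x = bil n T' x x" "T \<in> carrier_mat n n" "transpose_mat T = T"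
    "T' \<in> carrier_mat n n" "transpose_mat T' = T'"
  shows "bil n T x y = bil n T' x (y :: nat \<Rightarrow> 'a)"
proof -
  have "bil n T (\<lambda>i. x i + 1 * y i) (\<lambda>i. x i + 1 * y i) = bil n T x x + bil n T y y + 2 * bil n T x y"
    unfolding bil_add_left bil_add_right using bil_sym[OF assms(3,2), of y x] by simp
  moreover have "bil n T' (\<lambda>i. x i + 1 * y i) (\<lambda>i. x i + 1 * y i) = bil n T' x x + bil n T' y y + 2 * bil n T' x y"
    unfolding bil_add_left bil_add_right using bil_sym[OF assms(5,4), of y x] by simp
  ultimately show ?thesis using assms(1) char2 by (metis add_left_cancel mult_left_cancel)
qed

end

text \<open>
  Gram-Schmidt: the projection away from the vectors found so far has a non-isotropic image, which
  is rescaled by a square root.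
\<close>

lemma orthonormal_basis:
  fixes S :: "'a::{alg_closed_field, field_char_0} mat"
  assumes S: "S \<in> carrier_mat n n" "transpose_mat S = S" "det S \<noteq> 0"
  shows "\<exists>w. \<forall>i<n. \<forall>j<n. bil n S (w i) (w j) = (if i = j then 1 else 0)"
proof -
  have "\<exists>w. \<forall>i<k. \<forall>j<k. bil n S (w i) (w j) = (if i = j then 1 else 0)" if "k \<le> n" for k
    using that
  proof (induction k)
    case (Suc k)
    then obtain w where w: "\<And>i j. i < k \<Longrightarrow> j < k \<Longrightarrow> bil n S (w i) (w j) = (if i = j then 1 else 0)"
      by auto
    define \<pi> where "\<pi> x = (\<lambda>l. x l + (- 1) * (\<Sum>j<k. bil n S x (w j) * w j l))" for x
    have \<pi>w: "bil n S (\<pi> x) (w i) = 0" if "i < k" for x i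
    proof -
      have "bil n S (\<pi> x) (w i) = bil n S x (w i) - (\<Sum>j<k. bil n S x (w j) * bil n S (w j) (w i))"
        unfolding \<pi>_def bil_add_left bil_sum_left bil_scale_left by simp
      also have "(\<Sum>j<k. bil n S x (w j) * bil n S (w j) (w i)) = (\<Sum>j<k. if j = i then bil n S x (w j) else 0)"
        using that by (intro sum.cong refl) (simp add: w)
      also have "\<dots> = bil n S x (w i)" using that by simp
      finally show ?thesis by simp
    qed
    \<comment> \<open>otherwise polarization and nondegeneracy give \<open>\<pi> = 0\<close>, and \<open>k < n\<close> vectors would span the whole space\<close>
    have "\<exists>x. bil n S (\<pi> x) (\<pi> x) \<noteq> 0"
    proof (rule ccontr)
      assume "\<nexists>x. bil n S (\<pi> x) (\<pi> x) \<noteq> 0"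
      then have iso: "bil n S (\<pi> x) (\<pi> x) = 0" for x by simp
      have add: "\<pi> (\<lambda>i. x i + 1 * y i) = (\<lambda>i. \<pi> x i + 1 * \<pi> y i)" for x y
        unfolding \<pi>_def bil_add_left by (rule ext) (simp add: algebra_simps sum.distrib)
      have "bil n S (\<pi> x) (\<pi> y) = 0" for x y
      proof -
        have "bil n S (\<pi> (\<lambda>i. x i + 1 * y i)) (\<pi> (\<lambda>i. x i + 1 * y i)) = 0" by (rule iso)
        then show ?thesis
          unfolding add bil_add_left bil_add_right
          using bil_sym[OF S(2,1), of "\<pi> y" "\<pi> x"] iso by simp
      qed
      then have "bil n S (\<pi> x) y = 0" for x y
      proof -
        have "bil n S (\<pi> y) (\<pi> x) = bil n S y (\<pi> x) + (- 1) * (\<Sum>j<k. bil n S y (w j) * bil n S (w j) (\<pi> x))"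
          unfolding \<pi>_def[of y] bil_add_left bil_sum_left bil_scale_left by simp
        also have "(\<Sum>j<k. bil n S y (w j) * bil n S (w j) (\<pi> x)) = 0"
          using \<pi>w bil_sym[OF S(2,1), of _ "\<pi> x"] by (intro sum.neutral) simp
        finally show ?thesis
          using \<open>\<And>x y. bil n S (\<pi> x) (\<pi> y) = 0\<close> bil_sym[OF S(2,1), of y "\<pi> x"] by simp
      qed
      then have \<pi>0: "\<pi> x l = 0" if "l < n" for x l
        using bil_nondegenerate[OF S(1,2) _ S(3)] that by simp
      define M where "M = mat n n (\<lambda>(l, j). if j < k then w j l else 0)"
      define N where "N = mat n n (\<lambda>(j, i). bil n S (unitf i) (w j))"
      have "M * N = 1\<^sub>m n"
      proof (rule eq_matI)
        fix l i assume "l < dim_row (1\<^sub>m n :: 'a mat)" "i < dim_col (1\<^sub>m n :: 'a mat)"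
        then have li: "l < n" "i < n" by auto
        have "(M * N) $$ (l, i) = (\<Sum>j<n. (if j < k then w j l else 0) * bil n S (unitf i) (w j))"
          using li by (simp add: M_def N_def scalar_prod_def atLeast0LessThan)
        also have "\<dots> = (\<Sum>j<k. bil n S (unitf i) (w j) * w j l)"
          using Suc.prems by (intro sum.mono_neutral_cong_right) auto
        also have "\<dots> = unitf i l"
          using \<pi>0[OF li(1), of "unitf i"] by (simp add: \<pi>_def)
        finally show "(M * N) $$ (l, i) = 1\<^sub>m n $$ (l, i)" using li by (simp add: unitf_def)
      qed (auto simp: M_def N_def)
      then have "det M * det N = 1"
        using det_mult[of M n N] by (simp add: M_def N_def)
      moreover have "M *\<^sub>v unit_vec n k = 0\<^sub>v n"
        using Suc.prems by (intro eq_vecI) (auto simp: M_def)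
      then have "det M = 0"
        using Suc.prems det_0_iff_vec_prod_zero_field[of M n] by (auto simp: M_def intro!: exI[of _ "unit_vec n k"])
      ultimately show False by simp
    qed
    then obtain x where x: "bil n S (\<pi> x) (\<pi> x) \<noteq> 0" by auto
    obtain t where "poly [:- bil n S (\<pi> x) (\<pi> x), 0, 1:] t = 0"
      using alg_closed_imp_poly_has_root[of "[:- bil n S (\<pi> x) (\<pi> x), 0, 1:]"] by auto
    then have t: "t * t = bil n S (\<pi> x) (\<pi> x)" by simp
    with x have t0: "t \<noteq> 0" by auto
    define u where "u = (\<lambda>l. inverse t * \<pi> x l)"
    have uu: "bil n S u u = 1"
      unfolding u_def bil_scale_left bil_scale_right using t t0 by (simp add: field_simps flip: t)
    have uw: "bil n S u (w i) = 0" "bil n S (w i) u = 0" if "i < k" for i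
      using \<pi>w[OF that] bil_sym[OF S(2,1), of "w i" u] by (simp_all add: u_def bil_scale_left)
    show ?case
      by (rule exI[of _ "w(k := u)"]) (auto simp: less_Suc_eq w uu uw)
  qed simp
  then show ?thesis by blast
qed

lemma orthonormal_mat:
  fixes S :: "'a::{alg_closed_field, field_char_0} mat"
  assumes S: "S \<in> carrier_mat n n" "transpose_mat S = S" "det S \<noteq> 0"
  obtains W where "W \<in> carrier_mat n n" "transpose_mat W * S * W = 1\<^sub>m n"
proof -
  obtain w where w: "\<And>i j. i < n \<Longrightarrow> j < n \<Longrightarrow> bil n S (w i) (w j) = (if i = j then 1 else 0)"
    using orthonormal_basis[OF S] by blast
  define W where "W = mat n n (\<lambda>(l, j). w j l)"
  have W: "W \<in> carrier_mat n n" by (simp add: W_def)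
  have "transpose_mat W * S * W = 1\<^sub>m n"
  proof (rule eq_matI)
    fix i j assume "i < dim_row (1\<^sub>m n :: 'a mat)" "j < dim_col (1\<^sub>m n :: 'a mat)"
    then have ij: "i < n" "j < n" by auto
    have "(transpose_mat W * S * W) $$ (i, j) = bil n S (app n W (unitf i)) (app n W (unitf j))"
      using ij by (simp add: bil_app[OF S(1) W] bil_unitf)
    also have "\<dots> = bil n S (w i) (w j)"
      using ij by (intro bil_cong) (simp_all add: app_unitf W_def)
    finally show "(transpose_mat W * S * W) $$ (i, j) = 1\<^sub>m n $$ (i, j)" using ij w by simp
  qed (use W S in auto)
  with W that show ?thesis by blast
qed

lemma transpose_conj:
  assumes "S \<in> carrier_mat n n" "g \<in> carrier_mat n n"
  shows "transpose_mat (transpose_mat g * S * g) = transpose_mat g * transpose_mat S * (g :: 'a::comm_ring_1 mat)"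
proof -
  have "transpose_mat (transpose_mat g * S * g) = transpose_mat g * (transpose_mat S * transpose_mat (transpose_mat g))"
    using assms by (subst transpose_mult[of _ n n _ n], simp_all, subst transpose_mult[of _ n n _ n], simp_all)
  also have "\<dots> = transpose_mat g * transpose_mat S * g"
    using assms by (subst assoc_mult_mat[of _ n n _ n _ n]) auto
  finally show ?thesis .
qed

lemma conj_mult:
  assumes "S \<in> carrier_mat n n" "g \<in> carrier_mat n n" "h \<in> carrier_mat n n"
  shows "transpose_mat (g * h) * S * (g * h) = transpose_mat h * (transpose_mat g * S * g) * (h :: 'a::comm_ring_1 mat)"
proof -
  note cl = mult_carrier_mat[of _ n n _ n] transpose_carrier_mat
  have "transpose_mat (g * h) * S * (g * h) = (transpose_mat h * transpose_mat g) * S * (g * h)"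
    using assms by (simp add: transpose_mult[of g n n h n])
  also have "\<dots> = transpose_mat h * (transpose_mat g * S) * (g * h)"
    using assms by (subst assoc_mult_mat[of "transpose_mat h" n n "transpose_mat g" n S n]) (auto intro: cl)
  also have "\<dots> = transpose_mat h * ((transpose_mat g * S) * (g * h))"
    using assms by (intro assoc_mult_mat[of _ n n _ n _ n]) (auto intro: cl)
  also have "(transpose_mat g * S) * (g * h) = transpose_mat g * S * g * h"
    using assms by (intro assoc_mult_mat[symmetric, of _ n n _ n _ n]) (auto intro: cl)
  also have "transpose_mat h * (transpose_mat g * S * g * h) = transpose_mat h * (transpose_mat g * S * g) * h"
    using assms by (intro assoc_mult_mat[symmetric, of _ n n _ n _ n]) (auto intro: cl)
  finally show ?thesis .
qed

lemma det_conj: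
  assumes "S \<in> carrier_mat n n" "g \<in> carrier_mat n n"
  shows "det (transpose_mat g * S * g) = det g ^ 2 * det (S :: 'a::comm_ring_1 mat)"
proof -
  have "det (transpose_mat g * S * g) = det (transpose_mat g * S) * det g"
    using assms by (intro det_mult[of _ n]) (auto intro: mult_carrier_mat[of _ n n])
  also have "det (transpose_mat g * S) = det (transpose_mat g) * det S"
    using assms by (intro det_mult[of _ n]) auto
  finally show ?thesis using assms by (simp add: det_transpose power2_eq_square)
qed

lemma inverse_mat_exists:
  assumes "g \<in> carrier_mat n n" "det g \<noteq> (0 :: 'a::field)"
  obtains h where "h \<in> carrier_mat n n" "g * h = 1\<^sub>m n" "h * g = 1\<^sub>m n" "det g * det h = 1"
    "\<And>R. is_subfield R \<Longrightarrow> (\<And>i j. i < n \<Longrightarrow> j < n \<Longrightarrow> g $$ (i, j) \<in> R) \<Longrightarrow>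
      (\<And>i j. i < n \<Longrightarrow> j < n \<Longrightarrow> h $$ (i, j) \<in> R)"
proof -
  define h where "h = (1 / det g) \<cdot>\<^sub>m adj_mat g"
  note a = adj_mat[OF assms(1)]
  have h: "h \<in> carrier_mat n n" using a by (simp add: h_def)
  have "g * h = (1 / det g) \<cdot>\<^sub>m (g * adj_mat g)"
    unfolding h_def using a assms by (intro mult_smult_distrib) auto
  then have gh: "g * h = 1\<^sub>m n" using a(2) assms by (intro eq_matI) auto
  then have "h * g = 1\<^sub>m n" using mat_mult_left_right_inverse assms(1) h by blast
  moreover have "det g * det h = 1" using det_mult[OF assms(1) h] gh by simp
  moreover have "h $$ (i, j) \<in> R"
    if R: "is_subfield R" and gR: "\<And>i j. i < n \<Longrightarrow> j < n \<Longrightarrow> g $$ (i, j) \<in> R" and ij: "i < n" "j < n" for R i j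
  proof -
    note RR = is_subring_subfield[OF R]
    have "mat_delete g j i $$ (a, b) \<in> R" if "a < n - 1" "b < n - 1" for a b
      using that assms(1) by (auto simp: mat_delete_def intro!: gR)
    then have "det (mat_delete g j i) \<in> R"
      using assms(1) by (intro subring_det[OF RR]) (auto simp: mat_delete_def)
    moreover have "det g \<in> R" using gR assms(1) by (intro subring_det[OF RR]) auto
    ultimately show ?thesis
      using ij a(1) assms(1) unfolding h_def
      by (auto simp: adj_mat_def cofactor_def intro!: subring_mult[OF RR] subfield_divide[OF R]
          subring_power[OF RR] subring_uminus[OF RR] subring_one[OF RR])
  qed
  ultimately show ?thesis using that[OF h gh] by blast
qed

section \<open>Products of reflections\<close>

context
  fixes n :: nat and S :: "'a::{alg_closed_field, field_char_0} mat"
  assumes S: "S \<in> carrier_mat n n" "transpose_mat S = S" and det: "det S \<noteq> 0"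
begin

lemma two_neq_zero': "(2 :: 'a) \<noteq> 0" by simp

lemmas RP = S(1) S(2) two_neq_zero'

text \<open>
  The basis vectors are put back into their place one after the other. For unit vectors \<open>y\<close> and \<open>w\<close> the
  reflection along \<open>y - w\<close> exchanges them, unless \<open>y - w\<close> is isotropic. In that case the reflection
  along \<open>y + w\<close> takes \<open>y\<close> to \<open>-w\<close>, and the reflection along \<open>w\<close> corrects the sign. Both leave the
  earlier basis vectors alone, as these are orthogonal to \<open>y\<close> and to \<open>w\<close>.
\<close>

lemma move_to_basis:
  assumes w: "\<And>i j. i < n \<Longrightarrow> j < n \<Longrightarrow> bil n S (w i) (w j) = (if i = j then 1 else 0)"
    and g: "g \<in> carrier_mat n n" "\<And>x y. bil n S (app n g x) (app n g y) = bil n S x y" and "k \<le> n"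
  shows "\<exists>vs. length vs \<le> 2 * k \<and> (\<forall>v\<in>set vs. bil n S v v \<noteq> 0) \<and>
    (\<forall>i<k. \<forall>l<n. app n (refl_prod n S vs * g) (w i) l = w i l)"
  using \<open>k \<le> n\<close>
proof (induction k)
  case 0
  show ?case by (intro exI[of _ "[]"]) simp
next
  case (Suc k)
  then obtain vs where vs: "length vs \<le> 2 * k" "\<forall>v\<in>set vs. bil n S v v \<noteq> 0"
    "\<And>i l. i < k \<Longrightarrow> l < n \<Longrightarrow> app n (refl_prod n S vs * g) (w i) l = w i l" by auto
  have k: "k < n" using Suc.prems by simp
  define h where "h = refl_prod n S vs * g"
  have hc: "h \<in> carrier_mat n n"
    unfolding h_def using g refl_prod_carrier by (auto intro: mult_carrier_mat[of _ n n])
  have hp: "bil n S (app n h x) (app n h y) = bil n S x y" for x y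
  proof -
    have "bil n S (app n h x) (app n h y) =
      bil n S (app n (refl_prod n S vs) (app n g x)) (app n (refl_prod n S vs) (app n g y))"
      unfolding h_def using g refl_prod_carrier by (intro bil_cong app_mult) auto
    then show ?thesis using refl_prod_preserves[OF RP vs(2)] g(2) by simp
  qed
  define y where "y = app n h (w k)"
  have yy: "bil n S y y = 1" unfolding y_def hp using w[OF k k] by simp
  have yw: "bil n S y (w i) = 0" if "i < k" for i
  proof -
    have "bil n S y (w i) = bil n S (app n h (w k)) (app n h (w i))"
      unfolding y_def using vs(3)[OF that] by (intro bil_cong) (auto simp: h_def)
    then show ?thesis unfolding hp using w[of k i] that k by simp
  qed
  have wk: "bil n S (w k) (w k) = 1" "bil n S (w k) (w i) = 0" if "i < k" for i
    using w[of k k] w[of k i] that k by simp_all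
  have wk1: "bil n S (w k) (w k) = 1" using w[OF k k] by simp
  note sym = bil_sym[OF S(2,1)]
  define t where "t = bil n S y (w k)"
  have "\<exists>us. length us \<le> 2 \<and> (\<forall>v\<in>set us. bil n S v v \<noteq> 0) \<and>
    (\<forall>l<n. app n (refl_prod n S us) y l = w k l) \<and>
    (\<forall>i<k. \<forall>l<n. app n (refl_prod n S us) (w i) l = w i l)"
  proof (cases "t = 1")
    case False
    define a where "a = (\<lambda>i. y i + (- 1) * w k i)"
    have aa: "bil n S a a = 2 * (1 - t)"
      unfolding a_def bil_add_left bil_add_right using yy wk1 sym[of "w k" y]
      by (simp add: t_def)
    have ya: "bil n S y a = 1 - t"
      unfolding a_def bil_add_right using yy by (simp add: t_def)
    have wa: "bil n S (w i) a = 0" if "i < k" for i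
      unfolding a_def bil_add_right using yw[OF that] wk(2)[OF that] sym by simp
    have "app n (refl_mat n S a) y l = w k l" if "l < n" for l
      using that False by (simp add: app_refl_mat aa ya) (simp add: a_def field_simps)
    moreover have "app n (refl_mat n S a) (w i) l = w i l" if "i < k" "l < n" for i l
      using that by (simp add: app_refl_mat wa)
    ultimately show ?thesis
      using aa False
      by (intro exI[of _ "[a]"]) (auto simp: refl_prod_simps right_mult_one_mat[OF refl_mat_carrier])
  next
    case True
    define a where "a = (\<lambda>i. y i + 1 * w k i)"
    have aa: "bil n S a a = 4"
      unfolding a_def bil_add_left bil_add_right using yy wk1 sym[of "w k" y] True
      by (simp add: t_def)
    have ya: "bil n S y a = 2"
      unfolding a_def bil_add_right using yy True by (simp add: t_def)
    have wa: "bil n S (w i) a = 0" if "i < k" for i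
      unfolding a_def bil_add_right using yw[OF that] wk(2)[OF that] sym by simp
    have 1: "app n (refl_mat n S a) y l = (- 1) * w k l" if "l < n" for l
      using that by (simp add: app_refl_mat aa ya) (simp add: a_def)
    have 2: "app n (refl_mat n S a) (w i) l = w i l" if "i < k" "l < n" for i l
      using that by (simp add: app_refl_mat wa)
    have P: "refl_prod n S [w k, a] = refl_mat n S (w k) * refl_mat n S a"
      by (simp add: refl_prod_simps right_mult_one_mat[OF refl_mat_carrier])
    have "app n (refl_prod n S [w k, a]) y l = w k l" if "l < n" for l
    proof -
      have "app n (refl_prod n S [w k, a]) y l = app n (refl_mat n S (w k)) (\<lambda>l. (- 1) * w k l) l"
        unfolding P using that 1 by (subst app_mult[of _ n]) (auto intro!: fun_cong[OF app_cong])
      then show ?thesis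
        using that by (simp only: app_refl_mat bil_scale_left) (simp add: wk1)
    qed
    moreover have "app n (refl_prod n S [w k, a]) (w i) l = w i l" if "i < k" "l < n" for i l
    proof -
      have "app n (refl_prod n S [w k, a]) (w i) l = app n (refl_mat n S (w k)) (w i) l"
        unfolding P using that 2 by (subst app_mult[of _ n]) (auto intro!: fun_cong[OF app_cong])
      then show ?thesis
        using that wk(2)[OF that(1)] sym[of "w i" "w k"] by (simp add: app_refl_mat)
    qed
    ultimately show ?thesis
      using aa wk1 by (intro exI[of _ "[w k, a]"]) auto
  qed
  then obtain us where us: "length us \<le> 2" "\<forall>v\<in>set us. bil n S v v \<noteq> 0"
    "\<And>l. l < n \<Longrightarrow> app n (refl_prod n S us) y l = w k l"
    "\<And>i l. i < k \<Longrightarrow> l < n \<Longrightarrow> app n (refl_prod n S us) (w i) l = w i l" by blast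
  have P: "refl_prod n S (us @ vs) * g = refl_prod n S us * h"
    unfolding refl_prod_append h_def
    by (rule assoc_mult_mat[OF refl_prod_carrier refl_prod_carrier g(1)])
  have "app n (refl_prod n S us * h) (w i) l = w i l" if "i < Suc k" "l < n" for i l
  proof -
    have "app n (refl_prod n S us * h) (w i) l = app n (refl_prod n S us) (app n h (w i)) l"
      by (rule app_mult[OF refl_prod_carrier hc that(2)])
    also have "\<dots> = w i l"
    proof (cases "i = k")
      case True then show ?thesis using us(3)[OF that(2)] by (simp add: y_def)
    next
      case False
      then have "i < k" using that by simp
      moreover from this have "app n (refl_prod n S us) (app n h (w i)) = app n (refl_prod n S us) (w i)"
        using vs(3) by (intro app_cong) (simp add: h_def)
      ultimately show ?thesis using us(4) that by simp
    qed
    finally show ?thesis .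
  qed
  then show ?case
    using us(1,2) vs(1,2) by (intro exI[of _ "us @ vs"]) (auto simp: P)
qed

text \<open>
  A number of factors that does not depend on \<open>g\<close> is needed for a single generic element to
  specialise to every element of the group. The determinant fixes the parity, and pairs of equal
  reflections fill up the product.
\<close>

theorem cartan_dieudonne:
  assumes g: "g \<in> carrier_mat n n" "transpose_mat g * S * g = S" "det g = 1" and "n > 0"
  shows "\<exists>vs. length vs = 2 * n \<and> (\<forall>v\<in>set vs. bil n S v v \<noteq> 0) \<and> g = refl_prod n S vs"
proof -
  obtain w where w: "\<And>i j. i < n \<Longrightarrow> j < n \<Longrightarrow> bil n S (w i) (w j) = (if i = j then 1 else 0)"
    using orthonormal_basis[OF S det] by blast
  have gp: "bil n S (app n g x) (app n g y) = bil n S x y" for x y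
    using preserves_bil_iff[OF S(1) g(1)] g(2) by blast
  obtain vs where vs: "length vs \<le> 2 * n" "\<forall>v\<in>set vs. bil n S v v \<noteq> 0"
    "\<And>i l. i < n \<Longrightarrow> l < n \<Longrightarrow> app n (refl_prod n S vs * g) (w i) l = w i l"
    using move_to_basis[OF w g(1) gp, of n] by auto
  define W where "W = mat n n (\<lambda>(l, j). w j l)"
  have W: "W \<in> carrier_mat n n" by (simp add: W_def)
  let ?P = "refl_prod n S vs"
  have PgC: "?P * g \<in> carrier_mat n n"
    using g refl_prod_carrier by (auto intro: mult_carrier_mat[of _ n n])
  have "transpose_mat W * S * W = 1\<^sub>m n"
  proof (rule eq_matI)
    fix i j assume "i < dim_row (1\<^sub>m n :: 'a mat)" "j < dim_col (1\<^sub>m n :: 'a mat)"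
    then have ij: "i < n" "j < n" by auto
    have "(transpose_mat W * S * W) $$ (i, j) = bil n S (app n W (unitf i)) (app n W (unitf j))"
      using ij by (simp add: bil_app[OF S(1) W] bil_unitf)
    also have "\<dots> = bil n S (w i) (w j)"
      using ij by (intro bil_cong) (simp_all add: app_unitf W_def)
    finally show "(transpose_mat W * S * W) $$ (i, j) = 1\<^sub>m n $$ (i, j)" using ij w by simp
  qed (use W S in auto)
  then have "det W ^ 2 * det S = 1" using det_conj[OF S(1) W] by simp
  then have "det W \<noteq> 0" by auto
  then obtain V where V: "V \<in> carrier_mat n n" "W * V = 1\<^sub>m n" using inverse_mat_exists[OF W] by metis
  have "?P * g * W = W"
  proof (rule eq_matI)
    fix l j assume "l < dim_row W" "j < dim_col W"
    then have lj: "l < n" "j < n" using W by auto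
    have "(?P * g * W) $$ (l, j) = app n (?P * g * W) (unitf j) l" using lj by (simp add: app_unitf)
    also have "\<dots> = app n (?P * g) (app n W (unitf j)) l" by (rule app_mult[OF PgC W lj(1)])
    also have "app n (?P * g) (app n W (unitf j)) = app n (?P * g) (w j)"
      using lj by (intro app_cong) (simp add: app_unitf W_def)
    also have "\<dots> l = W $$ (l, j)" using vs(3) lj by (simp add: W_def)
    finally show "(?P * g * W) $$ (l, j) = W $$ (l, j)" .
  qed (use PgC W in auto)
  then have "?P * g * (W * V) = W * V"
    using assoc_mult_mat[OF PgC W V(1)] by simp
  then have Pg: "?P * g = 1\<^sub>m n" using V right_mult_one_mat[OF PgC] by simp
  define us where "us = rev vs"
  have "refl_prod n S us = refl_prod n S us * (?P * g)"
    unfolding Pg by (rule right_mult_one_mat[OF refl_prod_carrier, symmetric])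
  also have "\<dots> = refl_prod n S us * ?P * g"
    by (rule assoc_mult_mat[symmetric, OF refl_prod_carrier refl_prod_carrier g(1)])
  also have "\<dots> = g" unfolding us_def refl_prod_rev[OF RP vs(2)] using g by simp
  finally have gus: "g = refl_prod n S us" by simp
  have us: "length us \<le> 2 * n" "\<forall>v\<in>set us. bil n S v v \<noteq> 0" using vs by (auto simp: us_def)
  have "even (length us)"
  proof (rule ccontr)
    assume "odd (length us)"
    then have "det g = - 1" using refl_prod_det[OF RP us(2)] gus by simp
    with g show False by simp
  qed
  have pad: "\<exists>vs. length vs = length us + 2 * k \<and> (\<forall>v\<in>set vs. bil n S v v \<noteq> 0) \<and> g = refl_prod n S vs" for k
  proof (induction k)
    case (Suc k)
    then obtain vs where vs: "length vs = length us + 2 * k" "\<forall>v\<in>set vs. bil n S v v \<noteq> 0"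
      "g = refl_prod n S vs" by blast
    let ?R = "refl_mat n S (w 0)"
    have w0: "bil n S (w 0) (w 0) \<noteq> 0" using w[of 0 0] \<open>n > 0\<close> by simp
    have "refl_prod n S (w 0 # w 0 # vs) = ?R * ?R * refl_prod n S vs"
      unfolding refl_prod_simps
      by (rule assoc_mult_mat[symmetric, OF refl_mat_carrier refl_mat_carrier refl_prod_carrier])
    also have "\<dots> = g" using refl_square[OF RP w0] vs(3) left_mult_one_mat[OF refl_prod_carrier] by simp
    finally show ?case using vs w0 by (intro exI[of _ "w 0 # w 0 # vs"]) auto
  qed (use us gus in auto)
  from \<open>even (length us)\<close> us(1) have "2 * n = length us + 2 * (n - length us div 2)" by auto
  with pad[of "n - length us div 2"] show ?thesis by metis
qed

text \<open>
  Both forms have orthonormal bases, whose comparison gives a matrix \<open>M\<close> with the right Gram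
  matrix and with determinant \<open>d\<close> or \<open>- d\<close>. The sign is corrected by a change of sign of one basis vector.
\<close>

theorem gram_matrix_surjective:
  assumes S': "S' \<in> carrier_mat n n" "transpose_mat S' = S'" and d: "det S' = d ^ 2 * det S" "d \<noteq> 0" and "n > 0"
  shows "\<exists>M\<in>carrier_mat n n. transpose_mat M * S * M = S' \<and> det M = d"
proof -
  obtain W where W: "W \<in> carrier_mat n n" "transpose_mat W * S * W = 1\<^sub>m n"
    by (rule orthonormal_mat[OF S det])
  have "det S' \<noteq> 0" using d det by simp
  then obtain W' where W': "W' \<in> carrier_mat n n" "transpose_mat W' * S' * W' = 1\<^sub>m n"
    by (rule orthonormal_mat[OF S'])
  have "det W' ^ 2 * det S' = 1" using det_conj[OF S'(1) W'(1)] W'(2) by simp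
  then have "det W' \<noteq> 0" by auto
  then obtain V where V: "V \<in> carrier_mat n n" "W' * V = 1\<^sub>m n"
    using inverse_mat_exists[OF W'(1)] by metis
  have VV: "transpose_mat V * V = S'"
  proof -
    have "transpose_mat (W' * V) * S' * (W' * V) = transpose_mat V * 1\<^sub>m n * V"
      using conj_mult[OF S'(1) W'(1) V(1)] W'(2) by simp
    then show ?thesis using V S' by (simp add: right_mult_one_mat[of _ n n])
  qed
  define D where "D = mat n n (\<lambda>(i, j). if i = j then if i = 0 then - 1 else 1 else (0 :: 'a))"
  have D: "D \<in> carrier_mat n n" by (simp add: D_def)
  have DD: "transpose_mat D * D = 1\<^sub>m n"
  proof (rule eq_matI)
    fix i j assume "i < dim_row (1\<^sub>m n :: 'a mat)" "j < dim_col (1\<^sub>m n :: 'a mat)"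
    then have ij: "i < n" "j < n" by auto
    have "(transpose_mat D * D) $$ (i, j) = (\<Sum>l<n. D $$ (l, i) * D $$ (l, j))"
      using ij D by (simp add: scalar_prod_def atLeast0LessThan)
    also have "\<dots> = D $$ (i, i) * D $$ (i, j)"
      using ij by (subst sum.remove[of _ i]) (auto simp: D_def intro!: sum.neutral)
    finally show "(transpose_mat D * D) $$ (i, j) = 1\<^sub>m n $$ (i, j)" using ij by (auto simp: D_def)
  qed (use D in auto)
  have "det D = det (mat n n (\<lambda>(i, j). (if i = j then 1 else 0) - 2 * unitf 0 i * unitf 0 j))"
    by (intro arg_cong[of _ _ det] eq_matI) (auto simp: D_def unitf_def)
  also have "\<dots> = 1 - (\<Sum>i<n. unitf 0 i * (2 * unitf 0 i))"
    by (rule det_one_minus_rank_one)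
  also have "(\<Sum>i<n. unitf 0 i * (2 * unitf 0 i)) = (\<Sum>i<n. (2 * unitf 0 i) * unitf 0 i :: 'a)"
    by (intro sum.cong refl) (rule mult.commute)
  also have "\<dots> = 2 * unitf 0 0"
    by (rule sum_unitf) (fact \<open>n > 0\<close>)
  finally have detD: "det D = (- 1 :: 'a)" by (simp add: unitf_def)
  have main: "\<exists>M\<in>carrier_mat n n. transpose_mat M * S * M = S' \<and> det M = det Q * det V"
    if Q: "Q \<in> carrier_mat n n" "transpose_mat Q * S * Q = 1\<^sub>m n" for Q
  proof (rule bexI[of _ "Q * V"])
    have "transpose_mat (Q * V) * S * (Q * V) = transpose_mat V * 1\<^sub>m n * V"
      using conj_mult[OF S(1) Q(1) V(1)] Q(2) by simp
    then show "transpose_mat (Q * V) * S * (Q * V) = S' \<and> det (Q * V) = det Q * det V"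
      using V VV det_mult[OF Q(1) V(1)] by (simp add: right_mult_one_mat[of _ n n])
  qed (use Q V in auto)
  have "det S' = (det W * det V) ^ 2 * det S"
  proof -
    obtain M where M: "M \<in> carrier_mat n n" "transpose_mat M * S * M = S'" "det M = det W * det V"
      using main[OF W] by blast
    with det_conj[OF S(1) M(1)] show ?thesis by simp
  qed
  with d det have "(det W * det V) ^ 2 = d ^ 2" by simp
  then have "det W * det V = d \<or> det W * det V = - d" by (simp add: power2_eq_iff)
  then show ?thesis
  proof
    assume "det W * det V = d" with main[OF W] show ?thesis by simp
  next
    assume neg: "det W * det V = - d"
    have "transpose_mat (W * D) * S * (W * D) = transpose_mat D * 1\<^sub>m n * D"
      using conj_mult[OF S(1) W(1) D] W(2) by simp
    then have "transpose_mat (W * D) * S * (W * D) = 1\<^sub>m n"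
      using D DD by (simp add: right_mult_one_mat[of _ n n])
    then obtain M where "M \<in> carrier_mat n n" "transpose_mat M * S * M = S'" "det M = det (W * D) * det V"
      using main[of "W * D"] W D by (meson mult_carrier_mat)
    moreover have "det (W * D) * det V = d"
      using det_mult[OF W(1) D] detD neg by simp
    ultimately show ?thesis by auto
  qed
qed

end

section \<open>Specialising matrices\<close>

lemma map_mat_mult_hom_on:
  assumes R: "is_subring R" and \<psi>: "hom_on R \<psi>"
    and g: "g \<in> carrier_mat n m" "\<And>i j. i < n \<Longrightarrow> j < m \<Longrightarrow> g $$ (i, j) \<in> R"
    and h: "h \<in> carrier_mat m l" "\<And>i j. i < m \<Longrightarrow> j < l \<Longrightarrow> h $$ (i, j) \<in> R"
  shows "map_mat \<psi> (g * h) = map_mat \<psi> g * map_mat \<psi> h"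
    and "i < n \<Longrightarrow> j < l \<Longrightarrow> (g * h) $$ (i, j) \<in> R"
proof -
  have eq: "(g * h) $$ (i, j) = (\<Sum>k<m. g $$ (i, k) * h $$ (k, j))" if "i < n" "j < l" for i j
    using that g h by (simp add: scalar_prod_def atLeast0LessThan)
  show "map_mat \<psi> (g * h) = map_mat \<psi> g * map_mat \<psi> h"
  proof (rule eq_matI)
    fix i j assume "i < dim_row (map_mat \<psi> g * map_mat \<psi> h)" "j < dim_col (map_mat \<psi> g * map_mat \<psi> h)"
    then have ij: "i < n" "j < l" using g h by auto
    have "map_mat \<psi> (g * h) $$ (i, j) = \<psi> (\<Sum>k<m. g $$ (i, k) * h $$ (k, j))"
      using ij g h eq by simp
    also have "\<dots> = (\<Sum>k<m. \<psi> (g $$ (i, k)) * \<psi> (h $$ (k, j)))"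
      using ij by (subst hom_on_sum[OF R \<psi>])
        (auto intro!: sum.cong hom_on_mult[OF R \<psi>] subring_mult[OF R] g h)
    also have "\<dots> = (map_mat \<psi> g * map_mat \<psi> h) $$ (i, j)"
      using ij g h by (simp add: scalar_prod_def atLeast0LessThan)
    finally show "map_mat \<psi> (g * h) $$ (i, j) = (map_mat \<psi> g * map_mat \<psi> h) $$ (i, j)" .
  qed (use g h in auto)
  show "(g * h) $$ (i, j) \<in> R" if "i < n" "j < l"
    unfolding eq[OF that] using that g h by (intro subring_sum[OF R] subring_mult[OF R]) auto
qed

lemma bil_hom_on:
  assumes R: "is_subring R" and \<psi>: "hom_on R \<psi>" and S: "S \<in> carrier_mat n n"
    and SR: "\<And>i j. i < n \<Longrightarrow> j < n \<Longrightarrow> S $$ (i, j) \<in> R"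
    and v: "\<And>i. i < n \<Longrightarrow> v i \<in> R" "\<And>i. i < n \<Longrightarrow> w i \<in> R"
  shows "\<psi> (bil n S v w) = bil n (map_mat \<psi> S) (\<lambda>i. \<psi> (v i)) (\<lambda>i. \<psi> (w i))" "bil n S v w \<in> R"
proof -
  note cl = subring_sum[OF R] subring_mult[OF R]
  have "\<psi> (bil n S v w) = (\<Sum>i<n. \<psi> (\<Sum>j<n. S $$ (i, j) * v i * w j))"
    unfolding bil_def by (intro hom_on_sum[OF R \<psi>] cl SR v) auto
  also have "\<dots> = (\<Sum>i<n. \<Sum>j<n. \<psi> (S $$ (i, j) * v i * w j))"
    by (intro sum.cong refl hom_on_sum[OF R \<psi>] cl SR v) auto
  also have "\<dots> = (\<Sum>i<n. \<Sum>j<n. map_mat \<psi> S $$ (i, j) * \<psi> (v i) * \<psi> (w j))"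
    using S by (intro sum.cong refl) (simp add: hom_on_mult[OF R \<psi>] SR v cl)
  finally show "\<psi> (bil n S v w) = bil n (map_mat \<psi> S) (\<lambda>i. \<psi> (v i)) (\<lambda>i. \<psi> (w i))"
    by (simp add: bil_def)
  show "bil n S v w \<in> R" unfolding bil_def by (auto intro!: cl SR v)
qed

lemma refl_prod_hom_on:
  fixes \<psi> :: "'a::field \<Rightarrow> 'b::field"
  assumes R: "is_subring R" and \<psi>: "hom_on R \<psi>" and S: "S \<in> carrier_mat n n"
    and SR: "\<And>i j. i < n \<Longrightarrow> j < n \<Longrightarrow> S $$ (i, j) \<in> R"
    and vs: "\<And>v i. v \<in> set vs \<Longrightarrow> i < n \<Longrightarrow> v i \<in> R"
      "\<And>v. v \<in> set vs \<Longrightarrow> bil n S v v \<noteq> 0 \<and> inverse (bil n S v v) \<in> R"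
  shows "map_mat \<psi> (refl_prod n S vs) = refl_prod n (map_mat \<psi> S) (map (\<lambda>v i. \<psi> (v i)) vs)
    \<and> refl_prod n S vs \<in> carrier_mat n n \<and> (\<forall>i<n. \<forall>j<n. refl_prod n S vs $$ (i, j) \<in> R)"
  using vs
proof (induction vs)
  case Nil
  have "map_mat \<psi> (1\<^sub>m n) = 1\<^sub>m n"
    by (intro eq_matI) (auto simp: hom_on_zero[OF R \<psi>] hom_on_one[OF R \<psi>])
  then show ?case
    by (auto simp: subring_zero[OF R] subring_one[OF R])
next
  case (Cons v vs)
  have IH: "map_mat \<psi> (refl_prod n S vs) = refl_prod n (map_mat \<psi> S) (map (\<lambda>v i. \<psi> (v i)) vs)
    \<and> refl_prod n S vs \<in> carrier_mat n n \<and> (\<forall>i<n. \<forall>j<n. refl_prod n S vs $$ (i, j) \<in> R)"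
    using Cons.prems by (intro Cons.IH) auto
  have v: "\<And>i. i < n \<Longrightarrow> v i \<in> R" "bil n S v v \<noteq> 0" "inverse (bil n S v v) \<in> R"
    using Cons.prems by auto
  have b: "\<psi> (bil n S v v) = bil n (map_mat \<psi> S) (\<lambda>i. \<psi> (v i)) (\<lambda>i. \<psi> (v i))" "bil n S v v \<in> R"
    by (rule bil_hom_on[OF R \<psi> S SR v(1) v(1)]; assumption)+
  have "\<psi> (bil n S v v) * \<psi> (inverse (bil n S v v)) = 1"
    using hom_on_mult[OF R \<psi> b(2) v(3)] v(2) hom_on_one[OF R \<psi>] by simp
  then have inv: "\<psi> (inverse (bil n S v v)) = inverse (\<psi> (bil n S v v))"
    by (metis inverse_unique)
  let ?R = "refl_mat n S v"
  note cl = subring_sum[OF R] subring_mult[OF R] subring_diff[OF R] subring_zero[OF R] subring_one[OF R]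
    subring_of_nat[OF R, of 2, simplified]
  have two: "(2 :: 'a) \<in> R" "\<psi> 2 = 2" using subring_of_nat[OF R, of 2] hom_on_of_nat[OF R \<psi>, of 2] by simp_all
  have RR: "?R $$ (i, j) \<in> R" if "i < n" "j < n" for i j
    using that unfolding refl_mat_def by (auto intro!: cl two v SR subring_uminus[OF R])
  have "map_mat \<psi> ?R = refl_mat n (map_mat \<psi> S) (\<lambda>i. \<psi> (v i))"
  proof (rule eq_matI)
    fix i j assume "i < dim_row (refl_mat n (map_mat \<psi> S) (\<lambda>i. \<psi> (v i)))"
      "j < dim_col (refl_mat n (map_mat \<psi> S) (\<lambda>i. \<psi> (v i)))"
    then have ij: "i < n" "j < n" by (auto simp: refl_mat_def)
    have w: "(\<Sum>l<n. S $$ (j, l) * v l) \<in> R" "\<psi> (\<Sum>l<n. S $$ (j, l) * v l) = (\<Sum>l<n. \<psi> (S $$ (j, l)) * \<psi> (v l))"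
      using ij by (auto intro!: cl v SR) (subst hom_on_sum[OF R \<psi>]; auto intro!: sum.cong hom_on_mult[OF R \<psi>] cl v SR)
    have w': "2 * inverse (bil n S v v) * (\<Sum>l<n. S $$ (j, l) * v l) \<in> R"
      by (intro subring_mult[OF R] two v w)
    have "\<psi> (2 * inverse (bil n S v v) * (\<Sum>l<n. S $$ (j, l) * v l)) =
      2 * inverse (\<psi> (bil n S v v)) * (\<Sum>l<n. \<psi> (S $$ (j, l)) * \<psi> (v l))"
      by (simp add: hom_on_mult[OF R \<psi>] subring_mult[OF R] two v w inv)
    moreover have "\<psi> (if i = j then 1 else 0) = (if i = j then 1 else 0)" "(if i = j then 1 else 0) \<in> R"
      by (auto simp: hom_on_zero[OF R \<psi>] hom_on_one[OF R \<psi>] intro: cl)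
    ultimately show "map_mat \<psi> ?R $$ (i, j) = refl_mat n (map_mat \<psi> S) (\<lambda>i. \<psi> (v i)) $$ (i, j)"
      using ij S w' v(1)[of i] unfolding refl_mat_def b(1)[symmetric]
      by (simp add: hom_on_diff[OF R \<psi>] hom_on_mult[OF R \<psi>] subring_mult[OF R])
  qed (auto simp: refl_mat_def)
  moreover have "refl_prod n S (v # vs) = ?R * refl_prod n S vs"
    "refl_prod n (map_mat \<psi> S) (map (\<lambda>v i. \<psi> (v i)) (v # vs)) =
      refl_mat n (map_mat \<psi> S) (\<lambda>i. \<psi> (v i)) * refl_prod n (map_mat \<psi> S) (map (\<lambda>v i. \<psi> (v i)) vs)"
    by (simp_all add: refl_prod_def)
  ultimately show ?case
    using IH map_mat_mult_hom_on[OF R \<psi> refl_mat_carrier RR, of "refl_prod n S vs" n]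
      mult_carrier_mat[OF refl_mat_carrier refl_prod_carrier] by auto
qed

section \<open>The special orthogonal group in coordinates\<close>

definition gram_mat :: "nat \<Rightarrow> ('k::field vec \<Rightarrow> 'k) \<Rightarrow> 'k mat"
  where "gram_mat n q = mat n n (\<lambda>(i, j). polar q (unit_vec n i) (unit_vec n j))"

lemma gram_mat_carrier [simp]: "gram_mat n q \<in> carrier_mat n n"
  by (simp add: gram_mat_def)

lemma polar_sym: "v \<in> carrier_vec n \<Longrightarrow> w \<in> carrier_vec n \<Longrightarrow> polar q v w = polar q w v"
  unfolding polar_def by (subst comm_add_vec[of v n w]) auto

text \<open>
  Additivity and homogeneity in the first argument are part of the definition of a quadratic form;
  the expansion is by induction over the initial segments of \<open>v\<close>.
\<close>

lemma polar_expand: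
  fixes q :: "'k::field vec \<Rightarrow> 'k"
  assumes q: "quadratic_form n q" and v: "v \<in> carrier_vec n" and w: "w \<in> carrier_vec n"
  shows "polar q v w = (\<Sum>i<n. v $ i * polar q (unit_vec n i) w)"
proof -
  define t where "t k = vec n (\<lambda>i. if i < k then v $ i else 0)" for k
  have add: "polar q (u + u') w = polar q u w + polar q u' w" if "u \<in> carrier_vec n" "u' \<in> carrier_vec n" for u u'
    using q that w by (auto simp: quadratic_form_def)
  have smult: "polar q (a \<cdot>\<^sub>v u) w = a * polar q u w" if "u \<in> carrier_vec n" for u a
    using q that w by (auto simp: quadratic_form_def)
  have "polar q (t k) w = (\<Sum>i<k. v $ i * polar q (unit_vec n i) w)" if "k \<le> n" for k
    using that
  proof (induction k)
    case 0
    have "t 0 = 0 \<cdot>\<^sub>v 0\<^sub>v n" by (intro eq_vecI) (auto simp: t_def)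
    then show ?case using smult[of "0\<^sub>v n" 0] by simp
  next
    case (Suc k)
    have "t (Suc k) = t k + v $ k \<cdot>\<^sub>v unit_vec n k"
      using Suc.prems by (intro eq_vecI) (auto simp: t_def less_Suc_eq)
    then show ?case
      using Suc add[of "t k" "v $ k \<cdot>\<^sub>v unit_vec n k"] smult[of "unit_vec n k" "v $ k"] by (simp add: t_def)
  qed
  moreover have "t n = v" using v by (intro eq_vecI) (auto simp: t_def)
  ultimately show ?thesis by (metis order_refl)
qed

lemma gram_mat_det:
  assumes q: "quadratic_form n q" "nondegenerate n q"
  shows "det (gram_mat n q) \<noteq> 0"
proof
  assume "det (gram_mat n q) = 0"
  then obtain v where v: "v \<in> carrier_vec n" "v \<noteq> 0\<^sub>v n" "gram_mat n q *\<^sub>v v = 0\<^sub>v n"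
    using det_0_iff_vec_prod_zero_field[OF gram_mat_carrier] by blast
  have e: "polar q (unit_vec n j) v = 0" if "j < n" for j
  proof -
    have "polar q (unit_vec n j) v = polar q v (unit_vec n j)" using v by (intro polar_sym[of _ n]) auto
    also have "\<dots> = (\<Sum>i<n. v $ i * polar q (unit_vec n i) (unit_vec n j))"
      using v by (intro polar_expand[OF q(1)]) auto
    also have "\<dots> = (\<Sum>i<n. gram_mat n q $$ (j, i) * v $ i)"
      using that by (intro sum.cong refl) (simp add: gram_mat_def polar_sym[of _ n])
    also have "\<dots> = (gram_mat n q *\<^sub>v v) $ j"
    proof (subst index_mult_mat_vec)
      show "j < dim_row (gram_mat n q)" using that by (simp add: gram_mat_def)
      show "(\<Sum>i<n. gram_mat n q $$ (j, i) * v $ i) = row (gram_mat n q) j \<bullet> v"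
        using that v(1) by (auto simp: scalar_prod_def atLeast0LessThan gram_mat_def intro!: sum.cong)
    qed
    finally show ?thesis unfolding v(3) using that by simp
  qed
  have "polar q v w = 0" if "w \<in> carrier_vec n" for w
  proof -
    have "polar q v w = polar q w v" using v that by (intro polar_sym[of _ n]) auto
    also have "\<dots> = 0" using polar_expand[OF q(1) that v(1)] e by simp
    finally show ?thesis .
  qed
  with v q(2) show False by (auto simp: nondegenerate_def)
qed

lemma sum_square_split:
  fixes f :: "nat \<Rightarrow> nat \<Rightarrow> 'a::comm_ring_1"
  assumes "\<And>i j. f i j = f j i"
  shows "(\<Sum>i<n. \<Sum>j<n. f i j) = (\<Sum>i<n. f i i) + 2 * (\<Sum>j<n. \<Sum>i<j. f i j)"
proof (induction n)
  case (Suc n)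
  have "(\<Sum>i<n. f n i) = (\<Sum>i<n. f i n)" using assms by simp
  then have "(\<Sum>i<Suc n. \<Sum>j<Suc n. f i j) =
      (\<Sum>i<n. \<Sum>j<n. f i j) + (\<Sum>i<n. f i n) + ((\<Sum>i<n. f i n) + f n n)"
    by (simp add: sum.distrib)
  with Suc show ?case by simp
qed simp

lemma base_change_bil:
  fixes q :: "'k::field_char_0 vec \<Rightarrow> 'k"
  assumes q: "quadratic_form n q"
  shows "2 * base_change n q (vec n x) = bil n (map_mat to_ac (gram_mat n q)) x x"
proof -
  have d: "polar q (unit_vec n i) (unit_vec n i) = 2 * q (unit_vec n i)" for i
  proof -
    have "unit_vec n i + unit_vec n i = 2 \<cdot>\<^sub>v (unit_vec n i :: 'k vec)" by (intro eq_vecI) auto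
    then have "q (unit_vec n i + unit_vec n i) = 2\<^sup>2 * q (unit_vec n i)"
      using q by (auto simp: quadratic_form_def)
    then show ?thesis by (simp add: polar_def)
  qed
  define p where "p i j = to_ac (polar q (unit_vec n i) (unit_vec n j)) * x i * x j" for i j
  have "bil n (map_mat to_ac (gram_mat n q)) x x = (\<Sum>i<n. \<Sum>j<n. p i j)"
    unfolding bil_def p_def by (intro sum.cong refl) (simp add: gram_mat_def)
  also have "\<dots> = (\<Sum>i<n. p i i) + 2 * (\<Sum>j<n. \<Sum>i<j. p i j)"
  proof (rule sum_square_split)
    show "p i j = p j i" for i j
      unfolding p_def using polar_sym[of "unit_vec n i" n "unit_vec n j" q] by simp
  qed
  also have "\<dots> = 2 * base_change n q (vec n x)"
    unfolding base_change_def p_def distrib_left sum_distrib_left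
    by (intro arg_cong2[where f = "(+)"] sum.cong refl) (auto simp: d power2_eq_square)
  finally show ?thesis by simp
qed

theorem special_orthogonal_iff:
  fixes q :: "'k::field_char_0 vec \<Rightarrow> 'k"
  assumes q: "quadratic_form n q"
  defines "S \<equiv> map_mat to_ac (gram_mat n q)"
  shows "g \<in> special_orthogonal n q \<longleftrightarrow> g \<in> carrier_mat n n \<and> det g = 1 \<and> transpose_mat g * S * g = S"
proof (cases "g \<in> carrier_mat n n")
  case g: True
  have S: "S \<in> carrier_mat n n" "transpose_mat S = S"
    unfolding S_def by (auto intro!: eq_matI simp: gram_mat_def polar_sym[of _ n])
  have gx: "g *\<^sub>v vec n x = vec n (app n g x)" for x
    using g by (intro eq_vecI) (auto simp: app_def scalar_prod_def atLeast0LessThan)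
  have "(\<forall>x\<in>carrier_vec n. base_change n q (g *\<^sub>v x) = base_change n q x) \<longleftrightarrow>
    (\<forall>x. base_change n q (g *\<^sub>v vec n x) = base_change n q (vec n x))"
  proof -
    have "vec n (\<lambda>i. v $ i) = v" if "v \<in> carrier_vec n" for v :: "'k alg_closure vec"
      using that by (intro eq_vecI) auto
    then show ?thesis by (metis vec_carrier)
  qed
  also have "\<dots> \<longleftrightarrow> (\<forall>x. bil n S (app n g x) (app n g x) = bil n S x x)"
    unfolding gx S_def base_change_bil[OF q, symmetric] by simp
  also have "\<dots> \<longleftrightarrow> (\<forall>x y. bil n S (app n g x) (app n g y) = bil n S x y)"
  proof
    assume *: "\<forall>x. bil n S (app n g x) (app n g x) = bil n S x x"
    show "\<forall>x y. bil n S (app n g x) (app n g y) = bil n S x y"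
    proof (intro allI)
      fix x y
      have "bil n (transpose_mat g * S * g) x y = bil n S x y"
      proof (rule bil_polarize[of S n])
        show "bil n (transpose_mat g * S * g) z z = bil n S z z" for z
          using * unfolding bil_app[OF S(1) g] by blast
        show "transpose_mat (transpose_mat g * S * g) = transpose_mat g * S * g"
          unfolding transpose_conj[OF S(1) g] S(2) ..
      qed (use S g in \<open>auto intro!: mult_carrier_mat[of _ n n]\<close>)
      then show "bil n S (app n g x) (app n g y) = bil n S x y" by (simp add: bil_app[OF S(1) g])
    qed
  qed simp
  also have "\<dots> \<longleftrightarrow> transpose_mat g * S * g = S" by (rule preserves_bil_iff[OF S(1) g])
  finally show ?thesis using g by (auto simp: special_orthogonal_def)
qed (auto simp: special_orthogonal_def)

section \<open>The group action on rational functions\<close>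

lemma mult_index:
  assumes "g \<in> carrier_mat n n" "h \<in> carrier_mat n n" "i < n" "j < n"
  shows "(g * h) $$ (i, j) = (\<Sum>l<n. g $$ (i, l) * h $$ (l, j))"
  using assms by (simp add: scalar_prod_def atLeast0LessThan)

lemma lin_subst_meval:
  "lin_subst m M = meval (mconst \<circ> id) (\<lambda>i. if i < m then \<Sum>j<m. mconst (M $$ (i, j)) * mvar j else mvar i)"
  by (simp add: lin_subst_def)

lemma inj_lin_subst:
  fixes M :: "'a::idom mat"
  assumes M: "M \<in> carrier_mat m m" "M' \<in> carrier_mat m m" "M * M' = 1\<^sub>m m"
  shows "inj_idom_hom (lin_subst m M)"
  unfolding lin_subst_meval
proof (rule inj_idom_hom_subst[where l' = "\<lambda>i. if i < m then \<Sum>j<m. mconst (M' $$ (i, j)) * mvar j else mvar i"])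
  show "inj_idom_hom (id :: 'a \<Rightarrow> 'a)" by unfold_locales auto
  interpret c: inj_idom_hom "mconst :: 'a \<Rightarrow> (nat, 'a) mpoly" by (rule inj_idom_hom_mconst)
  let ?l' = "\<lambda>i. if i < m then \<Sum>j<m. mconst (M' $$ (i, j)) * mvar j else mvar i :: (nat, 'a) mpoly"
  interpret s: comm_ring_hom "meval mconst ?l'" by (rule c.comm_ring_hom_meval)
  fix i
  show "meval mconst ?l' (if i < m then \<Sum>j<m. mconst (M $$ (i, j)) * mvar j else mvar i) = mvar i"
  proof (cases "i < m")
    case True
    have "meval mconst ?l' (\<Sum>j<m. mconst (M $$ (i, j)) * mvar j) =
        (\<Sum>j<m. \<Sum>k<m. mconst (M $$ (i, j) * M' $$ (j, k)) * mvar k)"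
      by (simp add: s.hom_sum c.meval_mult sum_distrib_left c.hom_mult mult.assoc)
    also have "\<dots> = (\<Sum>k<m. \<Sum>j<m. mconst (M $$ (i, j) * M' $$ (j, k)) * mvar k)"
      by (rule sum.swap)
    also have "\<dots> = (\<Sum>k<m. mconst ((M * M') $$ (i, k)) * mvar k)"
      using True by (intro sum.cong refl) (simp add: mult_index[OF M(1,2)] c.hom_sum sum_distrib_right)
    also have "\<dots> = (\<Sum>k<m. mvar k * unitf i k)"
      using True M(3) by (intro sum.cong refl) (auto simp: unitf_def)
    also have "\<dots> = mvar i" by (rule sum_unitf[OF True])
    finally show ?thesis using True by simp
  qed simp
qed

lemma fract_lin_subst:
  fixes M :: "'a::idom mat"
  assumes M: "M \<in> carrier_mat m m" "M' \<in> carrier_mat m m" "M * M' = 1\<^sub>m m"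
  shows "inj_idom_hom (fract_map (lin_subst m M))"
    "fract_map (lin_subst m M) (rconst c) = rconst c"
    "i < m \<Longrightarrow> fract_map (lin_subst m M) (rvar i) = (\<Sum>j<m. rconst (M $$ (i, j)) * rvar j)"
    "\<not> i < m \<Longrightarrow> fract_map (lin_subst m M) (rvar i) = rvar i"
proof -
  note inj = inj_lin_subst[OF M]
  interpret c: inj_idom_hom "mconst :: 'a \<Rightarrow> (nat, 'a) mpoly" by (rule inj_idom_hom_mconst)
  interpret t: inj_idom_hom "to_fract :: (nat, 'a) mpoly \<Rightarrow> 'a rat_fun" by (rule inj_idom_hom_to_fract)
  note h = fract_map_hom(2)[OF inj]
  show "inj_idom_hom (fract_map (lin_subst m M))" by (rule fract_map_hom(1)[OF inj])
  show "fract_map (lin_subst m M) (rconst c) = rconst c"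
    unfolding rconst_def h by (simp add: lin_subst_def)
  show "i < m \<Longrightarrow> fract_map (lin_subst m M) (rvar i) = (\<Sum>j<m. rconst (M $$ (i, j)) * rvar j)"
    unfolding rvar_def rconst_def h by (simp add: lin_subst_def t.hom_sum)
  show "\<not> i < m \<Longrightarrow> fract_map (lin_subst m M) (rvar i) = rvar i"
    unfolding rvar_def h by (simp add: lin_subst_def)
qed

lemma fract_map_coeffs:
  fixes \<sigma> :: "'a::idom \<Rightarrow> 'b::idom"
  assumes \<sigma>: "inj_idom_hom \<sigma>"
  shows "inj_idom_hom (fract_map (Poly_Mapping.map \<sigma>) :: 'a rat_fun \<Rightarrow> 'b rat_fun)"
    "fract_map (Poly_Mapping.map \<sigma>) (rconst c) = rconst (\<sigma> c)"
    "fract_map (Poly_Mapping.map \<sigma>) (rvar i) = rvar i"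
proof -
  interpret \<sigma>: inj_idom_hom \<sigma> by fact
  interpret c: inj_idom_hom "mconst :: 'b \<Rightarrow> (nat, 'b) mpoly" by (rule inj_idom_hom_mconst)
  have eq: "(Poly_Mapping.map \<sigma> :: (nat, 'a) mpoly \<Rightarrow> _) = meval (mconst \<circ> \<sigma>) mvar"
    by (rule ext) (simp add: meval_mvar_map)
  have inj: "inj_idom_hom (Poly_Mapping.map \<sigma> :: (nat, 'a) mpoly \<Rightarrow> (nat, 'b) mpoly)"
    unfolding eq by (rule inj_idom_hom_subst[where l' = mvar]) (simp_all add: \<sigma>)
  note h = fract_map_hom(2)[OF inj]
  show "inj_idom_hom (fract_map (Poly_Mapping.map \<sigma>) :: 'a rat_fun \<Rightarrow> 'b rat_fun)"
    by (rule fract_map_hom(1)[OF inj])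
  show "fract_map (Poly_Mapping.map \<sigma>) (rconst c) = rconst (\<sigma> c)"
    unfolding rconst_def h by (simp add: mconst_def)
  show "fract_map (Poly_Mapping.map \<sigma>) (rvar i) = rvar i"
    unfolding rvar_def h by (simp add: mvar_def)
qed

lemma rat_fun_hom_agree:
  assumes "inj_idom_hom (\<phi> :: 'a::idom rat_fun \<Rightarrow> 'b::field)" "inj_idom_hom \<psi>"
    and "\<And>c. \<phi> (rconst c) = \<psi> (rconst c)" "\<And>i. \<phi> (rvar i) = \<psi> (rvar i)"
  shows "\<phi> f = \<psi> f"
  by (rule field_gen_hom_agree[OF assms(1,2), of "range rconst \<union> range rvar"])
    (use assms(3,4) field_gen_rat_fun_UNIV in auto)

locale so_representation =
  fixes q :: "'k::field_char_0 vec \<Rightarrow> 'k"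
    and n m :: nat
    and \<rho> :: "'k alg_closure mat \<Rightarrow> 'k alg_closure mat"
  assumes n2: "n \<ge> 2"
    and quadratic: "quadratic_form n q" and nondeg: "nondegenerate n q"
    and rep: "linear_rep n (special_orthogonal n q) m \<rho>"
    and free: "almost_free n (special_orthogonal n q) m \<rho>"
begin

abbreviation G :: "'k alg_closure mat set"
  where "G \<equiv> special_orthogonal n q"

definition B :: "'k alg_closure mat"
  where "B = map_mat to_ac (gram_mat n q)"

lemma B: "B \<in> carrier_mat n n" "transpose_mat B = B" "det B \<noteq> 0"
proof -
  interpret inj_idom_hom "to_ac :: 'k \<Rightarrow> 'k alg_closure" by (rule inj_idom_hom_to_ac)
  show "B \<in> carrier_mat n n" "transpose_mat B = B"
    by (auto intro!: eq_matI simp: B_def gram_mat_def polar_sym[of _ n])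
  show "det B \<noteq> 0"
    using gram_mat_det[OF quadratic nondeg] by (simp add: B_def)
qed

lemma G_iff: "g \<in> G \<longleftrightarrow> g \<in> carrier_mat n n \<and> det g = 1 \<and> transpose_mat g * B * g = B"
  unfolding B_def by (rule special_orthogonal_iff[OF quadratic])

lemma G_carrier: "g \<in> G \<Longrightarrow> g \<in> carrier_mat n n" and G_det: "g \<in> G \<Longrightarrow> det g = 1"
  and G_form: "g \<in> G \<Longrightarrow> transpose_mat g * B * g = B"
  by (simp_all add: G_iff)

lemma G_one: "1\<^sub>m n \<in> G"
  using B by (simp add: G_iff)

lemma G_mult: "g \<in> G \<Longrightarrow> h \<in> G \<Longrightarrow> g * h \<in> G"
  using conj_mult[OF B(1), of g h] det_mult[of g n h] by (auto simp: G_iff)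

lemma G_inverse:
  assumes g: "g \<in> G"
  obtains h where "h \<in> G" "g * h = 1\<^sub>m n" "h * g = 1\<^sub>m n"
proof -
  obtain h where h: "h \<in> carrier_mat n n" "g * h = 1\<^sub>m n" "h * g = 1\<^sub>m n" "det g * det h = 1"
    using inverse_mat_exists[OF G_carrier[OF g]] G_det[OF g] by (metis one_neq_zero)
  have "transpose_mat h * B * h = transpose_mat (g * h) * B * (g * h)"
    using conj_mult[OF B(1) G_carrier[OF g] h(1)] G_form[OF g] by simp
  then have "h \<in> G" using h B G_det[OF g] by (auto simp: G_iff)
  with h that show ?thesis by blast
qed

lemma galois_hom: "\<sigma> \<in> galois_group \<Longrightarrow> inj_idom_hom \<sigma>" "\<sigma> \<in> galois_group \<Longrightarrow> \<sigma> (to_ac c) = to_ac (c :: 'k)"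
proof -
  assume "\<sigma> \<in> galois_group"
  then interpret field_isom \<sigma> by (simp add: galois_group_def)
  show "inj_idom_hom \<sigma>" by unfold_locales
qed (simp add: galois_group_def)

lemma galois_id: "(id :: 'k alg_closure \<Rightarrow> 'k alg_closure) \<in> galois_group"
proof -
  have "field_isom (id :: 'k alg_closure \<Rightarrow> _)" by unfold_locales auto
  then show ?thesis by (simp add: galois_group_def)
qed

lemma galois_comp:
  fixes \<sigma> \<tau> :: "'k alg_closure \<Rightarrow> 'k alg_closure"
  assumes "\<sigma> \<in> galois_group" "\<tau> \<in> galois_group" shows "\<sigma> \<circ> \<tau> \<in> galois_group"
proof -
  interpret s: field_isom \<sigma> using assms by (simp add: galois_group_def)
  interpret t: field_isom \<tau> using assms by (simp add: galois_group_def)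
  have "surj (\<sigma> \<circ> \<tau>)" using s.surj t.surj by (rule comp_surj[rotated])
  then have "field_isom (\<sigma> \<circ> \<tau>)"
    by unfold_locales (auto simp: s.hom_add t.hom_add s.hom_mult t.hom_mult)
  then show ?thesis using assms by (simp add: galois_group_def)
qed

lemma galois_map_B: "\<sigma> \<in> galois_group \<Longrightarrow> map_mat \<sigma> B = B"
  by (intro eq_matI) (auto simp: B_def gram_mat_def galois_hom(2))

lemma galois_G:
  assumes \<sigma>: "\<sigma> \<in> galois_group" and g: "g \<in> G"
  shows "map_mat \<sigma> g \<in> G"
proof -
  interpret inj_idom_hom \<sigma> by (rule galois_hom(1)[OF \<sigma>])
  note c = G_carrier[OF g]
  have "map_mat \<sigma> (transpose_mat g * B * g) = map_mat \<sigma> (transpose_mat g * B) * map_mat \<sigma> g"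
    using c B(1) by (intro mat_hom_mult[of _ n n _ n]) auto
  also have "map_mat \<sigma> (transpose_mat g * B) = map_mat \<sigma> (transpose_mat g) * map_mat \<sigma> B"
    using c B(1) by (intro mat_hom_mult[of _ n n _ n]) auto
  also have "map_mat \<sigma> (transpose_mat g) = transpose_mat (map_mat \<sigma> g)"
    by (intro eq_matI) auto
  finally show ?thesis
    using c G_det[OF g] by (simp add: G_iff G_form[OF g] galois_map_B[OF \<sigma>])
qed

lemma \<rho>_carrier: "g \<in> G \<Longrightarrow> \<rho> g \<in> carrier_mat m m" and \<rho>_one: "\<rho> (1\<^sub>m n) = 1\<^sub>m m"
  and \<rho>_mult: "g \<in> G \<Longrightarrow> h \<in> G \<Longrightarrow> \<rho> (g * h) = \<rho> g * \<rho> h"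
  using rep by (simp_all add: linear_rep_def)

lemma \<rho>_inverse: "h \<in> G \<Longrightarrow> g \<in> G \<Longrightarrow> g * h = 1\<^sub>m n \<Longrightarrow> \<rho> g * \<rho> h = 1\<^sub>m m"
  using \<rho>_mult[of g h] \<rho>_one by simp

definition entry :: "nat \<Rightarrow> nat \<Rightarrow> (nat \<times> nat, 'k) mpoly"
  where "entry i j = (SOME p. mvars p \<subseteq> {..<n} \<times> {..<n} \<and>
    (\<forall>g\<in>G. \<rho> g $$ (i, j) = meval to_ac (\<lambda>ij. g $$ ij) p))"

lemma entry:
  assumes "i < m" "j < m"
  shows "mvars (entry i j) \<subseteq> {..<n} \<times> {..<n}"
    "g \<in> G \<Longrightarrow> \<rho> g $$ (i, j) = meval to_ac (\<lambda>ij. g $$ ij) (entry i j)"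
proof -
  have "\<exists>p. mvars p \<subseteq> {..<n} \<times> {..<n} \<and> (\<forall>g\<in>G. \<rho> g $$ (i, j) = meval to_ac (\<lambda>ij. g $$ ij) p)"
    using rep assms G_det unfolding linear_rep_def regular_over_def by fastforce
  then have "mvars (entry i j) \<subseteq> {..<n} \<times> {..<n} \<and>
      (\<forall>g\<in>G. \<rho> g $$ (i, j) = meval to_ac (\<lambda>ij. g $$ ij) (entry i j))"
    unfolding entry_def by (rule someI_ex)
  then show "mvars (entry i j) \<subseteq> {..<n} \<times> {..<n}"
    "g \<in> G \<Longrightarrow> \<rho> g $$ (i, j) = meval to_ac (\<lambda>ij. g $$ ij) (entry i j)"
    by blast+
qed

lemma galois_\<rho>:
  assumes \<sigma>: "\<sigma> \<in> galois_group" and g: "g \<in> G"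
  shows "\<rho> (map_mat \<sigma> g) = map_mat \<sigma> (\<rho> g)"
proof (rule eq_matI)
  interpret inj_idom_hom \<sigma> by (rule galois_hom(1)[OF \<sigma>])
  fix i j assume "i < dim_row (map_mat \<sigma> (\<rho> g))" "j < dim_col (map_mat \<sigma> (\<rho> g))"
  then have ij: "i < m" "j < m" using \<rho>_carrier[OF g] by auto
  have "\<sigma> (\<rho> g $$ (i, j)) = meval (\<sigma> \<circ> to_ac) (\<sigma> \<circ> (\<lambda>ij. g $$ ij)) (entry i j)"
    by (simp add: entry(2)[OF ij g] hom_meval)
  also have "\<dots> = meval to_ac (\<lambda>ij. map_mat \<sigma> g $$ ij) (entry i j)"
    using entry(1)[OF ij] G_carrier[OF g] by (intro meval_cong) (auto simp: galois_hom(2)[OF \<sigma>])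
  also have "\<dots> = \<rho> (map_mat \<sigma> g) $$ (i, j)"
    by (rule entry(2)[OF ij galois_G[OF \<sigma> g], symmetric])
  finally show "\<rho> (map_mat \<sigma> g) $$ (i, j) = map_mat \<sigma> (\<rho> g) $$ (i, j)"
    using ij \<rho>_carrier[OF g] by simp
qed (use \<rho>_carrier[OF g] \<rho>_carrier[OF galois_G[OF \<sigma> g]] in auto)

text \<open>
  The points of \<open>G\<close> over the algebraic closure and the Galois group, combined into one group. A
  pair acts on functions by the automorphism on coefficients, followed by the substitution. As
  substitutions compose in the opposite order, the matrices of a product are multiplied in
  reverse.
\<close>

definition J :: "('k alg_closure mat \<times> ('k alg_closure \<Rightarrow> 'k alg_closure)) set"
  where "J = G \<times> galois_group"

definition times_J :: "'k alg_closure mat \<times> ('k alg_closure \<Rightarrow> 'k alg_closure) \<Rightarrow> _ \<Rightarrow> _"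
  where "times_J = (\<lambda>(g, \<sigma>) (h, \<tau>). (map_mat \<sigma> h * g, \<sigma> \<circ> \<tau>))"

lemma times_J: "i \<in> J \<Longrightarrow> j \<in> J \<Longrightarrow> times_J i j \<in> J"
  by (auto simp: J_def times_J_def intro!: G_mult galois_G galois_comp)

definition actV :: "'k alg_closure mat \<times> ('k alg_closure \<Rightarrow> 'k alg_closure) \<Rightarrow> 'k alg_closure rat_fun \<Rightarrow> 'k alg_closure rat_fun"
  where "actV = (\<lambda>(g, \<sigma>). fract_map (lin_subst m (\<rho> g)) \<circ> fract_map (Poly_Mapping.map \<sigma>))"

lemma actV:
  assumes "(g, \<sigma>) \<in> J"
  shows "inj_idom_hom (actV (g, \<sigma>))" "actV (g, \<sigma>) (rconst c) = rconst (\<sigma> c)"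
    "i < m \<Longrightarrow> actV (g, \<sigma>) (rvar i) = (\<Sum>j<m. rconst (\<rho> g $$ (i, j)) * rvar j)"
    "\<not> i < m \<Longrightarrow> actV (g, \<sigma>) (rvar i) = rvar i"
proof -
  have g: "g \<in> G" and \<sigma>: "\<sigma> \<in> galois_group" using assms by (auto simp: J_def)
  obtain h where h: "h \<in> G" "g * h = 1\<^sub>m n" using G_inverse[OF g] by metis
  note l = fract_lin_subst[OF \<rho>_carrier[OF g] \<rho>_carrier[OF h(1)] \<rho>_inverse[OF h(1) g h(2)]]
  note c = fract_map_coeffs[OF galois_hom(1)[OF \<sigma>]]
  show "inj_idom_hom (actV (g, \<sigma>))"
    unfolding actV_def by (simp add: inj_idom_hom_comp l c)
  show "actV (g, \<sigma>) (rconst c) = rconst (\<sigma> c)"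
    "i < m \<Longrightarrow> actV (g, \<sigma>) (rvar i) = (\<Sum>j<m. rconst (\<rho> g $$ (i, j)) * rvar j)"
    "\<not> i < m \<Longrightarrow> actV (g, \<sigma>) (rvar i) = rvar i"
    by (simp_all add: actV_def l c)
qed

lemma actV_times:
  assumes i: "i \<in> J" and j: "j \<in> J"
  shows "actV (times_J i j) f = actV i (actV j f)"
proof -
  obtain g \<sigma> h \<tau> where ij: "i = (g, \<sigma>)" "j = (h, \<tau>)" by (metis surj_pair)
  have g: "g \<in> G" and \<sigma>: "\<sigma> \<in> galois_group" and h: "h \<in> G" and \<tau>: "\<tau> \<in> galois_group"
    using i j by (auto simp: J_def ij)
  interpret i: inj_idom_hom "actV (g, \<sigma>)" by (rule actV(1)) (use i ij in simp)
  interpret c: inj_idom_hom "rconst :: _ \<Rightarrow> 'k alg_closure rat_fun" by (rule inj_idom_hom_rconst)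
  interpret \<sigma>: inj_idom_hom \<sigma> by (rule galois_hom(1)[OF \<sigma>])
  note I = i[unfolded ij] and H = j[unfolded ij]
  have T: "(map_mat \<sigma> h * g, \<sigma> \<circ> \<tau>) \<in> J" using times_J[OF i j] by (simp add: times_J_def ij)
  have "actV (times_J i j) f = (actV i \<circ> actV j) f"
  proof (rule rat_fun_hom_agree[of "actV (times_J i j)" "actV i \<circ> actV j"])
    show "inj_idom_hom (actV (times_J i j))" using actV(1)[OF T] by (simp add: times_J_def ij)
    show "inj_idom_hom (actV i \<circ> actV j)" using actV(1)[OF I] actV(1)[OF H] by (simp add: ij inj_idom_hom_comp)
    show "actV (times_J i j) (rconst c) = (actV i \<circ> actV j) (rconst c)" for c
      by (simp add: times_J_def ij actV(2)[OF T] actV(2)[OF I] actV(2)[OF H])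
    show "actV (times_J i j) (rvar a) = (actV i \<circ> actV j) (rvar a)" for a
    proof (cases "a < m")
      case True
      have "(actV i \<circ> actV j) (rvar a) = (\<Sum>b<m. \<Sum>c<m. rconst (\<sigma> (\<rho> h $$ (a, b)) * \<rho> g $$ (b, c)) * rvar c)"
        using True by (simp add: ij actV(3)[OF H] i.hom_sum i.hom_mult actV(2)[OF I] actV(3)[OF I] sum_distrib_left c.hom_mult mult.assoc)
      also have "\<dots> = (\<Sum>c<m. \<Sum>b<m. rconst (\<sigma> (\<rho> h $$ (a, b)) * \<rho> g $$ (b, c)) * rvar c)"
        by (rule sum.swap)
      also have "\<dots> = (\<Sum>c<m. rconst ((map_mat \<sigma> (\<rho> h) * \<rho> g) $$ (a, c)) * rvar c)"
        using True \<rho>_carrier[OF h] \<rho>_carrier[OF g]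
        by (intro sum.cong refl) (subst mult_index[of _ m]; simp add: c.hom_sum sum_distrib_right)
      also have "map_mat \<sigma> (\<rho> h) * \<rho> g = \<rho> (map_mat \<sigma> h * g)"
        using \<rho>_mult[OF galois_G[OF \<sigma> h] g] galois_\<rho>[OF \<sigma> h] by simp
      finally show ?thesis using True by (simp add: times_J_def ij actV(3)[OF T])
    qed (simp add: times_J_def ij actV(4)[OF T] actV(4)[OF I] actV(4)[OF H])
  qed
  then show ?thesis by simp
qed

definition K :: "'k alg_closure rat_fun set"
  where "K = invariant_field G m \<rho>"

text \<open>
  The two conditions in the definition of the invariant field are those for the pairs with one
  trivial component, and the action of a pair is composed of the actions of two such pairs.
\<close>

lemma K_iff: "f \<in> K \<longleftrightarrow> f \<in> rat_funs m \<and> (\<forall>j\<in>J. actV j f = f)"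
proof -
  have id1: "fract_map (lin_subst m (\<rho> (1\<^sub>m n))) f = f" for f
  proof -
    note l = fract_lin_subst[of "1\<^sub>m m :: 'k alg_closure mat" m "1\<^sub>m m", simplified]
    have "fract_map (lin_subst m (1\<^sub>m m)) f = id f"
    proof (rule rat_fun_hom_agree[where \<psi> = id])
      show "inj_idom_hom (id :: 'k alg_closure rat_fun \<Rightarrow> _)" by unfold_locales auto
      show "fract_map (lin_subst m (1\<^sub>m m)) (rvar i) = id (rvar i :: 'k alg_closure rat_fun)" for i
      proof (cases "i < m")
        case True
        have "(\<Sum>j<m. rconst (1\<^sub>m m $$ (i, j)) * rvar j) = (\<Sum>j<m. rvar j * unitf i j :: 'k alg_closure rat_fun)"
        proof (intro sum.cong refl)
          interpret c: inj_idom_hom "rconst :: _ \<Rightarrow> 'k alg_closure rat_fun" by (rule inj_idom_hom_rconst)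
          fix j assume "j \<in> {..<m}"
          then show "rconst (1\<^sub>m m $$ (i, j)) * rvar j = (rvar j * unitf i j :: 'k alg_closure rat_fun)"
            using True by (simp add: unitf_def)
        qed
        then show ?thesis using True l(3)[of i] sum_unitf[OF True, of rvar] by simp
      qed (simp add: l)
    qed (simp_all add: l)
    then show ?thesis by (simp add: \<rho>_one)
  qed
  have id2: "fract_map (Poly_Mapping.map id) f = (f :: 'k alg_closure rat_fun)" for f
  proof -
    note c = fract_map_coeffs[OF galois_hom(1)[OF galois_id]]
    have "fract_map (Poly_Mapping.map id) f = id f"
    proof (rule rat_fun_hom_agree[where \<psi> = id])
      show "inj_idom_hom (id :: 'k alg_closure rat_fun \<Rightarrow> _)" by unfold_locales auto
      show "inj_idom_hom (fract_map (Poly_Mapping.map id) :: 'k alg_closure rat_fun \<Rightarrow> _)"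
        by (rule c(1))
      show "fract_map (Poly_Mapping.map id) (rconst c) = id (rconst c :: 'k alg_closure rat_fun)" for c
        using c(2)[of c] unfolding id_def .
      show "fract_map (Poly_Mapping.map id) (rvar i) = id (rvar i :: 'k alg_closure rat_fun)" for i
        using c(3)[of i] unfolding id_def .
    qed
    then show ?thesis by simp
  qed
  show ?thesis
  proof
    assume "f \<in> K"
    then show "f \<in> rat_funs m \<and> (\<forall>j\<in>J. actV j f = f)"
      by (auto simp: K_def invariant_field_def geom_invariant_field_def J_def actV_def)
  next
    assume f: "f \<in> rat_funs m \<and> (\<forall>j\<in>J. actV j f = f)"
    have "fract_map (lin_subst m (\<rho> g)) f = f" if "g \<in> G" for g
    proof -
      have "actV (g, id) f = f" using f that galois_id by (auto simp: J_def)
      then show ?thesis by (simp add: actV_def id2)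
    qed
    moreover have "fract_map (Poly_Mapping.map \<sigma>) f = f" if "\<sigma> \<in> galois_group" for \<sigma>
    proof -
      have "actV (1\<^sub>m n, \<sigma>) f = f" using f that G_one by (auto simp: J_def)
      then show ?thesis by (simp add: actV_def id1)
    qed
    ultimately show "f \<in> K"
      using f by (auto simp: K_def invariant_field_def geom_invariant_field_def)
  qed
qed

text \<open>
  Rational functions on \<open>V\<close> and on the space of matrices together are rational functions whose
  coefficients are rational functions on \<open>V\<close>. The coordinates \<open>x\<close> of \<open>V\<close> are constants of the outer
  field. The matrix entry \<open>(i, j)\<close> is the variable with the number \<open>j * n + i\<close>, so that the
  entries of a column are consecutive.
\<close>

definition xvar :: "nat \<Rightarrow> 'k alg_closure rat_fun rat_fun"
  where "xvar i = rconst (rvar i)"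

definition mvx :: "nat \<Rightarrow> nat \<Rightarrow> 'k alg_closure rat_fun rat_fun"
  where "mvx i j = rvar (j * n + i)"

definition cE :: "'k alg_closure \<Rightarrow> 'k alg_closure rat_fun rat_fun"
  where "cE c = rconst (rconst c)"

lemma inj_idom_hom_cE: "inj_idom_hom cE"
  using inj_idom_hom_comp[OF inj_idom_hom_rconst inj_idom_hom_rconst] unfolding cE_def[abs_def] comp_def .

text \<open>
  Left multiplication of the generic matrix by \<open>\<Gamma>\<close>. The variables that are not matrix entries are fixed,
  so that the substitution is injective on the whole field.
\<close>

definition matrix_subst :: "'k alg_closure rat_fun mat \<Rightarrow> nat \<Rightarrow> (nat, 'k alg_closure rat_fun) mpoly"
  where "matrix_subst \<Gamma> k = (if k < n * n
    then \<Sum>l<n. mconst (\<Gamma> $$ (k mod n, l)) * mvar ((k div n) * n + l) else mvar k)"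

definition matrix_hom :: "('k alg_closure rat_fun \<Rightarrow> 'k alg_closure rat_fun) \<Rightarrow> 'k alg_closure rat_fun mat \<Rightarrow>
    'k alg_closure rat_fun rat_fun \<Rightarrow> 'k alg_closure rat_fun rat_fun"
  where "matrix_hom \<tau> \<Gamma> = fract_map (meval (mconst \<circ> \<tau>) (matrix_subst \<Gamma>))"

definition actE :: "'k alg_closure mat \<times> ('k alg_closure \<Rightarrow> 'k alg_closure) \<Rightarrow>
    'k alg_closure rat_fun rat_fun \<Rightarrow> 'k alg_closure rat_fun rat_fun"
  where "actE j = matrix_hom (actV j) (map_mat rconst (fst j))"

lemma mvx_bound:
  assumes "b < n" "l < n" shows "b * n + l < n * n"
proof -
  have "b * n + l < (b + 1) * n" using assms by simp
  also have "\<dots> \<le> n * n" using assms by (intro mult_le_mono1) simp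
  finally show ?thesis .
qed

lemma index_bound: "k < n * n \<Longrightarrow> l < n \<Longrightarrow> (k div n) * n + l < n * n"
  by (intro mvx_bound less_mult_imp_div_less)

lemma inj_matrix_subst:
  assumes \<tau>: "inj_idom_hom \<tau>"
    and \<Gamma>: "\<Gamma> \<in> carrier_mat n n" "\<Gamma>' \<in> carrier_mat n n" "\<Gamma> * \<Gamma>' = 1\<^sub>m n"
  shows "inj_idom_hom (meval (mconst \<circ> \<tau>) (matrix_subst \<Gamma>))"
proof -
  interpret c: inj_idom_hom "mconst :: 'k alg_closure rat_fun \<Rightarrow> (nat, _) mpoly" by (rule inj_idom_hom_mconst)
  interpret s: comm_ring_hom "meval mconst (matrix_subst \<Gamma>') :: (nat, 'k alg_closure rat_fun) mpoly \<Rightarrow> _"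
    by (rule c.comm_ring_hom_meval)
  show ?thesis
  proof (rule inj_idom_hom_subst[OF \<tau>, where l' = "matrix_subst \<Gamma>'"])
    fix k
    show "meval mconst (matrix_subst \<Gamma>') (matrix_subst \<Gamma> k) = mvar k"
    proof (cases "k < n * n")
      case True
      have n0: "n > 0" using n2 by simp
      let ?a = "k mod n" and ?b = "k div n"
      have a: "?a < n" using n0 by simp
      have 1: "matrix_subst \<Gamma>' (?b * n + l) = (\<Sum>l'<n. mconst (\<Gamma>' $$ (l, l')) * mvar (?b * n + l'))"
        if "l < n" for l
        using index_bound[OF True that] that by (simp add: matrix_subst_def)
      have "meval mconst (matrix_subst \<Gamma>') (matrix_subst \<Gamma> k) =
          (\<Sum>l<n. mconst (\<Gamma> $$ (?a, l)) * matrix_subst \<Gamma>' (?b * n + l))"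
        using True by (simp add: matrix_subst_def[of \<Gamma>] s.hom_sum s.hom_mult)
      also have "\<dots> = (\<Sum>l<n. \<Sum>l'<n. mconst (\<Gamma> $$ (?a, l) * \<Gamma>' $$ (l, l')) * mvar (?b * n + l'))"
        by (intro sum.cong refl) (simp add: 1 sum_distrib_left c.hom_mult mult.assoc)
      also have "\<dots> = (\<Sum>l'<n. \<Sum>l<n. mconst (\<Gamma> $$ (?a, l) * \<Gamma>' $$ (l, l')) * mvar (?b * n + l'))"
        by (rule sum.swap)
      also have "\<dots> = (\<Sum>l'<n. mconst ((\<Gamma> * \<Gamma>') $$ (?a, l')) * mvar (?b * n + l'))"
        using a by (intro sum.cong refl) (simp add: mult_index[OF \<Gamma>(1,2)] c.hom_sum sum_distrib_right)
      also have "\<dots> = (\<Sum>l'<n. mvar (?b * n + l') * unitf ?a l')"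
        using a \<Gamma>(3) by (intro sum.cong refl) (auto simp: unitf_def)
      also have "\<dots> = mvar (?b * n + ?a)" by (rule sum_unitf[OF a])
      finally show ?thesis by simp
    qed (simp add: matrix_subst_def)
  qed
qed

lemma matrix_hom:
  assumes \<tau>: "inj_idom_hom \<tau>"
    and \<Gamma>: "\<Gamma> \<in> carrier_mat n n" "\<Gamma>' \<in> carrier_mat n n" "\<Gamma> * \<Gamma>' = 1\<^sub>m n"
  shows "inj_idom_hom (matrix_hom \<tau> \<Gamma>)" "matrix_hom \<tau> \<Gamma> (rconst f) = rconst (\<tau> f)"
    "i < n \<Longrightarrow> j < n \<Longrightarrow> matrix_hom \<tau> \<Gamma> (mvx i j) = (\<Sum>l<n. rconst (\<Gamma> $$ (i, l)) * mvx l j)"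
    "\<not> k < n * n \<Longrightarrow> matrix_hom \<tau> \<Gamma> (rvar k) = rvar k"
proof -
  note inj = inj_matrix_subst[OF assms]
  interpret c: inj_idom_hom "mconst :: 'k alg_closure rat_fun \<Rightarrow> (nat, _) mpoly" by (rule inj_idom_hom_mconst)
  interpret t: inj_idom_hom "to_fract :: _ \<Rightarrow> 'k alg_closure rat_fun rat_fun" by (rule inj_idom_hom_to_fract)
  interpret a: inj_idom_hom \<tau> by (rule \<tau>)
  interpret ca: comm_ring_hom "mconst \<circ> \<tau> :: _ \<Rightarrow> (nat, _) mpoly"
    by unfold_locales (simp_all add: c.hom_add c.hom_mult a.hom_add a.hom_mult)
  note h = fract_map_hom(2)[OF inj]
  show "inj_idom_hom (matrix_hom \<tau> \<Gamma>)" unfolding matrix_hom_def by (rule fract_map_hom(1)[OF inj])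
  show "matrix_hom \<tau> \<Gamma> (rconst f) = rconst (\<tau> f)"
    unfolding rconst_def matrix_hom_def using h by simp
  have var: "matrix_hom \<tau> \<Gamma> (rvar k) = to_fract (matrix_subst \<Gamma> k)" for k
    unfolding rvar_def matrix_hom_def using h by simp
  show "matrix_hom \<tau> \<Gamma> (rvar k) = rvar k" if "\<not> k < n * n"
    unfolding var using that by (simp add: matrix_subst_def rvar_def)
  show "matrix_hom \<tau> \<Gamma> (mvx i j) = (\<Sum>l<n. rconst (\<Gamma> $$ (i, l)) * mvx l j)" if "i < n" "j < n"
  proof -
    have "j * n + i < n * n" using that by (intro mvx_bound)
    then have "matrix_hom \<tau> \<Gamma> (mvx i j) = to_fract (\<Sum>l<n. mconst (\<Gamma> $$ (i, l)) * mvar (j * n + l))"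
      using that by (simp add: mvx_def var matrix_subst_def)
    then show ?thesis
      by (simp add: mvx_def t.hom_sum rvar_def) (simp add: rconst_def)
  qed
qed

lemma actE:
  assumes "(g, \<sigma>) \<in> J"
  shows "inj_idom_hom (actE (g, \<sigma>))" "actE (g, \<sigma>) (rconst f) = rconst (actV (g, \<sigma>) f)"
    "i < n \<Longrightarrow> j < n \<Longrightarrow> actE (g, \<sigma>) (mvx i j) = (\<Sum>l<n. cE (g $$ (i, l)) * mvx l j)"
    "\<not> k < n * n \<Longrightarrow> actE (g, \<sigma>) (rvar k) = rvar k"
    "actE (g, \<sigma>) (cE c) = cE (\<sigma> c)"
    "i < m \<Longrightarrow> actE (g, \<sigma>) (xvar i) = (\<Sum>j<m. cE (\<rho> g $$ (i, j)) * xvar j)"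
proof -
  interpret r': inj_idom_hom "rconst :: 'k alg_closure \<Rightarrow> _" by (rule inj_idom_hom_rconst)
  interpret r: inj_idom_hom "rconst :: 'k alg_closure rat_fun \<Rightarrow> _" by (rule inj_idom_hom_rconst)
  have g: "g \<in> G" using assms by (simp add: J_def)
  obtain h where h: "h \<in> G" "g * h = 1\<^sub>m n" using G_inverse[OF g] by metis
  note gc = G_carrier[OF g] and hc = G_carrier[OF h(1)]
  have "map_mat rconst g * map_mat rconst h = (1\<^sub>m n :: 'k alg_closure rat_fun mat)"
    using r'.mat_hom_mult[OF gc hc] h(2) r'.mat_hom_one by simp
  with gc hc have \<Gamma>: "map_mat rconst g \<in> carrier_mat n n" "map_mat rconst h \<in> carrier_mat n n"
    "map_mat rconst g * map_mat rconst h = (1\<^sub>m n :: 'k alg_closure rat_fun mat)" by auto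
  note M = matrix_hom[OF actV(1)[OF assms] \<Gamma>]
  show "inj_idom_hom (actE (g, \<sigma>))" using M(1) by (simp add: actE_def)
  show const: "actE (g, \<sigma>) (rconst f) = rconst (actV (g, \<sigma>) f)" for f
    using M(2) by (simp add: actE_def)
  show "\<not> k < n * n \<Longrightarrow> actE (g, \<sigma>) (rvar k) = rvar k" using M(4) by (simp add: actE_def)
  show "actE (g, \<sigma>) (mvx i j) = (\<Sum>l<n. cE (g $$ (i, l)) * mvx l j)" if "i < n" "j < n"
    using M(3)[OF that] that gc by (simp add: actE_def cE_def)
  show "actE (g, \<sigma>) (cE c) = cE (\<sigma> c)" by (simp add: cE_def const actV(2)[OF assms])
  show "actE (g, \<sigma>) (xvar i) = (\<Sum>j<m. cE (\<rho> g $$ (i, j)) * xvar j)" if "i < m"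
    using that by (simp add: xvar_def cE_def const actV(3)[OF assms] r.hom_sum r.hom_mult)
qed

lemma rvar_mvx: "k < n * n \<Longrightarrow> rvar k = mvx (k mod n) (k div n)"
  by (simp add: mvx_def)

lemma div_mod_bound: "k < n * n \<Longrightarrow> k mod n < n" "k < n * n \<Longrightarrow> k div n < n"
  using n2 by (simp_all add: less_mult_imp_div_less)

lemma actE_times:
  assumes i: "i \<in> J" and j: "j \<in> J"
  shows "actE (times_J i j) f = actE i (actE j f)"
proof -
  obtain g \<sigma> h \<tau> where ij: "i = (g, \<sigma>)" "j = (h, \<tau>)" by (metis surj_pair)
  have g: "g \<in> G" and \<sigma>: "\<sigma> \<in> galois_group" and h: "h \<in> G" and \<tau>: "\<tau> \<in> galois_group"
    using i j by (auto simp: J_def ij)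
  note I = i[unfolded ij] and H = j[unfolded ij]
  interpret i: inj_idom_hom "actE (g, \<sigma>)" by (rule actE(1)[OF I])
  interpret c: inj_idom_hom cE by (rule inj_idom_hom_cE)
  have T: "(map_mat \<sigma> h * g, \<sigma> \<circ> \<tau>) \<in> J" using times_J[OF i j] by (simp add: times_J_def ij)
  have "actE (times_J i j) f = (actE i \<circ> actE j) f"
  proof (rule rat_fun_hom_agree[of "actE (times_J i j)" "actE i \<circ> actE j"])
    show "inj_idom_hom (actE (times_J i j))" using actE(1)[OF T] by (simp add: times_J_def ij)
    show "inj_idom_hom (actE i \<circ> actE j)" using actE(1)[OF I] actE(1)[OF H] by (simp add: ij inj_idom_hom_comp)
    show "actE (times_J i j) (rconst c) = (actE i \<circ> actE j) (rconst c)" for c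
      using actV_times[OF i j, of c] by (simp add: times_J_def ij actE(2)[OF T] actE(2)[OF I] actE(2)[OF H])
    show "actE (times_J i j) (rvar k) = (actE i \<circ> actE j) (rvar k)" for k
    proof (cases "k < n * n")
      case True
      note b = div_mod_bound[OF True]
      let ?a = "k mod n" and ?b = "k div n"
      have "(actE i \<circ> actE j) (rvar k) = (\<Sum>l<n. \<Sum>c<n. cE (\<sigma> (h $$ (?a, l)) * g $$ (l, c)) * mvx c ?b)"
        using b by (simp add: ij rvar_mvx[OF True] actE(3)[OF H] i.hom_sum i.hom_mult actE(5)[OF I] actE(3)[OF I]
            sum_distrib_left c.hom_mult mult.assoc)
      also have "\<dots> = (\<Sum>c<n. \<Sum>l<n. cE (\<sigma> (h $$ (?a, l)) * g $$ (l, c)) * mvx c ?b)"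
        by (rule sum.swap)
      also have "\<dots> = (\<Sum>c<n. cE ((map_mat \<sigma> h * g) $$ (?a, c)) * mvx c ?b)"
        using b G_carrier[OF h] G_carrier[OF g]
        by (intro sum.cong refl) (subst mult_index[of _ n]; simp add: c.hom_sum sum_distrib_right)
      finally show ?thesis using b by (simp add: times_J_def ij rvar_mvx[OF True] actE(3)[OF T])
    qed (simp add: times_J_def ij actE(4)[OF T] actE(4)[OF I] actE(4)[OF H])
  qed
  then show ?thesis by simp
qed

lemma one_J: "(1\<^sub>m n, id) \<in> J"
  by (simp add: J_def G_one galois_id)

end

lemma hom_on_preimage:
  assumes R: "is_subring R" "hom_on R \<phi>" and R': "is_subring R'"
  shows "is_subring {w \<in> R. \<phi> w \<in> R'}"
    and "hom_on R' \<phi>' \<Longrightarrow> hom_on {w \<in> R. \<phi> w \<in> R'} (\<lambda>w. \<phi>' (\<phi> w))"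
  using hom_on_one[OF R] hom_on_diff[OF R] hom_on_mult[OF R] subring_one[OF R(1)] subring_diff[OF R(1)]
    subring_mult[OF R(1)] subring_one[OF R'] subring_diff[OF R'] subring_mult[OF R']
    hom_on_one[OF R'] hom_on_diff[OF R'] hom_on_mult[OF R']
  unfolding is_subring_def hom_on_def by auto

section \<open>Covariants of the representation\<close>

context so_representation
begin

definition BE :: "'k alg_closure rat_fun rat_fun mat"
  where "BE = map_mat cE B"

text \<open>
  A generic element of the group is the product of \<open>2 n\<close> reflections along generic vectors. This
  parametrization is rational, although \<open>G\<close> is only given by equations. The variables of the outer
  field, which are the matrix entries elsewhere, serve as the coordinates of these vectors. Then
  \<open>yvar\<close> are the coordinates of the image of the generic point \<open>x\<close> of \<open>V\<close> under the generic element.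
\<close>

definition gvec :: "nat \<Rightarrow> nat \<Rightarrow> 'k alg_closure rat_fun rat_fun"
  where "gvec a i = rvar (a * n + i)"

definition gen :: "'k alg_closure rat_fun rat_fun mat"
  where "gen = refl_prod n BE (map gvec [0..<2 * n])"

definition \<rho>gen :: "nat \<Rightarrow> nat \<Rightarrow> 'k alg_closure rat_fun rat_fun"
  where "\<rho>gen i j = meval (cE \<circ> to_ac) (\<lambda>ij. gen $$ ij) (entry i j)"

definition yvar :: "nat \<Rightarrow> 'k alg_closure rat_fun rat_fun"
  where "yvar i = (\<Sum>j<m. \<rho>gen i j * xvar j)"

lemma two_neq_zero_A: "(2 :: 'k alg_closure) \<noteq> 0" by simp

lemma nonisotropic_vector: "\<exists>w. bil n B w w \<noteq> 0"
  using orthonormal_basis[OF B] n2 by (metis less_le_trans one_neq_zero pos2)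

lemma BE_carrier: "BE \<in> carrier_mat n n"
  using B by (simp add: BE_def)

text \<open>
  The target is a general field with a map \<open>\<iota>\<close> from the algebraic closure, since the values are
  taken both in the algebraic closure and in the rational functions on \<open>V\<close>.
\<close>

lemma gen_hom_on:
  fixes \<psi> :: "'k alg_closure rat_fun rat_fun \<Rightarrow> 'f::field" and \<iota> :: "'k alg_closure \<Rightarrow> 'f"
  assumes R: "is_subring R" "hom_on R \<psi>" and \<iota>: "inj_idom_hom \<iota>"
    and c: "\<And>c. cE c \<in> R \<and> \<psi> (cE c) = \<iota> c"
    and v: "\<And>a i. a < 2 * n \<Longrightarrow> i < n \<Longrightarrow> gvec a i \<in> R \<and> \<psi> (gvec a i) = \<iota> (us a i)"
    and inv: "\<And>a. a < 2 * n \<Longrightarrow> bil n BE (gvec a) (gvec a) \<noteq> 0 \<and> inverse (bil n BE (gvec a) (gvec a)) \<in> R"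
    and us: "\<And>a. a < 2 * n \<Longrightarrow> bil n B (us a) (us a) \<noteq> 0"
  defines "g \<equiv> refl_prod n B (map us [0..<2 * n])"
  shows "g \<in> G" "map_mat \<psi> gen = map_mat \<iota> g" "\<And>i j. i < n \<Longrightarrow> j < n \<Longrightarrow> gen $$ (i, j) \<in> R"
    "\<And>i j. i < m \<Longrightarrow> j < m \<Longrightarrow> \<rho>gen i j \<in> R \<and> \<psi> (\<rho>gen i j) = \<iota> (\<rho> g $$ (i, j))"
proof -
  interpret \<iota>: inj_idom_hom \<iota> by fact
  have nz: "\<forall>v\<in>set (map us [0..<2 * n]). bil n B v v \<noteq> 0" using us by auto
  have "det g = 1"
    unfolding g_def using refl_prod_det[OF B(1,2) two_neq_zero_A nz] by simp
  moreover have "transpose_mat g * B * g = B"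
    unfolding g_def by (rule refl_prod_isometry[OF B(1,2) two_neq_zero_A nz])
  ultimately show g: "g \<in> G" by (simp add: G_iff g_def)
  have h: "map_mat \<psi> (refl_prod n BE (map gvec [0..<2 * n])) =
      refl_prod n (map_mat \<psi> BE) (map (\<lambda>v i. \<psi> (v i)) (map gvec [0..<2 * n]))
    \<and> refl_prod n BE (map gvec [0..<2 * n]) \<in> carrier_mat n n \<and>
      (\<forall>i<n. \<forall>j<n. refl_prod n BE (map gvec [0..<2 * n]) $$ (i, j) \<in> R)"
    by (rule refl_prod_hom_on[OF R BE_carrier]) (use c v inv B(1) in \<open>auto simp: BE_def\<close>)
  have h': "map_mat \<iota> (refl_prod n B (map us [0..<2 * n])) =
      refl_prod n (map_mat \<iota> B) (map (\<lambda>v i. \<iota> (v i)) (map us [0..<2 * n]))"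
    by (rule conjunct1[OF refl_prod_hom_on[OF is_subring_UNIV hom_on_fieldI[OF \<iota>] B(1)]]) (use us in auto)
  show "gen $$ (i, j) \<in> R" if "i < n" "j < n" for i j
    using h that by (simp add: gen_def)
  have BB: "map_mat \<psi> BE = map_mat \<iota> B"
    using B(1) c by (intro eq_matI) (auto simp: BE_def)
  have cong: "refl_prod n S (map f xs) = refl_prod n S (map f' xs)"
    if "\<And>a i. a \<in> set xs \<Longrightarrow> i < n \<Longrightarrow> f a i = f' a i" for S :: "'f mat" and f f' :: "nat \<Rightarrow> nat \<Rightarrow> 'f" and xs
    using that
  proof (induction xs)
    case (Cons a xs)
    have "bil n S (f a) (f a) = bil n S (f' a) (f' a)" using Cons.prems by (intro bil_cong) auto
    then have "refl_mat n S (f a) = refl_mat n S (f' a)"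
      unfolding refl_mat_def using Cons.prems by (intro cong_mat refl) auto
    then show ?case using Cons by simp
  qed simp
  show gen: "map_mat \<psi> gen = map_mat \<iota> g"
    unfolding gen_def g_def conjunct1[OF h] h' BB map_map comp_def
    by (rule cong) (use v in auto)
  show "\<rho>gen i j \<in> R \<and> \<psi> (\<rho>gen i j) = \<iota> (\<rho> g $$ (i, j))" if ij: "i < m" "j < m" for i j
  proof -
    have vR: "gen $$ ij' \<in> R" if "ij' \<in> mvars (entry i j)" for ij'
      using that entry(1)[OF ij] h unfolding gen_def by auto
    have cR: "(cE \<circ> to_ac) c \<in> R" for c :: 'k using c by simp
    have "\<psi> (\<rho>gen i j) = meval (\<psi> \<circ> (cE \<circ> to_ac)) (\<psi> \<circ> (\<lambda>ij. gen $$ ij)) (entry i j)"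
      unfolding \<rho>gen_def by (rule meval_hom_on[OF R]) (use vR cR in auto)
    also have "\<dots> = meval (\<iota> \<circ> to_ac) (\<iota> \<circ> (\<lambda>ij. g $$ ij)) (entry i j)"
    proof (rule meval_cong)
      fix ij' assume "ij' \<in> mvars (entry i j)"
      then obtain a b where "ij' = (a, b)" "a < n" "b < n" using entry(1)[OF ij] by auto
      moreover have "gen \<in> carrier_mat n n" using h by (simp add: gen_def)
      ultimately show "(\<psi> \<circ> (\<lambda>ij. gen $$ ij)) ij' = (\<iota> \<circ> (\<lambda>ij. g $$ ij)) ij'"
        using arg_cong[OF gen, of "\<lambda>M. M $$ (a, b)"] G_carrier[OF g] by simp
    qed (use c in simp)
    also have "\<dots> = \<iota> (\<rho> g $$ (i, j))"
      unfolding entry(2)[OF ij g] by (rule \<iota>.hom_meval[symmetric])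
    finally show ?thesis
      unfolding \<rho>gen_def using vR cR by (auto intro!: meval_in_subring[OF R(1)])
  qed
qed

text \<open>
  A point \<open>s\<close> of the parameter space at which the generic element is defined and takes the value \<open>g\<close>.
\<close>

definition good_point :: "(nat \<Rightarrow> 'k alg_closure rat_fun) \<Rightarrow> 'k alg_closure mat \<Rightarrow> bool"
  where "good_point s g \<longleftrightarrow> map_mat (spec s) gen = map_mat rconst g \<and>
    (\<forall>i<n. \<forall>j<n. gen $$ (i, j) \<in> spec_dom s) \<and>
    (\<forall>i<m. \<forall>j<m. \<rho>gen i j \<in> spec_dom s \<and> spec s (\<rho>gen i j) = rconst (\<rho> g $$ (i, j)))"

lemma good_point_exists:
  assumes us: "\<And>a. a < 2 * n \<Longrightarrow> bil n B (us a) (us a) \<noteq> 0"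
  shows "good_point (\<lambda>k. rconst (us (k div n) (k mod n))) (refl_prod n B (map us [0..<2 * n]))"
    "a < 2 * n \<Longrightarrow> bil n BE (gvec a) (gvec a) \<noteq> 0"
proof -
  let ?s = "\<lambda>k. rconst (us (k div n) (k mod n))"
  note R = hom_on_spec[of ?s]
  have c: "cE c \<in> spec_dom ?s \<and> spec ?s (cE c) = rconst c" for c by (simp add: cE_def)
  have v: "gvec a i \<in> spec_dom ?s \<and> spec ?s (gvec a i) = rconst (us a i)" if "i < n" for a i
    using that by (simp add: gvec_def)
  interpret r: inj_idom_hom "rconst :: 'k alg_closure \<Rightarrow> _" by (rule inj_idom_hom_rconst)
  have b: "bil n BE (gvec a) (gvec a) \<in> spec_dom ?s"
    "spec ?s (bil n BE (gvec a) (gvec a)) = rconst (bil n B (us a) (us a))" for a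
  proof -
    have "spec ?s (bil n BE (gvec a) (gvec a)) =
      bil n (map_mat (spec ?s) BE) (\<lambda>i. spec ?s (gvec a i)) (\<lambda>i. spec ?s (gvec a i))"
      using c v B(1) by (intro bil_hom_on[OF R BE_carrier]) (auto simp: BE_def)
    also have "map_mat (spec ?s) BE = map_mat rconst B"
      using c B(1) by (intro eq_matI) (auto simp: BE_def)
    also have "bil n (map_mat rconst B) (\<lambda>i. spec ?s (gvec a i)) (\<lambda>i. spec ?s (gvec a i)) =
      bil n (map_mat rconst B) (\<lambda>i. rconst (us a i)) (\<lambda>i. rconst (us a i))"
      using v by (intro bil_cong) auto
    also have "\<dots> = rconst (bil n B (us a) (us a))"
      by (rule bil_hom_on(1)[OF is_subring_UNIV hom_on_fieldI[OF inj_idom_hom_rconst] B(1), symmetric]) auto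
    finally show "spec ?s (bil n BE (gvec a) (gvec a)) = rconst (bil n B (us a) (us a))" .
    show "bil n BE (gvec a) (gvec a) \<in> spec_dom ?s"
      using c v B(1) by (intro bil_hom_on[OF R BE_carrier]) (auto simp: BE_def)
  qed
  have nz: "bil n BE (gvec a) (gvec a) \<noteq> 0" if "a < 2 * n" for a
  proof
    assume "bil n BE (gvec a) (gvec a) = 0"
    then have "rconst (bil n B (us a) (us a)) = 0" using b(2)[of a] hom_on_zero[OF R] by simp
    with us[OF that] show False by simp
  qed
  then show "a < 2 * n \<Longrightarrow> bil n BE (gvec a) (gvec a) \<noteq> 0" by simp
  have inv: "bil n BE (gvec a) (gvec a) \<noteq> 0 \<and> inverse (bil n BE (gvec a) (gvec a)) \<in> spec_dom ?s"
    if "a < 2 * n" for a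
    using nz[OF that] b us[OF that] by (auto intro!: spec_inverse)
  note gh = gen_hom_on[OF R inj_idom_hom_rconst c v inv us]
  show "good_point ?s (refl_prod n B (map us [0..<2 * n]))"
    unfolding good_point_def by (intro conjI allI impI) (use gh in auto)
qed

lemma good_point_G:
  assumes "g \<in> G" shows "\<exists>s. good_point s g"
proof -
  obtain vs where vs: "length vs = 2 * n" "\<forall>v\<in>set vs. bil n B v v \<noteq> 0" "g = refl_prod n B vs"
    using cartan_dieudonne[OF B, of g] assms n2 by (auto simp: G_iff)
  have "vs = map (\<lambda>a. vs ! a) [0..<2 * n]" using vs(1) by (metis map_nth)
  moreover have "bil n B (vs ! a) (vs ! a) \<noteq> 0" if "a < 2 * n" for a using vs that by auto
  ultimately show ?thesis using good_point_exists(1)[of "\<lambda>a. vs ! a"] vs(3) by metis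
qed

lemma gvec_nonisotropic: "a < 2 * n \<Longrightarrow> bil n BE (gvec a) (gvec a) \<noteq> 0"
proof -
  obtain w where "bil n B w w \<noteq> 0" using nonisotropic_vector by blast
  then show "a < 2 * n \<Longrightarrow> bil n BE (gvec a) (gvec a) \<noteq> 0"
    using good_point_exists(2)[of "\<lambda>_. w"] by simp
qed

text \<open>
  The coordinates of the generic vectors, together with the denominators of the reflections: a
  partial homomorphism that is defined on them makes every vector non-isotropic.
\<close>

definition params :: "'k alg_closure rat_fun rat_fun set"
  where "params = (\<lambda>(a, i). gvec a i) ` ({..<2 * n} \<times> {..<n}) \<union>
    (\<lambda>a. inverse (bil n BE (gvec a) (gvec a))) ` {..<2 * n}"

lemma params_hom:
  assumes R: "is_subring R" "hom_on R \<psi>" and sub: "range cE \<union> params \<subseteq> R" and c: "\<And>c. \<psi> (cE c) = c"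
  defines "us \<equiv> \<lambda>a i. \<psi> (gvec a i)"
  defines "g \<equiv> refl_prod n B (map us [0..<2 * n])"
  shows "g \<in> G" "map_mat \<psi> gen = g" "\<And>i j. i < n \<Longrightarrow> j < n \<Longrightarrow> gen $$ (i, j) \<in> R"
    "\<And>i j. i < m \<Longrightarrow> j < m \<Longrightarrow> \<rho>gen i j \<in> R \<and> \<psi> (\<rho>gen i j) = \<rho> g $$ (i, j)"
    "\<And>a. a < 2 * n \<Longrightarrow> bil n B (us a) (us a) \<noteq> 0"
proof -
  have id: "inj_idom_hom (id :: 'k alg_closure \<Rightarrow> _)" by unfold_locales auto
  have v: "gvec a i \<in> R" if "a < 2 * n" "i < n" for a i using sub that by (auto simp: params_def)
  have cR: "cE c \<in> R" for c using sub by auto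
  have inv: "inverse (bil n BE (gvec a) (gvec a)) \<in> R" if "a < 2 * n" for a using sub that by (auto simp: params_def)
  have us: "bil n B (us a) (us a) \<noteq> 0" if a: "a < 2 * n" for a
  proof -
    have b: "bil n BE (gvec a) (gvec a) \<in> R"
      using cR v[OF a] B(1) by (intro bil_hom_on[OF R BE_carrier]) (auto simp: BE_def)
    have "\<psi> (bil n BE (gvec a) (gvec a)) = bil n (map_mat \<psi> BE) (us a) (us a)"
      unfolding us_def using cR v[OF a] B(1) by (intro bil_hom_on[OF R BE_carrier]) (auto simp: BE_def)
    also have "map_mat \<psi> BE = B" using c B(1) by (intro eq_matI) (auto simp: BE_def)
    finally have "bil n B (us a) (us a) * \<psi> (inverse (bil n BE (gvec a) (gvec a))) = \<psi> 1"
      using hom_on_mult[OF R b inv[OF a]] gvec_nonisotropic[OF a] by simp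
    then show ?thesis using hom_on_one[OF R] by auto
  qed
  then show "a < 2 * n \<Longrightarrow> bil n B (us a) (us a) \<noteq> 0" for a .
  note gh = gen_hom_on[OF R id, of us]
  have map_mat_id: "map_mat id M = M" for M :: "'k alg_closure mat" by (intro eq_matI) auto
  show "g \<in> G" "map_mat \<psi> gen = g" "\<And>i j. i < n \<Longrightarrow> j < n \<Longrightarrow> gen $$ (i, j) \<in> R"
    "\<And>i j. i < m \<Longrightarrow> j < m \<Longrightarrow> \<rho>gen i j \<in> R \<and> \<psi> (\<rho>gen i j) = \<rho> g $$ (i, j)"
    unfolding g_def using gh cR c v inv us gvec_nonisotropic by (auto simp: us_def map_mat_id)
qed

lemma gen_in_params:
  assumes "i < n" "j < n" shows "gen $$ (i, j) \<in> ring_gen (range cE \<union> params)"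
proof -
  let ?R = "ring_gen (range cE \<union> params)"
  have h: "hom_on ?R id" by (simp add: hom_on_def)
  have c: "cE c \<in> ?R" for c by (auto intro: ring_gen.incl)
  have v: "gvec a i \<in> ?R" if "a < 2 * n" "i < n" for a i
    using that by (intro ring_gen.incl) (auto simp: params_def)
  have inv: "inverse (bil n BE (gvec a) (gvec a)) \<in> ?R" if "a < 2 * n" for a
    using that by (intro ring_gen.incl) (auto simp: params_def)
  have SR: "BE $$ (i, j) \<in> ?R" if "i < n" "j < n" for i j
    using that c B(1) by (simp add: BE_def)
  have "v' i \<in> ?R" if "v' \<in> set (map gvec [0..<2 * n])" "i < n" for v' i
    using that v by auto
  moreover have "bil n BE v' v' \<noteq> 0 \<and> inverse (bil n BE v' v') \<in> ?R" if "v' \<in> set (map gvec [0..<2 * n])" for v'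
    using that inv gvec_nonisotropic by auto
  ultimately have "(\<forall>i<n. \<forall>j<n. refl_prod n BE (map gvec [0..<2 * n]) $$ (i, j) \<in> ?R)"
    using refl_prod_hom_on[OF is_subring_ring_gen h BE_carrier SR, of "map gvec [0..<2 * n]"] by blast
  with assms show ?thesis by (simp add: gen_def)
qed

lemma params_finite: "finite params"
  by (simp add: params_def)

text \<open>
  A non-empty open set contains the non-vanishing locus of one polynomial.
\<close>

lemma free_open:
  obtains p :: "(nat, 'k) mpoly" where "mvars p \<subseteq> {..<m}" "\<exists>x. meval to_ac x p \<noteq> 0"
    "\<And>x g. meval to_ac x p \<noteq> 0 \<Longrightarrow> g \<in> G \<Longrightarrow> \<rho> g *\<^sub>v vec m x = vec m x \<Longrightarrow> g = 1\<^sub>m n"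
proof -
  obtain U where U: "zariski_open m U" "U \<noteq> {}" "\<forall>x\<in>U. {g \<in> G. \<rho> g *\<^sub>v x = x} = {1\<^sub>m n}"
    using free by (auto simp: almost_free_def)
  obtain P :: "(nat, 'k) mpoly set" where P: "\<forall>p\<in>P. mvars p \<subseteq> {..<m}"
    "U = {x \<in> carrier_vec m. \<exists>p\<in>P. meval to_ac (\<lambda>i. x $ i) p \<noteq> 0}"
    using U(1) by (auto simp: zariski_open_def)
  then obtain x p where xp: "p \<in> P" "meval to_ac (vec_index x) p \<noteq> 0" using U(2) by auto
  show ?thesis
  proof (rule that[of p])
    show "mvars p \<subseteq> {..<m}" using P xp by auto
    show "\<exists>x. meval to_ac x p \<noteq> 0" using xp by auto
    fix x g assume x: "meval to_ac x p \<noteq> 0" and g: "g \<in> G" "\<rho> g *\<^sub>v vec m x = vec m x"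
    have "meval to_ac (\<lambda>i. vec m x $ i) p = meval to_ac x p"
    proof (rule meval_cong)
      fix i assume "i \<in> mvars p"
      then have "i < m" using P(1) xp(1) by auto
      then show "vec m x $ i = x i" by simp
    qed simp
    with x xp P have "vec m x \<in> U" by auto
    with U(3) g show "g = 1\<^sub>m n" by blast
  qed
qed

text \<open>The coordinates of the pair of \<open>x\<close> and \<open>\<rho>(g) x\<close>, for generic \<open>x\<close> and \<open>g\<close>.\<close>

definition xy :: "'k alg_closure rat_fun rat_fun set"
  where "xy = xvar ` {..<m} \<union> yvar ` {..<m}"

text \<open>
  Almost freeness says that \<open>g\<close> is determined by \<open>x\<close> and \<open>\<rho>(g) x\<close>. If an entry were not a rational
  function of these, then two specialisations would agree on \<open>x\<close> and on \<open>\<rho>(g) x\<close> but not on \<open>g\<close>, at a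
  point \<open>x\<close> of the open set where stabilizers are trivial.
\<close>

lemma gen_rational_in_xy:
  assumes ab: "a < n" "b < n"
  shows "gen $$ (a, b) \<in> field_gen (range cE \<union> xy)"
proof (rule ccontr)
  assume not: "gen $$ (a, b) \<notin> field_gen (range cE \<union> xy)"
  obtain p :: "(nat, 'k) mpoly" where p: "mvars p \<subseteq> {..<m}" "\<exists>x. meval to_ac x p \<noteq> 0"
    "\<And>x g. meval to_ac x p \<noteq> 0 \<Longrightarrow> g \<in> G \<Longrightarrow> \<rho> g *\<^sub>v vec m x = vec m x \<Longrightarrow> g = 1\<^sub>m n"
    using free_open by blast
  \<comment> \<open>the equation of the complement of an open set with trivial stabilizers, at the generic point\<close>
  define d where "d = meval (cE \<circ> to_ac) xvar p"
  let ?S = "ring_gen (range cE \<union> xy \<union> params)"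
  note SR = is_subring_ring_gen[of "range cE \<union> xy \<union> params"]
  have inS: "range cE \<union> params \<subseteq> ?S" "xy \<subseteq> ?S" by (auto intro: ring_gen.incl)
  have d0: "d \<noteq> 0"
  proof
    assume "d = 0"
    obtain x where x: "meval to_ac x p \<noteq> 0" using p by blast
    interpret r: inj_idom_hom "rconst :: 'k alg_closure rat_fun \<Rightarrow> _" by (rule inj_idom_hom_rconst)
    have "d = rconst (meval (rconst \<circ> to_ac) rvar p)"
      unfolding r.hom_meval d_def by (simp add: comp_def cE_def xvar_def[abs_def])
    then have 0: "meval (rconst \<circ> to_ac) rvar p = (0 :: 'k alg_closure rat_fun)" using \<open>d = 0\<close> by simp
    have "spec x (meval (rconst \<circ> to_ac) rvar p) = meval (spec x \<circ> (rconst \<circ> to_ac)) (spec x \<circ> rvar) p"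
      by (rule meval_hom_on[OF hom_on_spec]) auto
    also have "\<dots> = meval to_ac x p" by (intro meval_cong) auto
    finally show False using x 0 hom_on_zero[OF hom_on_spec] by metis
  qed
  have dS: "d \<in> ?S"
    unfolding d_def
  proof (rule meval_in_subring[OF SR])
    show "xvar i \<in> ?S" if "i \<in> mvars p" for i
      using inS(2) that p(1) by (auto simp: xy_def)
    show "(cE \<circ> to_ac) c \<in> ?S" for c using inS(1) by auto
  qed
  have uS: "gen $$ (a, b) \<in> ?S"
    using gen_in_params ring_gen_mono[of "range cE \<union> params" "range cE \<union> xy \<union> params"] ab by blast
  obtain \<psi>1 \<psi>2 where \<psi>: "hom_on ?S \<psi>1" "hom_on ?S \<psi>2" "\<And>c. \<psi>1 (cE c) = c" "\<And>c. \<psi>2 (cE c) = c"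
    "\<And>y. y \<in> xy \<Longrightarrow> \<psi>1 y = \<psi>2 y" "\<psi>1 d \<noteq> 0" "\<psi>2 d \<noteq> 0" "\<psi>1 (gen $$ (a, b)) \<noteq> \<psi>2 (gen $$ (a, b))"
    using separating_points[OF inj_idom_hom_cE _ params_finite uS not dS d0] by (auto simp: xy_def)
  have val: "\<exists>g\<in>G. map_mat \<psi> gen = g \<and> meval to_ac (\<lambda>i. \<psi> (xvar i)) p \<noteq> 0 \<and>
      \<rho> g *\<^sub>v vec m (\<lambda>i. \<psi> (xvar i)) = vec m (\<lambda>i. \<psi> (yvar i))"
    if h: "hom_on ?S \<psi>" "\<And>c. \<psi> (cE c) = c" "\<psi> d \<noteq> 0" for \<psi>
  proof -
    define g where "g = refl_prod n B (map (\<lambda>a i. \<psi> (gvec a i)) [0..<2 * n])"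
    note ph = params_hom[OF SR h(1) inS(1) h(2), folded g_def]
    have "\<psi> d = meval (\<psi> \<circ> (cE \<circ> to_ac)) (\<psi> \<circ> xvar) p"
      unfolding d_def
    proof (rule meval_hom_on[OF SR h(1)])
      show "xvar i \<in> ?S" if "i \<in> mvars p" for i
        using inS(2) that p(1) by (auto simp: xy_def)
      show "(cE \<circ> to_ac) c \<in> ?S" for c using inS(1) by auto
    qed
    also have "\<dots> = meval to_ac (\<lambda>i. \<psi> (xvar i)) p" by (intro meval_cong) (auto simp: h(2))
    finally have 1: "meval to_ac (\<lambda>i. \<psi> (xvar i)) p \<noteq> 0" using h(3) by simp
    have "\<rho> g *\<^sub>v vec m (\<lambda>i. \<psi> (xvar i)) = vec m (\<lambda>i. \<psi> (yvar i))"
    proof (rule eq_vecI)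
      fix i assume "i < dim_vec (vec m (\<lambda>i. \<psi> (yvar i)))"
      then have i: "i < m" by simp
      have xS: "xvar j \<in> ?S" if "j < m" for j using inS that by (auto simp: xy_def)
      have "\<psi> (yvar i) = (\<Sum>j<m. \<psi> (\<rho>gen i j * xvar j))"
        unfolding yvar_def using ph(4)[OF i] xS by (intro hom_on_sum[OF SR h(1)] subring_mult[OF SR]) auto
      also have "\<dots> = (\<Sum>j<m. \<rho> g $$ (i, j) * \<psi> (xvar j))"
        using ph(4)[OF i] xS by (intro sum.cong refl) (simp add: hom_on_mult[OF SR h(1)])
      finally show "(\<rho> g *\<^sub>v vec m (\<lambda>i. \<psi> (xvar i))) $ i = vec m (\<lambda>i. \<psi> (yvar i)) $ i"
        using i \<rho>_carrier[OF ph(1)] by (simp add: scalar_prod_def atLeast0LessThan)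
    qed (use \<rho>_carrier[OF ph(1)] in auto)
    with 1 ph show ?thesis by auto
  qed
  obtain g1 where g1: "g1 \<in> G" "map_mat \<psi>1 gen = g1" "meval to_ac (\<lambda>i. \<psi>1 (xvar i)) p \<noteq> 0"
      "\<rho> g1 *\<^sub>v vec m (\<lambda>i. \<psi>1 (xvar i)) = vec m (\<lambda>i. \<psi>1 (yvar i))"
    using val[OF \<psi>(1,3,6)] by blast
  obtain g2 where g2: "g2 \<in> G" "map_mat \<psi>2 gen = g2" "meval to_ac (\<lambda>i. \<psi>2 (xvar i)) p \<noteq> 0"
      "\<rho> g2 *\<^sub>v vec m (\<lambda>i. \<psi>2 (xvar i)) = vec m (\<lambda>i. \<psi>2 (yvar i))"
    using val[OF \<psi>(2,4,7)] by blast
  define \<xi> where "\<xi> = vec m (\<lambda>i. \<psi>1 (xvar i))"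
  have \<xi>: "\<xi> \<in> carrier_vec m" "\<xi> = vec m (\<lambda>i. \<psi>2 (xvar i))"
    unfolding \<xi>_def using \<psi>(5) by (auto intro!: eq_vecI simp: xy_def)
  have "vec m (\<lambda>i. \<psi>1 (yvar i)) = vec m (\<lambda>i. \<psi>2 (yvar i))"
    using \<psi>(5) by (auto intro!: eq_vecI simp: xy_def)
  then have same: "\<rho> g1 *\<^sub>v \<xi> = \<rho> g2 *\<^sub>v \<xi>"
    using g1(4) g2(4) \<xi>(2) by (simp add: \<xi>_def)
  obtain h where h: "h \<in> G" "g1 * h = 1\<^sub>m n" "h * g1 = 1\<^sub>m n" using G_inverse[OF g1(1)] by blast
  have "\<rho> (h * g2) *\<^sub>v \<xi> = \<rho> h *\<^sub>v (\<rho> g2 *\<^sub>v \<xi>)"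
    unfolding \<rho>_mult[OF h(1) g2(1)]
    by (rule assoc_mult_mat_vec[OF \<rho>_carrier[OF h(1)] \<rho>_carrier[OF g2(1)] \<xi>(1)])
  also have "\<dots> = \<rho> h *\<^sub>v (\<rho> g1 *\<^sub>v \<xi>)" by (simp add: same)
  also have "\<dots> = \<rho> (h * g1) *\<^sub>v \<xi>"
    unfolding \<rho>_mult[OF h(1) g1(1)]
    by (rule assoc_mult_mat_vec[symmetric, OF \<rho>_carrier[OF h(1)] \<rho>_carrier[OF g1(1)] \<xi>(1)])
  also have "\<dots> = \<xi>" using h(3) \<rho>_one \<xi>(1) by simp
  finally have "\<rho> (h * g2) *\<^sub>v \<xi> = \<xi>" .
  then have "h * g2 = 1\<^sub>m n"
    using p(3)[OF g1(3) G_mult[OF h(1) g2(1)]] by (simp add: \<xi>_def)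
  then have "g1 * (h * g2) = g1" using G_carrier[OF g1(1)] by simp
  moreover have "g1 * (h * g2) = g2"
    using assoc_mult_mat[OF G_carrier[OF g1(1)] G_carrier[OF h(1)] G_carrier[OF g2(1)]] h(2)
      left_mult_one_mat[OF G_carrier[OF g2(1)]] by simp
  ultimately have "map_mat \<psi>1 gen = map_mat \<psi>2 gen" using g1 g2 by simp
  moreover have "gen \<in> carrier_mat n n" by (simp add: gen_def)
  ultimately have "\<psi>1 (gen $$ (a, b)) = \<psi>2 (gen $$ (a, b))"
    using ab by (metis carrier_matD index_map_mat(1))
  with \<psi>(8) show False by simp
qed

lemma rat_funs_subfield: "is_subfield (rat_funs m :: 'k alg_closure rat_fun set)"
  unfolding rat_funs_field_gen by (rule is_subfield_field_gen)

lemma rconst_in_rat_funs: "rconst c \<in> rat_funs m"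
  unfolding rat_funs_field_gen by (auto intro: field_gen_incl)

lemma rvar_in_rat_funs: "i < m \<Longrightarrow> rvar i \<in> rat_funs m"
  unfolding rat_funs_field_gen by (auto intro: field_gen_incl)

lemma actV_stable:
  assumes j: "j \<in> J" and f: "f \<in> rat_funs m"
  shows "actV j f \<in> rat_funs m"
proof -
  obtain g \<sigma> where j': "j = (g, \<sigma>)" "(g, \<sigma>) \<in> J" using j by (metis surj_pair)
  note R = is_subring_subfield[OF rat_funs_subfield]
  interpret field_hom "actV j" unfolding j'(1) by (rule field_hom_of_inj[OF actV(1)[OF j'(2)]])
  have "is_subfield {f. actV j f \<in> rat_funs m}"
    using rat_funs_subfield by (auto simp: is_subfield_def is_subring_def hom_distribs)
  moreover have "range rconst \<union> rvar ` {..<m} \<subseteq> {f. actV j f \<in> rat_funs m}"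
    using j' by (auto simp: actV(2,3)[OF j'(2)] rconst_in_rat_funs
        intro!: subring_sum[OF R] subring_mult[OF R] rvar_in_rat_funs)
  ultimately show ?thesis
    using f field_gen_least unfolding rat_funs_field_gen by blast
qed

lemma actV_one: "f \<in> rat_funs m \<Longrightarrow> actV (1\<^sub>m n, id) f = f"
proof -
  interpret c: inj_idom_hom "rconst :: 'k alg_closure \<Rightarrow> _" by (rule inj_idom_hom_rconst)
  assume f: "f \<in> rat_funs m"
  have "actV (1\<^sub>m n, id) f = id f"
  proof (rule field_gen_hom_agree[OF actV(1)[OF one_J]])
    show "inj_idom_hom (id :: 'k alg_closure rat_fun \<Rightarrow> _)" by unfold_locales auto
    show "f \<in> field_gen (range rconst \<union> rvar ` {..<m})" using f by (simp add: rat_funs_field_gen)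
    fix a :: "'k alg_closure rat_fun" assume "a \<in> range rconst \<union> rvar ` {..<m}"
    then consider c where "a = rconst c" | i where "a = rvar i" "i < m" by auto
    then show "actV (1\<^sub>m n, id) a = id (a :: 'k alg_closure rat_fun)"
    proof cases
      case 1 then show ?thesis using actV(2)[OF one_J, of c] by simp
    next
      case 2
      have "actV (1\<^sub>m n, id) (rvar i) = (\<Sum>j<m. rvar j * unitf i j)"
        unfolding actV(3)[OF one_J 2(2)] \<rho>_one using 2 by (intro sum.cong refl) (auto simp: unitf_def)
      then show ?thesis using 2 sum_unitf[OF 2(2), of rvar] by simp
    qed
  qed
  then show ?thesis by simp
qed

lemma char_rat_fun: "n' > 0 \<Longrightarrow> of_nat n' \<noteq> (0 :: 'k alg_closure rat_fun)"
proof -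
  interpret c: inj_idom_hom "rconst :: 'k alg_closure \<Rightarrow> _" by (rule inj_idom_hom_rconst)
  show "n' > 0 \<Longrightarrow> of_nat n' \<noteq> (0 :: 'k alg_closure rat_fun)"
    by (metis c.hom_of_nat c.hom_0_iff of_nat_eq_0_iff less_numeral_extra(3))
qed

lemma semilinear_V: "semilinear_action J actV (\<lambda>(g, \<sigma>). map_mat rconst g) (rat_funs m) n (1\<^sub>m n, id)"
proof -
  interpret c: inj_idom_hom "rconst :: 'k alg_closure \<Rightarrow> _" by (rule inj_idom_hom_rconst)
  show ?thesis
  proof (rule semilinear_action.intro)
    show "inj_idom_hom (actV j)" if "j \<in> J" for j using that actV(1) by (cases j) auto
    show "is_subfield (rat_funs m :: 'k alg_closure rat_fun set)" by (rule rat_funs_subfield)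
    show "actV j x \<in> rat_funs m" if "j \<in> J" "x \<in> rat_funs m" for j x using that by (rule actV_stable)
    show "of_nat k \<noteq> (0 :: 'k alg_closure rat_fun)" if "0 < k" for k using that by (rule char_rat_fun)
    show "(1\<^sub>m n, id) \<in> J" by (rule one_J)
    show "actV (1\<^sub>m n, id) x = x" if "x \<in> rat_funs m" for x using that by (rule actV_one)
    show "(case (1\<^sub>m n :: 'k alg_closure mat, id :: 'k alg_closure \<Rightarrow> 'k alg_closure) of (g, \<sigma>) \<Rightarrow> map_mat rconst g) = 1\<^sub>m n" by (simp add: c.mat_hom_one)
    fix j assume j: "j \<in> J"
    obtain g \<sigma> where j': "j = (g, \<sigma>)" by force
    have g: "g \<in> G" using j j' by (simp add: J_def)
    note gc = G_carrier[OF g]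
    show "(case j of (g, \<sigma>) \<Rightarrow> map_mat rconst g) \<in> carrier_mat n n" using gc j' by simp
    show "(case j of (g, \<sigma>) \<Rightarrow> map_mat rconst g) $$ (a, b) \<in> rat_funs m" if "a < n" "b < n" for a b
      using gc j' that by (simp add: rconst_in_rat_funs)
    obtain h where h: "h \<in> G" "h * g = 1\<^sub>m n" using G_inverse[OF g] by blast
    show "\<exists>S\<in>carrier_mat n n. (\<forall>a<n. \<forall>b<n. S $$ (a, b) \<in> rat_funs m) \<and> S * (case j of (g, \<sigma>) \<Rightarrow> map_mat rconst g) = 1\<^sub>m n"
    proof (rule bexI[of _ "map_mat rconst h"])
      show "(\<forall>a<n. \<forall>b<n. map_mat rconst h $$ (a, b) \<in> rat_funs m) \<and> map_mat rconst h * (case j of (g, \<sigma>) \<Rightarrow> map_mat rconst g) = 1\<^sub>m n"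
        using G_carrier[OF h(1)] c.mat_hom_mult[OF G_carrier[OF h(1)] gc] h(2) j'
        by (simp add: rconst_in_rat_funs c.mat_hom_one)
    qed (use G_carrier[OF h(1)] in simp)
  next
    fix i j assume i: "i \<in> J" and j: "j \<in> J"
    obtain g \<sigma> h \<tau> where ij: "i = (g, \<sigma>)" "j = (h, \<tau>)" by (metis surj_pair)
    have g: "g \<in> G" and \<sigma>: "\<sigma> \<in> galois_group" and h: "h \<in> G" using i j by (auto simp: J_def ij)
    show "\<exists>l\<in>J. (\<forall>x\<in>rat_funs m. actV l x = actV i (actV j x)) \<and> (case l of (g, \<sigma>) \<Rightarrow> map_mat rconst g) =
        map_mat (actV i) (case j of (g, \<sigma>) \<Rightarrow> map_mat rconst g) * (case i of (g, \<sigma>) \<Rightarrow> map_mat rconst g)"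
    proof (rule bexI[OF _ times_J[OF i j]], intro conjI ballI)
      show "actV (times_J i j) x = actV i (actV j x)" for x by (rule actV_times[OF i j])
      have "map_mat (actV i) (map_mat rconst h) = map_mat rconst (map_mat \<sigma> h)"
        using i by (intro eq_matI) (auto simp: ij actV(2))
      moreover have "map_mat rconst (map_mat \<sigma> h * g) = map_mat rconst (map_mat \<sigma> h) * map_mat rconst g"
        using G_carrier[OF g] G_carrier[OF h] by (intro c.mat_hom_mult[of _ n n _ n]) auto
      ultimately show "(case times_J i j of (g, \<sigma>) \<Rightarrow> map_mat rconst g) =
        map_mat (actV i) (case j of (g, \<sigma>) \<Rightarrow> map_mat rconst g) * (case i of (g, \<sigma>) \<Rightarrow> map_mat rconst g)"
        by (simp add: ij times_J_def)
    qed
  qed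
qed

text \<open>
  Hilbert 90 applies because the entries of \<open>g\<close> are rational functions of \<open>x\<close> and \<open>\<rho>(g) x\<close>. For generic \<open>x\<close>
  the coordinates of \<open>\<rho>(g) x\<close> are orbit maps, so that these functions are quotients of orbit sums.
\<close>

lemma covariant_frame_V:
  obtains \<Phi> where "\<Phi> \<in> carrier_mat n n" "\<And>a b. a < n \<Longrightarrow> b < n \<Longrightarrow> \<Phi> $$ (a, b) \<in> rat_funs m" "det \<Phi> \<noteq> 0"
    "\<And>g \<sigma>. (g, \<sigma>) \<in> J \<Longrightarrow> map_mat (actV (g, \<sigma>)) \<Phi> = map_mat rconst g * \<Phi>"
proof -
  interpret sa: semilinear_action J actV "\<lambda>(g, \<sigma>). map_mat rconst g" "rat_funs m" n "(1\<^sub>m n, id)"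
    by (rule semilinear_V)
  interpret c: inj_idom_hom "rconst :: 'k alg_closure \<Rightarrow> _" by (rule inj_idom_hom_rconst)
  let ?Q = "ring_gen (range cE \<union> xy)"
  note QR = is_subring_ring_gen[of "range cE \<union> xy"]
  \<comment> \<open>evaluated at group elements, a polynomial in \<open>x\<close> and \<open>\<rho>(g) x\<close> becomes an orbit sum\<close>
  have orbit: "\<exists>\<phi>. sa.orbit_sum \<phi> \<and> (\<forall>g \<sigma> s. (g, \<sigma>) \<in> J \<longrightarrow> good_point s g \<longrightarrow>
      w \<in> spec_dom s \<and> spec s w = \<phi> (g, \<sigma>))" if "w \<in> ?Q" for w
    using that
  proof induction
    case one
    then show ?case
      using sa.orbit_sum_const[OF subring_one[OF is_subring_subfield[OF rat_funs_subfield]]]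
      by (intro exI[of _ "\<lambda>_. 1"]) (auto simp: subring_one[OF hom_on_spec(1)] hom_on_one[OF hom_on_spec])
  next
    case (incl w)
    then consider c where "w = cE c" | i where "w = xvar i" "i < m" | i where "w = yvar i" "i < m"
      by (auto simp: xy_def)
    then show ?case
    proof cases
      case 1
      then show ?thesis using sa.orbit_sum_const[OF rconst_in_rat_funs[of c]]
        by (intro exI[of _ "\<lambda>_. rconst c"]) (auto simp: cE_def)
    next
      case 2
      then show ?thesis using sa.orbit_sum_const[OF rvar_in_rat_funs[of i]]
        by (intro exI[of _ "\<lambda>_. rvar i"]) (auto simp: xvar_def)
    next
      case 3
      show ?thesis
      proof (intro exI[of _ "\<lambda>j. actV j (rvar i)"] conjI allI impI)
        show "sa.orbit_sum (\<lambda>j. actV j (rvar i))" by (rule sa.orbit_sum_orbit[OF rvar_in_rat_funs[OF 3(2)]])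
        fix g \<sigma> s assume j: "(g, \<sigma>) \<in> J" and s: "good_point s g"
        note R = hom_on_spec[of s]
        have *: "\<rho>gen i j \<in> spec_dom s" "spec s (\<rho>gen i j) = rconst (\<rho> g $$ (i, j))" if "j < m" for j
          using s 3(2) that by (auto simp: good_point_def)
        have x: "xvar j \<in> spec_dom s" "spec s (xvar j) = rvar j" for j by (auto simp: xvar_def)
        show "w \<in> spec_dom s"
          unfolding 3 yvar_def using * x by (auto intro!: subring_sum[OF R(1)] subring_mult[OF R(1)])
        have "spec s w = (\<Sum>j<m. spec s (\<rho>gen i j * xvar j))"
          unfolding 3 yvar_def using * x by (intro hom_on_sum[OF R] subring_mult[OF R(1)]) auto
        also have "\<dots> = actV (g, \<sigma>) (rvar i)"
          unfolding actV(3)[OF j 3(2)] using * x by (intro sum.cong refl) (simp add: hom_on_mult[OF R])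
        finally show "spec s w = actV (g, \<sigma>) (rvar i)" .
      qed
    qed
  next
    case (diff a b)
    obtain \<phi> where 1: "sa.orbit_sum \<phi>"
      "\<forall>g \<sigma> s. (g, \<sigma>) \<in> J \<longrightarrow> good_point s g \<longrightarrow> a \<in> spec_dom s \<and> spec s a = \<phi> (g, \<sigma>)"
      using diff.IH(1) by (elim exE conjE) rule
    obtain \<psi> where 2: "sa.orbit_sum \<psi>"
      "\<forall>g \<sigma> s. (g, \<sigma>) \<in> J \<longrightarrow> good_point s g \<longrightarrow> b \<in> spec_dom s \<and> spec s b = \<psi> (g, \<sigma>)"
      using diff.IH(2) by (elim exE conjE) rule
    show ?case
    proof (intro exI[of _ "\<lambda>j. \<phi> j - \<psi> j"] conjI allI impI)
      show "sa.orbit_sum (\<lambda>j. \<phi> j - \<psi> j)" by (rule sa.orbit_sum_diff[OF 1(1) 2(1)])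
      fix g \<sigma> s assume "(g, \<sigma>) \<in> J" "good_point s g"
      then have "a \<in> spec_dom s" "spec s a = \<phi> (g, \<sigma>)" "b \<in> spec_dom s" "spec s b = \<psi> (g, \<sigma>)"
        using 1(2) 2(2) by simp_all
      then show "a - b \<in> spec_dom s" "spec s (a - b) = \<phi> (g, \<sigma>) - \<psi> (g, \<sigma>)"
        by (simp_all add: subring_diff[OF hom_on_spec(1)] hom_on_diff[OF hom_on_spec])
    qed
  next
    case (mult a b)
    obtain \<phi> where 1: "sa.orbit_sum \<phi>"
      "\<forall>g \<sigma> s. (g, \<sigma>) \<in> J \<longrightarrow> good_point s g \<longrightarrow> a \<in> spec_dom s \<and> spec s a = \<phi> (g, \<sigma>)"
      using mult.IH(1) by (elim exE conjE) rule
    obtain \<psi> where 2: "sa.orbit_sum \<psi>"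
      "\<forall>g \<sigma> s. (g, \<sigma>) \<in> J \<longrightarrow> good_point s g \<longrightarrow> b \<in> spec_dom s \<and> spec s b = \<psi> (g, \<sigma>)"
      using mult.IH(2) by (elim exE conjE) rule
    show ?case
    proof (intro exI[of _ "\<lambda>j. \<phi> j * \<psi> j"] conjI allI impI)
      show "sa.orbit_sum (\<lambda>j. \<phi> j * \<psi> j)" by (rule sa.orbit_sum_mult[OF 1(1) 2(1)])
      fix g \<sigma> s assume "(g, \<sigma>) \<in> J" "good_point s g"
      then have "a \<in> spec_dom s" "spec s a = \<phi> (g, \<sigma>)" "b \<in> spec_dom s" "spec s b = \<psi> (g, \<sigma>)"
        using 1(2) 2(2) by simp_all
      then show "a * b \<in> spec_dom s" "spec s (a * b) = \<phi> (g, \<sigma>) * \<psi> (g, \<sigma>)"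
        by (simp_all add: subring_mult[OF hom_on_spec(1)] hom_on_mult[OF hom_on_spec])
    qed
  qed
  \<comment> \<open>a common denominator of the entries of the generic element\<close>
  have "\<exists>Q. Q \<in> ?Q \<and> Q \<noteq> 0 \<and> (\<forall>ab\<in>P. Q * gen $$ ab \<in> ?Q)" if "finite P" "P \<subseteq> {..<n} \<times> {..<n}" for P
    using that
  proof (induction P rule: finite_induct)
    case empty
    then show ?case using subring_one[OF QR] by (intro exI[of _ 1]) simp
  next
    case (insert ab P)
    then obtain Q where Q: "Q \<in> ?Q" "Q \<noteq> 0" "\<forall>ab\<in>P. Q * gen $$ ab \<in> ?Q" by auto
    obtain a b where ab: "ab = (a, b)" "a < n" "b < n" using insert.prems by auto
    obtain x y where xy: "x \<in> ?Q" "y \<in> ?Q" "y \<noteq> 0" "gen $$ ab = x / y"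
      using field_gen_fractions[OF gen_rational_in_xy[OF ab(2,3)]] ab(1) by metis
    have "Q * y * gen $$ ab = Q * x" using xy by simp
    show ?case
    proof (intro exI[of _ "Q * y"] conjI ballI)
      fix ab' assume "ab' \<in> insert ab P"
      then consider "ab' = ab" | "ab' \<in> P" by auto
      then show "Q * y * gen $$ ab' \<in> ?Q"
      proof cases
        case 1
        then show ?thesis using \<open>Q * y * gen $$ ab = Q * x\<close> Q xy subring_mult[OF QR] by simp
      next
        case 2
        then have "y * (Q * gen $$ ab') \<in> ?Q" using Q xy subring_mult[OF QR] by blast
        then show ?thesis by (simp add: mult_ac)
      qed
    qed (use Q xy subring_mult[OF QR] in auto)
  qed
  from this[of "{..<n} \<times> {..<n}"] obtain Q where Q: "Q \<in> ?Q" "Q \<noteq> 0"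
    "\<And>a b. a < n \<Longrightarrow> b < n \<Longrightarrow> Q * gen $$ (a, b) \<in> ?Q" by auto
  obtain \<phi> where \<phi>: "sa.orbit_sum \<phi>"
    "\<And>g \<sigma> s. (g, \<sigma>) \<in> J \<Longrightarrow> good_point s g \<Longrightarrow> Q \<in> spec_dom s \<and> spec s Q = \<phi> (g, \<sigma>)"
    using orbit[OF Q(1)] by (elim exE conjE) blast
  have "sa.good \<phi>"
    unfolding sa.good_def
  proof (intro conjI allI impI \<phi>(1))
    fix a b assume ab: "a < n" "b < n"
    obtain \<psi> where \<psi>: "sa.orbit_sum \<psi>"
      "\<And>g \<sigma> s. (g, \<sigma>) \<in> J \<Longrightarrow> good_point s g \<Longrightarrow>
        Q * gen $$ (a, b) \<in> spec_dom s \<and> spec s (Q * gen $$ (a, b)) = \<psi> (g, \<sigma>)"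
      using orbit[OF Q(3)[OF ab]] by (elim exE conjE) blast
    show "sa.orbit_sum (\<lambda>j. \<phi> j * (case j of (g, \<sigma>) \<Rightarrow> map_mat rconst g) $$ (a, b))"
    proof (rule sa.orbit_sum_cong[OF \<psi>(1)])
      fix j assume "j \<in> J"
      then obtain g \<sigma> where j: "j = (g, \<sigma>)" "(g, \<sigma>) \<in> J" "g \<in> G" by (auto simp: J_def)
      obtain s where s: "good_point s g" using good_point_G[OF j(3)] by blast
      have gab: "gen $$ (a, b) \<in> spec_dom s" "spec s (gen $$ (a, b)) = rconst (g $$ (a, b))"
      proof -
        show "gen $$ (a, b) \<in> spec_dom s" using s ab by (simp add: good_point_def)
        have "map_mat (spec s) gen $$ (a, b) = map_mat rconst g $$ (a, b)" using s by (simp add: good_point_def)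
        then show "spec s (gen $$ (a, b)) = rconst (g $$ (a, b))"
          using ab G_carrier[OF j(3)] by (simp add: gen_def carrier_matD[OF refl_prod_carrier])
      qed
      have "\<psi> j = spec s Q * spec s (gen $$ (a, b))"
        using \<psi>(2)[OF j(2) s] \<phi>(2)[OF j(2) s] gab j(1) by (simp add: hom_on_mult[OF hom_on_spec])
      also have "\<dots> = \<phi> j * map_mat rconst g $$ (a, b)"
        using \<phi>(2)[OF j(2) s] gab ab G_carrier[OF j(3)] j(1) by simp
      finally show "\<psi> j = \<phi> j * (case j of (g, \<sigma>) \<Rightarrow> map_mat rconst g) $$ (a, b)" by (simp add: j(1))
    qed
  qed
  \<comment> \<open>a specialisation of \<open>x\<close> and of the parameters where \<open>Q\<close> does not vanish yields a suitable group element\<close>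
  moreover have "\<exists>j\<in>J. \<phi> j \<noteq> 0"
  proof -
    let ?Y = "xvar ` {..<m} \<union> params"
    let ?P = "ring_gen (range cE \<union> ?Y)"
    note PR = is_subring_ring_gen[of "range cE \<union> ?Y"]
    have sub: "range cE \<union> params \<subseteq> ?P" "xvar ` {..<m} \<subseteq> ?P" by (auto intro: ring_gen.incl)
    have "\<rho>gen i j \<in> ?P" if ij: "i < m" "j < m" for i j
      unfolding \<rho>gen_def
    proof (rule meval_in_subring[OF PR])
      fix ab assume "ab \<in> mvars (entry i j)"
      then obtain a b where "ab = (a, b)" "a < n" "b < n" using entry(1)[OF ij] by auto
      then show "gen $$ ab \<in> ?P"
        using gen_in_params ring_gen_mono[of "range cE \<union> params" "range cE \<union> ?Y"] by blast
    qed (use sub in auto)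
    then have "yvar i \<in> ?P" if "i < m" for i
      using that sub(2) unfolding yvar_def by (auto intro!: subring_sum[OF PR] subring_mult[OF PR])
    then have xyP: "range cE \<union> xy \<subseteq> ?P" using sub by (auto simp: xy_def)
    then have "Q \<in> ?P" using Q(1) ring_gen_least[OF PR] by blast
    moreover have "finite ?Y" by (simp add: params_finite)
    ultimately obtain \<psi> where \<psi>: "hom_on ?P \<psi>" "\<And>c. \<psi> (cE c) = c" "\<psi> Q \<noteq> 0"
      using nonvanishing_point[OF inj_idom_hom_cE _ _ Q(2)] by metis
    define us where "us = (\<lambda>a i. \<psi> (gvec a i))"
    define g where "g = refl_prod n B (map us [0..<2 * n])"
    note ph = params_hom[OF PR \<psi>(1) sub(1) \<psi>(2), folded us_def, folded g_def]
    define s where "s = (\<lambda>k. rconst (us (k div n) (k mod n)) :: 'k alg_closure rat_fun)"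
    have s: "good_point s g" unfolding s_def g_def by (rule good_point_exists(1)) (use ph(5) in \<open>simp add: us_def\<close>)
    have j: "(g, id) \<in> J" using ph(1) galois_id by (simp add: J_def)
    define \<xi> where "\<xi> = (\<lambda>i. \<psi> (xvar i))"
    \<comment> \<open>the same specialisation in two steps, first the parameters and then \<open>x\<close>\<close>
    define W where "W = {w \<in> spec_dom s. spec s w \<in> spec_dom \<xi>}"
    have W: "is_subring W" "hom_on W (\<lambda>w. spec \<xi> (spec s w))"
      unfolding W_def by (rule hom_on_preimage[OF hom_on_spec hom_on_spec(1)], rule hom_on_preimage(2)[OF hom_on_spec hom_on_spec])
    have cW: "cE c \<in> W" "spec \<xi> (spec s (cE c)) = \<psi> (cE c)" for c using \<psi>(2) by (auto simp: W_def cE_def)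
    have xW: "xvar i \<in> W" "spec \<xi> (spec s (xvar i)) = \<psi> (xvar i)" for i by (auto simp: W_def xvar_def \<xi>_def)
    have rW: "\<rho>gen i j \<in> W" "spec \<xi> (spec s (\<rho>gen i j)) = \<psi> (\<rho>gen i j)" if "i < m" "j < m" for i j
      using s that ph(4)[OF that] by (auto simp: W_def good_point_def)
    have yW: "yvar i \<in> W" "spec \<xi> (spec s (yvar i)) = \<psi> (yvar i)" if "i < m" for i
    proof -
      show "yvar i \<in> W" unfolding yvar_def using that rW xW by (intro subring_sum[OF W(1)] subring_mult[OF W(1)]) auto
      have "spec \<xi> (spec s (yvar i)) = (\<Sum>j<m. spec \<xi> (spec s (\<rho>gen i j * xvar j)))"
        unfolding yvar_def using that rW xW by (intro hom_on_sum[OF W] subring_mult[OF W(1)]) auto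
      also have "\<dots> = (\<Sum>j<m. \<psi> (\<rho>gen i j * xvar j))"
        using that rW xW ph(4)[OF that] sub(2)
        by (intro sum.cong refl) (auto simp: hom_on_mult[OF W] hom_on_mult[OF PR \<psi>(1)])
      also have "\<dots> = \<psi> (yvar i)"
        unfolding yvar_def using that ph(4)[OF that] sub(2)
        by (intro hom_on_sum[OF PR \<psi>(1), symmetric] subring_mult[OF PR]) auto
      finally show "spec \<xi> (spec s (yvar i)) = \<psi> (yvar i)" .
    qed
    have sub': "range cE \<union> xy \<subseteq> W \<inter> ?P" using cW xW yW xyP by (auto simp: xy_def)
    have I: "is_subring (W \<inter> ?P)" using W(1) PR by (auto simp: is_subring_def)
    have "spec \<xi> (spec s Q) = \<psi> Q"
      by (rule hom_on_agree[OF I hom_on_mono[OF W(2)] hom_on_mono[OF \<psi>(1)] sub' _ Q(1)])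
        (use cW xW yW in \<open>auto simp: xy_def\<close>)
    then have "spec s Q \<noteq> 0" using \<psi>(3) hom_on_zero[OF hom_on_spec] by metis
    then show ?thesis using \<phi>(2)[OF j s] j by auto
  qed
  ultimately obtain j0 where j0: "sa.good \<phi>" "j0 \<in> J" "\<phi> j0 \<noteq> 0" by blast
  obtain \<Phi> where \<Phi>: "\<Phi> \<in> carrier_mat n n" "\<And>a b. a < n \<Longrightarrow> b < n \<Longrightarrow> \<Phi> $$ (a, b) \<in> rat_funs m" "det \<Phi> \<noteq> 0"
    "\<And>j. j \<in> J \<Longrightarrow> map_mat (actV j) \<Phi> = (case j of (g, \<sigma>) \<Rightarrow> map_mat rconst g) * \<Phi>"
    using sa.hilbert_90[OF j0] by blast
  show ?thesis by (rule that[OF \<Phi>(1-3)]) (use \<Phi>(4) in auto)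
qed

end

section \<open>Invariants of a generic matrix\<close>

context so_representation
begin

definition MX :: "'k alg_closure rat_fun rat_fun set"
  where "MX = rvar ` {..<n * n}"

text \<open>
  The field of rational functions on the space of matrices alone, inside the field of functions on
  both spaces.
\<close>

definition FW :: "'k alg_closure rat_fun rat_fun set"
  where "FW = field_gen (range cE \<union> MX)"

definition Xm :: "'k alg_closure rat_fun rat_fun mat"
  where "Xm = mat n n (\<lambda>(i, j). mvx i j)"

lemma MX_iff: "x \<in> MX \<longleftrightarrow> (\<exists>i<n. \<exists>j<n. x = mvx i j)"
proof
  assume "x \<in> MX"
  then obtain k where k: "k < n * n" "x = rvar k" by (auto simp: MX_def)
  show "\<exists>i<n. \<exists>j<n. x = mvx i j"
    by (intro exI[of _ "k mod n"] exI[of _ "k div n"] conjI div_mod_bound k(1)) (use k rvar_mvx in simp)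
next
  assume "\<exists>i<n. \<exists>j<n. x = mvx i j"
  then show "x \<in> MX" by (auto simp: MX_def mvx_def mvx_bound)
qed

lemma mvx_in_MX: "i < n \<Longrightarrow> j < n \<Longrightarrow> mvx i j \<in> MX"
  by (auto simp: MX_iff)

lemma Xm_carrier: "Xm \<in> carrier_mat n n"
  by (simp add: Xm_def)

lemma Xm_index: "i < n \<Longrightarrow> j < n \<Longrightarrow> Xm $$ (i, j) = mvx i j"
  by (simp add: Xm_def)

lemma FW_subfield: "is_subfield FW" and FW_subring: "is_subring FW"
  unfolding FW_def by (rule is_subfield_field_gen is_subring_field_gen)+

lemma cE_in_FW: "cE c \<in> FW" and MX_in_FW: "x \<in> MX \<Longrightarrow> x \<in> FW"
  unfolding FW_def by (auto intro: field_gen_incl)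

lemma actE_hom: "j \<in> J \<Longrightarrow> inj_idom_hom (actE j)"
  using actE(1) by (cases j) auto

lemma actE_MX_ring:
  assumes j: "j \<in> J" and f: "f \<in> ring_gen (range cE \<union> MX)"
  shows "actE j f \<in> ring_gen (range cE \<union> MX)"
proof -
  obtain g \<sigma> where j': "j = (g, \<sigma>)" "(g, \<sigma>) \<in> J" using j by (metis surj_pair)
  let ?R = "ring_gen (range cE \<union> MX)"
  note R = is_subring_ring_gen[of "range cE \<union> MX"]
  interpret inj_idom_hom "actE j" by (rule actE_hom[OF j])
  have "is_subring {f. actE j f \<in> ?R}"
    using R by (auto simp: is_subring_def hom_distribs)
  moreover have "range cE \<union> MX \<subseteq> {f. actE j f \<in> ?R}"
  proof
    have c: "cE c \<in> ?R" and x: "l < n \<Longrightarrow> i < n \<Longrightarrow> mvx l i \<in> ?R" for c l i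
      by (auto intro: ring_gen.incl mvx_in_MX)
    fix a assume "a \<in> range cE \<union> MX"
    then consider c where "a = cE c" | i l where "a = mvx i l" "i < n" "l < n" by (auto simp: MX_iff)
    then show "a \<in> {f. actE j f \<in> ?R}"
      by cases (auto simp: j' actE(3,5)[OF j'(2)] intro!: subring_sum[OF R] subring_mult[OF R] c x)
  qed
  ultimately show ?thesis using f ring_gen_least by blast
qed

lemma actE_stable:
  assumes j: "j \<in> J" and f: "f \<in> FW"
  shows "actE j f \<in> FW"
proof -
  interpret field_hom "actE j" by (rule field_hom_of_inj[OF actE_hom[OF j]])
  have "is_subfield {f. actE j f \<in> FW}"
    using FW_subfield by (auto simp: is_subfield_def is_subring_def hom_distribs)
  moreover have "range cE \<union> MX \<subseteq> {f. actE j f \<in> FW}"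
    using actE_MX_ring[OF j ring_gen.incl] ring_gen_subset_field_gen unfolding FW_def by blast
  ultimately show ?thesis using f field_gen_least unfolding FW_def by blast
qed

lemma actE_one: "f \<in> FW \<Longrightarrow> actE (1\<^sub>m n, id) f = f"
proof -
  interpret c: inj_idom_hom cE by (rule inj_idom_hom_cE)
  assume f: "f \<in> FW"
  have "actE (1\<^sub>m n, id) f = id f"
  proof (rule field_gen_hom_agree[OF actE(1)[OF one_J]])
    show "inj_idom_hom (id :: 'k alg_closure rat_fun rat_fun \<Rightarrow> _)" by unfold_locales auto
    show "f \<in> field_gen (range cE \<union> MX)" using f by (simp add: FW_def)
    fix a :: "'k alg_closure rat_fun rat_fun" assume "a \<in> range cE \<union> MX"
    then consider c where "a = cE c" | i j where "a = mvx i j" "i < n" "j < n" by (auto simp: MX_iff)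
    then show "actE (1\<^sub>m n, id) a = id a"
    proof cases
      case 1 then show ?thesis using actE(5)[OF one_J, of c] by simp
    next
      case 2
      have "actE (1\<^sub>m n, id) (mvx i j) = (\<Sum>l<n. mvx l j * unitf i l)"
        unfolding actE(3)[OF one_J 2(2,3)] using 2 by (intro sum.cong refl) (auto simp: unitf_def)
      then show ?thesis using 2 sum_unitf[OF 2(2), of "\<lambda>l. mvx l j"] by simp
    qed
  qed
  then show ?thesis by simp
qed

lemma char_E: "n' > 0 \<Longrightarrow> of_nat n' \<noteq> (0 :: 'k alg_closure rat_fun rat_fun)"
proof -
  interpret c: inj_idom_hom cE by (rule inj_idom_hom_cE)
  show "n' > 0 \<Longrightarrow> of_nat n' \<noteq> (0 :: 'k alg_closure rat_fun rat_fun)"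
    by (metis c.hom_of_nat c.hom_0_iff of_nat_eq_0_iff less_numeral_extra(3))
qed

lemma actE_cE_mat: "(g, \<sigma>) \<in> J \<Longrightarrow> map_mat (actE (g, \<sigma>)) (map_mat cE M) = map_mat cE (map_mat \<sigma> M)"
  by (intro eq_matI) (auto simp: actE(5))

lemma actE_Xm:
  assumes "(g, \<sigma>) \<in> J" shows "map_mat (actE (g, \<sigma>)) Xm = map_mat cE g * Xm"
proof (rule eq_matI)
  have gc: "g \<in> carrier_mat n n" using assms by (auto simp: J_def G_carrier)
  fix i j assume "i < dim_row (map_mat cE g * Xm)" "j < dim_col (map_mat cE g * Xm)"
  then have ij: "i < n" "j < n" using gc by (auto simp: Xm_def)
  have "(map_mat cE g * Xm) $$ (i, j) = (\<Sum>l<n. map_mat cE g $$ (i, l) * Xm $$ (l, j))"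
    using gc Xm_carrier ij by (intro mult_index) auto
  also have "\<dots> = (\<Sum>l<n. cE (g $$ (i, l)) * mvx l j)"
    using gc ij by (intro sum.cong refl) (simp add: Xm_index)
  finally show "map_mat (actE (g, \<sigma>)) Xm $$ (i, j) = (map_mat cE g * Xm) $$ (i, j)"
    using ij actE(3)[OF assms ij] Xm_carrier by (simp add: Xm_index)
qed (use assms in \<open>auto simp: J_def Xm_def dest: G_carrier\<close>)

text \<open>Specialising the generic matrix to \<open>M\<close> leaves functions on \<open>V\<close>, in which \<open>x\<close> is still generic.\<close>

definition mpoint :: "'k alg_closure mat \<Rightarrow> nat \<Rightarrow> 'k alg_closure rat_fun"
  where "mpoint M = (\<lambda>k. rconst (M $$ (k mod n, k div n)))"

lemma spec_mpoint:
  "cE c \<in> spec_dom (mpoint M)" "spec (mpoint M) (cE c) = rconst c"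
  "mvx i j \<in> spec_dom (mpoint M)" "i < n \<Longrightarrow> spec (mpoint M) (mvx i j) = rconst (M $$ (i, j))"
  by (simp_all add: cE_def mvx_def mpoint_def)

text \<open>
  The Gram matrix of the generic matrix; its entries and \<open>det Xm\<close> are the basic invariants.
\<close>

definition bmat :: "'k alg_closure rat_fun rat_fun mat"
  where "bmat = transpose_mat Xm * BE * Xm"

lemma bmat_carrier: "bmat \<in> carrier_mat n n"
  using Xm_carrier BE_carrier unfolding bmat_def by (auto intro!: mult_carrier_mat[of _ n n])

lemma bmat_hom_on:
  fixes \<psi> :: "'k alg_closure rat_fun rat_fun \<Rightarrow> 'f::field"
  assumes R: "is_subring R" "hom_on R \<psi>" and c: "\<And>c. cE c \<in> R" and x: "\<And>i j. i < n \<Longrightarrow> j < n \<Longrightarrow> mvx i j \<in> R"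
  shows "map_mat \<psi> bmat = transpose_mat (map_mat \<psi> Xm) * map_mat \<psi> BE * map_mat \<psi> Xm"
    "i < n \<Longrightarrow> j < n \<Longrightarrow> bmat $$ (i, j) \<in> R" "det Xm \<in> R" "\<psi> (det Xm) = det (map_mat \<psi> Xm)"
proof -
  have tc: "transpose_mat Xm \<in> carrier_mat n n" using Xm_carrier by simp
  have tR: "transpose_mat Xm $$ (i, j) \<in> R" if "i < n" "j < n" for i j
    using that x Xm_carrier by (simp add: Xm_index)
  have BR: "BE $$ (i, j) \<in> R" if "i < n" "j < n" for i j
    using that c B(1) by (simp add: BE_def)
  have xR: "Xm $$ (i, j) \<in> R" if "i < n" "j < n" for i j
    using that x by (simp add: Xm_index)
  note 1 = map_mat_mult_hom_on[OF R tc tR BE_carrier BR]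
  have c1: "transpose_mat Xm * BE \<in> carrier_mat n n" using tc BE_carrier by (intro mult_carrier_mat)
  have r1: "(transpose_mat Xm * BE) $$ (i, j) \<in> R" if "i < n" "j < n" for i j using that by (intro 1(2))
  note 2 = map_mat_mult_hom_on[OF R c1 r1 Xm_carrier xR]
  have "map_mat \<psi> (transpose_mat Xm) = transpose_mat (map_mat \<psi> Xm)" by (intro eq_matI) auto
  moreover have "map_mat \<psi> (transpose_mat Xm * BE) = map_mat \<psi> (transpose_mat Xm) * map_mat \<psi> BE"
    by (rule map_mat_mult_hom_on(1)[OF R tc tR BE_carrier BR])
  moreover have "map_mat \<psi> (transpose_mat Xm * BE * Xm) = map_mat \<psi> (transpose_mat Xm * BE) * map_mat \<psi> Xm"
    by (rule map_mat_mult_hom_on(1)[OF R c1 r1 Xm_carrier xR])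
  ultimately show "map_mat \<psi> bmat = transpose_mat (map_mat \<psi> Xm) * map_mat \<psi> BE * map_mat \<psi> Xm"
    by (simp add: bmat_def)
  show "i < n \<Longrightarrow> j < n \<Longrightarrow> bmat $$ (i, j) \<in> R" unfolding bmat_def by (intro 2(2))
  show "det Xm \<in> R" using xR Xm_carrier by (intro subring_det[OF R(1)]) auto
  show "\<psi> (det Xm) = det (map_mat \<psi> Xm)" using xR Xm_carrier by (intro hom_on_det[OF R]) auto
qed

lemma spec_mpoint_mats:
  assumes "M \<in> carrier_mat n n"
  shows "map_mat (spec (mpoint M)) Xm = map_mat rconst M" "map_mat (spec (mpoint M)) BE = map_mat rconst B"
    "map_mat (spec (mpoint M)) bmat = map_mat rconst (transpose_mat M * B * M)"
    "spec (mpoint M) (det Xm) = rconst (det M)"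
proof -
  interpret r: inj_idom_hom "rconst :: 'k alg_closure \<Rightarrow> _" by (rule inj_idom_hom_rconst)
  show X: "map_mat (spec (mpoint M)) Xm = map_mat rconst M"
    using assms by (intro eq_matI) (auto simp: Xm_def spec_mpoint)
  show BB: "map_mat (spec (mpoint M)) BE = map_mat rconst B"
    by (intro eq_matI) (auto simp: BE_def spec_mpoint)
  note h = bmat_hom_on[OF hom_on_spec[of "mpoint M"] spec_mpoint(1) spec_mpoint(3)]
  have "map_mat rconst (transpose_mat M * B * M) = map_mat rconst (transpose_mat M * B) * map_mat rconst M"
    using assms B by (intro r.mat_hom_mult[of _ n n _ n]) (auto intro!: mult_carrier_mat[of _ n n])
  also have "map_mat rconst (transpose_mat M * B) = map_mat rconst (transpose_mat M) * map_mat rconst B"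
    using assms B by (intro r.mat_hom_mult[of _ n n _ n]) auto
  also have "map_mat rconst (transpose_mat M) = transpose_mat (map_mat rconst M)" by (intro eq_matI) auto
  finally show "map_mat (spec (mpoint M)) bmat = map_mat rconst (transpose_mat M * B * M)"
    by (simp add: h(1) X BB)
  show "spec (mpoint M) (det Xm) = rconst (det M)"
    using h(4) by (simp add: X)
qed

lemma det_Xm: "det Xm \<noteq> 0"
proof
  assume "det Xm = 0"
  then have "rconst (det (1\<^sub>m n :: 'k alg_closure mat)) = (0 :: 'k alg_closure rat_fun)"
    unfolding spec_mpoint_mats(4)[OF one_carrier_mat, symmetric]
    by (simp add: hom_on_zero[OF hom_on_spec[of "mpoint (1\<^sub>m n)"]])
  interpret r: inj_idom_hom "rconst :: 'k alg_closure \<Rightarrow> _" by (rule inj_idom_hom_rconst)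
  show False using \<open>rconst (det (1\<^sub>m n :: 'k alg_closure mat)) = _\<close> by simp
qed

lemma semilinear_W: "semilinear_action J actE (\<lambda>(g, \<sigma>). map_mat cE (\<rho> g)) FW m (1\<^sub>m n, id)"
proof -
  interpret c: inj_idom_hom cE by (rule inj_idom_hom_cE)
  show ?thesis
  proof (rule semilinear_action.intro)
    show "inj_idom_hom (actE j)" if "j \<in> J" for j using that by (rule actE_hom)
    show "is_subfield FW" by (rule FW_subfield)
    show "actE j x \<in> FW" if "j \<in> J" "x \<in> FW" for j x using that by (rule actE_stable)
    show "of_nat k \<noteq> (0 :: 'k alg_closure rat_fun rat_fun)" if "0 < k" for k using that by (rule char_E)
    show "(1\<^sub>m n, id) \<in> J" by (rule one_J)
    show "actE (1\<^sub>m n, id) x = x" if "x \<in> FW" for x using that by (rule actE_one)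
    show "(case (1\<^sub>m n :: 'k alg_closure mat, id :: 'k alg_closure \<Rightarrow> 'k alg_closure) of (g, \<sigma>) \<Rightarrow> map_mat cE (\<rho> g)) = 1\<^sub>m m"
      by (simp add: \<rho>_one c.mat_hom_one)
    fix j assume j: "j \<in> J"
    obtain g \<sigma> where j': "j = (g, \<sigma>)" by force
    have g: "g \<in> G" using j j' by (simp add: J_def)
    note gc = \<rho>_carrier[OF g]
    show "(case j of (g, \<sigma>) \<Rightarrow> map_mat cE (\<rho> g)) \<in> carrier_mat m m" using gc j' by simp
    show "(case j of (g, \<sigma>) \<Rightarrow> map_mat cE (\<rho> g)) $$ (a, b) \<in> FW" if "a < m" "b < m" for a b
      using gc j' that by (simp add: cE_in_FW)
    obtain h where h: "h \<in> G" "h * g = 1\<^sub>m n" using G_inverse[OF g] by blast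
    show "\<exists>S\<in>carrier_mat m m. (\<forall>a<m. \<forall>b<m. S $$ (a, b) \<in> FW) \<and> S * (case j of (g, \<sigma>) \<Rightarrow> map_mat cE (\<rho> g)) = 1\<^sub>m m"
    proof (rule bexI[of _ "map_mat cE (\<rho> h)"])
      show "(\<forall>a<m. \<forall>b<m. map_mat cE (\<rho> h) $$ (a, b) \<in> FW) \<and> map_mat cE (\<rho> h) * (case j of (g, \<sigma>) \<Rightarrow> map_mat cE (\<rho> g)) = 1\<^sub>m m"
        using \<rho>_carrier[OF h(1)] c.mat_hom_mult[OF \<rho>_carrier[OF h(1)] gc] \<rho>_inverse[OF g h(1,2)] j'
        by (simp add: cE_in_FW c.mat_hom_one)
    qed (use \<rho>_carrier[OF h(1)] in simp)
  next
    fix i j assume i: "i \<in> J" and j: "j \<in> J"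
    obtain g \<sigma> h \<tau> where ij: "i = (g, \<sigma>)" "j = (h, \<tau>)" by (metis surj_pair)
    have g: "g \<in> G" and \<sigma>: "\<sigma> \<in> galois_group" and h: "h \<in> G" using i j by (auto simp: J_def ij)
    show "\<exists>l\<in>J. (\<forall>x\<in>FW. actE l x = actE i (actE j x)) \<and> (case l of (g, \<sigma>) \<Rightarrow> map_mat cE (\<rho> g)) =
        map_mat (actE i) (case j of (g, \<sigma>) \<Rightarrow> map_mat cE (\<rho> g)) * (case i of (g, \<sigma>) \<Rightarrow> map_mat cE (\<rho> g))"
    proof (rule bexI[OF _ times_J[OF i j]], intro conjI ballI)
      show "actE (times_J i j) x = actE i (actE j x)" for x by (rule actE_times[OF i j])
      have "map_mat (actE i) (map_mat cE (\<rho> h)) = map_mat cE (map_mat \<sigma> (\<rho> h))"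
        using i by (simp add: ij actE_cE_mat)
      moreover have "map_mat cE (\<rho> (map_mat \<sigma> h * g)) = map_mat cE (map_mat \<sigma> (\<rho> h)) * map_mat cE (\<rho> g)"
        unfolding \<rho>_mult[OF galois_G[OF \<sigma> h] g] galois_\<rho>[OF \<sigma> h]
        using \<rho>_carrier[OF g] \<rho>_carrier[OF h] by (intro c.mat_hom_mult[of _ m m _ m]) auto
      ultimately show "(case times_J i j of (g, \<sigma>) \<Rightarrow> map_mat cE (\<rho> g)) =
        map_mat (actE i) (case j of (g, \<sigma>) \<Rightarrow> map_mat cE (\<rho> g)) * (case i of (g, \<sigma>) \<Rightarrow> map_mat cE (\<rho> g))"
        by (simp add: ij times_J_def)
    qed
  qed
qed

text \<open>
  The analogue of \<open>covariant_frame_V\<close> for the action on matrices. Here the entries of \<open>g\<close> are orbit sums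
  without any denominator, since \<open>g = (g * Xm) * V\<close> for the inverse \<open>V\<close> of \<open>Xm\<close>, and hence so are the entries of \<open>\<rho> g\<close>.
\<close>

lemma covariant_frame_W:
  obtains \<Psi> where "\<Psi> \<in> carrier_mat m m" "\<And>a b. a < m \<Longrightarrow> b < m \<Longrightarrow> \<Psi> $$ (a, b) \<in> FW" "det \<Psi> \<noteq> 0"
    "\<And>g \<sigma>. (g, \<sigma>) \<in> J \<Longrightarrow> map_mat (actE (g, \<sigma>)) \<Psi> = map_mat cE (\<rho> g) * \<Psi>"
proof -
  interpret sa: semilinear_action J actE "\<lambda>(g, \<sigma>). map_mat cE (\<rho> g)" FW m "(1\<^sub>m n, id)"
    by (rule semilinear_W)
  interpret c: inj_idom_hom cE by (rule inj_idom_hom_cE)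
  obtain V where V: "V \<in> carrier_mat n n" "Xm * V = 1\<^sub>m n" "\<And>i j. i < n \<Longrightarrow> j < n \<Longrightarrow> V $$ (i, j) \<in> FW"
  proof (rule inverse_mat_exists[OF Xm_carrier det_Xm])
    fix h assume h: "h \<in> carrier_mat n n" "Xm * h = 1\<^sub>m n"
      "\<And>R i j. is_subfield R \<Longrightarrow> (\<And>i j. i < n \<Longrightarrow> j < n \<Longrightarrow> Xm $$ (i, j) \<in> R) \<Longrightarrow>
        i < n \<Longrightarrow> j < n \<Longrightarrow> h $$ (i, j) \<in> R"
    show ?thesis
      by (rule that[OF h(1,2)]) (use h(3)[OF FW_subfield] in \<open>simp add: Xm_index MX_in_FW mvx_in_MX\<close>)
  qed
  have entry_orbit: "sa.orbit_sum (\<lambda>j. cE (fst j $$ (a, b)))" if ab: "a < n" "b < n" for a b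
  proof (rule sa.orbit_sum_cong)
    show "sa.orbit_sum (\<lambda>j. \<Sum>l<n. actE j (mvx a l) * V $$ (l, b))"
    proof (intro sa.orbit_sum_sum sa.orbit_sum_mult)
      fix l assume "l \<in> {..<n}"
      then have "mvx a l \<in> FW" "V $$ (l, b) \<in> FW" using ab V(3) MX_in_FW[OF mvx_in_MX] by auto
      then show "sa.orbit_sum (\<lambda>j. actE j (mvx a l))" "sa.orbit_sum (\<lambda>j. V $$ (l, b))"
        by (auto intro: sa.orbit_sum_orbit sa.orbit_sum_const)
    qed
    fix j assume "j \<in> J"
    then obtain g \<sigma> where j: "j = (g, \<sigma>)" "(g, \<sigma>) \<in> J" by (metis surj_pair)
    then have gc: "g \<in> carrier_mat n n" by (auto simp: J_def G_carrier)
    have "map_mat (actE (g, \<sigma>)) Xm * V = map_mat cE g * (Xm * V)"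
      unfolding actE_Xm[OF j(2)] by (rule assoc_mult_mat[of _ n n _ n _ n]) (use gc Xm_carrier V in auto)
    also have "\<dots> = map_mat cE g" using V(2) gc by (simp add: right_mult_one_mat[of _ n n])
    finally have "(map_mat (actE (g, \<sigma>)) Xm * V) $$ (a, b) = cE (g $$ (a, b))" using gc ab by simp
    moreover have "(map_mat (actE (g, \<sigma>)) Xm * V) $$ (a, b) = (\<Sum>l<n. map_mat (actE (g, \<sigma>)) Xm $$ (a, l) * V $$ (l, b))"
      using ab Xm_carrier V(1) by (intro mult_index) auto
    ultimately show "(\<Sum>l<n. actE j (mvx a l) * V $$ (l, b)) = cE (fst j $$ (a, b))"
      using ab Xm_carrier by (simp add: j Xm_index)
  qed
  have T_orbit: "sa.orbit_sum (\<lambda>j. 1 * (case j of (g, \<sigma>) \<Rightarrow> map_mat cE (\<rho> g)) $$ (a, b))" if ab: "a < m" "b < m" for a b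
  proof (rule sa.orbit_sum_cong)
    show "sa.orbit_sum (\<lambda>j. meval (cE \<circ> to_ac) (\<lambda>ij. cE (fst j $$ ij)) (entry a b))"
      unfolding meval_def
    proof (intro sa.orbit_sum_sum sa.orbit_sum_mult sa.orbit_sum_prod sa.orbit_sum_power)
      fix \<mu> ij assume "\<mu> \<in> Poly_Mapping.keys (entry a b)" "ij \<in> Poly_Mapping.keys \<mu>"
      then have "ij \<in> mvars (entry a b)" by (auto simp: mvars_def)
      then obtain i j where "ij = (i, j)" "i < n" "j < n" using entry(1)[OF ab] by auto
      then show "sa.orbit_sum (\<lambda>j. cE (fst j $$ ij))" using entry_orbit by simp
    qed (auto intro!: sa.orbit_sum_const cE_in_FW)
    fix j assume "j \<in> J"
    then obtain g \<sigma> where j: "j = (g, \<sigma>)" "g \<in> G" by (auto simp: J_def)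
    have "cE (\<rho> g $$ (a, b)) = meval (cE \<circ> to_ac) (cE \<circ> (\<lambda>ij. g $$ ij)) (entry a b)"
      unfolding entry(2)[OF ab j(2)] by (rule c.hom_meval)
    then show "meval (cE \<circ> to_ac) (\<lambda>ij. cE (fst j $$ ij)) (entry a b) =
        1 * (case j of (g, \<sigma>) \<Rightarrow> map_mat cE (\<rho> g)) $$ (a, b)"
      using ab \<rho>_carrier[OF j(2)] by (simp add: j comp_def)
  qed
  have good: "sa.good (\<lambda>_. 1)"
    unfolding sa.good_def using T_orbit sa.orbit_sum_const[OF subring_one[OF FW_subring]] by simp
  show ?thesis
  proof (rule sa.hilbert_90[OF good one_J one_neq_zero])
    fix \<Psi> assume \<Psi>: "\<Psi> \<in> carrier_mat m m" "\<And>a b. a < m \<Longrightarrow> b < m \<Longrightarrow> \<Psi> $$ (a, b) \<in> FW" "det \<Psi> \<noteq> 0"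
      "\<And>j. j \<in> J \<Longrightarrow> map_mat (actE j) \<Psi> = (case j of (g, \<sigma>) \<Rightarrow> map_mat cE (\<rho> g)) * \<Psi>"
    show ?thesis by (rule that[OF \<Psi>(1-3)]) (use \<Psi>(4) in auto)
  qed
qed

definition bset :: "'k alg_closure rat_fun rat_fun set"
  where "bset = (\<lambda>ij. bmat $$ ij) ` ({..<n} \<times> {..<n}) \<union> {det Xm}"

lemma bset_in_ring: "bset \<subseteq> ring_gen (range cE \<union> MX)"
proof -
  note R = is_subring_ring_gen[of "range cE \<union> MX"]
  have "hom_on (ring_gen (range cE \<union> MX)) id" by (simp add: hom_on_def)
  moreover have "cE c \<in> ring_gen (range cE \<union> MX)"
    and "i < n \<Longrightarrow> j < n \<Longrightarrow> mvx i j \<in> ring_gen (range cE \<union> MX)" for c i j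
    by (auto intro: ring_gen.incl mvx_in_MX)
  ultimately show ?thesis using bmat_hom_on(2,3)[OF R] by (auto simp: bset_def)
qed

lemma bset_in_FW: "bset \<subseteq> FW"
  using bset_in_ring ring_gen_subset_field_gen unfolding FW_def by blast

lemma bset_fixed:
  assumes j: "j \<in> J" and f: "f \<in> bset"
  shows "actE j f = f"
proof -
  obtain g \<sigma> where j': "j = (g, \<sigma>)" "(g, \<sigma>) \<in> J" using j by (metis surj_pair)
  have g: "g \<in> G" and \<sigma>: "\<sigma> \<in> galois_group" using j' by (auto simp: J_def)
  interpret c: inj_idom_hom cE by (rule inj_idom_hom_cE)
  have gE: "map_mat cE g \<in> carrier_mat n n" using G_carrier[OF g] by simp
  note h = bmat_hom_on[OF is_subring_UNIV hom_on_fieldI[OF actE_hom[OF j]] UNIV_I UNIV_I]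
  have B': "map_mat (actE j) BE = BE"
    unfolding BE_def j'(1) actE_cE_mat[OF j'(2)] galois_map_B[OF \<sigma>] ..
  have gB: "transpose_mat (map_mat cE g) * BE * map_mat cE g = BE"
  proof -
    have "map_mat cE (transpose_mat g * B * g) = map_mat cE (transpose_mat g * B) * map_mat cE g"
      using G_carrier[OF g] B by (intro c.mat_hom_mult[of _ n n _ n]) (auto intro!: mult_carrier_mat[of _ n n])
    also have "map_mat cE (transpose_mat g * B) = map_mat cE (transpose_mat g) * BE"
      unfolding BE_def using G_carrier[OF g] B by (intro c.mat_hom_mult[of _ n n _ n]) auto
    also have "map_mat cE (transpose_mat g) = transpose_mat (map_mat cE g)" by (intro eq_matI) auto
    finally show ?thesis unfolding G_form[OF g] BE_def by (rule sym)
  qed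
  have "map_mat (actE j) bmat = transpose_mat (map_mat cE g * Xm) * BE * (map_mat cE g * Xm)"
    unfolding h(1) B' by (simp add: j'(1) actE_Xm[OF j'(2)])
  also have "\<dots> = bmat"
    unfolding conj_mult[OF BE_carrier gE Xm_carrier] gB bmat_def ..
  finally have b: "map_mat (actE j) bmat = bmat" .
  have "actE j (det Xm) = det (map_mat cE g * Xm)"
    using h(4) by (simp add: j'(1) actE_Xm[OF j'(2)])
  also have "\<dots> = det (map_mat cE g) * det Xm" by (rule det_mult[OF gE Xm_carrier])
  also have "det (map_mat cE g) = 1" using G_det[OF g] by simp
  finally have d: "actE j (det Xm) = det Xm" by simp
  show ?thesis
  proof (cases "f = det Xm")
    case False
    then obtain a b where ab: "a < n" "b < n" "f = bmat $$ (a, b)" using f by (auto simp: bset_def)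
    have "map_mat (actE j) bmat $$ (a, b) = bmat $$ (a, b)" by (simp only: \<open>map_mat (actE j) bmat = bmat\<close>)
    then show ?thesis using ab bmat_carrier by simp
  qed (use d in simp)
qed

text \<open>
  If \<open>f\<close> were not a rational function of the basic invariants, then there would be two matrices at
  which the basic invariants agree and \<open>f\<close> does not. But matrices with the same Gram matrix and the
  same nonzero determinant differ by an element \<open>g\<close> of the group, and \<open>f\<close> is invariant under \<open>g\<close>.
\<close>

lemma invariant_in_bset_field:
  assumes f: "f \<in> FW" "\<And>j. j \<in> J \<Longrightarrow> actE j f = f"
  shows "f \<in> field_gen (range cE \<union> bset)"
proof (rule ccontr)
  assume not: "f \<notin> field_gen (range cE \<union> bset)"
  obtain P Q where PQ: "P \<in> ring_gen (range cE \<union> MX)" "Q \<in> ring_gen (range cE \<union> MX)" "Q \<noteq> 0" "f = P / Q"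
    using field_gen_fractions[OF f(1)[unfolded FW_def]] by blast
  let ?S = "ring_gen (range cE \<union> bset \<union> (MX \<union> {f}))" and ?M = "ring_gen (range cE \<union> MX)"
  note SR = is_subring_ring_gen[of "range cE \<union> bset \<union> (MX \<union> {f})"] and MR = is_subring_ring_gen[of "range cE \<union> MX"]
  have MS: "?M \<subseteq> ?S" by (rule ring_gen_mono) auto
  have cS: "cE c \<in> ?S" "cE c \<in> ?M" and xS: "x \<in> MX \<Longrightarrow> x \<in> ?S" "x \<in> MX \<Longrightarrow> x \<in> ?M" and fS: "f \<in> ?S" for c x
    by (auto intro: ring_gen.incl)
  have dM: "det Xm \<in> ?M" using bset_in_ring by (auto simp: bset_def)
  have "Q * det Xm \<in> ?S" using MS PQ dM subring_mult[OF SR] by blast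
  moreover have "Q * det Xm \<noteq> 0" using PQ det_Xm by simp
  moreover have "finite bset" "finite (MX \<union> {f})" by (auto simp: bset_def MX_def)
  ultimately obtain \<psi>1 \<psi>2 where \<psi>: "hom_on ?S \<psi>1" "hom_on ?S \<psi>2" "\<And>c. \<psi>1 (cE c) = c" "\<And>c. \<psi>2 (cE c) = c"
    "\<And>y. y \<in> bset \<Longrightarrow> \<psi>1 y = \<psi>2 y" "\<psi>1 (Q * det Xm) \<noteq> 0" "\<psi>2 (Q * det Xm) \<noteq> 0" "\<psi>1 f \<noteq> \<psi>2 f"
    using separating_points[OF inj_idom_hom_cE _ _ fS not, of "Q * det Xm"] by metis
  define M1 M2 where "M1 = map_mat \<psi>1 Xm" and "M2 = map_mat \<psi>2 Xm"
  have Mc: "M1 \<in> carrier_mat n n" "M2 \<in> carrier_mat n n" using Xm_carrier by (auto simp: M1_def M2_def)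
  have BB: "map_mat \<psi>1 BE = B" "map_mat \<psi>2 BE = B"
    by (intro eq_matI; auto simp: BE_def \<psi>)+
  note h1 = bmat_hom_on[OF SR \<psi>(1) cS(1) xS(1)[OF mvx_in_MX], unfolded BB M1_def[symmetric]]
  note h2 = bmat_hom_on[OF SR \<psi>(2) cS(1) xS(1)[OF mvx_in_MX], unfolded BB M2_def[symmetric]]
  have dQ: "\<psi>1 Q \<noteq> 0" "\<psi>2 Q \<noteq> 0" "det M1 \<noteq> 0"
  proof -
    have "Q \<in> ?S" "det Xm \<in> ?S" using MS PQ(2) dM by blast+
    then show "\<psi>1 Q \<noteq> 0" "\<psi>2 Q \<noteq> 0" "det M1 \<noteq> 0"
      using \<psi>(6,7) h1(4) by (auto simp: hom_on_mult[OF SR \<psi>(1)] hom_on_mult[OF SR \<psi>(2)])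
  qed
  have det: "det M1 = det M2" using h1(4) h2(4) \<psi>(5)[of "det Xm"] by (simp add: bset_def)
  have "map_mat \<psi>1 bmat = map_mat \<psi>2 bmat"
    using \<psi>(5) bmat_carrier by (intro eq_matI) (auto simp: bset_def)
  then have gram: "transpose_mat M1 * B * M1 = transpose_mat M2 * B * M2" using h1(1) h2(1) by simp
  obtain V where V: "V \<in> carrier_mat n n" "M1 * V = 1\<^sub>m n" "V * M1 = 1\<^sub>m n" "det M1 * det V = 1"
    using inverse_mat_exists[OF Mc(1) dQ(3)] by metis
  \<comment> \<open>the group element that takes the first matrix to the second one\<close>
  define g where "g = M2 * V"
  have gM: "g * M1 = M2"
  proof -
    have "g * M1 = M2 * (V * M1)" unfolding g_def by (rule assoc_mult_mat[OF Mc(2) V(1) Mc(1)])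
    then show ?thesis using V(3) Mc by (simp add: right_mult_one_mat[of _ n n])
  qed
  have "transpose_mat g * B * g = transpose_mat V * (transpose_mat M1 * B * M1) * V"
    unfolding g_def conj_mult[OF B(1) Mc(2) V(1)] gram ..
  also have "\<dots> = transpose_mat (M1 * V) * B * (M1 * V)" by (rule conj_mult[OF B(1) Mc(1) V(1), symmetric])
  also have "\<dots> = B" using V(2) B by simp
  finally have "g \<in> G"
    using det_mult[OF Mc(2) V(1)] V(4) det Mc V by (auto simp: G_iff g_def)
  then have gJ: "(g, id) \<in> J" using galois_id by (simp add: J_def)
  interpret a: field_hom "actE (g, id)" by (rule field_hom_of_inj[OF actE_hom[OF gJ]])
  have aM: "actE (g, id) x \<in> ?M" if "x \<in> ?M" for x using actE_MX_ring[OF gJ that] .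
  have agree: "\<psi>1 (actE (g, id) x) = \<psi>2 x" if "x \<in> ?M" for x
  proof (rule hom_on_agree[OF MR _ hom_on_mono[OF \<psi>(2) MS] _ _ that])
    show "hom_on ?M (\<lambda>x. \<psi>1 (actE (g, id) x))"
      by (rule hom_on_mono[OF hom_on_preimage(2)[OF MR hom_on_fieldI[OF actE_hom[OF gJ]] SR \<psi>(1)]])
        (use aM MS in auto)
    show "range cE \<union> MX \<subseteq> ?M" by (auto intro: ring_gen.incl)
    fix x assume "x \<in> range cE \<union> MX"
    then consider c where "x = cE c" | i j where "x = mvx i j" "i < n" "j < n" by (auto simp: MX_iff)
    then show "\<psi>1 (actE (g, id) x) = \<psi>2 x"
    proof cases
      case 1 then show ?thesis using actE(5)[OF gJ, of c] \<psi> by simp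
    next
      case 2
      have "\<psi>1 (actE (g, id) x) = (\<Sum>l<n. \<psi>1 (cE (g $$ (i, l)) * mvx l j))"
        unfolding 2(1) actE(3)[OF gJ 2(2,3)] using cS xS(1)[OF mvx_in_MX] 2
        by (intro hom_on_sum[OF SR \<psi>(1)] subring_mult[OF SR]) auto
      also have "\<dots> = (\<Sum>l<n. g $$ (i, l) * M1 $$ (l, j))"
        using cS xS(1)[OF mvx_in_MX] 2 Xm_carrier
        by (intro sum.cong refl) (simp add: hom_on_mult[OF SR \<psi>(1)] \<psi> M1_def Xm_index)
      also have "\<dots> = (g * M1) $$ (i, j)"
        using 2 Mc G_carrier[OF \<open>g \<in> G\<close>] by (intro mult_index[symmetric]) auto
      also have "\<dots> = \<psi>2 x" unfolding gM using 2 Xm_carrier by (simp add: M2_def Xm_index)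
      finally show ?thesis .
    qed
  qed
  have "actE (g, id) P * Q = P * actE (g, id) Q"
  proof -
    have "actE (g, id) f * actE (g, id) Q = actE (g, id) P" using PQ(3,4) by (simp flip: a.hom_mult)
    then have faQ: "f * actE (g, id) Q = actE (g, id) P" by (simp add: f(2)[OF gJ])
    have "f * Q = P" using PQ(3,4) by simp
    then show ?thesis unfolding faQ[symmetric] by (simp only: mult_ac flip: \<open>f * Q = P\<close>)
  qed
  then have "\<psi>1 (actE (g, id) P * Q) = \<psi>1 (P * actE (g, id) Q)" by simp
  then have "\<psi>2 P * \<psi>1 Q = \<psi>1 P * \<psi>2 Q"
    using agree PQ aM MS by (simp add: hom_on_mult[OF SR \<psi>(1)] subset_iff)
  moreover have "\<psi>1 f * \<psi>1 Q = \<psi>1 P" "\<psi>2 f * \<psi>2 Q = \<psi>2 P"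
    using hom_on_mult[OF SR \<psi>(1) fS, of Q] hom_on_mult[OF SR \<psi>(2) fS, of Q] PQ MS by auto
  ultimately have "\<psi>2 f * (\<psi>2 Q * \<psi>1 Q) = \<psi>1 f * (\<psi>2 Q * \<psi>1 Q)" by (simp add: mult_ac)
  with dQ \<psi>(8) show False by simp
qed

definition kE :: "'k alg_closure rat_fun rat_fun set"
  where "kE = range (\<lambda>c. cE (to_ac c))"

text \<open>
  The first component of a pair acts trivially on constants, hence this is the fixed field of the
  Galois group.
\<close>

lemma galois_constants: "{x \<in> range cE. \<forall>j\<in>J. actE j x = x} = kE"
proof
  interpret c: inj_idom_hom cE by (rule inj_idom_hom_cE)
  show "{x \<in> range cE. \<forall>j\<in>J. actE j x = x} \<subseteq> kE"
  proof
    fix x assume "x \<in> {x \<in> range cE. \<forall>j\<in>J. actE j x = x}"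
    then obtain c where c: "x = cE c" "\<forall>j\<in>J. actE j (cE c) = cE c" by auto
    have "\<sigma> c = c" if "\<sigma> \<in> galois_group" for \<sigma>
    proof -
      have j: "(1\<^sub>m n, \<sigma>) \<in> J" using that G_one by (simp add: J_def)
      show ?thesis using c(2) j actE(5)[OF j, of c] by auto
    qed
    then have "c \<in> range to_ac" by (rule galois_fixed_field)
    then show "x \<in> kE" using c by (auto simp: kE_def)
  qed
  show "kE \<subseteq> {x \<in> range cE. \<forall>j\<in>J. actE j x = x}"
    by (auto simp: kE_def J_def actE(5) galois_hom(2))
qed

text \<open>
  The basic invariants generate over the algebraic closure. As they are already defined over \<open>k\<close>, the
  coefficients descend by \<open>fixed_field_generators\<close>.
\<close>

lemma invariants_W: "{f \<in> FW. \<forall>j\<in>J. actE j f = f} = field_gen (kE \<union> bset)"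
proof
  show "{f \<in> FW. \<forall>j\<in>J. actE j f = f} \<subseteq> field_gen (kE \<union> bset)"
  proof
    fix f assume f: "f \<in> {f \<in> FW. \<forall>j\<in>J. actE j f = f}"
    have sub: "is_subfield (range cE)"
    proof -
      interpret field_hom cE by (rule field_hom_of_inj[OF inj_idom_hom_cE])
      have "is_subring (range cE)" using is_subring_image[OF is_subring_UNIV hom_on_fieldI[OF inj_idom_hom_cE]] .
      then show ?thesis by (auto simp: is_subfield_def simp flip: hom_inverse)
    qed
    have st: "actE j x \<in> range cE" if "j \<in> J" "x \<in> range cE" for j x
      using that actE(5) by (cases j) auto
    have "f \<in> field_gen ({x \<in> range cE. \<forall>j\<in>J. actE j x = x} \<union> bset)"
      by (rule fixed_field_generators[OF actE_hom sub st bset_fixed])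
        (use f invariant_in_bset_field in auto)
    then show "f \<in> field_gen (kE \<union> bset)" by (simp add: galois_constants)
  qed
  have "is_subfield {f \<in> FW. \<forall>j\<in>J. actE j f = f}"
  proof -
    have "is_subfield {f. actE j f = f}" if "j \<in> J" for j
    proof -
      interpret field_hom "actE j" by (rule field_hom_of_inj[OF actE_hom[OF that]])
      show ?thesis by (auto simp: is_subfield_def is_subring_def hom_distribs)
    qed
    then show ?thesis using FW_subfield by (auto simp: is_subfield_def is_subring_def)
  qed
  moreover have "kE \<union> bset \<subseteq> {f \<in> FW. \<forall>j\<in>J. actE j f = f}"
  proof -
    have "kE \<subseteq> FW" using cE_in_FW by (auto simp: kE_def)
    moreover have "\<forall>j\<in>J. actE j x = x" if "x \<in> kE" for x using that galois_constants by auto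
    moreover have "\<forall>j\<in>J. actE j x = x" if "x \<in> bset" for x using that bset_fixed by auto
    ultimately show ?thesis using bset_in_FW by auto
  qed
  ultimately show "field_gen (kE \<union> bset) \<subseteq> {f \<in> FW. \<forall>j\<in>J. actE j f = f}"
    by (rule field_gen_least)
qed

end

section \<open>Algebraic independence of the invariants\<close>

text \<open>
  Laplace expansion along the last row: the determinant is an affine function of the corner entry.
\<close>

lemma det_corner:
  fixes f :: "nat \<times> nat \<Rightarrow> 'a::comm_ring_1"
  shows "det (mat (Suc l) (Suc l) (\<lambda>ij. if ij = (l, l) then r else f ij)) =
    r * det (mat l l f) + det (mat (Suc l) (Suc l) (\<lambda>ij. if ij = (l, l) then 0 else f ij))"
proof -
  define A where "A r = mat (Suc l) (Suc l) (\<lambda>ij. if ij = (l, l) then r else f ij)" for r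
  have A: "A r \<in> carrier_mat (Suc l) (Suc l)" for r by (simp add: A_def)
  have del: "mat_delete (A r) l j = mat_delete (A 0) l j" for r j
    by (rule eq_matI) (auto simp: mat_delete_def A_def)
  have "mat_delete (A r) l l = mat l l f" for r
    by (rule eq_matI) (auto simp: mat_delete_def A_def)
  then have cof: "cofactor (A r) l l = det (mat l l f)" for r
    by (simp add: cofactor_def)
  have "det (A r) = (\<Sum>j<Suc l. A r $$ (l, j) * cofactor (A r) l j)" for r
    by (rule laplace_expansion_row[OF A]) simp
  also have "\<dots> r = r * det (mat l l f) + (\<Sum>j<l. f (l, j) * cofactor (A 0) l j)" for r
    unfolding sum.lessThan_Suc cof
    by (simp add: A_def[of r] cofactor_def del[of r, unfolded A_def[of r]] add.commute)
  finally show ?thesis by (simp add: A_def[symmetric])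
qed

lemma polynomial_nonroot:
  fixes c :: "(nat, 'a::{alg_closed_field, field_char_0}) mpoly"
  assumes "c \<noteq> 0"
  obtains s where "meval id s c \<noteq> 0"
proof -
  have "finite (mvars c)" by (simp add: mvars_def)
  then have fin: "finite (rvar ` mvars c :: 'a rat_fun set)" by simp
  have c: "to_fract c \<in> ring_gen (range rconst \<union> rvar ` mvars c)" "to_fract c \<noteq> (0 :: 'a rat_fun)"
    using assms by (auto intro: to_fract_in_ring_gen)
  obtain \<psi> where \<psi>: "hom_on (ring_gen (range rconst \<union> rvar ` mvars c)) \<psi>" "\<And>a :: 'a. \<psi> (rconst a) = a" "\<psi> (to_fract c) \<noteq> 0"
    by (rule nonvanishing_point[OF inj_idom_hom_rconst fin c]) blast
  have "\<psi> (meval rconst rvar c) = meval (\<psi> \<circ> rconst) (\<psi> \<circ> rvar) c"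
    by (rule meval_hom_on[OF is_subring_ring_gen \<psi>(1)]) (auto intro: ring_gen.incl)
  then have "meval id (\<psi> \<circ> rvar) c \<noteq> 0"
    using \<psi>(2,3) by (simp add: to_fract_meval comp_def id_def)
  then show ?thesis by (rule that)
qed

context so_representation
begin

text \<open>
  The basic invariants without the last diagonal entry of the Gram matrix.
\<close>

definition grams :: "'k alg_closure rat_fun rat_fun set"
  where "grams = (\<lambda>ij. bmat $$ ij) ` ({..<n} \<times> {..<n} - {(n - 1, n - 1)}) \<union> {det Xm}"

lemma bmat_sym: "i < n \<Longrightarrow> j < n \<Longrightarrow> bmat $$ (i, j) = bmat $$ (j, i)"
proof -
  have t: "transpose_mat BE = BE"
    using B(1,2) unfolding BE_def by (metis map_mat_transpose)
  have tX: "transpose_mat Xm \<in> carrier_mat n n" using Xm_carrier by simp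
  have tb: "transpose_mat bmat = transpose_mat Xm * transpose_mat (transpose_mat Xm * BE)"
    unfolding bmat_def by (rule transpose_mult[of _ n n]) (use tX BE_carrier Xm_carrier in auto)
  have "transpose_mat (transpose_mat Xm * BE) = BE * Xm"
    using transpose_mult[OF tX BE_carrier] t by simp
  then have "transpose_mat bmat = bmat"
    using tb assoc_mult_mat[OF tX BE_carrier Xm_carrier] by (simp add: bmat_def)
  then show "i < n \<Longrightarrow> j < n \<Longrightarrow> bmat $$ (i, j) = bmat $$ (j, i)"
    using bmat_carrier by (metis carrier_matD index_transpose_mat(1))
qed

text \<open>
  At a matrix with orthonormal columns the Gram matrix is the identity.
\<close>

lemma gram_minor: "det (mat (n - 1) (n - 1) (\<lambda>ij. bmat $$ ij)) \<noteq> 0"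
proof
  assume 0: "det (mat (n - 1) (n - 1) (\<lambda>ij. bmat $$ ij)) = 0"
  interpret r: inj_idom_hom "rconst :: 'k alg_closure \<Rightarrow> _" by (rule inj_idom_hom_rconst)
  obtain W where W: "W \<in> carrier_mat n n" "transpose_mat W * B * W = 1\<^sub>m n"
    by (rule orthonormal_mat[OF B])
  let ?s = "spec (mpoint W)" and ?m = "mat (n - 1) (n - 1) (\<lambda>ij. bmat $$ ij)"
  note S = hom_on_spec[of "mpoint W"]
  have dom: "bmat $$ (i, j) \<in> spec_dom (mpoint W)" if "i < n" "j < n" for i j
    using that by (rule bmat_hom_on(2)[OF S spec_mpoint(1) spec_mpoint(3)])
  have val: "?s (bmat $$ (i, j)) = rconst (1\<^sub>m n $$ (i, j))" if "i < n" "j < n" for i j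
  proof -
    have "map_mat ?s bmat $$ (i, j) = map_mat rconst (1\<^sub>m n) $$ (i, j)"
      using spec_mpoint_mats(3)[OF W(1)] W(2) by simp
    then show ?thesis using that bmat_carrier by simp
  qed
  have "?s (det ?m) = det (map_mat ?s ?m)"
    by (rule hom_on_det[OF S]) (auto intro: dom)
  also have "map_mat ?s ?m = 1\<^sub>m (n - 1)"
    by (rule eq_matI) (auto simp: val)
  finally show False using 0 hom_on_zero[OF S] by simp
qed

lemma n_Suc: "n = Suc (n - 1)"
  using n2 by simp

lemma bmat_corner:
  "bmat = mat (Suc (n - 1)) (Suc (n - 1)) (\<lambda>ij. if ij = (n - 1, n - 1) then bmat $$ (n - 1, n - 1) else bmat $$ ij)"
  using bmat_carrier n_Suc by (intro eq_matI) auto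

lemma det_bmat: "det bmat = det Xm ^ 2 * det BE"
  unfolding bmat_def by (rule det_conj[OF BE_carrier Xm_carrier])

lemma kE_BE: "i < n \<Longrightarrow> j < n \<Longrightarrow> BE $$ (i, j) \<in> kE"
  using B(1) by (auto simp: BE_def B_def kE_def gram_mat_def)

text \<open>
  The relation \<open>det bmat = det Xm ^ 2 * det BE\<close> is linear in the corner entry, with the nonzero minor
  \<open>gram_minor\<close> as coefficient, and can be solved for it.
\<close>

lemma bset_field: "field_gen (kE \<union> bset) = field_gen (kE \<union> grams)"
proof
  show "field_gen (kE \<union> grams) \<subseteq> field_gen (kE \<union> bset)"
    by (rule field_gen_mono) (auto simp: grams_def bset_def)
  let ?R = "field_gen (kE \<union> grams)"
  note R = is_subring_field_gen[of "kE \<union> grams"]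
  have gR: "bmat $$ (i, j) \<in> ?R" if "i < n" "j < n" "(i, j) \<noteq> (n - 1, n - 1)" for i j
    using that by (intro field_gen_incl) (auto simp: grams_def)
  have "det BE \<in> ?R"
    using BE_carrier by (intro subring_det[OF R] field_gen_incl) (auto intro: kE_BE)
  moreover have "det Xm \<in> ?R" by (intro field_gen_incl) (simp add: grams_def)
  ultimately have dR: "det bmat \<in> ?R"
    unfolding det_bmat by (intro subring_mult[OF R] subring_power[OF R])
  define u v where "u = det (mat (n - 1) (n - 1) (\<lambda>ij. bmat $$ ij))"
    and "v = det (mat (Suc (n - 1)) (Suc (n - 1)) (\<lambda>ij. if ij = (n - 1, n - 1) then 0 else bmat $$ ij))"
  have "u \<in> ?R" unfolding u_def by (rule subring_det[OF R]) (auto intro!: gR)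
  moreover have "v \<in> ?R"
    unfolding v_def using n_Suc by (intro subring_det[OF R]) (auto intro!: gR subring_zero[OF R])
  moreover have "det bmat = bmat $$ (n - 1, n - 1) * u + v"
    unfolding u_def v_def by (subst bmat_corner) (rule det_corner)
  then have "bmat $$ (n - 1, n - 1) = (det bmat - v) / u"
    using gram_minor unfolding u_def[symmetric] by simp
  ultimately have "bmat $$ (n - 1, n - 1) \<in> ?R"
    using dR by (simp add: subfield_divide[OF is_subfield_field_gen] subring_diff[OF R])
  then have "kE \<union> bset \<subseteq> ?R"
    using gR by (auto simp: bset_def grams_def intro: field_gen_incl)
  then show "field_gen (kE \<union> bset) \<subseteq> ?R"
    by (rule field_gen_least[OF is_subfield_field_gen])
qed

lemma grams_in_ring: "grams \<subseteq> ring_gen (range cE \<union> MX)"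
  using bset_in_ring by (auto simp: grams_def bset_def)

text \<open>
  Choose values for the basic invariants at which \<open>p\<close> does not vanish and at which the determinant
  and the minor are nonzero. The corner entry of the Gram matrix is then determined by the relation,
  and a matrix with these invariants exists. So \<open>p\<close> does not vanish at the generic
  invariants either. The elements of \<open>T\<close>, further arguments of the polynomial, receive constant values \<open>\<eta>\<close>.

  The variables of \<open>p\<close> are named by an arbitrary type and \<open>t\<close> gives their values, because the
  lemma is used for the images of the invariants under an automorphism.
\<close>

lemma gram_nonroot:
  fixes p :: "('i, 'k alg_closure rat_fun rat_fun) mpoly"
  assumes p: "Poly_Mapping.range p \<subseteq> kE" "inj_on t (mvars p)" "t ` mvars p \<subseteq> grams \<union> T" "p \<noteq> 0"
    and T: "finite T"
  obtains \<eta> where "meval id (\<lambda>i. if t i \<in> grams then t i else cE (\<eta> (t i))) p \<noteq> 0"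
proof -
  interpret c: inj_idom_hom cE by (rule inj_idom_hom_cE)
  interpret r: inj_idom_hom "rconst :: 'k alg_closure \<Rightarrow> _" by (rule inj_idom_hom_rconst)
  interpret i: comm_ring_hom "id :: 'k alg_closure \<Rightarrow> _" by unfold_locales auto
  interpret m: comm_ring_hom "mconst :: 'k alg_closure \<Rightarrow> (nat, 'k alg_closure) mpoly" by (rule comm_ring_hom_mconst)
  interpret m': comm_ring_hom "mconst :: 'k alg_closure \<Rightarrow> ('i, 'k alg_closure) mpoly" by (rule comm_ring_hom_mconst)
  have "finite (grams \<union> T)" using T by (simp add: grams_def)
  then obtain e :: "'k alg_closure rat_fun rat_fun \<Rightarrow> nat" where e: "inj_on e (grams \<union> T)"
    using finite_imp_inj_to_nat_seg by meson
  define e' where "e' = inv_into (grams \<union> T) e"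
  have e': "e' (e x) = x" if "x \<in> grams \<union> T" for x using e that by (simp add: e'_def)
  define t' where "t' = inv_into (mvars p) t"
  have t': "t' (t i) = i" if "i \<in> mvars p" for i using p(2) that by (simp add: t'_def)
  define h where "h = inv_into UNIV cE"
  have h: "h (cE a) = a" for a unfolding h_def by simp
  have h0: "h 0 = 0" using h[of 0] by simp
  \<comment> \<open>the polynomial \<open>p\<close> over the algebraic closure, with numbered variables\<close>
  define qq where "qq = meval (mconst \<circ> h) (mvar \<circ> (e \<circ> t)) p"
  have "qq \<noteq> 0"
  proof
    assume "qq = 0"
    interpret s: comm_ring_hom "meval mconst (mvar \<circ> (t' \<circ> e')) :: (nat, 'k alg_closure) mpoly \<Rightarrow> ('i, 'k alg_closure) mpoly"
      by (rule m'.comm_ring_hom_meval)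
    have "meval mconst (mvar \<circ> (t' \<circ> e')) qq = meval (mconst \<circ> h) mvar p"
      unfolding qq_def s.hom_meval
    proof (intro meval_cong)
      fix i assume i: "i \<in> mvars p"
      then have "t i \<in> grams \<union> T" using p(3) by blast
      then show "(meval mconst (mvar \<circ> (t' \<circ> e')) \<circ> (mvar \<circ> (e \<circ> t))) i = (mvar i :: ('i, 'k alg_closure) mpoly)"
        using e' t' i by simp
    qed simp
    also have "\<dots> = Poly_Mapping.map h p" by (rule meval_mvar_map[of h, OF h0])
    finally have 0: "Poly_Mapping.map h p = 0" using \<open>qq = 0\<close> by simp
    obtain \<mu> where \<mu>: "Poly_Mapping.lookup p \<mu> \<noteq> 0" using p(4) by (metis lookup_zero poly_mapping_eqI)
    then have "Poly_Mapping.lookup p \<mu> \<in> Poly_Mapping.range p"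
      by (intro in_keys_lookup_in_range) (simp add: in_keys_iff)
    then have "Poly_Mapping.lookup p \<mu> \<in> range cE" using p(1) by (auto simp: kE_def)
    then obtain a where a: "Poly_Mapping.lookup p \<mu> = cE a" by auto
    have "Poly_Mapping.lookup (Poly_Mapping.map h p) \<mu> = a"
      using \<mu> a h by (simp add: Poly_Mapping.map.rep_eq)
    then show False using 0 \<mu> a by simp
  qed
  interpret ev: comm_ring_hom "meval cE e' :: (nat, 'k alg_closure) mpoly \<Rightarrow> _" by (rule c.comm_ring_hom_meval)
  have bg: "bmat $$ (i, j) \<in> grams" if "i < n - 1" "j < n - 1" for i j using that by (auto simp: grams_def)
  define dd where "dd = det (mat (n - 1) (n - 1) (\<lambda>ij. mvar (e (bmat $$ ij)) :: (nat, 'k alg_closure) mpoly))"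
  have "meval cE e' dd = det (mat (n - 1) (n - 1) (\<lambda>ij. bmat $$ ij))"
    unfolding dd_def ev.hom_det[symmetric] by (rule arg_cong[of _ _ det], rule eq_matI) (auto simp: e' bg)
  then have "dd \<noteq> 0" using gram_minor by auto
  define mm where "mm = (mvar (e (det Xm)) :: (nat, 'k alg_closure) mpoly)"
  have "meval cE e' mm = det Xm" by (simp add: mm_def e' grams_def)
  then have "mm \<noteq> 0" using det_Xm by auto
  obtain s where "meval id s (qq * dd * mm) \<noteq> 0"
    using polynomial_nonroot[of "qq * dd * mm"] \<open>qq \<noteq> 0\<close> \<open>dd \<noteq> 0\<close> \<open>mm \<noteq> 0\<close> by auto
  then have nz: "meval id s qq \<noteq> 0" "meval id s dd \<noteq> 0" "meval id s mm \<noteq> 0"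
    by (auto simp: i.meval_mult)
  interpret s: comm_ring_hom "meval id s :: (nat, 'k alg_closure) mpoly \<Rightarrow> _" by (rule i.comm_ring_hom_meval)
  define f where "f ij = s (e (bmat $$ ij))" for ij
  define \<delta> where "\<delta> = s (e (det Xm))"
  have q: "meval h (s \<circ> (e \<circ> t)) p \<noteq> 0"
    using nz(1) unfolding qq_def s.hom_meval by (simp add: comp_def)
  have "meval id s dd = det (mat (n - 1) (n - 1) f)"
    unfolding dd_def s.hom_det[symmetric] by (rule arg_cong[of _ _ det], rule eq_matI) (auto simp: f_def)
  then have f: "det (mat (n - 1) (n - 1) f) \<noteq> 0" using nz(2) by simp
  have \<delta>: "\<delta> \<noteq> 0" using nz(3) by (simp add: mm_def \<delta>_def)
  let ?N = "Suc (n - 1)"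
  \<comment> \<open>the corner entry that makes the determinant equal to \<open>\<delta>\<^sup>2 * det B\<close>\<close>
  define u where "u = (\<delta>\<^sup>2 * det B - det (mat ?N ?N (\<lambda>ij. if ij = (n - 1, n - 1) then 0 else f ij))) / det (mat (n - 1) (n - 1) f)"
  define S where "S = mat ?N ?N (\<lambda>ij. if ij = (n - 1, n - 1) then u else f ij)"
  have S: "S \<in> carrier_mat n n" using n_Suc by (simp add: S_def)
  have dS: "det S = \<delta>\<^sup>2 * det B"
    unfolding S_def det_corner[of _ u f] using f by (simp add: u_def)
  have "transpose_mat S = S"
    using n_Suc by (intro eq_matI) (auto simp: S_def f_def bmat_sym)
  then obtain M where M: "M \<in> carrier_mat n n" "transpose_mat M * B * M = S" "det M = \<delta>"
    using gram_matrix_surjective[OF B S _ dS \<delta>] n2 by auto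
  let ?s = "spec (mpoint M)"
  have val: "?s x = rconst (s (e x))" if "x \<in> grams" for x
  proof (cases "x = det Xm")
    case True
    then show ?thesis using spec_mpoint_mats(4)[OF M(1)] M(3) by (simp add: \<delta>_def)
  next
    case False
    then obtain i j where ij: "i < n" "j < n" "(i, j) \<noteq> (n - 1, n - 1)" "x = bmat $$ (i, j)"
      using \<open>x \<in> grams\<close> by (auto simp: grams_def)
    have "map_mat ?s bmat $$ (i, j) = map_mat rconst S $$ (i, j)"
      using spec_mpoint_mats(3)[OF M(1)] M(2) by simp
    then show ?thesis using ij bmat_carrier S n_Suc by (auto simp: S_def f_def)
  qed
  let ?\<eta> = "\<lambda>i. if t i \<in> grams then t i else cE ((s \<circ> e) (t i))"
  note SP = hom_on_spec[of "mpoint M"]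
  have sub: "ring_gen (range cE \<union> MX) \<subseteq> spec_dom (mpoint M)"
    by (rule ring_gen_least[OF SP(1)]) (auto simp: MX_iff spec_mpoint)
  have "?s (meval id ?\<eta> p) = meval (?s \<circ> id) (?s \<circ> ?\<eta>) p"
    by (rule meval_hom_on[OF SP]) (use p(1) grams_in_ring sub in \<open>auto simp: kE_def spec_mpoint\<close>)
  also have "\<dots> = meval (rconst \<circ> h) (rconst \<circ> (s \<circ> (e \<circ> t))) p"
    by (rule meval_cong) (use p(1) val in \<open>auto simp: kE_def spec_mpoint h\<close>)
  also have "\<dots> = rconst (meval h (s \<circ> (e \<circ> t)) p)" by (rule r.hom_meval[symmetric])
  finally have "meval id ?\<eta> p \<noteq> 0" using q hom_on_zero[OF SP] by auto
  then show ?thesis by (rule that)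
qed

text \<open>
  The product of \<open>w\<close> with the denominators of the elements of \<open>Y\<close> is a nonzero polynomial in the matrix
  entries. At a matrix where it does not vanish, all of \<open>Y\<close> is defined, and the values are constants
  because functions in \<open>FW\<close> do not involve \<open>x\<close>.
\<close>

lemma generic_matrix_point:
  assumes Y: "finite Y" "Y \<subseteq> FW" and w: "w \<in> ring_gen (range cE \<union> MX)" "w \<noteq> 0"
  obtains M where "spec (mpoint M) w \<noteq> 0" "Y \<subseteq> spec_dom (mpoint M)" "spec (mpoint M) ` Y \<subseteq> range rconst"
proof -
  interpret r: inj_idom_hom "rconst :: 'k alg_closure \<Rightarrow> _" by (rule inj_idom_hom_rconst)
  let ?R = "ring_gen (range cE \<union> MX)"
  note R = is_subring_ring_gen[of "range cE \<union> MX"]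
  have inR: "x \<in> spec_dom (mpoint M) \<and> spec (mpoint M) x \<in> range rconst" if "x \<in> ?R" for x M
  proof -
    have "is_subring (range (rconst :: 'k alg_closure \<Rightarrow> _))"
      using is_subring_image[OF is_subring_UNIV hom_on_fieldI[OF inj_idom_hom_rconst]] .
    from hom_on_preimage(1)[OF hom_on_spec this, of "mpoint M"]
    have "?R \<subseteq> {w \<in> spec_dom (mpoint M). spec (mpoint M) w \<in> range rconst}"
      by (rule ring_gen_least) (auto simp: MX_iff spec_mpoint)
    then show ?thesis using that by blast
  qed
  have "\<exists>c\<in>?R. c \<noteq> 0 \<and> (\<forall>M. spec (mpoint M) c \<noteq> 0 \<longrightarrow>
      Y \<subseteq> spec_dom (mpoint M) \<and> spec (mpoint M) ` Y \<subseteq> range rconst)"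
    using Y
  proof (induction Y)
    case empty
    show ?case by (rule bexI[of _ 1]) (auto intro: subring_one[OF R])
  next
    case (insert y Y)
    then obtain c where c: "c \<in> ?R" "c \<noteq> 0" "\<And>M. spec (mpoint M) c \<noteq> 0 \<Longrightarrow>
      Y \<subseteq> spec_dom (mpoint M) \<and> spec (mpoint M) ` Y \<subseteq> range rconst" by auto
    have "y \<in> field_gen (range cE \<union> MX)" using insert.prems by (simp add: FW_def)
    then obtain a b where ab: "a \<in> ?R" "b \<in> ?R" "b \<noteq> 0" "y = a / b" by (rule field_gen_fractions)
    show ?case
    proof (intro bexI[of _ "b * c"] conjI allI impI)
      show "b * c \<in> ?R" using ab c by (intro subring_mult[OF R])
      show "b * c \<noteq> 0" using ab c by simp
      fix M assume nz: "spec (mpoint M) (b * c) \<noteq> 0"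
      note S = hom_on_spec[of "mpoint M"]
      have dom: "a \<in> spec_dom (mpoint M)" "b \<in> spec_dom (mpoint M)" "c \<in> spec_dom (mpoint M)"
        using inR ab c by auto
      then have nz': "spec (mpoint M) b \<noteq> 0" "spec (mpoint M) c \<noteq> 0"
        using nz hom_on_mult[OF S, of b c] by auto
      have "inverse b \<in> spec_dom (mpoint M)" by (rule spec_inverse[OF dom(2) nz'(1)])
      then have y: "y \<in> spec_dom (mpoint M)"
        using dom(1) subring_mult[OF S(1)] by (simp add: ab(4) divide_inverse)
      have "spec (mpoint M) y * spec (mpoint M) b = spec (mpoint M) a"
        using hom_on_mult[OF S y dom(2)] ab(3,4) by simp
      moreover obtain a' b' where "spec (mpoint M) a = rconst a'" "spec (mpoint M) b = rconst b'"
        using inR[OF ab(1)] inR[OF ab(2)] by (meson imageE)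
      ultimately have "spec (mpoint M) y = rconst (a' / b')"
      proof -
        interpret field_hom "rconst :: 'k alg_closure \<Rightarrow> _" by (rule field_hom_of_inj[OF inj_idom_hom_rconst])
        assume 1: "spec (mpoint M) y * spec (mpoint M) b = spec (mpoint M) a"
          "spec (mpoint M) a = rconst a'" "spec (mpoint M) b = rconst b'"
        have "b' \<noteq> 0" using nz'(1) 1 by auto
        then have "rconst (a' / b') * rconst b' = spec (mpoint M) y * rconst b'"
          using 1 by (simp flip: r.hom_mult)
        then show ?thesis using nz'(1) 1 by simp
      qed
      then show "insert y Y \<subseteq> spec_dom (mpoint M)" "spec (mpoint M) ` insert y Y \<subseteq> range rconst"
        using y c(3)[OF nz'(2)] by auto
    qed
  qed
  then obtain c where c: "c \<in> ?R" "c \<noteq> 0" "\<And>M. spec (mpoint M) c \<noteq> 0 \<Longrightarrow>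
      Y \<subseteq> spec_dom (mpoint M) \<and> spec (mpoint M) ` Y \<subseteq> range rconst" by blast
  have wc: "w * c \<in> ?R" "w * c \<noteq> 0" using w c subring_mult[OF R] by auto
  have fin: "finite MX" by (simp add: MX_def)
  obtain \<psi> where \<psi>: "hom_on ?R \<psi>" "\<And>a. \<psi> (cE a) = a" "\<psi> (w * c) \<noteq> 0"
    by (rule nonvanishing_point[OF inj_idom_hom_cE fin wc]) blast
  define M where "M = mat n n (\<lambda>(i, j). \<psi> (mvx i j))"
  have "spec (mpoint M) x = rconst (\<psi> x)" if "x \<in> ?R" for x
  proof (rule hom_on_agree[OF R _ _ _ _ that])
    show "hom_on ?R (spec (mpoint M))"
      by (rule hom_on_mono[OF hom_on_spec(2)]) (use inR in auto)
    have "hom_on {x \<in> ?R. \<psi> x \<in> UNIV} (\<lambda>x. rconst (\<psi> x))"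
      by (rule hom_on_preimage(2)[OF R \<psi>(1) is_subring_UNIV hom_on_fieldI[OF inj_idom_hom_rconst]])
    then show "hom_on ?R (\<lambda>x. rconst (\<psi> x))" by simp
    show "range cE \<union> MX \<subseteq> ?R" by (auto intro: ring_gen.incl)
    fix a assume "a \<in> range cE \<union> MX"
    then show "spec (mpoint M) a = rconst (\<psi> a)"
      by (auto simp: MX_iff spec_mpoint \<psi> M_def)
  qed
  then have "spec (mpoint M) (w * c) \<noteq> 0" using wc(1) \<psi>(3) by simp
  then have "spec (mpoint M) w \<noteq> 0" "spec (mpoint M) c \<noteq> 0"
    using hom_on_mult[OF hom_on_spec[of "mpoint M"], of w c] inR w(1) c(1) by auto
  with c(3)[OF this(2)] show ?thesis by (intro that) auto
qed

definition xcol :: "'k alg_closure rat_fun rat_fun mat"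
  where "xcol = mat m 1 (\<lambda>(i, _). xvar i)"

lemma xcol_carrier: "xcol \<in> carrier_mat m 1"
  by (simp add: xcol_def)

text \<open>
  The column \<open>V * xcol\<close> is a change of coordinates of \<open>x\<close> with coefficients in \<open>FW\<close>. At a fixed generic
  matrix, \<open>x\<close> can be chosen such that it takes any prescribed values, in particular those for
  which \<open>gram_nonroot\<close> leaves a nonzero function of the matrix. Hence a polynomial relation would
  give the value zero where this function is not zero.
\<close>

theorem invariants_independent:
  assumes \<Psi>: "\<Psi> \<in> carrier_mat m m" "\<And>a b. a < m \<Longrightarrow> b < m \<Longrightarrow> \<Psi> $$ (a, b) \<in> FW"
    and V: "V \<in> carrier_mat m m" "\<And>a b. a < m \<Longrightarrow> b < m \<Longrightarrow> V $$ (a, b) \<in> FW"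
    and V\<Psi>: "V * \<Psi> = 1\<^sub>m m"
  fixes p :: "('i, 'k alg_closure rat_fun rat_fun) mpoly"
  assumes p: "Poly_Mapping.range p \<subseteq> kE" "inj_on t (mvars p)" "t ` mvars p \<subseteq> grams \<union> elements_mat (V * xcol)"
    "meval id t p = 0"
  shows "p = 0"
proof (rule ccontr)
  assume "p \<noteq> 0"
  define T where "T = (\<lambda>i. (V * xcol) $$ (i, 0)) ` {..<m}"
  have "elements_mat (V * xcol) \<subseteq> T"
    using V(1) xcol_carrier by (auto simp: T_def dest!: elements_matD)
  then have pT: "t ` mvars p \<subseteq> grams \<union> T" using p(3) by blast
  have T: "finite T" by (simp add: T_def)
  obtain \<eta> where \<eta>: "meval id (\<lambda>i. if t i \<in> grams then t i else cE (\<eta> (t i))) p \<noteq> 0"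
    by (rule gram_nonroot[OF p(1,2) pT \<open>p \<noteq> 0\<close> T])
  let ?y = "\<lambda>x. if x \<in> grams then x else cE (\<eta> x)"
  let ?R = "ring_gen (range cE \<union> MX)"
  have cR: "cE a \<in> ?R" for a by (auto intro: ring_gen.incl)
  have kR: "kE \<subseteq> ?R" using cR by (auto simp: kE_def)
  have yR: "?y x \<in> ?R" for x using cR grams_in_ring by auto
  define w where "w = meval id (\<lambda>i. ?y (t i)) p"
  have w: "w \<in> ?R" "w \<noteq> 0"
    using \<eta> meval_in_subring[OF is_subring_ring_gen, of p "\<lambda>i. ?y (t i)" "range cE \<union> MX" id] yR p(1) kR by (auto simp: w_def)
  \<comment> \<open>everything that must be defined at the matrix \<open>M\<close>\<close>
  define Y where "Y = {w} \<union> (\<lambda>ij. \<Psi> $$ ij) ` ({..<m} \<times> {..<m}) \<union> (\<lambda>ij. V $$ ij) ` ({..<m} \<times> {..<m}) \<union> grams \<union> ?y ` T"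
  have "finite Y" using T by (simp add: Y_def grams_def)
  moreover have "Y \<subseteq> FW"
  proof -
    have "?R \<subseteq> FW" unfolding FW_def by (rule ring_gen_subset_field_gen)
    moreover have "?y ` T \<subseteq> ?R" using yR by blast
    ultimately show ?thesis using \<Psi>(2) V(2) w(1) grams_in_ring unfolding Y_def by auto
  qed
  ultimately obtain M where M: "spec (mpoint M) w \<noteq> 0" "Y \<subseteq> spec_dom (mpoint M)" "spec (mpoint M) ` Y \<subseteq> range rconst"
    by (rule generic_matrix_point[OF _ _ w])
  define \<psi> where "\<psi> f = inv_into UNIV rconst (spec (mpoint M) f)" for f
  interpret r: inj_idom_hom "rconst :: 'k alg_closure \<Rightarrow> _" by (rule inj_idom_hom_rconst)
  have \<psi>: "spec (mpoint M) f = rconst (\<psi> f)" if "f \<in> Y" for f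
    using M(3) that by (auto simp: \<psi>_def f_inv_into_f)
  define H where "H = mat m 1 (\<lambda>(i, _). \<psi> (?y ((V * xcol) $$ (i, 0))))"
  have H: "H \<in> carrier_mat m 1" by (simp add: H_def)
  \<comment> \<open>the point of \<open>V\<close> at which \<open>V * xcol\<close> takes the prescribed values \<open>H\<close>\<close>
  define \<xi> where "\<xi> i = (map_mat \<psi> \<Psi> * H) $$ (i, 0)" for i
  define D where "D = {f \<in> spec_dom (mpoint M). spec (mpoint M) f \<in> spec_dom \<xi>}"
  define \<phi> where "\<phi> f = spec \<xi> (spec (mpoint M) f)" for f
  note S = hom_on_spec[of "mpoint M"]
  have D: "is_subring D" "hom_on D \<phi>"
    using hom_on_preimage[OF S hom_on_spec(1)[of \<xi>]] hom_on_spec(2)[of \<xi>] unfolding D_def \<phi>_def by auto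
  have YD: "f \<in> D" "\<phi> f = \<psi> f" if "f \<in> Y" for f
    using M(2) \<psi>[OF that] that by (auto simp: D_def \<phi>_def)
  have xD: "xvar i \<in> D" "\<phi> (xvar i) = \<xi> i" for i by (simp_all add: D_def \<phi>_def xvar_def)
  have cD: "cE a \<in> D" "\<phi> (cE a) = a" for a by (simp_all add: D_def \<phi>_def spec_mpoint)
  have YV: "V $$ (i, j) \<in> Y" "\<Psi> $$ (i, j) \<in> Y" if "i < m" "j < m" for i j using that by (auto simp: Y_def)
  have colD: "xcol $$ (i, j) \<in> D" if "i < m" "j < 1" for i j using that xD by (simp add: xcol_def)
  have VD: "V $$ (i, j) \<in> D" "\<Psi> $$ (i, j) \<in> D" if "i < m" "j < m" for i j using that YV YD(1) by auto
  note VX = map_mat_mult_hom_on[OF D V(1) VD(1) xcol_carrier colD]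
  have "map_mat \<phi> (V * xcol) = H"
  proof -
    have 1: "map_mat \<phi> V \<in> carrier_mat m m" and 2: "map_mat \<phi> \<Psi> \<in> carrier_mat m m" using V \<Psi> by auto
    have \<Psi>': "map_mat \<phi> \<Psi> = map_mat \<psi> \<Psi>" using \<Psi>(1) YV YD by (intro eq_matI) auto
    have "map_mat \<phi> xcol = map_mat \<phi> \<Psi> * H"
      unfolding \<Psi>' using \<Psi>(1) H by (intro eq_matI) (auto simp: xcol_def xD \<xi>_def)
    then have "map_mat \<phi> (V * xcol) = map_mat \<phi> V * (map_mat \<phi> \<Psi> * H)" using VX(1) by simp
    also have "\<dots> = (map_mat \<phi> V * map_mat \<phi> \<Psi>) * H" by (rule assoc_mult_mat[OF 1 2 H, symmetric])
    also have "map_mat \<phi> V * map_mat \<phi> \<Psi> = map_mat \<phi> (V * \<Psi>)"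
      by (rule map_mat_mult_hom_on(1)[OF D V(1) VD(1) \<Psi>(1) VD(2), symmetric])
    also have "map_mat \<phi> (V * \<Psi>) = 1\<^sub>m m"
      unfolding V\<Psi> using hom_on_zero[OF D] hom_on_one[OF D] by (intro eq_matI) auto
    finally show ?thesis using H by simp
  qed
  then have T\<phi>: "\<phi> x = \<phi> (?y x)" "x \<in> D" if "x \<in> T" for x
  proof -
    obtain i where i: "i < m" "x = (V * xcol) $$ (i, 0)" using \<open>x \<in> T\<close> by (auto simp: T_def)
    have "map_mat \<phi> (V * xcol) $$ (i, 0) = H $$ (i, 0)" by (simp only: \<open>map_mat \<phi> (V * xcol) = H\<close>)
    then have "\<phi> x = \<psi> (?y x)" using i V(1) xcol_carrier by (simp add: H_def)
    moreover have "?y x \<in> Y" using that by (auto simp: Y_def)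
    ultimately show "\<phi> x = \<phi> (?y x)" by (simp only: YD(2))
    show "x \<in> D" unfolding i(2) using i(1) by (intro VX(2)) auto
  qed
  have gD: "x \<in> D" if "x \<in> grams" for x using that YD(1) by (auto simp: Y_def)
  have tD: "t i \<in> D" "\<phi> (t i) = \<phi> (?y (t i))" "?y (t i) \<in> D" if "i \<in> mvars p" for i
  proof -
    have "t i \<in> grams \<or> t i \<in> T" using pT that by blast
    then show "t i \<in> D" "\<phi> (t i) = \<phi> (?y (t i))" "?y (t i) \<in> D" using gD T\<phi> cD(1) by auto
  qed
  have kD: "c \<in> D" if "c \<in> kE" for c using that cD(1) by (auto simp: kE_def)
  have "\<phi> (meval id t p) = meval (\<phi> \<circ> id) (\<phi> \<circ> t) p"
    by (rule meval_hom_on[OF D]) (use tD(1) kD p(1) in auto)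
  also have "\<dots> = meval (\<phi> \<circ> id) (\<phi> \<circ> (\<lambda>i. ?y (t i))) p"
    by (rule meval_cong) (simp_all only: comp_def tD(2))
  also have "\<dots> = \<phi> w"
    unfolding w_def by (rule meval_hom_on[OF D, symmetric]) (use tD(3) kD p(1) in auto)
  finally have 0: "\<phi> w = 0" using p(4) hom_on_zero[OF D] by simp
  have "w \<in> Y" by (simp add: Y_def)
  then show False using 0 YD(2) \<psi> M(1) by auto
qed

end

section \<open>Stable rationality\<close>

text \<open>
  Two matrices that transform by the same factor have an invariant quotient.
\<close>

lemma frame_quotient_fixed:
  fixes \<phi> :: "'a::field \<Rightarrow> 'a"
  assumes \<phi>: "inj_idom_hom \<phi>"
    and c: "\<Phi> \<in> carrier_mat r r" "V \<in> carrier_mat r r" "T \<in> carrier_mat r r" "Y \<in> carrier_mat r s"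
    and inv: "V * \<Phi> = 1\<^sub>m r" "\<Phi> * V = 1\<^sub>m r"
    and eq: "map_mat \<phi> \<Phi> = T * \<Phi>" "map_mat \<phi> Y = T * Y"
  shows "map_mat \<phi> (V * Y) = V * Y"
proof -
  interpret inj_idom_hom \<phi> by fact
  have Vc: "map_mat \<phi> V \<in> carrier_mat r r" using c by simp
  have "map_mat \<phi> V * (T * \<Phi>) = 1\<^sub>m r"
    using mat_hom_mult[OF c(2,1)] inv(1) mat_hom_one[of r] by (simp add: eq)
  then have 1: "(map_mat \<phi> V * T) * \<Phi> = 1\<^sub>m r" by (simp add: assoc_mult_mat[OF Vc c(3,1)])
  have VT: "map_mat \<phi> V * T \<in> carrier_mat r r" using Vc c by (intro mult_carrier_mat)
  have "map_mat \<phi> V * T = (map_mat \<phi> V * T) * (\<Phi> * V)"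
    using VT by (simp add: inv right_mult_one_mat[OF VT])
  also have "\<dots> = ((map_mat \<phi> V * T) * \<Phi>) * V" by (rule assoc_mult_mat[OF VT c(1,2), symmetric])
  also have "\<dots> = V" using c by (simp add: 1 left_mult_one_mat[OF c(2)])
  finally have 2: "map_mat \<phi> V * T = V" .
  have "map_mat \<phi> (V * Y) = map_mat \<phi> V * (T * Y)" using mat_hom_mult[OF c(2,4)] by (simp add: eq)
  also have "\<dots> = V * Y" using assoc_mult_mat[OF Vc c(3,4)] 2 by simp
  finally show ?thesis .
qed

lemma field_gen_idem: "field_gen (field_gen S \<union> T) = field_gen (S \<union> T)"
proof
  have "field_gen S \<union> T \<subseteq> field_gen (S \<union> T)"
    using field_gen_mono[of S "S \<union> T"] field_gen_incl[of _ "S \<union> T"] by blast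
  then show "field_gen (field_gen S \<union> T) \<subseteq> field_gen (S \<union> T)"
    by (rule field_gen_least[OF is_subfield_field_gen])
  show "field_gen (S \<union> T) \<subseteq> field_gen (field_gen S \<union> T)"
    using field_gen_incl[of _ S] by (intro field_gen_mono) blast
qed

lemma field_gen_frame_subset:
  assumes V: "V \<in> carrier_mat r r" "\<And>i j. i < r \<Longrightarrow> j < r \<Longrightarrow> V $$ (i, j) \<in> F"
    and Y: "Y \<in> carrier_mat r s"
  shows "field_gen (F \<union> elements_mat (V * Y)) \<subseteq> field_gen (F \<union> elements_mat Y)"
proof (rule field_gen_least[OF is_subfield_field_gen])
  let ?R = "field_gen (F \<union> elements_mat Y)"
  have VR: "V $$ (i, j) \<in> ?R" if "i < r" "j < r" for i j using V(2)[OF that] by (auto intro: field_gen_incl)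
  have YR: "Y $$ (i, j) \<in> ?R" if "i < r" "j < s" for i j
    using elements_matI[OF Y that] by (auto intro: field_gen_incl)
  have id: "hom_on ?R id" by (simp add: hom_on_def)
  note map_mat_mult_hom_on(2)[OF is_subring_field_gen id V(1) VR Y YR]
  then have "elements_mat (V * Y) \<subseteq> ?R"
    using V(1) Y by (auto dest!: elements_matD)
  then show "F \<union> elements_mat (V * Y) \<subseteq> ?R" by (auto intro: field_gen_incl)
qed

text \<open>
  An invertible change of coordinates over \<open>F\<close> does not change the field.
\<close>

lemma field_gen_frame:
  assumes V: "V \<in> carrier_mat r r" "\<And>i j. i < r \<Longrightarrow> j < r \<Longrightarrow> V $$ (i, j) \<in> F"
    and \<Phi>: "\<Phi> \<in> carrier_mat r r" "\<And>i j. i < r \<Longrightarrow> j < r \<Longrightarrow> \<Phi> $$ (i, j) \<in> F" "\<Phi> * V = 1\<^sub>m r"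
    and Y: "Y \<in> carrier_mat r s"
  shows "field_gen (F \<union> elements_mat (V * Y)) = field_gen (F \<union> elements_mat Y)"
proof
  have "\<Phi> * (V * Y) = Y"
    using assoc_mult_mat[OF \<Phi>(1) V(1) Y] \<Phi>(3) Y by simp
  then show "field_gen (F \<union> elements_mat Y) \<subseteq> field_gen (F \<union> elements_mat (V * Y))"
    using field_gen_frame_subset[OF \<Phi>(1,2), of "V * Y" s] V(1) Y by (metis mult_carrier_mat)
qed (rule field_gen_frame_subset[OF V Y])

lemma fixed_field_eq:
  fixes act :: "'j \<Rightarrow> 'e::field \<Rightarrow> 'e"
  assumes act: "\<And>j. j \<in> J \<Longrightarrow> inj_idom_hom (act j)"
    and F: "is_subfield F" and stable: "\<And>j x. j \<in> J \<Longrightarrow> x \<in> F \<Longrightarrow> act j x \<in> F"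
    and Z: "\<And>j z. j \<in> J \<Longrightarrow> z \<in> Z \<Longrightarrow> act j z = z"
  shows "{f \<in> field_gen (F \<union> Z). \<forall>j\<in>J. act j f = f} = field_gen ({x \<in> F. \<forall>j\<in>J. act j x = x} \<union> Z)"
proof
  show "{f \<in> field_gen (F \<union> Z). \<forall>j\<in>J. act j f = f} \<subseteq> field_gen ({x \<in> F. \<forall>j\<in>J. act j x = x} \<union> Z)"
  proof
    fix f assume "f \<in> {f \<in> field_gen (F \<union> Z). \<forall>j\<in>J. act j f = f}"
    then show "f \<in> field_gen ({x \<in> F. \<forall>j\<in>J. act j x = x} \<union> Z)"
      by (intro fixed_field_generators[OF act F stable Z]) auto
  qed
  have "is_subfield {f. act j f = f}" if "j \<in> J" for j
  proof -
    interpret field_hom "act j" by (rule field_hom_of_inj[OF act[OF that]])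
    show ?thesis by (auto simp: is_subfield_def is_subring_def hom_distribs)
  qed
  then have "is_subfield {f \<in> field_gen (F \<union> Z). \<forall>j\<in>J. act j f = f}"
    using is_subfield_field_gen[of "F \<union> Z"] by (auto simp: is_subfield_def is_subring_def)
  moreover have "{x \<in> F. \<forall>j\<in>J. act j x = x} \<union> Z \<subseteq> {f \<in> field_gen (F \<union> Z). \<forall>j\<in>J. act j f = f}"
    using Z by (auto intro: field_gen_incl)
  ultimately show "field_gen ({x \<in> F. \<forall>j\<in>J. act j x = x} \<union> Z) \<subseteq> {f \<in> field_gen (F \<union> Z). \<forall>j\<in>J. act j f = f}"
    by (rule field_gen_least)
qed

context so_representation
begin

lemma elements_Xm: "elements_mat Xm = MX"
proof
  show "elements_mat Xm \<subseteq> MX"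
    using Xm_carrier by (auto simp: Xm_index mvx_in_MX dest!: elements_matD)
  show "MX \<subseteq> elements_mat Xm"
  proof
    fix x assume "x \<in> MX"
    then obtain i j where "i < n" "j < n" "x = mvx i j" by (auto simp: MX_iff)
    then show "x \<in> elements_mat Xm" by (simp add: elements_matI[OF Xm_carrier, of i j] Xm_index)
  qed
qed

lemma elements_xcol: "elements_mat xcol = xvar ` {..<m}"
  by (auto simp: xcol_def elements_mat_def)

definition FV :: "'k alg_closure rat_fun rat_fun set"
  where "FV = rconst ` rat_funs m"

lemma FV_field_gen: "FV = field_gen (range cE \<union> xvar ` {..<m})"
proof -
  have "rconst ` (range rconst \<union> rvar ` {..<m}) = range cE \<union> xvar ` {..<m}"
    by (auto simp: cE_def xvar_def)
  then show ?thesis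
    unfolding FV_def rat_funs_field_gen field_gen_image[OF inj_idom_hom_rconst] by simp
qed

lemma FV_subfield: "is_subfield FV"
  unfolding FV_field_gen by (rule is_subfield_field_gen)

lemma actE_FV_stable: "j \<in> J \<Longrightarrow> f \<in> FV \<Longrightarrow> actE j f \<in> FV"
  using actE(2) actV_stable by (cases j) (auto simp: FV_def)

lemma invariants_V: "{f \<in> FV. \<forall>j\<in>J. actE j f = f} = rconst ` K"
proof -
  interpret r: inj_idom_hom "rconst :: 'k alg_closure rat_fun \<Rightarrow> _" by (rule inj_idom_hom_rconst)
  have "actE j (rconst f) = rconst f \<longleftrightarrow> actV j f = f" if "j \<in> J" for j f
  proof -
    obtain g \<sigma> where j: "j = (g, \<sigma>)" by force
    show ?thesis using actE(2)[of g \<sigma> f] that unfolding j by simp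
  qed
  then have "(\<forall>j\<in>J. actE j (rconst f) = rconst f) \<longleftrightarrow> (\<forall>j\<in>J. actV j f = f)" for f by blast
  then show ?thesis unfolding FV_def using K_iff by blast
qed

text \<open>
  Both sides are the field of rational functions on the two spaces together.
\<close>

lemma FV_FW: "field_gen (FV \<union> elements_mat Xm) = field_gen (FW \<union> elements_mat xcol)"
  unfolding FV_field_gen FW_def field_gen_idem elements_Xm elements_xcol by (simp only: Un_ac)

lemma actE_xcol:
  assumes "(g, \<sigma>) \<in> J" shows "map_mat (actE (g, \<sigma>)) xcol = map_mat cE (\<rho> g) * xcol"
proof (rule eq_matI)
  have gc: "\<rho> g \<in> carrier_mat m m" using assms by (auto simp: J_def \<rho>_carrier)
  fix i j assume "i < dim_row (map_mat cE (\<rho> g) * xcol)" "j < dim_col (map_mat cE (\<rho> g) * xcol)"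
  then have ij: "i < m" "j = 0" using gc by (auto simp: xcol_def)
  have "(map_mat cE (\<rho> g) * xcol) $$ (i, j) = (\<Sum>l<m. map_mat cE (\<rho> g) $$ (i, l) * xcol $$ (l, j))"
    using gc ij xcol_carrier by (simp add: scalar_prod_def atLeast0LessThan)
  also have "\<dots> = (\<Sum>l<m. cE (\<rho> g $$ (i, l)) * xvar l)"
    using gc ij by (intro sum.cong refl) (simp add: xcol_def)
  finally show "map_mat (actE (g, \<sigma>)) xcol $$ (i, j) = (map_mat cE (\<rho> g) * xcol) $$ (i, j)"
    using ij actE(6)[OF assms ij(1)] by (simp add: xcol_def)
qed (use assms in \<open>auto simp: J_def xcol_def dest: \<rho>_carrier\<close>)

lemma ground_field_kE: "rconst ` ground_field = kE"
  by (auto simp: ground_field_def kE_def cE_def)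

text \<open>
  The matrix \<open>\<Phi>\<close> makes the entries of \<open>\<Phi>\<^sup>-\<^sup>1 X\<close> invariant, and \<open>\<Psi>\<close> those of \<open>\<Psi>\<^sup>-\<^sup>1 x\<close>. This gives two
  descriptions of the fixed field of \<open>J\<close>. The automorphism \<open>\<theta>\<close> over the functions on \<open>V\<close>, which
  multiplies the generic matrix by \<open>\<Phi>\<close>, maps the first one to the field of rational functions in
  $n^2$ variables over the invariants of \<open>V\<close>. Its value at the second one is purely transcendental.
\<close>

theorem stably_rational_K: "stably_rational ground_field K"
proof -
  obtain \<Phi> where \<Phi>: "\<Phi> \<in> carrier_mat n n" "\<And>a b. a < n \<Longrightarrow> b < n \<Longrightarrow> \<Phi> $$ (a, b) \<in> rat_funs m" "det \<Phi> \<noteq> 0"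
    "\<And>g \<sigma>. (g, \<sigma>) \<in> J \<Longrightarrow> map_mat (actV (g, \<sigma>)) \<Phi> = map_mat rconst g * \<Phi>"
    by (rule covariant_frame_V) blast
  obtain \<Phi>' where \<Phi>': "\<Phi>' \<in> carrier_mat n n" "\<Phi> * \<Phi>' = 1\<^sub>m n" "\<Phi>' * \<Phi> = 1\<^sub>m n"
    "\<And>a b. a < n \<Longrightarrow> b < n \<Longrightarrow> \<Phi>' $$ (a, b) \<in> rat_funs m"
  proof (rule inverse_mat_exists[OF \<Phi>(1,3)])
    fix h assume h: "h \<in> carrier_mat n n" "\<Phi> * h = 1\<^sub>m n" "h * \<Phi> = 1\<^sub>m n"
      "\<And>R i j. is_subfield R \<Longrightarrow> (\<And>i j. i < n \<Longrightarrow> j < n \<Longrightarrow> \<Phi> $$ (i, j) \<in> R) \<Longrightarrow>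
        i < n \<Longrightarrow> j < n \<Longrightarrow> h $$ (i, j) \<in> R"
    show ?thesis by (rule that[OF h(1-3)]) (use h(4)[OF rat_funs_subfield \<Phi>(2)] in blast)
  qed
  obtain \<Psi> where \<Psi>: "\<Psi> \<in> carrier_mat m m" "\<And>a b. a < m \<Longrightarrow> b < m \<Longrightarrow> \<Psi> $$ (a, b) \<in> FW" "det \<Psi> \<noteq> 0"
    "\<And>g \<sigma>. (g, \<sigma>) \<in> J \<Longrightarrow> map_mat (actE (g, \<sigma>)) \<Psi> = map_mat cE (\<rho> g) * \<Psi>"
    by (rule covariant_frame_W) blast
  obtain V where V: "V \<in> carrier_mat m m" "\<Psi> * V = 1\<^sub>m m" "V * \<Psi> = 1\<^sub>m m"
    "\<And>a b. a < m \<Longrightarrow> b < m \<Longrightarrow> V $$ (a, b) \<in> FW"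
  proof (rule inverse_mat_exists[OF \<Psi>(1,3)])
    fix h assume h: "h \<in> carrier_mat m m" "\<Psi> * h = 1\<^sub>m m" "h * \<Psi> = 1\<^sub>m m"
      "\<And>R i j. is_subfield R \<Longrightarrow> (\<And>i j. i < m \<Longrightarrow> j < m \<Longrightarrow> \<Psi> $$ (i, j) \<in> R) \<Longrightarrow>
        i < m \<Longrightarrow> j < m \<Longrightarrow> h $$ (i, j) \<in> R"
    show ?thesis by (rule that[OF h(1-3)]) (use h(4)[OF FW_subfield \<Psi>(2)] in blast)
  qed
  interpret r: inj_idom_hom "rconst :: 'k alg_closure rat_fun \<Rightarrow> _" by (rule inj_idom_hom_rconst)
  define P Q where "P = map_mat rconst \<Phi>" and "Q = map_mat rconst \<Phi>'"
  have PQ: "P \<in> carrier_mat n n" "Q \<in> carrier_mat n n" using \<Phi>(1) \<Phi>'(1) by (simp_all add: P_def Q_def)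
  have PQ1: "P * Q = 1\<^sub>m n" "Q * P = 1\<^sub>m n"
    using r.mat_hom_mult[OF \<Phi>(1) \<Phi>'(1)] r.mat_hom_mult[OF \<Phi>'(1) \<Phi>(1)] \<Phi>'(2,3) r.mat_hom_one[of n]
    by (simp_all add: P_def Q_def)
  have PQF: "P $$ (i, j) \<in> FV" "Q $$ (i, j) \<in> FV" if "i < n" "j < n" for i j
    using that \<Phi>(1,2) \<Phi>'(1,4) by (auto simp: P_def Q_def FV_def)
  let ?Z = "elements_mat (Q * Xm)" and ?Y = "elements_mat (V * xcol)"
  have Zfix: "actE j z = z" if "j \<in> J" "z \<in> ?Z" for j z
  proof -
    obtain g \<sigma> where j: "j = (g, \<sigma>)" "(g, \<sigma>) \<in> J" using \<open>j \<in> J\<close> by (metis surj_pair)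
    have gc: "map_mat cE g \<in> carrier_mat n n" using j by (auto simp: J_def G_carrier)
    have "map_mat (actE j) P = map_mat rconst (map_mat (actV j) \<Phi>)"
      unfolding P_def by (intro eq_matI) (auto simp: j(1) actE(2)[OF j(2)])
    also have "\<dots> = map_mat rconst (map_mat rconst g) * P"
      unfolding j(1) \<Phi>(4)[OF j(2)] P_def using gc \<Phi>(1) by (intro r.mat_hom_mult[of _ n n _ n]) auto
    also have "map_mat rconst (map_mat rconst g) = map_mat cE g" by (intro eq_matI) (auto simp: cE_def)
    finally have "map_mat (actE j) (Q * Xm) = Q * Xm"
      using actE_Xm[OF j(2)] j(1) by (intro frame_quotient_fixed[OF actE_hom[OF \<open>j \<in> J\<close>] PQ gc Xm_carrier PQ1(2,1)]) simp_all
    moreover obtain a b where ab: "a < dim_row (Q * Xm)" "b < dim_col (Q * Xm)" "z = (Q * Xm) $$ (a, b)"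
      using elements_matD[OF \<open>z \<in> ?Z\<close>] by blast
    ultimately show ?thesis by (metis index_map_mat(1))
  qed
  have Yfix: "actE j z = z" if "j \<in> J" "z \<in> ?Y" for j z
  proof -
    obtain g \<sigma> where j: "j = (g, \<sigma>)" "(g, \<sigma>) \<in> J" using \<open>j \<in> J\<close> by (metis surj_pair)
    have gc: "map_mat cE (\<rho> g) \<in> carrier_mat m m" using j by (auto simp: J_def \<rho>_carrier)
    have "map_mat (actE j) (V * xcol) = V * xcol"
      using actE_xcol[OF j(2)] \<Psi>(4)[OF j(2)] j(1)
      by (intro frame_quotient_fixed[OF actE_hom[OF \<open>j \<in> J\<close>] \<Psi>(1) V(1) gc xcol_carrier V(3,2)]) simp_all
    moreover obtain a b where ab: "a < dim_row (V * xcol)" "b < dim_col (V * xcol)" "z = (V * xcol) $$ (a, b)"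
      using elements_matD[OF \<open>z \<in> ?Y\<close>] by blast
    ultimately show ?thesis by (metis index_map_mat(1))
  qed
  \<comment> \<open>the fixed field of \<open>J\<close>, computed over the functions on \<open>V\<close> and over the functions on matrices\<close>
  have "field_gen (rconst ` K \<union> ?Z) = {f \<in> field_gen (FV \<union> ?Z). \<forall>j\<in>J. actE j f = f}"
    unfolding invariants_V[symmetric]
    by (rule fixed_field_eq[OF actE_hom FV_subfield actE_FV_stable Zfix, symmetric])
  also have "field_gen (FV \<union> ?Z) = field_gen (FV \<union> elements_mat Xm)"
    by (rule field_gen_frame[OF PQ(2) PQF(2) PQ(1) PQF(1) PQ1(1) Xm_carrier])
  also have "\<dots> = field_gen (FW \<union> elements_mat xcol)" by (rule FV_FW)
  also have "\<dots> = field_gen (FW \<union> ?Y)"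
    by (rule field_gen_frame[OF V(1,4) \<Psi>(1,2) V(2) xcol_carrier, symmetric])
  also have "{f \<in> field_gen (FW \<union> ?Y). \<forall>j\<in>J. actE j f = f} = field_gen ({f \<in> FW. \<forall>j\<in>J. actE j f = f} \<union> ?Y)"
    by (rule fixed_field_eq[OF actE_hom FW_subfield actE_stable Yfix])
  also have "\<dots> = field_gen (kE \<union> (grams \<union> ?Y))"
    unfolding invariants_W bset_field field_gen_idem by (simp only: Un_assoc)
  finally have D: "field_gen (rconst ` K \<union> ?Z) = field_gen (kE \<union> (grams \<union> ?Y))" .

  have id: "inj_idom_hom (id :: 'k alg_closure rat_fun \<Rightarrow> _)" by unfold_locales auto
  define \<theta> where "\<theta> = matrix_hom id \<Phi>"
  note \<theta> = matrix_hom[OF id \<Phi>(1) \<Phi>'(1,2), folded \<theta>_def]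
  interpret \<theta>: inj_idom_hom \<theta> by (rule \<theta>(1))
  have \<theta>c: "\<theta> (rconst f) = rconst f" for f using \<theta>(2) by simp
  have "map_mat \<theta> Xm = P * Xm"
  proof (rule eq_matI)
    fix i j assume "i < dim_row (P * Xm)" "j < dim_col (P * Xm)"
    then have ij: "i < n" "j < n" using PQ Xm_carrier by auto
    have "(P * Xm) $$ (i, j) = (\<Sum>l<n. P $$ (i, l) * Xm $$ (l, j))"
      by (rule mult_index[OF PQ(1) Xm_carrier ij])
    also have "\<dots> = (\<Sum>l<n. rconst (\<Phi> $$ (i, l)) * mvx l j)"
      using ij \<Phi>(1) by (intro sum.cong refl) (simp add: P_def Xm_index)
    finally show "map_mat \<theta> Xm $$ (i, j) = (P * Xm) $$ (i, j)"
      using \<theta>(3)[OF ij] ij Xm_carrier by (simp add: Xm_index)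
  qed (use PQ Xm_carrier in auto)
  moreover have "map_mat \<theta> Q = Q"
    unfolding Q_def by (intro eq_matI) (auto simp: \<theta>c)
  ultimately have "map_mat \<theta> (Q * Xm) = Q * (P * Xm)"
    using \<theta>.mat_hom_mult[OF PQ(2) Xm_carrier] by simp
  also have "\<dots> = Xm"
    using assoc_mult_mat[OF PQ(2,1) Xm_carrier] PQ1(2) Xm_carrier by simp
  finally have \<theta>Z: "\<theta> ` ?Z = MX"
    by (simp only: elements_Xm flip: elements_mat_map)
  have \<theta>k: "\<theta> c = c" if "c \<in> kE" for c using that \<theta>c by (auto simp: kE_def cE_def)
  define B' where "B' = \<theta> ` (grams \<union> ?Y)"
  have "field_gen (rconst ` K \<union> rvar ` {..<n * n}) = field_gen (\<theta> ` (rconst ` K \<union> ?Z))"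
    by (simp only: image_Un \<theta>Z image_image \<theta>c MX_def)
  also have "\<dots> = field_gen (\<theta> ` (kE \<union> (grams \<union> ?Y)))"
    unfolding field_gen_image[OF \<theta>(1), symmetric] D ..
  also have "\<theta> ` (kE \<union> (grams \<union> ?Y)) = kE \<union> B'"
    unfolding B'_def image_Un using \<theta>k by (simp add: image_cong[of kE kE \<theta> "\<lambda>x. x"])
  finally have gen: "field_gen (rconst ` K \<union> rvar ` {..<n * n}) = field_gen (kE \<union> B')" .
  have "alg_independent kE B'"
    unfolding alg_independent_def
  proof (intro allI impI)
    fix p :: "('k alg_closure rat_fun rat_fun, 'k alg_closure rat_fun rat_fun) mpoly"
    assume p: "Poly_Mapping.range p \<subseteq> kE" "mvars p \<subseteq> B'" "meval id id p = 0"
    define t where "t = inv_into (grams \<union> ?Y) \<theta>"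
    have t: "\<theta> (t x) = x" "t x \<in> grams \<union> ?Y" if "x \<in> mvars p" for x
    proof -
      have "x \<in> \<theta> ` (grams \<union> ?Y)" using that p(2) unfolding B'_def by blast
      then show "\<theta> (t x) = x" "t x \<in> grams \<union> ?Y"
        unfolding t_def by (rule f_inv_into_f, rule inv_into_into)
    qed
    have "\<theta> (meval id t p) = meval (\<theta> \<circ> id) (\<theta> \<circ> t) p" by (rule \<theta>.hom_meval)
    also have "\<dots> = meval id id p" by (rule meval_cong) (use t \<theta>k p(1) in auto)
    finally have "meval id t p = 0" using p(3) by simp
    then show "p = 0"
      using t p(1) by (intro invariants_independent[OF \<Psi>(1,2) V(1,4,3), of p t]) (auto intro: inj_on_inverseI[of _ \<theta>])
  qed
  then show ?thesis
    unfolding stably_rational_def purely_transcendental_def ground_field_kE using gen by blast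
qed

end

theorem proposition4p12:
  fixes q :: "'k::field_char_0 vec \<Rightarrow> 'k"
    and n m :: nat
    and \<rho> :: "'k alg_closure mat \<Rightarrow> 'k alg_closure mat"
  assumes "n \<ge> 2"
    and "quadratic_form n q" and "nondegenerate n q"
    and "linear_rep n (special_orthogonal n q) m \<rho>"
    and "almost_free n (special_orthogonal n q) m \<rho>"
  shows "stably_rational ground_field (invariant_field (special_orthogonal n q) m \<rho>)"
proof -
  interpret so_representation q n m \<rho> using assms by (rule so_representation.intro)
  show ?thesis using stably_rational_K by (simp only: K_def)
qed

end
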